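(* Let $\mathcal A$ be a premodular category over $\mathbf k$, and let $\hat U:\hat{\mathcal A}\to\hat{\mathcal A}$ be the functor on its horizontal trace that is the identity on objects and acts on morphisms by $\psi\mapsto\widetilde\psi$. Then, with tensor structure given by the braiding $c_{Y,X}:\hat U(X)\,\hat\otimes^{\mathrm{op}}\,\hat U(Y)=Y X\to XY=\hat U(X\hat\otimes Y)$, there is a tensor equivalence $$(\hat U,c):(\hat{\mathcal A},\hat\otimes)\simeq(\hat{\mathcal A},\hat\otimes^{\mathrm{op}}).$$ Furthermore, the inverse twist gives a natural isomorphism $\theta^{-1}:\hat U^2\cong\mathrm{id}$, so $\hat U$ generates a $\mathbb Z/2$-action on $\hat{\mathcal A}$ (not an action by tensor functors). The tensor equivalence and the $\mathbb Z/2$-action extend naturally to the Karoubi envelope $\mathrm{Kar}(\hat{\mathcal A})$.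
   Context: $\mathbf k$ is an algebraically closed field of characteristic zero. A premodular category $\mathcal A$ is a $\mathbf k$-linear ribbon fusion category, with unit $\mathbf 1$, tensor product $\otimes$ (also concatenation), braiding $c_{X,Y}:XY\to YX$, twist $\theta$ with $\theta_{XY}=c_{Y,X}c_{X,Y}(\theta_X\otimes\theta_Y)$; associativity and pivotal isomorphisms are suppressed. Via the pivotal structure there are $\widetilde{\mathrm{ev}}_A:AA^*\to\mathbf 1$ and $\widetilde{\mathrm{coev}}_A:\mathbf 1\to A^*A$. Horizontal trace: $\hat{\mathcal A}$ has the objects of $\mathcal A$ and $\mathrm{Hom}_{\hat{\mathcal A}}(X,X')=\bigoplus_A\mathrm{Hom}_{\mathcal A}(AX,X'A)/\sim$, where $\psi\circ(f\otimes\mathrm{id}_X)\sim(\mathrm{id}_{X'}\otimes f)\circ\psi$ for $\psi:BX\to X'A$, $f:A\to B$. The composite of $\varphi:AX\to X'A$ and $\psi:BX'\to X''B$ is $(\psi\otimes\mathrm{id}_A)(\mathrm{id}_B\otimes\varphi)$. A morphism of $\mathcal A$ gives a morphism of $\hat{\mathcal A}$ by taking $A=\mathbf 1$; in this sense $c_{Y,X}$ and $\theta_X^{-1}$ are morphisms of $\hat{\mathcal A}$. The tensor product $\hat\otimes$ is that of $\mathcal A$ on objects, and for $\varphi:AX\to X'A$, $\psi:BY\to Y'B$, $\varphi\hat\otimes\psi=(\mathrm{id}_{X'}\otimes c_{Y',A}^{-1}\otimes\mathrm{id}_B)(\varphi\otimes\psi)(\mathrm{id}_A\otimes c_{B,X}\otimes\mathrm{id}_Y)$;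 unit $\mathbf 1$. $X\hat\otimes^{\mathrm{op}}Y=Y\hat\otimes X$. For $\psi:AX\to X'A$, $\widetilde\psi:A^*X\to X'A^*$ is $$\widetilde\psi=c_{X',A^*}^{-1}\circ(\mathrm{id}_{A^*X'}\otimes\widetilde{\mathrm{ev}}_A)(\mathrm{id}_{A^*}\otimes\psi\otimes\mathrm{id}_{A^*})(\widetilde{\mathrm{coev}}_A\otimes\mathrm{id}_{XA^*})\circ c_{A^*,X};$$ it induces a map on $\mathrm{Hom}_{\hat{\mathcal A}}(X,X')$. A $\mathbb Z/2$-action generated by a functor $U$ means $U$ together with a natural isomorphism $\eta:U^2\cong\mathrm{id}$ with $U\eta=\eta U$. *)

theory Defs
  imports
    "HOL-Computational_Algebra.Polynomial"
    "HOL-Algebra.AbelCoset"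
    "HOL-Algebra.Module"
begin

section \<open>Linear categories\<close>

text \<open>
  Small categories with explicit sets of objects and arrows; an arrow determines its source and
  target, and \<open>g \<cdot> f\<close> is ``first f, then g''.  Operations are total HOL functions and are only
  constrained on composable (parallel, \dots) arrows.  The ground field is the type \<open>'k\<close>.
\<close>

definition scalars :: "'k::field ring" where
  "scalars = \<lparr>carrier = UNIV, monoid.mult = (*), one = 1, ring.zero = 0, add = (+)\<rparr>"

record ('o, 'a, 'k) linear_cat =
  Obj :: "'o set"
  Arr :: "'a set"
  Dom :: "'a \<Rightarrow> 'o"
  Cod :: "'a \<Rightarrow> 'o"
  Idt :: "'o \<Rightarrow> 'a"
  Cmp :: "'a \<Rightarrow> 'a \<Rightarrow> 'a"  (infixr \<open>\<cdot>\<index>\<close> 55)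
  Zer :: "'o \<Rightarrow> 'o \<Rightarrow> 'a"
  Add :: "'a \<Rightarrow> 'a \<Rightarrow> 'a"
  Scl :: "'k \<Rightarrow> 'a \<Rightarrow> 'a"

definition Mor :: "('o, 'a, 'k, 'z) linear_cat_scheme \<Rightarrow> 'o \<Rightarrow> 'o \<Rightarrow> 'a set" where
  "Mor C X Y = {f \<in> Arr C. Dom C f = X \<and> Cod C f = Y}"

text \<open>The fields \<open>mult\<close> and \<open>one\<close> of the record \<open>module\<close> play no role for modules.\<close>

definition hom_space :: "('o, 'a, 'k, 'z) linear_cat_scheme \<Rightarrow> 'o \<Rightarrow> 'o \<Rightarrow> ('k, 'a) module" where
  "hom_space C X Y =
     \<lparr>carrier = Mor C X Y, monoid.mult = undefined, one = undefined,
      ring.zero = Zer C X Y, add = Add C, smult = Scl C\<rparr>"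

definition generated_submodule :: "('k, 'r) ring_scheme \<Rightarrow> ('k, 'v, 'm) module_scheme \<Rightarrow> 'v set \<Rightarrow> 'v set"
  where "generated_submodule R M S = \<Inter>{H. submodule H R M \<and> S \<subseteq> H}"

locale linear_category =
  fixes C :: "('o, 'a, 'k::field, 'z) linear_cat_scheme" (structure)
  assumes Dom_Cod: "f \<in> Arr C \<Longrightarrow> Dom C f \<in> Obj C \<and> Cod C f \<in> Obj C"
    and Idt_Mor: "X \<in> Obj C \<Longrightarrow> Idt C X \<in> Mor C X X"
    and Cmp_Mor: "f \<in> Mor C X Y \<Longrightarrow> g \<in> Mor C Y Z \<Longrightarrow> g \<cdot> f \<in> Mor C X Z"
    and Cmp_Idt: "f \<in> Mor C X Y \<Longrightarrow> f \<cdot> Idt C X = f"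
    and Idt_Cmp: "f \<in> Mor C X Y \<Longrightarrow> Idt C Y \<cdot> f = f"
    and Cmp_assoc:
      "f \<in> Mor C W X \<Longrightarrow> g \<in> Mor C X Y \<Longrightarrow> h \<in> Mor C Y Z \<Longrightarrow> (h \<cdot> g) \<cdot> f = h \<cdot> (g \<cdot> f)"
    and hom_space_module:
      "X \<in> Obj C \<Longrightarrow> Y \<in> Obj C \<Longrightarrow> module (scalars :: 'k ring) (hom_space C X Y)"
    and Cmp_Add_right:
      "f \<in> Mor C X Y \<Longrightarrow> f' \<in> Mor C X Y \<Longrightarrow> g \<in> Mor C Y Z \<Longrightarrow>
        g \<cdot> Add C f f' = Add C (g \<cdot> f) (g \<cdot> f')"
    and Cmp_Add_left:
      "f \<in> Mor C X Y \<Longrightarrow> g \<in> Mor C Y Z \<Longrightarrow> g' \<in> Mor C Y Z \<Longrightarrow>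
        Add C g g' \<cdot> f = Add C (g \<cdot> f) (g' \<cdot> f)"
    and Cmp_Scl_right:
      "f \<in> Mor C X Y \<Longrightarrow> g \<in> Mor C Y Z \<Longrightarrow> g \<cdot> Scl C a f = Scl C a (g \<cdot> f)"
    and Cmp_Scl_left:
      "f \<in> Mor C X Y \<Longrightarrow> g \<in> Mor C Y Z \<Longrightarrow> Scl C a g \<cdot> f = Scl C a (g \<cdot> f)"

definition inverse_arrows :: "('o, 'a, 'k, 'z) linear_cat_scheme \<Rightarrow> 'a \<Rightarrow> 'a \<Rightarrow> bool" where
  "inverse_arrows C f g \<longleftrightarrow>
     f \<in> Arr C \<and> g \<in> Mor C (Cod C f) (Dom C f) \<and>
     Cmp C g f = Idt C (Dom C f) \<and> Cmp C f g = Idt C (Cod C f)"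

definition iso_arr :: "('o, 'a, 'k, 'z) linear_cat_scheme \<Rightarrow> 'a \<Rightarrow> bool" where
  "iso_arr C f \<longleftrightarrow> (\<exists>g. inverse_arrows C f g)"

definition inv_arr :: "('o, 'a, 'k, 'z) linear_cat_scheme \<Rightarrow> 'a \<Rightarrow> 'a" where
  "inv_arr C f = (THE g. inverse_arrows C f g)"

definition iso_objs :: "('o, 'a, 'k, 'z) linear_cat_scheme \<Rightarrow> 'o \<Rightarrow> 'o \<Rightarrow> bool" where
  "iso_objs C X Y \<longleftrightarrow> (\<exists>f \<in> Mor C X Y. iso_arr C f)"


section \<open>Abelian and semisimple categories\<close>

text \<open>For \<open>n = 0\<close> this says that \<open>X\<close> is a zero object.\<close>

definition is_direct_sum ::
    "('o, 'a, 'k, 'z) linear_cat_scheme \<Rightarrow> nat \<Rightarrow> (nat \<Rightarrow> 'o) \<Rightarrow> 'o \<Rightarrow> (nat \<Rightarrow> 'a) \<Rightarrow> (nat \<Rightarrow> 'a) \<Rightarrow> bool"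
  where
  "is_direct_sum C n S X ins prj \<longleftrightarrow>
     X \<in> Obj C \<and> (\<forall>i<n. S i \<in> Obj C \<and> ins i \<in> Mor C (S i) X \<and> prj i \<in> Mor C X (S i)) \<and>
     (\<forall>i<n. \<forall>j<n. Cmp C (prj i) (ins j) = (if i = j then Idt C (S i) else Zer C (S j) (S i))) \<and>
     finsum (hom_space C X X) (\<lambda>i. Cmp C (ins i) (prj i)) {..<n} = Idt C X"

definition mono_arr :: "('o, 'a, 'k, 'z) linear_cat_scheme \<Rightarrow> 'a \<Rightarrow> bool" where
  "mono_arr C f \<longleftrightarrow> f \<in> Arr C \<and>
     (\<forall>Z \<in> Obj C. \<forall>g \<in> Mor C Z (Dom C f). \<forall>h \<in> Mor C Z (Dom C f).
        Cmp C f g = Cmp C f h \<longrightarrow> g = h)"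

definition epi_arr :: "('o, 'a, 'k, 'z) linear_cat_scheme \<Rightarrow> 'a \<Rightarrow> bool" where
  "epi_arr C f \<longleftrightarrow> f \<in> Arr C \<and>
     (\<forall>Z \<in> Obj C. \<forall>g \<in> Mor C (Cod C f) Z. \<forall>h \<in> Mor C (Cod C f) Z.
        Cmp C g f = Cmp C h f \<longrightarrow> g = h)"

definition is_kernel :: "('o, 'a, 'k, 'z) linear_cat_scheme \<Rightarrow> 'a \<Rightarrow> 'a \<Rightarrow> bool" where
  "is_kernel C f k \<longleftrightarrow>
     f \<in> Arr C \<and> k \<in> Arr C \<and> Cod C k = Dom C f \<and>
     Cmp C f k = Zer C (Dom C k) (Cod C f) \<and>
     (\<forall>Z \<in> Obj C. \<forall>g \<in> Mor C Z (Dom C f). Cmp C f g = Zer C Z (Cod C f) \<longrightarrow>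
        (\<exists>!h. h \<in> Mor C Z (Dom C k) \<and> Cmp C k h = g))"

definition is_cokernel :: "('o, 'a, 'k, 'z) linear_cat_scheme \<Rightarrow> 'a \<Rightarrow> 'a \<Rightarrow> bool" where
  "is_cokernel C f q \<longleftrightarrow>
     f \<in> Arr C \<and> q \<in> Arr C \<and> Dom C q = Cod C f \<and>
     Cmp C q f = Zer C (Dom C f) (Cod C q) \<and>
     (\<forall>Z \<in> Obj C. \<forall>g \<in> Mor C (Cod C f) Z. Cmp C g f = Zer C (Dom C f) Z \<longrightarrow>
        (\<exists>!h. h \<in> Mor C (Cod C q) Z \<and> Cmp C h q = g))"

locale abelian_linear_category = linear_category C
  for C :: "('o, 'a, 'k::field, 'z) linear_cat_scheme" (structure) +
  assumes direct_sums: "\<forall>i<n. S i \<in> Obj C \<Longrightarrow> \<exists>X ins prj. is_direct_sum C n S X ins prj"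
    and kernels: "f \<in> Arr C \<Longrightarrow> \<exists>k. is_kernel C f k"
    and cokernels: "f \<in> Arr C \<Longrightarrow> \<exists>q. is_cokernel C f q"
    and mono_is_kernel: "mono_arr C f \<Longrightarrow> \<exists>g. is_kernel C g f"
    and epi_is_cokernel: "epi_arr C f \<Longrightarrow> \<exists>g. is_cokernel C g f"

definition simple_obj :: "('o, 'a, 'k, 'z) linear_cat_scheme \<Rightarrow> 'o \<Rightarrow> bool" where
  "simple_obj C X \<longleftrightarrow>
     X \<in> Obj C \<and> Idt C X \<noteq> Zer C X X \<and>
     (\<forall>f. mono_arr C f \<and> Cod C f = X \<longrightarrow> Idt C (Dom C f) = Zer C (Dom C f) (Dom C f) \<or> iso_arr C f)"

locale finite_semisimple_category = abelian_linear_category C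
  for C :: "('o, 'a, 'k::field, 'z) linear_cat_scheme" (structure) +
  assumes semisimple:
      "X \<in> Obj C \<Longrightarrow> \<exists>n S ins prj. (\<forall>i<n. simple_obj C (S i)) \<and> is_direct_sum C n S X ins prj"
    and finitely_many_simples:
      "\<exists>\<S>. finite \<S> \<and> (\<forall>X. simple_obj C X \<longrightarrow> (\<exists>Y \<in> \<S>. simple_obj C Y \<and> iso_objs C X Y))"
    and finite_dimensional_homs:
      "X \<in> Obj C \<Longrightarrow> Y \<in> Obj C \<Longrightarrow>
        \<exists>B. finite B \<and> B \<subseteq> Mor C X Y \<and>
          generated_submodule (scalars :: 'k ring) (hom_space C X Y) B = Mor C X Y"


section \<open>Monoidal, rigid, and premodular categories\<close>

text \<open>
  Associators \<open>Asc X Y Z : (X \<boxtimes> Y) \<boxtimes> Z \<rightarrow> X \<boxtimes> (Y \<boxtimes> Z)\<close> and unitors \<open>LUn X : \<one> \<boxtimes> X \<rightarrow> X\<close>,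
  \<open>RUn X : X \<boxtimes> \<one> \<rightarrow> X\<close> are part of the data, so no strictness is assumed.
\<close>

record ('o, 'a, 'k) monoidal_cat = "('o, 'a, 'k) linear_cat" +
  Unit :: "'o"  (\<open>\<I>\<index>\<close>)
  TenO :: "'o \<Rightarrow> 'o \<Rightarrow> 'o"  (infixr \<open>\<boxtimes>\<index>\<close> 70)
  TenA :: "'a \<Rightarrow> 'a \<Rightarrow> 'a"  (infixr \<open>\<star>\<index>\<close> 70)
  Asc :: "'o \<Rightarrow> 'o \<Rightarrow> 'o \<Rightarrow> 'a"
  LUn :: "'o \<Rightarrow> 'a"
  RUn :: "'o \<Rightarrow> 'a"

locale monoidal_category = linear_category C
  for C :: "('o, 'a, 'k::field, 'z) monoidal_cat_scheme" (structure) +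
  assumes Unit_Obj: "\<I> \<in> Obj C"
    and TenO_Obj: "X \<in> Obj C \<Longrightarrow> Y \<in> Obj C \<Longrightarrow> X \<boxtimes> Y \<in> Obj C"
    and TenA_Mor:
      "f \<in> Mor C X X' \<Longrightarrow> g \<in> Mor C Y Y' \<Longrightarrow> f \<star> g \<in> Mor C (X \<boxtimes> Y) (X' \<boxtimes> Y')"
    and TenA_Idt: "X \<in> Obj C \<Longrightarrow> Y \<in> Obj C \<Longrightarrow> Idt C X \<star> Idt C Y = Idt C (X \<boxtimes> Y)"
    and TenA_Cmp:
      "f \<in> Mor C X X' \<Longrightarrow> f' \<in> Mor C X' X'' \<Longrightarrow> g \<in> Mor C Y Y' \<Longrightarrow> g' \<in> Mor C Y' Y'' \<Longrightarrow>
        (f' \<cdot> f) \<star> (g' \<cdot> g) = (f' \<star> g') \<cdot> (f \<star> g)"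
    and TenA_Add_left:
      "f \<in> Mor C X X' \<Longrightarrow> f' \<in> Mor C X X' \<Longrightarrow> g \<in> Mor C Y Y' \<Longrightarrow>
        Add C f f' \<star> g = Add C (f \<star> g) (f' \<star> g)"
    and TenA_Add_right:
      "f \<in> Mor C X X' \<Longrightarrow> g \<in> Mor C Y Y' \<Longrightarrow> g' \<in> Mor C Y Y' \<Longrightarrow>
        f \<star> Add C g g' = Add C (f \<star> g) (f \<star> g')"
    and TenA_Scl_left:
      "f \<in> Mor C X X' \<Longrightarrow> g \<in> Mor C Y Y' \<Longrightarrow> Scl C a f \<star> g = Scl C a (f \<star> g)"
    and TenA_Scl_right:
      "f \<in> Mor C X X' \<Longrightarrow> g \<in> Mor C Y Y' \<Longrightarrow> f \<star> Scl C a g = Scl C a (f \<star> g)"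
    and Asc_Mor:
      "X \<in> Obj C \<Longrightarrow> Y \<in> Obj C \<Longrightarrow> Z \<in> Obj C \<Longrightarrow>
        Asc C X Y Z \<in> Mor C ((X \<boxtimes> Y) \<boxtimes> Z) (X \<boxtimes> (Y \<boxtimes> Z)) \<and> iso_arr C (Asc C X Y Z)"
    and Asc_natural:
      "f \<in> Mor C X X' \<Longrightarrow> g \<in> Mor C Y Y' \<Longrightarrow> h \<in> Mor C Z Z' \<Longrightarrow>
        Asc C X' Y' Z' \<cdot> ((f \<star> g) \<star> h) = (f \<star> (g \<star> h)) \<cdot> Asc C X Y Z"
    and LUn_Mor: "X \<in> Obj C \<Longrightarrow> LUn C X \<in> Mor C (\<I> \<boxtimes> X) X \<and> iso_arr C (LUn C X)"
    and LUn_natural: "f \<in> Mor C X Y \<Longrightarrow> LUn C Y \<cdot> (Idt C \<I> \<star> f) = f \<cdot> LUn C X"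
    and RUn_Mor: "X \<in> Obj C \<Longrightarrow> RUn C X \<in> Mor C (X \<boxtimes> \<I>) X \<and> iso_arr C (RUn C X)"
    and RUn_natural: "f \<in> Mor C X Y \<Longrightarrow> RUn C Y \<cdot> (f \<star> Idt C \<I>) = f \<cdot> RUn C X"
    and pentagon:
      "W \<in> Obj C \<Longrightarrow> X \<in> Obj C \<Longrightarrow> Y \<in> Obj C \<Longrightarrow> Z \<in> Obj C \<Longrightarrow>
        Asc C W X (Y \<boxtimes> Z) \<cdot> Asc C (W \<boxtimes> X) Y Z =
        (Idt C W \<star> Asc C X Y Z) \<cdot> Asc C W (X \<boxtimes> Y) Z \<cdot> (Asc C W X Y \<star> Idt C Z)"
    and triangle:
      "X \<in> Obj C \<Longrightarrow> Y \<in> Obj C \<Longrightarrow>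
        (Idt C X \<star> LUn C Y) \<cdot> Asc C X \<I> Y = RUn C X \<star> Idt C Y"

record ('o, 'a, 'k) ribbon_cat = "('o, 'a, 'k) monoidal_cat" +
  Dual :: "'o \<Rightarrow> 'o"
  Ev :: "'o \<Rightarrow> 'a"
  Coev :: "'o \<Rightarrow> 'a"
  Brd :: "'o \<Rightarrow> 'o \<Rightarrow> 'a"
  Twist :: "'o \<Rightarrow> 'a"

text \<open>\<open>Y\<close> is a left dual of \<open>X\<close> via \<open>ev : Y \<boxtimes> X \<rightarrow> \<one>\<close> and \<open>coev : \<one> \<rightarrow> X \<boxtimes> Y\<close>.\<close>

definition is_left_dual ::
    "('o, 'a, 'k, 'z) monoidal_cat_scheme \<Rightarrow> 'o \<Rightarrow> 'o \<Rightarrow> 'a \<Rightarrow> 'a \<Rightarrow> bool" where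
  "is_left_dual C X Y ev coev \<longleftrightarrow>
     Y \<in> Obj C \<and> ev \<in> Mor C (Y \<boxtimes> X) \<I> \<and> coev \<in> Mor C \<I> (X \<boxtimes> Y) \<and>
     RUn C X \<cdot> (Idt C X \<star> ev) \<cdot> Asc C X Y X \<cdot> (coev \<star> Idt C X) \<cdot> inv_arr C (LUn C X) = Idt C X \<and>
     LUn C Y \<cdot> (ev \<star> Idt C Y) \<cdot> inv_arr C (Asc C Y X Y) \<cdot> (Idt C Y \<star> coev) \<cdot> inv_arr C (RUn C Y)
       = Idt C Y"
  for C (structure)

definition dual_arr :: "('o, 'a, 'k, 'z) ribbon_cat_scheme \<Rightarrow> 'a \<Rightarrow> 'a" where
  "dual_arr C f =
     (let X = Dom C f; Y = Cod C f; X' = Dual C X; Y' = Dual C Y in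
       LUn C X' \<cdot> (Ev C Y \<star> Idt C X') \<cdot> inv_arr C (Asc C Y' Y X') \<cdot>
       (Idt C Y' \<star> (f \<star> Idt C X')) \<cdot> (Idt C Y' \<star> Coev C X) \<cdot> inv_arr C (RUn C Y'))"
  for C (structure)

locale fusion_category = monoidal_category C + finite_semisimple_category C
  for C :: "('o, 'a, 'k::field, 'z) ribbon_cat_scheme" (structure) +
  assumes left_duals: "X \<in> Obj C \<Longrightarrow> is_left_dual C X (Dual C X) (Ev C X) (Coev C X)"
    and right_duals: "X \<in> Obj C \<Longrightarrow> \<exists>Y \<in> Obj C. \<exists>ev coev. is_left_dual C Y X ev coev"
    and simple_Unit: "simple_obj C \<I>"

locale premodular_category = fusion_category C
  for C :: "('o, 'a, 'k::field, 'z) ribbon_cat_scheme" (structure) +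
  assumes Brd_Mor:
      "X \<in> Obj C \<Longrightarrow> Y \<in> Obj C \<Longrightarrow> Brd C X Y \<in> Mor C (X \<boxtimes> Y) (Y \<boxtimes> X) \<and> iso_arr C (Brd C X Y)"
    and Brd_natural:
      "f \<in> Mor C X X' \<Longrightarrow> g \<in> Mor C Y Y' \<Longrightarrow> Brd C X' Y' \<cdot> (f \<star> g) = (g \<star> f) \<cdot> Brd C X Y"
    and hexagon1:
      "X \<in> Obj C \<Longrightarrow> Y \<in> Obj C \<Longrightarrow> Z \<in> Obj C \<Longrightarrow>
        Asc C Y Z X \<cdot> Brd C X (Y \<boxtimes> Z) \<cdot> Asc C X Y Z =
        (Idt C Y \<star> Brd C X Z) \<cdot> Asc C Y X Z \<cdot> (Brd C X Y \<star> Idt C Z)"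
    and hexagon2:
      "X \<in> Obj C \<Longrightarrow> Y \<in> Obj C \<Longrightarrow> Z \<in> Obj C \<Longrightarrow>
        inv_arr C (Asc C Z X Y) \<cdot> Brd C (X \<boxtimes> Y) Z \<cdot> inv_arr C (Asc C X Y Z) =
        (Brd C X Z \<star> Idt C Y) \<cdot> inv_arr C (Asc C X Z Y) \<cdot> (Idt C X \<star> Brd C Y Z)"
    and Twist_Mor: "X \<in> Obj C \<Longrightarrow> Twist C X \<in> Mor C X X \<and> iso_arr C (Twist C X)"
    and Twist_natural: "f \<in> Mor C X Y \<Longrightarrow> Twist C Y \<cdot> f = f \<cdot> Twist C X"
    and balancing:
      "X \<in> Obj C \<Longrightarrow> Y \<in> Obj C \<Longrightarrow>
        Twist C (X \<boxtimes> Y) = Brd C Y X \<cdot> Brd C X Y \<cdot> (Twist C X \<star> Twist C Y)"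
    and Twist_Dual: "X \<in> Obj C \<Longrightarrow> Twist C (Dual C X) = dual_arr C (Twist C X)"

text \<open>
  The pivotal structure of a ribbon category: the Drinfeld isomorphism
  \<open>X \<rightarrow> X \<boxtimes> (X* \<boxtimes> X**) \<rightarrow> (X* \<boxtimes> X) \<boxtimes> X** \<rightarrow> X**\<close> precomposed with the twist.
\<close>

definition pivot :: "('o, 'a, 'k, 'z) ribbon_cat_scheme \<Rightarrow> 'o \<Rightarrow> 'a" where
  "pivot C X =
     (let X' = Dual C X; X'' = Dual C X' in
       LUn C X'' \<cdot> (Ev C X \<star> Idt C X'') \<cdot> (Brd C X X' \<star> Idt C X'') \<cdot> inv_arr C (Asc C X X' X'') \<cdot>
       (Idt C X \<star> Coev C X') \<cdot> inv_arr C (RUn C X) \<cdot> Twist C X)"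
  for C (structure)

text \<open>\<open>piv_ev C X : X \<boxtimes> X* \<rightarrow> \<one>\<close> and \<open>piv_coev C X : \<one> \<rightarrow> X* \<boxtimes> X\<close>.\<close>

definition piv_ev :: "('o, 'a, 'k, 'z) ribbon_cat_scheme \<Rightarrow> 'o \<Rightarrow> 'a" where
  "piv_ev C X = Ev C (Dual C X) \<cdot> (pivot C X \<star> Idt C (Dual C X))"
  for C (structure)

definition piv_coev :: "('o, 'a, 'k, 'z) ribbon_cat_scheme \<Rightarrow> 'o \<Rightarrow> 'a" where
  "piv_coev C X = (Idt C (Dual C X) \<star> inv_arr C (pivot C X)) \<cdot> Coev C (Dual C X)"
  for C (structure)


section \<open>Functors\<close>

text \<open>A functor is given by its object map \<open>Fo\<close> and its arrow map \<open>Fa\<close>.\<close>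

locale linear_functor = C: linear_category C + D: linear_category D
  for C :: "('o, 'a, 'k::field, 'z) linear_cat_scheme"
    and D :: "('p, 'b, 'k, 'y) linear_cat_scheme" +
  fixes Fo :: "'o \<Rightarrow> 'p" and Fa :: "'a \<Rightarrow> 'b"
  assumes Fo_Obj: "X \<in> Obj C \<Longrightarrow> Fo X \<in> Obj D"
    and Fa_Mor: "f \<in> Mor C X Y \<Longrightarrow> Fa f \<in> Mor D (Fo X) (Fo Y)"
    and Fa_Idt: "X \<in> Obj C \<Longrightarrow> Fa (Idt C X) = Idt D (Fo X)"
    and Fa_Cmp: "f \<in> Mor C X Y \<Longrightarrow> g \<in> Mor C Y Z \<Longrightarrow> Fa (g \<cdot>\<^bsub>C\<^esub> f) = Fa g \<cdot>\<^bsub>D\<^esub> Fa f"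
    and Fa_Add: "f \<in> Mor C X Y \<Longrightarrow> g \<in> Mor C X Y \<Longrightarrow> Fa (Add C f g) = Add D (Fa f) (Fa g)"
    and Fa_Scl: "f \<in> Mor C X Y \<Longrightarrow> Fa (Scl C a f) = Scl D a (Fa f)"

definition natural_iso ::
    "('o, 'a, 'k, 'z) linear_cat_scheme \<Rightarrow> ('p, 'b, 'k, 'y) linear_cat_scheme \<Rightarrow>
     ('o \<Rightarrow> 'p) \<Rightarrow> ('a \<Rightarrow> 'b) \<Rightarrow> ('o \<Rightarrow> 'p) \<Rightarrow> ('a \<Rightarrow> 'b) \<Rightarrow> ('o \<Rightarrow> 'b) \<Rightarrow> bool" where
  "natural_iso C D Fo Fa Go Ga \<eta> \<longleftrightarrow>
     (\<forall>X \<in> Obj C. \<eta> X \<in> Mor D (Fo X) (Go X) \<and> iso_arr D (\<eta> X)) \<and>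
     (\<forall>f \<in> Arr C. \<eta> (Cod C f) \<cdot>\<^bsub>D\<^esub> Fa f = Ga f \<cdot>\<^bsub>D\<^esub> \<eta> (Dom C f))"

definition category_equivalence ::
    "('o, 'a, 'k::field, 'z) linear_cat_scheme \<Rightarrow> ('p, 'b, 'k, 'y) linear_cat_scheme \<Rightarrow>
     ('o \<Rightarrow> 'p) \<Rightarrow> ('a \<Rightarrow> 'b) \<Rightarrow> bool" where
  "category_equivalence C D Fo Fa \<longleftrightarrow>
     linear_functor C D Fo Fa \<and>
     (\<exists>Go Ga \<eta> \<epsilon>. linear_functor D C Go Ga \<and>
        natural_iso C C id id (Go \<circ> Fo) (Ga \<circ> Fa) \<eta> \<and>
        natural_iso D D (Fo \<circ> Go) (Fa \<circ> Ga) id id \<epsilon>)"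

text \<open>Structure maps \<open>J X Y : F X \<boxtimes> F Y \<rightarrow> F (X \<boxtimes> Y)\<close> and \<open>e : \<one> \<rightarrow> F \<one>\<close>.\<close>

locale tensor_functor =
  linear_functor C D Fo Fa + C: monoidal_category C + D: monoidal_category D
  for C :: "('o, 'a, 'k::field, 'z) monoidal_cat_scheme"
    and D :: "('p, 'b, 'k, 'y) monoidal_cat_scheme"
    and Fo :: "'o \<Rightarrow> 'p" and Fa :: "'a \<Rightarrow> 'b" +
  fixes J :: "'o \<Rightarrow> 'o \<Rightarrow> 'b" and e :: 'b
  assumes J_Mor:
      "X \<in> Obj C \<Longrightarrow> Y \<in> Obj C \<Longrightarrow>
        J X Y \<in> Mor D (Fo X \<boxtimes>\<^bsub>D\<^esub> Fo Y) (Fo (X \<boxtimes>\<^bsub>C\<^esub> Y)) \<and> iso_arr D (J X Y)"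
    and J_natural:
      "f \<in> Mor C X X' \<Longrightarrow> g \<in> Mor C Y Y' \<Longrightarrow>
        J X' Y' \<cdot>\<^bsub>D\<^esub> (Fa f \<star>\<^bsub>D\<^esub> Fa g) = Fa (f \<star>\<^bsub>C\<^esub> g) \<cdot>\<^bsub>D\<^esub> J X Y"
    and e_Mor: "e \<in> Mor D \<I>\<^bsub>D\<^esub> (Fo \<I>\<^bsub>C\<^esub>) \<and> iso_arr D e"
    and J_assoc:
      "X \<in> Obj C \<Longrightarrow> Y \<in> Obj C \<Longrightarrow> Z \<in> Obj C \<Longrightarrow>
        Fa (Asc C X Y Z) \<cdot>\<^bsub>D\<^esub> J (X \<boxtimes>\<^bsub>C\<^esub> Y) Z \<cdot>\<^bsub>D\<^esub> (J X Y \<star>\<^bsub>D\<^esub> Idt D (Fo Z)) =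
        J X (Y \<boxtimes>\<^bsub>C\<^esub> Z) \<cdot>\<^bsub>D\<^esub> (Idt D (Fo X) \<star>\<^bsub>D\<^esub> J Y Z) \<cdot>\<^bsub>D\<^esub> Asc D (Fo X) (Fo Y) (Fo Z)"
    and J_left_unit:
      "X \<in> Obj C \<Longrightarrow>
        Fa (LUn C X) \<cdot>\<^bsub>D\<^esub> J \<I>\<^bsub>C\<^esub> X \<cdot>\<^bsub>D\<^esub> (e \<star>\<^bsub>D\<^esub> Idt D (Fo X)) = LUn D (Fo X)"
    and J_right_unit:
      "X \<in> Obj C \<Longrightarrow>
        Fa (RUn C X) \<cdot>\<^bsub>D\<^esub> J X \<I>\<^bsub>C\<^esub> \<cdot>\<^bsub>D\<^esub> (Idt D (Fo X) \<star>\<^bsub>D\<^esub> e) = RUn D (Fo X)"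

definition tensor_equivalence ::
    "('o, 'a, 'k::field, 'z) monoidal_cat_scheme \<Rightarrow> ('p, 'b, 'k, 'y) monoidal_cat_scheme \<Rightarrow>
     ('o \<Rightarrow> 'p) \<Rightarrow> ('a \<Rightarrow> 'b) \<Rightarrow> ('o \<Rightarrow> 'o \<Rightarrow> 'b) \<Rightarrow> 'b \<Rightarrow> bool" where
  "tensor_equivalence C D Fo Fa J e \<longleftrightarrow>
     tensor_functor C D Fo Fa J e \<and> category_equivalence C D Fo Fa"

definition rev_tensor ::
    "('o, 'a, 'k, 'z) monoidal_cat_scheme \<Rightarrow> ('o, 'a, 'k, 'z) monoidal_cat_scheme" where
  "rev_tensor C =
     C\<lparr>TenO := \<lambda>X Y. TenO C Y X, TenA := \<lambda>f g. TenA C g f,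
       Asc := \<lambda>X Y Z. inv_arr C (Asc C Z Y X), LUn := RUn C, RUn := LUn C\<rparr>"

definition z2_action ::
    "('o, 'a, 'k::field, 'z) linear_cat_scheme \<Rightarrow> ('o \<Rightarrow> 'o) \<Rightarrow> ('a \<Rightarrow> 'a) \<Rightarrow> ('o \<Rightarrow> 'a) \<Rightarrow> bool" where
  "z2_action C Uo Ua \<eta> \<longleftrightarrow>
     linear_functor C C Uo Ua \<and>
     natural_iso C C (Uo \<circ> Uo) (Ua \<circ> Ua) id id \<eta> \<and>
     (\<forall>X \<in> Obj C. Ua (\<eta> X) = \<eta> (Uo X))"


section \<open>The horizontal trace\<close>

text \<open>The direct sum of the spaces of arrows \<open>A \<boxtimes> X \<rightarrow> X' \<boxtimes> A\<close> over all objects \<open>A\<close>.\<close>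

definition trace_sum ::
    "('o, 'a, 'k, 'z) monoidal_cat_scheme \<Rightarrow> 'o \<Rightarrow> 'o \<Rightarrow> ('k, 'o \<Rightarrow> 'a) module" where
  "trace_sum C X X' =
     \<lparr>carrier = {p \<in> \<Pi>\<^sub>E A \<in> Obj C. Mor C (A \<boxtimes> X) (X' \<boxtimes> A).
                  finite {A \<in> Obj C. p A \<noteq> Zer C (A \<boxtimes> X) (X' \<boxtimes> A)}},
      monoid.mult = undefined, one = undefined,
      ring.zero = (\<lambda>A \<in> Obj C. Zer C (A \<boxtimes> X) (X' \<boxtimes> A)),
      add = (\<lambda>p q. \<lambda>A \<in> Obj C. Add C (p A) (q A)),
      smult = (\<lambda>a p. \<lambda>A \<in> Obj C. Scl C a (p A))\<rparr>"
  for C (structure)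

definition trace_supp ::
    "('o, 'a, 'k, 'z) monoidal_cat_scheme \<Rightarrow> 'o \<Rightarrow> 'o \<Rightarrow> ('o \<Rightarrow> 'a) \<Rightarrow> 'o set" where
  "trace_supp C X X' p = {A \<in> Obj C. p A \<noteq> Zer C (A \<boxtimes> X) (X' \<boxtimes> A)}"
  for C (structure)

definition trace_single ::
    "('o, 'a, 'k, 'z) monoidal_cat_scheme \<Rightarrow> 'o \<Rightarrow> 'o \<Rightarrow> 'o \<Rightarrow> 'a \<Rightarrow> 'o \<Rightarrow> 'a" where
  "trace_single C X X' A \<psi> = (\<lambda>B \<in> Obj C. if B = A then \<psi> else Zer C (B \<boxtimes> X) (X' \<boxtimes> B))"
  for C (structure)

definition trace_rel :: "('o, 'a, 'k::field, 'z) monoidal_cat_scheme \<Rightarrow> 'o \<Rightarrow> 'o \<Rightarrow> ('o \<Rightarrow> 'a) set" where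
  "trace_rel C X X' =
     generated_submodule (scalars :: 'k ring) (trace_sum C X X')
       {trace_single C X X' A (\<psi> \<cdot> (f \<star> Idt C X))
          \<ominus>\<^bsub>trace_sum C X X'\<^esub> trace_single C X X' B ((Idt C X' \<star> f) \<cdot> \<psi>)
        | A B f \<psi>. A \<in> Obj C \<and> B \<in> Obj C \<and> f \<in> Mor C A B \<and> \<psi> \<in> Mor C (B \<boxtimes> X) (X' \<boxtimes> A)}"
  for C (structure)

text \<open>An arrow of the horizontal trace is a triple of source, target and coset.\<close>

type_synonym ('o, 'a) trace_arr = "'o \<times> 'o \<times> ('o \<Rightarrow> 'a) set"

definition trace_class ::
    "('o, 'a, 'k::field, 'z) monoidal_cat_scheme \<Rightarrow> 'o \<Rightarrow> 'o \<Rightarrow> ('o \<Rightarrow> 'a) \<Rightarrow> ('o \<Rightarrow> 'a) set" where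
  "trace_class C X X' p = trace_rel C X X' +>\<^bsub>trace_sum C X X'\<^esub> p"

text \<open>The morphism of the horizontal trace given by a morphism \<open>X \<rightarrow> X'\<close>, with \<open>A = \<one>\<close>.\<close>

definition trace_embed :: "('o, 'a, 'k::field, 'z) monoidal_cat_scheme \<Rightarrow> 'a \<Rightarrow> ('o, 'a) trace_arr" where
  "trace_embed C f =
     (let X = Dom C f; X' = Cod C f in
       (X, X', trace_class C X X' (trace_single C X X' \<I> (inv_arr C (RUn C X') \<cdot> f \<cdot> LUn C X))))"
  for C (structure)

text \<open>For \<open>\<phi> : A \<boxtimes> X \<rightarrow> X' \<boxtimes> A\<close> and \<open>\<psi> : B \<boxtimes> X' \<rightarrow> X'' \<boxtimes> B\<close>, on the strand \<open>B \<boxtimes> A\<close>.\<close>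

definition strand_comp ::
    "('o, 'a, 'k, 'z) monoidal_cat_scheme \<Rightarrow> 'o \<Rightarrow> 'o \<Rightarrow> 'o \<Rightarrow> 'o \<Rightarrow> 'o \<Rightarrow> 'a \<Rightarrow> 'a \<Rightarrow> 'a" where
  "strand_comp C X X' X'' A B \<phi> \<psi> =
     Asc C X'' B A \<cdot> (\<psi> \<star> Idt C A) \<cdot> inv_arr C (Asc C B X' A) \<cdot> (Idt C B \<star> \<phi>) \<cdot> Asc C B A X"
  for C (structure)

text \<open>\<open>(W \<boxtimes> X) \<boxtimes> (Y \<boxtimes> Z) \<rightarrow> W \<boxtimes> ((X \<boxtimes> Y) \<boxtimes> Z)\<close>\<close>

definition group_middle :: "('o, 'a, 'k, 'z) monoidal_cat_scheme \<Rightarrow> 'o \<Rightarrow> 'o \<Rightarrow> 'o \<Rightarrow> 'o \<Rightarrow> 'a" where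
  "group_middle C W X Y Z = (Idt C W \<star> inv_arr C (Asc C X Y Z)) \<cdot> Asc C W X (Y \<boxtimes> Z)"
  for C (structure)

text \<open>
  The arrow \<open>id \<otimes> f \<otimes> id : (W \<boxtimes> X) \<boxtimes> (Y \<boxtimes> Z) \<rightarrow> (W \<boxtimes> X') \<boxtimes> (Y' \<boxtimes> Z)\<close> for \<open>f : X \<boxtimes> Y \<rightarrow> X' \<boxtimes> Y'\<close>.
\<close>

definition middle ::
    "('o, 'a, 'k, 'z) monoidal_cat_scheme \<Rightarrow> 'o \<Rightarrow> 'o \<Rightarrow> 'o \<Rightarrow> 'o \<Rightarrow> 'o \<Rightarrow> 'o \<Rightarrow> 'a \<Rightarrow> 'a" where
  "middle C W X Y X' Y' Z f =
     inv_arr C (group_middle C W X' Y' Z) \<cdot> (Idt C W \<star> (f \<star> Idt C Z)) \<cdot> group_middle C W X Y Z"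
  for C (structure)

text \<open>For \<open>\<phi> : A \<boxtimes> X \<rightarrow> X' \<boxtimes> A\<close> and \<open>\<psi> : B \<boxtimes> Y \<rightarrow> Y' \<boxtimes> B\<close>, on the strand \<open>A \<boxtimes> B\<close>.\<close>

definition strand_tensor ::
    "('o, 'a, 'k, 'z) ribbon_cat_scheme \<Rightarrow>
     'o \<Rightarrow> 'o \<Rightarrow> 'o \<Rightarrow> 'o \<Rightarrow> 'o \<Rightarrow> 'o \<Rightarrow> 'a \<Rightarrow> 'a \<Rightarrow> 'a" where
  "strand_tensor C X X' Y Y' A B \<phi> \<psi> =
     middle C X' A Y' Y' A B (inv_arr C (Brd C Y' A)) \<cdot> (\<phi> \<star> \<psi>) \<cdot> middle C A B X X B Y (Brd C B X)"
  for C (structure)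

text \<open>For \<open>\<psi> : A \<boxtimes> X \<rightarrow> X' \<boxtimes> A\<close>, on the strand \<open>A*\<close>.\<close>

definition strand_tilde ::
    "('o, 'a, 'k, 'z) ribbon_cat_scheme \<Rightarrow> 'o \<Rightarrow> 'o \<Rightarrow> 'o \<Rightarrow> 'a \<Rightarrow> 'a" where
  "strand_tilde C X X' A \<psi> =
     (let A' = Dual C A in
       inv_arr C (Brd C X' A') \<cdot> RUn C (A' \<boxtimes> X') \<cdot> (Idt C (A' \<boxtimes> X') \<star> piv_ev C A) \<cdot>
       middle C A' A X X' A A' \<psi> \<cdot>
       (piv_coev C A \<star> Idt C (X \<boxtimes> A')) \<cdot> inv_arr C (LUn C (X \<boxtimes> A')) \<cdot> Brd C A' X)"
  for C (structure)

text \<open>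
  Composition, tensor product and the tilde operation are extended (bi)linearly to the direct sums,
  and then to cosets as the union of the cosets of the results on all representatives.
\<close>

definition trace_comp ::
    "('o, 'a, 'k::field, 'z) ribbon_cat_scheme \<Rightarrow> ('o, 'a) trace_arr \<Rightarrow> ('o, 'a) trace_arr \<Rightarrow> ('o, 'a) trace_arr"
  where
  "trace_comp C = (\<lambda>(X', X'', Q) (X, _, P).
     (X, X'', \<Union>p\<in>P. \<Union>q\<in>Q. trace_class C X X''
        (\<Oplus>\<^bsub>trace_sum C X X''\<^esub>A \<in> trace_supp C X X' p.
         \<Oplus>\<^bsub>trace_sum C X X''\<^esub>B \<in> trace_supp C X' X'' q.
           trace_single C X X'' (B \<boxtimes> A) (strand_comp C X X' X'' A B (p A) (q B)))))"
  for C (structure)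

definition trace_tensor ::
    "('o, 'a, 'k::field, 'z) ribbon_cat_scheme \<Rightarrow> ('o, 'a) trace_arr \<Rightarrow> ('o, 'a) trace_arr \<Rightarrow> ('o, 'a) trace_arr"
  where
  "trace_tensor C = (\<lambda>(X, X', P) (Y, Y', Q).
     (X \<boxtimes> Y, X' \<boxtimes> Y', \<Union>p\<in>P. \<Union>q\<in>Q. trace_class C (X \<boxtimes> Y) (X' \<boxtimes> Y')
        (\<Oplus>\<^bsub>trace_sum C (X \<boxtimes> Y) (X' \<boxtimes> Y')\<^esub>A \<in> trace_supp C X X' p.
         \<Oplus>\<^bsub>trace_sum C (X \<boxtimes> Y) (X' \<boxtimes> Y')\<^esub>B \<in> trace_supp C Y Y' q.
           trace_single C (X \<boxtimes> Y) (X' \<boxtimes> Y') (A \<boxtimes> B)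
             (strand_tensor C X X' Y Y' A B (p A) (q B)))))"
  for C (structure)

definition trace_tilde ::
    "('o, 'a, 'k::field, 'z) ribbon_cat_scheme \<Rightarrow> ('o, 'a) trace_arr \<Rightarrow> ('o, 'a) trace_arr" where
  "trace_tilde C = (\<lambda>(X, X', P).
     (X, X', \<Union>p\<in>P. trace_class C X X'
        (\<Oplus>\<^bsub>trace_sum C X X'\<^esub>A \<in> trace_supp C X X' p.
           trace_single C X X' (Dual C A) (strand_tilde C X X' A (p A)))))"

definition horizontal_trace ::
    "('o, 'a, 'k::field, 'z) ribbon_cat_scheme \<Rightarrow> ('o, ('o, 'a) trace_arr, 'k) monoidal_cat" where
  "horizontal_trace C =
     \<lparr>Obj = Obj C,
      Arr = {(X, X', P). X \<in> Obj C \<and> X' \<in> Obj C \<and>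
                         P \<in> a_rcosets\<^bsub>trace_sum C X X'\<^esub> (trace_rel C X X')},
      Dom = (\<lambda>(X, X', P). X),
      Cod = (\<lambda>(X, X', P). X'),
      Idt = (\<lambda>X. trace_embed C (Idt C X)),
      Cmp = trace_comp C,
      Zer = (\<lambda>X X'. (X, X', trace_rel C X X')),
      Add = (\<lambda>(X, X', P) (_, _, Q). (X, X', P <+>\<^bsub>trace_sum C X X'\<^esub> Q)),
      Scl = (\<lambda>a (X, X', P). (X, X', \<Union>p\<in>P. trace_class C X X' (a \<odot>\<^bsub>trace_sum C X X'\<^esub> p))),
      Unit = Unit C,
      TenO = TenO C,
      TenA = trace_tensor C,
      Asc = (\<lambda>X Y Z. trace_embed C (Asc C X Y Z)),
      LUn = (\<lambda>X. trace_embed C (LUn C X)),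
      RUn = (\<lambda>X. trace_embed C (RUn C X))\<rparr>"


section \<open>Karoubi envelopes\<close>

text \<open>
  Objects are pairs \<open>(X, e)\<close> with \<open>e\<close> an idempotent on \<open>X\<close>; an arrow \<open>(X, e) \<rightarrow> (Y, d)\<close> is an arrow
  \<open>f : X \<rightarrow> Y\<close> with \<open>d \<cdot> f \<cdot> e = f\<close>, stored together with its source and target.
\<close>

type_synonym ('o, 'a) kar_arr = "('o \<times> 'a) \<times> ('o \<times> 'a) \<times> 'a"

definition kar_obj :: "('o, 'a, 'k, 'z) linear_cat_scheme \<Rightarrow> ('o \<times> 'a) set" where
  "kar_obj C = {(X, e). X \<in> Obj C \<and> e \<in> Mor C X X \<and> Cmp C e e = e}"

definition karoubi ::
    "('o, 'a, 'k, 'z) monoidal_cat_scheme \<Rightarrow> ('o \<times> 'a, ('o, 'a) kar_arr, 'k) monoidal_cat" where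
  "karoubi C =
     (let ten = (\<lambda>(X, e) (Y, d). (X \<boxtimes> Y, e \<star> d)); un = (\<I>, Idt C \<I>) in
     \<lparr>Obj = kar_obj C,
      Arr = {(p, q, f). p \<in> kar_obj C \<and> q \<in> kar_obj C \<and> f \<in> Mor C (fst p) (fst q) \<and>
                        snd q \<cdot> f \<cdot> snd p = f},
      Dom = (\<lambda>(p, q, f). p),
      Cod = (\<lambda>(p, q, f). q),
      Idt = (\<lambda>(X, e). ((X, e), (X, e), e)),
      Cmp = (\<lambda>(q, r, g) (p, _, f). (p, r, g \<cdot> f)),
      Zer = (\<lambda>p q. (p, q, Zer C (fst p) (fst q))),
      Add = (\<lambda>(p, q, f) (_, _, g). (p, q, Add C f g)),
      Scl = (\<lambda>a (p, q, f). (p, q, Scl C a f)),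
      Unit = un,
      TenO = ten,
      TenA = (\<lambda>(p, q, f) (p', q', f'). (ten p p', ten q q', f \<star> f')),
      Asc = (\<lambda>p q r. (ten (ten p q) r, ten p (ten q r),
               Asc C (fst p) (fst q) (fst r) \<cdot> ((snd p \<star> snd q) \<star> snd r))),
      LUn = (\<lambda>p. (ten un p, p, snd p \<cdot> LUn C (fst p))),
      RUn = (\<lambda>p. (ten p un, p, snd p \<cdot> RUn C (fst p)))\<rparr>)"
  for C (structure)

definition kar_incO :: "('o, 'a, 'k, 'z) linear_cat_scheme \<Rightarrow> 'o \<Rightarrow> 'o \<times> 'a" where
  "kar_incO C X = (X, Idt C X)"

definition kar_incA :: "('o, 'a, 'k, 'z) linear_cat_scheme \<Rightarrow> 'a \<Rightarrow> ('o, 'a) kar_arr" where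
  "kar_incA C f = (kar_incO C (Dom C f), kar_incO C (Cod C f), f)"

text \<open>
  The functor between Karoubi envelopes induced by a functor, and the transformation induced by a
  natural transformation \<open>\<eta>\<close> from \<open>(Fo, Fa)\<close> to \<open>(Go, Ga)\<close>, with values in \<open>D\<close>.
\<close>

definition kar_funO :: "('o \<Rightarrow> 'p) \<Rightarrow> ('a \<Rightarrow> 'b) \<Rightarrow> 'o \<times> 'a \<Rightarrow> 'p \<times> 'b" where
  "kar_funO Fo Fa = (\<lambda>(X, e). (Fo X, Fa e))"

definition kar_funA :: "('o \<Rightarrow> 'p) \<Rightarrow> ('a \<Rightarrow> 'b) \<Rightarrow> ('o, 'a) kar_arr \<Rightarrow> ('p, 'b) kar_arr" where
  "kar_funA Fo Fa = (\<lambda>(p, q, f). (kar_funO Fo Fa p, kar_funO Fo Fa q, Fa f))"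

definition kar_nat ::
    "('p, 'b, 'k, 'y) linear_cat_scheme \<Rightarrow> ('o \<Rightarrow> 'p) \<Rightarrow> ('a \<Rightarrow> 'b) \<Rightarrow> ('o \<Rightarrow> 'p) \<Rightarrow> ('a \<Rightarrow> 'b) \<Rightarrow>
     ('o \<Rightarrow> 'b) \<Rightarrow> 'o \<times> 'a \<Rightarrow> ('p, 'b) kar_arr" where
  "kar_nat D Fo Fa Go Ga \<eta> = (\<lambda>(X, e).
     (kar_funO Fo Fa (X, e), kar_funO Go Ga (X, e), Ga e \<cdot>\<^bsub>D\<^esub> \<eta> X \<cdot>\<^bsub>D\<^esub> Fa e))"

text \<open>The tensor structure on the induced functor.\<close>

definition kar_ten ::
    "('o, 'a, 'k, 'z) monoidal_cat_scheme \<Rightarrow> ('p, 'b, 'k, 'y) monoidal_cat_scheme \<Rightarrow>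
     ('o \<Rightarrow> 'p) \<Rightarrow> ('a \<Rightarrow> 'b) \<Rightarrow> ('o \<Rightarrow> 'o \<Rightarrow> 'b) \<Rightarrow> 'o \<times> 'a \<Rightarrow> 'o \<times> 'a \<Rightarrow> ('p, 'b) kar_arr" where
  "kar_ten C D Fo Fa J = (\<lambda>(X, e) (Y, d).
     ((Fo X \<boxtimes>\<^bsub>D\<^esub> Fo Y, Fa e \<star>\<^bsub>D\<^esub> Fa d), (Fo (X \<boxtimes>\<^bsub>C\<^esub> Y), Fa (e \<star>\<^bsub>C\<^esub> d)),
      Fa (e \<star>\<^bsub>C\<^esub> d) \<cdot>\<^bsub>D\<^esub> J X Y \<cdot>\<^bsub>D\<^esub> (Fa e \<star>\<^bsub>D\<^esub> Fa d)))"

end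

theory Submission
  imports Defs
begin

text \<open>
  Let \<open>C\<close> be the given premodular category, and write \<open>\<psi> : A X \<rightarrow> X' A\<close> for a representative of an
  arrow \<open>X \<rightarrow> X'\<close> of the horizontal trace; \<open>A\<close> is its strand.  All laws come down to moves of braid
  diagrams, with one reduction that is not diagrammatic.

  The identities of diagrams, with braidings and duals, are short once associators and unitors are
  invisible.  An object together with an isomorphism to a bracketed word of objects is called a
  presentation.  Transport along presentations turns the arrows of \<open>C\<close> into arrows between words,
  composition and tensor product into strict ones (\<open>rep_Cmp\<close>, \<open>rep_TenA\<close>), and every associator or
  unitor into an identity (\<open>rep_coherence\<close>).  Diagrams are therefore computed in the locale
  \<open>strict_braided\<close>, and \<open>rep_inj\<close> brings equations back to \<open>C\<close>.

  An arrow of the trace is a coset in a direct sum over all strands.  Since \<open>C\<close> has direct sums, and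
  the inclusion and projection of a summand can be slid along the strand, each coset is the class
  of one strand (\<open>trace_class_single\<close>), and two arrows can be put on a common one.  So every law has
  to be checked on single strands only, and there the slide relation says that \<open>\<Theta> (g \<otimes> id)\<close> and
  \<open>(id \<otimes> g) \<Theta>\<close> have equal classes (\<open>cl_slide\<close>).  In particular a strand may be conjugated by any
  isomorphism (\<open>cl_conj\<close>), for instance by the braiding of two strands.

  Tilde bends the strand around \<open>\<psi>\<close> by a dual of \<open>A\<close> and then braids it back to the other side.  Its
  class does not depend on the dual chosen (\<open>cl_tilde\<close>): two duals differ by an isomorphism, which
  slides along the strand.  Hence one may take \<open>A* B*\<close> as dual of \<open>B A\<close>; bending a composite then
  yields the bent factors in the reverse order, braiding reverses the order once more up to
  conjugation by a braiding, and tilde preserves composition (\<open>tilde_Cmp\<close>).  Pulling an object \<open>Y\<close>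
  through the bend shows that the braiding \<open>Y X \<rightarrow> X Y\<close> turns tensoring on one side into tensoring on
  the other (\<open>tilde_braid_right\<close>, \<open>tilde_braid_left\<close>), which is naturality of the tensor structure.
  The coherence of that structure is the Yang-Baxter equation.

  For the square of tilde take, in the second application, \<open>A\<close> itself as dual of \<open>A*\<close>, with evaluation
  and coevaluation turned around by the braiding.  The two bends then cancel, and what is left of
  tilde-tilde is \<open>\<psi>\<close> conjugated by the double braidings of the strand with \<open>X\<close> and with \<open>X'\<close>
  (\<open>rotate_flip_rotate\<close>).  By the balancing axiom a double braiding is a twist of the product
  divided by the twists of the factors.  The twist of the product commutes with \<open>\<psi>\<close>, the twist of
  the strand slides around and cancels, and the twists of \<open>X\<close> and \<open>X'\<close> remain (\<open>tilde_tilde\<close>).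

  Both statements pass to Karoubi envelopes because the Karoubi construction is functorial for
  linear functors, for natural isomorphisms and for tensor structures between monoidal categories.
\<close>

section \<open>Calculus in linear and monoidal categories\<close>

context linear_category
begin

lemma Mor_iff: "f \<in> Mor C X Y \<longleftrightarrow> f \<in> Arr C \<and> Dom C f = X \<and> Cod C f = Y"
  by (auto simp: Mor_def)

lemma Dom_Obj [simp]: "f \<in> Arr C \<Longrightarrow> Dom C f \<in> Obj C"
  and Cod_Obj [simp]: "f \<in> Arr C \<Longrightarrow> Cod C f \<in> Obj C"
  using Dom_Cod by auto

lemma Mor_Obj: "f \<in> Mor C X Y \<Longrightarrow> X \<in> Obj C \<and> Y \<in> Obj C"
  by (auto simp: Mor_iff)

lemma Idt_simps [simp]:
  "X \<in> Obj C \<Longrightarrow> Idt C X \<in> Arr C" "X \<in> Obj C \<Longrightarrow> Dom C (Idt C X) = X"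
  "X \<in> Obj C \<Longrightarrow> Cod C (Idt C X) = X"
  using Idt_Mor by (auto simp: Mor_iff)

lemma Cmp_simps [simp]:
  assumes "f \<in> Arr C" "g \<in> Arr C" "Dom C g = Cod C f"
  shows "g \<cdot> f \<in> Arr C" "Dom C (g \<cdot> f) = Dom C f" "Cod C (g \<cdot> f) = Cod C g"
  using Cmp_Mor[of f "Dom C f" "Cod C f" g "Cod C g"] assms by (auto simp: Mor_iff)

lemma Cmp_Idt_simps [simp]:
  "f \<in> Arr C \<Longrightarrow> Dom C f = X \<Longrightarrow> f \<cdot> Idt C X = f"
  "f \<in> Arr C \<Longrightarrow> Cod C f = Y \<Longrightarrow> Idt C Y \<cdot> f = f"
  using Cmp_Idt[of f X "Cod C f"] Idt_Cmp[of f "Dom C f" Y] by (auto simp: Mor_iff)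

lemma Cmp_assoc_simp [simp]:
  assumes "f \<in> Arr C" "g \<in> Arr C" "h \<in> Arr C" "Dom C g = Cod C f" "Dom C h = Cod C g"
  shows "(h \<cdot> g) \<cdot> f = h \<cdot> (g \<cdot> f)"
  using Cmp_assoc[of f "Dom C f" "Cod C f" g "Cod C g" h "Cod C h"] assms by (auto simp: Mor_iff)

lemma Cmp_tail:
  assumes "a \<cdot> b = r" "a \<in> Arr C" "b \<in> Arr C" "Dom C a = Cod C b" "k \<in> Arr C" "Cod C k = Dom C b"
  shows "a \<cdot> (b \<cdot> k) = r \<cdot> k"
  using assms Cmp_assoc_simp[of k b a] by simp

lemma inverse_arrows_unique:
  assumes "inverse_arrows C f g" "inverse_arrows C f h"
  shows "g = h"
proof -
  have gf: "g \<cdot> f = Idt C (Dom C f)" and fh: "f \<cdot> h = Idt C (Cod C f)"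
    and [simp]: "f \<in> Arr C" "g \<in> Arr C" "h \<in> Arr C" "Dom C g = Cod C f" "Cod C h = Dom C f"
      "Cod C g = Dom C f" "Dom C h = Cod C f"
    using assms by (auto simp: inverse_arrows_def Mor_iff)
  show ?thesis using Cmp_tail[OF gf, of h] by (simp add: fh)
qed

lemma inv_arrI:
  assumes "f \<in> Mor C X Y" "g \<in> Mor C Y X" "g \<cdot> f = Idt C X" "f \<cdot> g = Idt C Y"
  shows "iso_arr C f" "inv_arr C f = g"
proof -
  have *: "inverse_arrows C f g" using assms by (auto simp: inverse_arrows_def Mor_iff)
  then show "iso_arr C f" by (auto simp: iso_arr_def)
  show "inv_arr C f = g" unfolding inv_arr_def
    using * inverse_arrows_unique by blast
qed

lemma iso_inverse_arrows: "iso_arr C f \<Longrightarrow> inverse_arrows C f (inv_arr C f)"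
  unfolding iso_arr_def inv_arr_def using inverse_arrows_unique by (metis theI)

lemma iso_Arr [simp]: "iso_arr C f \<Longrightarrow> f \<in> Arr C"
  by (auto simp: iso_arr_def inverse_arrows_def)

lemma inv_arr_simps [simp]:
  assumes "iso_arr C f"
  shows "inv_arr C f \<in> Arr C" "Dom C (inv_arr C f) = Cod C f" "Cod C (inv_arr C f) = Dom C f"
    "inv_arr C f \<cdot> f = Idt C (Dom C f)" "f \<cdot> inv_arr C f = Idt C (Cod C f)"
  using iso_inverse_arrows[OF assms] by (auto simp: inverse_arrows_def Mor_iff)

lemma inv_arr_cancel [simp]:
  assumes "iso_arr C f" "k \<in> Arr C"
  shows "Cod C k = Dom C f \<Longrightarrow> inv_arr C f \<cdot> (f \<cdot> k) = k"
    "Cod C k = Cod C f \<Longrightarrow> f \<cdot> (inv_arr C f \<cdot> k) = k"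
  using assms by (auto simp: Cmp_tail)

lemma inv_arr_Mor: "f \<in> Mor C X Y \<Longrightarrow> iso_arr C f \<Longrightarrow> inv_arr C f \<in> Mor C Y X"
  by (auto simp: Mor_iff)

lemma iso_inv_arr [simp]:
  assumes "iso_arr C f"
  shows "iso_arr C (inv_arr C f)" "inv_arr C (inv_arr C f) = f"
  using inv_arrI[of "inv_arr C f" "Cod C f" "Dom C f" f] assms by (auto simp: Mor_iff)

lemma iso_Idt [simp]:
  assumes "X \<in> Obj C" shows "iso_arr C (Idt C X)" "inv_arr C (Idt C X) = Idt C X"
  using inv_arrI[of "Idt C X" X X "Idt C X"] assms by (auto simp: Mor_iff)

lemma iso_Cmp [simp]:
  assumes "iso_arr C f" "iso_arr C g" "Dom C g = Cod C f"
  shows "iso_arr C (g \<cdot> f)" "inv_arr C (g \<cdot> f) = inv_arr C f \<cdot> inv_arr C g"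
  using inv_arrI[of "g \<cdot> f" "Dom C f" "Cod C g" "inv_arr C f \<cdot> inv_arr C g"] assms
  by (auto simp: Mor_iff)

lemma iso_cancel_left:
  assumes "iso_arr C h" "f \<in> Arr C" "g \<in> Arr C" "Cod C f = Dom C h" "Cod C g = Dom C h" "h \<cdot> f = h \<cdot> g"
  shows "f = g"
proof -
  have "f = inv_arr C h \<cdot> (h \<cdot> f)" using assms(1-5) by simp
  also have "\<dots> = g" unfolding assms(6) using assms(1-5) by simp
  finally show ?thesis .
qed

lemma iso_cancel_right:
  assumes "iso_arr C h" "f \<in> Arr C" "g \<in> Arr C" "Dom C f = Cod C h" "Dom C g = Cod C h" "f \<cdot> h = g \<cdot> h"
  shows "f = g"
proof -
  have "(f \<cdot> h) \<cdot> inv_arr C h = (g \<cdot> h) \<cdot> inv_arr C h" using assms(6) by simp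
  then show ?thesis using assms(1-5) by simp
qed

end

context monoidal_category
begin

lemma TenO_Obj_simp [simp]: "X \<in> Obj C \<Longrightarrow> Y \<in> Obj C \<Longrightarrow> X \<boxtimes> Y \<in> Obj C"
  by (rule TenO_Obj)

lemma Unit_Obj_simp [simp]: "\<I> \<in> Obj C" by (rule Unit_Obj)

lemma TenA_simps [simp]:
  assumes "f \<in> Arr C" "g \<in> Arr C"
  shows "f \<star> g \<in> Arr C" "Dom C (f \<star> g) = Dom C f \<boxtimes> Dom C g" "Cod C (f \<star> g) = Cod C f \<boxtimes> Cod C g"
  using TenA_Mor[of f "Dom C f" "Cod C f" g "Dom C g" "Cod C g"] assms by (auto simp: Mor_iff)

lemma TenA_Idt_simp [simp]: "X \<in> Obj C \<Longrightarrow> Y \<in> Obj C \<Longrightarrow> Idt C X \<star> Idt C Y = Idt C (X \<boxtimes> Y)"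
  by (rule TenA_Idt)

lemma interchange:
  assumes "f \<in> Arr C" "f' \<in> Arr C" "g \<in> Arr C" "g' \<in> Arr C" "Dom C f' = Cod C f" "Dom C g' = Cod C g"
  shows "(f' \<star> g') \<cdot> (f \<star> g) = (f' \<cdot> f) \<star> (g' \<cdot> g)"
  using TenA_Cmp[of f "Dom C f" "Cod C f" f' "Cod C f'" g "Dom C g" "Cod C g" g' "Cod C g'"] assms
  by (auto simp: Mor_iff)

lemma interchange_tail:
  assumes "f \<in> Arr C" "f' \<in> Arr C" "g \<in> Arr C" "g' \<in> Arr C" "Dom C f' = Cod C f" "Dom C g' = Cod C g"
    "k \<in> Arr C" "Cod C k = Dom C f \<boxtimes> Dom C g"
  shows "(f' \<star> g') \<cdot> ((f \<star> g) \<cdot> k) = ((f' \<cdot> f) \<star> (g' \<cdot> g)) \<cdot> k"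
  using assms by (simp add: Cmp_tail[OF interchange])

lemma iso_TenA [simp]:
  assumes "iso_arr C f" "iso_arr C g"
  shows "iso_arr C (f \<star> g)" "inv_arr C (f \<star> g) = inv_arr C f \<star> inv_arr C g"
  using inv_arrI[of "f \<star> g" "Dom C f \<boxtimes> Dom C g" "Cod C f \<boxtimes> Cod C g" "inv_arr C f \<star> inv_arr C g"] assms
  by (auto simp: Mor_iff interchange)

lemma Asc_simps [simp]:
  assumes "X \<in> Obj C" "Y \<in> Obj C" "Z \<in> Obj C"
  shows "Asc C X Y Z \<in> Arr C" "Dom C (Asc C X Y Z) = (X \<boxtimes> Y) \<boxtimes> Z"
    "Cod C (Asc C X Y Z) = X \<boxtimes> (Y \<boxtimes> Z)" "iso_arr C (Asc C X Y Z)"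
  using Asc_Mor[OF assms] by (auto simp: Mor_iff)

lemma LUn_simps [simp]:
  assumes "X \<in> Obj C"
  shows "LUn C X \<in> Arr C" "Dom C (LUn C X) = \<I> \<boxtimes> X" "Cod C (LUn C X) = X" "iso_arr C (LUn C X)"
  using LUn_Mor[OF assms] by (auto simp: Mor_iff)

lemma RUn_simps [simp]:
  assumes "X \<in> Obj C"
  shows "RUn C X \<in> Arr C" "Dom C (RUn C X) = X \<boxtimes> \<I>" "Cod C (RUn C X) = X" "iso_arr C (RUn C X)"
  using RUn_Mor[OF assms] by (auto simp: Mor_iff)

lemma Asc_nat:
  assumes "f \<in> Arr C" "g \<in> Arr C" "h \<in> Arr C"
  shows "Asc C (Cod C f) (Cod C g) (Cod C h) \<cdot> ((f \<star> g) \<star> h)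
       = (f \<star> (g \<star> h)) \<cdot> Asc C (Dom C f) (Dom C g) (Dom C h)"
  using Asc_natural[of f "Dom C f" "Cod C f" g "Dom C g" "Cod C g" h] assms by (auto simp: Mor_iff)

lemma LUn_nat: "f \<in> Arr C \<Longrightarrow> LUn C (Cod C f) \<cdot> (Idt C \<I> \<star> f) = f \<cdot> LUn C (Dom C f)"
  using LUn_natural[of f "Dom C f" "Cod C f"] by (auto simp: Mor_iff)

lemma RUn_nat: "f \<in> Arr C \<Longrightarrow> RUn C (Cod C f) \<cdot> (f \<star> Idt C \<I>) = f \<cdot> RUn C (Dom C f)"
  using RUn_natural[of f "Dom C f" "Cod C f"] by (auto simp: Mor_iff)

lemma Idt_Unit_faithful:
  assumes "f \<in> Mor C X Y" "g \<in> Mor C X Y"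
  shows "Idt C \<I> \<star> f = Idt C \<I> \<star> g \<Longrightarrow> f = g" "f \<star> Idt C \<I> = g \<star> Idt C \<I> \<Longrightarrow> f = g"
proof -
  note [simp] = assms[unfolded Mor_iff]
  have [simp]: "X \<in> Obj C" "Y \<in> Obj C" using assms Mor_Obj by auto
  show "f = g" if "Idt C \<I> \<star> f = Idt C \<I> \<star> g"
    using LUn_nat[of f] LUn_nat[of g] that by (auto intro: iso_cancel_right[of "LUn C X"])
  show "f = g" if "f \<star> Idt C \<I> = g \<star> Idt C \<I>"
    using RUn_nat[of f] RUn_nat[of g] that by (auto intro: iso_cancel_right[of "RUn C X"])
qed

text \<open>
  Kelly's argument: tensoring with \<open>\<I>\<close> is faithful, and after tensoring with \<open>\<I>\<close> the equation follows
  from the pentagon for \<open>\<I>, \<I>, X, Y\<close> and the triangle.  The two lemmas below are of the same kind.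
\<close>

lemma LUn_TenO:
  assumes [simp]: "X \<in> Obj C" "Y \<in> Obj C"
  shows "LUn C (X \<boxtimes> Y) \<cdot> Asc C \<I> X Y = LUn C X \<star> Idt C Y"
proof (rule Idt_Unit_faithful(1))
  let ?K = "Asc C \<I> (\<I> \<boxtimes> X) Y \<cdot> (Asc C \<I> \<I> X \<star> Idt C Y)"
  show "Idt C \<I> \<star> (LUn C (X \<boxtimes> Y) \<cdot> Asc C \<I> X Y) = Idt C \<I> \<star> (LUn C X \<star> Idt C Y)"
  proof (rule iso_cancel_right[of ?K])
    have "(Idt C \<I> \<star> (LUn C (X \<boxtimes> Y) \<cdot> Asc C \<I> X Y)) \<cdot> ?K
        = (Idt C \<I> \<star> LUn C (X \<boxtimes> Y)) \<cdot> ((Idt C \<I> \<star> Asc C \<I> X Y) \<cdot> ?K)"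
      by (simp add: interchange_tail)
    also have "\<dots> = (Idt C \<I> \<star> LUn C (X \<boxtimes> Y)) \<cdot> (Asc C \<I> \<I> (X \<boxtimes> Y) \<cdot> Asc C (\<I> \<boxtimes> \<I>) X Y)"
      by (simp add: pentagon)
    also have "\<dots> = (RUn C \<I> \<star> Idt C (X \<boxtimes> Y)) \<cdot> Asc C (\<I> \<boxtimes> \<I>) X Y"
      by (simp add: Cmp_tail[OF triangle])
    also have "\<dots> = Asc C \<I> X Y \<cdot> ((RUn C \<I> \<star> Idt C X) \<star> Idt C Y)"
      using Asc_nat[of "RUn C \<I>" "Idt C X" "Idt C Y"] by simp
    also have "\<dots> = Asc C \<I> X Y \<cdot> (((Idt C \<I> \<star> LUn C X) \<cdot> Asc C \<I> \<I> X) \<star> Idt C Y)"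
      by (simp add: triangle)
    also have "\<dots> = Asc C \<I> X Y \<cdot> (((Idt C \<I> \<star> LUn C X) \<star> Idt C Y) \<cdot> (Asc C \<I> \<I> X \<star> Idt C Y))"
      by (simp add: interchange)
    also have "\<dots> = (Idt C \<I> \<star> (LUn C X \<star> Idt C Y)) \<cdot> ?K"
      using Cmp_tail[OF Asc_nat[of "Idt C \<I>" "LUn C X" "Idt C Y"], of "Asc C \<I> \<I> X \<star> Idt C Y"] by simp
    finally show "(Idt C \<I> \<star> (LUn C (X \<boxtimes> Y) \<cdot> Asc C \<I> X Y)) \<cdot> ?K = (Idt C \<I> \<star> (LUn C X \<star> Idt C Y)) \<cdot> ?K" .
  qed simp_all
qed (simp_all add: Mor_iff)

lemma RUn_TenO:
  assumes [simp]: "X \<in> Obj C" "Y \<in> Obj C"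
  shows "(Idt C X \<star> RUn C Y) \<cdot> Asc C X Y \<I> = RUn C (X \<boxtimes> Y)"
proof (rule Idt_Unit_faithful(2))
  show "((Idt C X \<star> RUn C Y) \<cdot> Asc C X Y \<I>) \<star> Idt C \<I> = RUn C (X \<boxtimes> Y) \<star> Idt C \<I>"
  proof (rule iso_cancel_left[of "Asc C X Y \<I>"])
    have "Asc C X Y \<I> \<cdot> (RUn C (X \<boxtimes> Y) \<star> Idt C \<I>)
        = Asc C X Y \<I> \<cdot> ((Idt C (X \<boxtimes> Y) \<star> LUn C \<I>) \<cdot> Asc C (X \<boxtimes> Y) \<I> \<I>)"
      using triangle[of "X \<boxtimes> Y" "\<I>"] by simp
    also have "\<dots> = (Idt C X \<star> (Idt C Y \<star> LUn C \<I>)) \<cdot> (Asc C X Y (\<I> \<boxtimes> \<I>) \<cdot> Asc C (X \<boxtimes> Y) \<I> \<I>)"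
      using Cmp_tail[OF Asc_nat[of "Idt C X" "Idt C Y" "LUn C \<I>"], of "Asc C (X \<boxtimes> Y) \<I> \<I>"] by simp
    also have "\<dots> = (Idt C X \<star> (Idt C Y \<star> LUn C \<I>)) \<cdot> ((Idt C X \<star> Asc C Y \<I> \<I>) \<cdot> Asc C X (Y \<boxtimes> \<I>) \<I> \<cdot> (Asc C X Y \<I> \<star> Idt C \<I>))"
      by (simp add: pentagon)
    also have "\<dots> = (Idt C X \<star> (RUn C Y \<star> Idt C \<I>)) \<cdot> Asc C X (Y \<boxtimes> \<I>) \<I> \<cdot> (Asc C X Y \<I> \<star> Idt C \<I>)"
      by (simp add: interchange_tail triangle)
    also have "\<dots> = Asc C X Y \<I> \<cdot> ((Idt C X \<star> RUn C Y) \<star> Idt C \<I>) \<cdot> (Asc C X Y \<I> \<star> Idt C \<I>)"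
      using Cmp_tail[OF Asc_nat[of "Idt C X" "RUn C Y" "Idt C \<I>"], of "Asc C X Y \<I> \<star> Idt C \<I>"] by simp
    also have "\<dots> = Asc C X Y \<I> \<cdot> (((Idt C X \<star> RUn C Y) \<cdot> Asc C X Y \<I>) \<star> Idt C \<I>)"
      by (simp add: interchange)
    finally show "Asc C X Y \<I> \<cdot> (((Idt C X \<star> RUn C Y) \<cdot> Asc C X Y \<I>) \<star> Idt C \<I>)
        = Asc C X Y \<I> \<cdot> (RUn C (X \<boxtimes> Y) \<star> Idt C \<I>)" by simp
  qed simp_all
qed (simp_all add: Mor_iff)

lemma LUn_Unit: "LUn C \<I> = RUn C \<I>"
proof (rule Idt_Unit_faithful(2))
  have *: "LUn C (\<I> \<boxtimes> \<I>) = Idt C \<I> \<star> LUn C \<I>"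
    using LUn_nat[of "LUn C \<I>"] by (auto intro: iso_cancel_left[of "LUn C \<I>"])
  show "LUn C \<I> \<star> Idt C \<I> = RUn C \<I> \<star> Idt C \<I>"
    using LUn_TenO[of \<I> \<I>] triangle[of \<I> \<I>] by (simp add: *)
qed (simp_all add: Mor_iff)

end

section \<open>Diagrams in a strict braided category\<close>

text \<open>
  A braided monoidal category whose objects are words and whose tensor product of objects is
  concatenation; \<open>bri\<close> is the inverse braiding.  The laws of lists make associativity and unitality
  invisible, so that the simplifier can normalise diagrams to right-nested composites of whiskered
  arrows.  Domains and codomains of composites and tensor products do not require the factors to
  be arrows, which keeps the typing side conditions cheap.
\<close>

locale strict_braided =
  fixes ob :: "'w list \<Rightarrow> bool" and arr :: "'b \<Rightarrow> bool" and dom cod :: "'b \<Rightarrow> 'w list"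
    and idn :: "'w list \<Rightarrow> 'b" (\<open>\<iota>\<close>)
    and cmp :: "'b \<Rightarrow> 'b \<Rightarrow> 'b" (infixr \<open>\<bullet>\<close> 55)
    and ten :: "'b \<Rightarrow> 'b \<Rightarrow> 'b" (infixr \<open>\<parallel>\<close> 70)
    and br bri :: "'w list \<Rightarrow> 'w list \<Rightarrow> 'b"
  assumes ob_simps [simp]: "ob []" "ob (w @ v) \<longleftrightarrow> ob w \<and> ob v"
    and arr_ob [simp]: "arr f \<Longrightarrow> ob (dom f)" "arr f \<Longrightarrow> ob (cod f)"
    and idn_simps [simp]: "ob w \<Longrightarrow> arr (\<iota> w)" "dom (\<iota> w) = w" "cod (\<iota> w) = w"
    and cmp_simps [simp]: "arr f \<Longrightarrow> arr g \<Longrightarrow> dom g = cod f \<Longrightarrow> arr (g \<bullet> f)"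
      "dom (g \<bullet> f) = dom f" "cod (g \<bullet> f) = cod g"
    and ten_simps [simp]: "arr f \<Longrightarrow> arr g \<Longrightarrow> arr (f \<parallel> g)"
      "dom (f \<parallel> g) = dom f @ dom g" "cod (f \<parallel> g) = cod f @ cod g"
    and cmp_idn [simp]: "arr f \<Longrightarrow> dom f = w \<Longrightarrow> f \<bullet> \<iota> w = f"
    and idn_cmp [simp]: "arr f \<Longrightarrow> cod f = w \<Longrightarrow> \<iota> w \<bullet> f = f"
    and cmp_assoc [simp]: "arr f \<Longrightarrow> arr g \<Longrightarrow> arr h \<Longrightarrow> dom g = cod f \<Longrightarrow> dom h = cod g \<Longrightarrow>
      (h \<bullet> g) \<bullet> f = h \<bullet> g \<bullet> f"
    and ten_idn [simp]: "ob w \<Longrightarrow> ob v \<Longrightarrow> \<iota> w \<parallel> \<iota> v = \<iota> (w @ v)"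
    and ten_cmp: "arr f \<Longrightarrow> arr f' \<Longrightarrow> arr g \<Longrightarrow> arr g' \<Longrightarrow> dom f' = cod f \<Longrightarrow> dom g' = cod g \<Longrightarrow>
      (f' \<bullet> f) \<parallel> (g' \<bullet> g) = (f' \<parallel> g') \<bullet> (f \<parallel> g)"
    and ten_assoc [simp]: "arr f \<Longrightarrow> arr g \<Longrightarrow> arr h \<Longrightarrow> (f \<parallel> g) \<parallel> h = f \<parallel> g \<parallel> h"
    and ten_unit [simp]: "arr f \<Longrightarrow> \<iota> [] \<parallel> f = f" "arr f \<Longrightarrow> f \<parallel> \<iota> [] = f"
    and br_simps [simp]: "ob w \<Longrightarrow> ob v \<Longrightarrow> arr (br w v)" "dom (br w v) = w @ v" "cod (br w v) = v @ w"
    and bri_simps [simp]: "ob w \<Longrightarrow> ob v \<Longrightarrow> arr (bri w v)" "dom (bri w v) = v @ w" "cod (bri w v) = w @ v"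
    and br_bri [simp]: "ob w \<Longrightarrow> ob v \<Longrightarrow> br w v \<bullet> bri w v = \<iota> (v @ w)"
    and bri_br [simp]: "ob w \<Longrightarrow> ob v \<Longrightarrow> bri w v \<bullet> br w v = \<iota> (w @ v)"
    and br_nat: "arr f \<Longrightarrow> arr g \<Longrightarrow> br (cod f) (cod g) \<bullet> (f \<parallel> g) = (g \<parallel> f) \<bullet> br (dom f) (dom g)"
    and br_append_right [simp]: "ob u \<Longrightarrow> ob v \<Longrightarrow> ob w \<Longrightarrow> br u (v @ w) = (\<iota> v \<parallel> br u w) \<bullet> (br u v \<parallel> \<iota> w)"
    and br_append_left [simp]: "ob u \<Longrightarrow> ob v \<Longrightarrow> ob w \<Longrightarrow> br (u @ v) w = (br u w \<parallel> \<iota> v) \<bullet> (\<iota> u \<parallel> br v w)"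
begin

text \<open>
  Composites are nested to the right, so a local equation for \<open>a \<bullet> b\<close> does not match inside
  \<open>a \<bullet> b \<bullet> k\<close>.  These lemmas extend an equation to that situation.
\<close>

lemma tail2:
  assumes "a \<bullet> b = r" "arr a" "arr b" "dom a = cod b" "arr k" "cod k = dom b"
  shows "a \<bullet> b \<bullet> k = r \<bullet> k"
  using assms cmp_assoc[of k b a] by simp

lemma tail3:
  assumes "a \<bullet> b \<bullet> c = r" "arr a" "arr b" "arr c" "dom a = cod b" "dom b = cod c" "arr k" "cod k = dom c"
  shows "a \<bullet> b \<bullet> c \<bullet> k = r \<bullet> k"
  using assms cmp_assoc[of k "b \<bullet> c" a] by simp

lemma tail4:
  assumes "a \<bullet> b \<bullet> c \<bullet> d = r" "arr a" "arr b" "arr c" "arr d" "dom a = cod b" "dom b = cod c" "dom c = cod d"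
    "arr k" "cod k = dom d"
  shows "a \<bullet> b \<bullet> c \<bullet> d \<bullet> k = r \<bullet> k"
  using assms cmp_assoc[of k "b \<bullet> c \<bullet> d" a] by simp

lemma idn_ten_merge [simp]: "ob w \<Longrightarrow> ob v \<Longrightarrow> arr f \<Longrightarrow> \<iota> w \<parallel> \<iota> v \<parallel> f = \<iota> (w @ v) \<parallel> f"
  using ten_assoc[of "\<iota> w" "\<iota> v" f] by simp

lemma whisk_left [simp]:
  "ob w \<Longrightarrow> arr f \<Longrightarrow> arr g \<Longrightarrow> dom g = cod f \<Longrightarrow> \<iota> w \<parallel> (g \<bullet> f) = (\<iota> w \<parallel> g) \<bullet> (\<iota> w \<parallel> f)"
  using ten_cmp[of "\<iota> w" "\<iota> w" f g] by simp

lemma whisk_right [simp]: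
  "ob w \<Longrightarrow> arr f \<Longrightarrow> arr g \<Longrightarrow> dom g = cod f \<Longrightarrow> (g \<bullet> f) \<parallel> \<iota> w = (g \<parallel> \<iota> w) \<bullet> (f \<parallel> \<iota> w)"
  using ten_cmp[of f g "\<iota> w" "\<iota> w"] by simp

lemma whisk: "l = r \<Longrightarrow> \<iota> w \<parallel> l \<parallel> \<iota> v = \<iota> w \<parallel> r \<parallel> \<iota> v"
  by simp

lemma ten_split1: "arr f \<Longrightarrow> arr g \<Longrightarrow> f \<parallel> g = (f \<parallel> \<iota> (cod g)) \<bullet> (\<iota> (dom f) \<parallel> g)"
  using ten_cmp[of "\<iota> (dom f)" f g "\<iota> (cod g)"] by simp

lemma ten_split2: "arr f \<Longrightarrow> arr g \<Longrightarrow> f \<parallel> g = (\<iota> (cod f) \<parallel> g) \<bullet> (f \<parallel> \<iota> (dom g))"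
  using ten_cmp[of f "\<iota> (cod f)" "\<iota> (dom g)" g] by simp

text \<open>
  Arrows on disjoint wires slide past each other; \<open>w\<close>, \<open>z\<close>, \<open>v\<close> are the idle wires to the left, in
  between, and to the right.
\<close>

lemma exchange:
  assumes "arr f" "arr g" "ob w" "ob z" "ob v"
  shows "(\<iota> w \<parallel> f \<parallel> \<iota> (z @ cod g @ v)) \<bullet> (\<iota> (w @ dom f @ z) \<parallel> g \<parallel> \<iota> v)
       = (\<iota> (w @ cod f @ z) \<parallel> g \<parallel> \<iota> v) \<bullet> (\<iota> w \<parallel> f \<parallel> \<iota> (z @ dom g @ v))"
proof -
  have "(f \<parallel> \<iota> (z @ cod g @ v)) \<bullet> (\<iota> (dom f) \<parallel> (\<iota> z \<parallel> g \<parallel> \<iota> v))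
      = (\<iota> (cod f) \<parallel> (\<iota> z \<parallel> g \<parallel> \<iota> v)) \<bullet> (f \<parallel> \<iota> (z @ dom g @ v))"
    using ten_split1[of f "\<iota> z \<parallel> g \<parallel> \<iota> v"] ten_split2[of f "\<iota> z \<parallel> g \<parallel> \<iota> v"] assms by simp
  from arg_cong[OF this, of "\<lambda>t. \<iota> w \<parallel> t"] show ?thesis using assms by simp
qed

lemma br_cancel [simp]:
  "ob w \<Longrightarrow> ob v \<Longrightarrow> arr k \<Longrightarrow> cod k = v @ w \<Longrightarrow> br w v \<bullet> bri w v \<bullet> k = k"
  "ob w \<Longrightarrow> ob v \<Longrightarrow> arr k \<Longrightarrow> cod k = w @ v \<Longrightarrow> bri w v \<bullet> br w v \<bullet> k = k"
  by (simp_all add: tail2[OF br_bri] tail2[OF bri_br])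

lemma whisk_br_cancel_left [simp]:
  assumes [simp]: "ob w" "ob v" "ob u"
  shows "(\<iota> u \<parallel> br w v) \<bullet> (\<iota> u \<parallel> bri w v) = \<iota> (u @ v @ w)"
    "(\<iota> u \<parallel> bri w v) \<bullet> (\<iota> u \<parallel> br w v) = \<iota> (u @ w @ v)"
  using whisk[OF br_bri[OF assms(1,2)], of u "[]"] whisk[OF bri_br[OF assms(1,2)], of u "[]"]
  by (simp_all del: br_bri bri_br)

lemma whisk_br_cancel_left_tail [simp]:
  assumes [simp]: "ob w" "ob v" "ob u" "arr k"
  shows "cod k = u @ v @ w \<Longrightarrow> (\<iota> u \<parallel> br w v) \<bullet> (\<iota> u \<parallel> bri w v) \<bullet> k = k"
    "cod k = u @ w @ v \<Longrightarrow> (\<iota> u \<parallel> bri w v) \<bullet> (\<iota> u \<parallel> br w v) \<bullet> k = k"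
  by (simp_all add: tail2[OF whisk_br_cancel_left(1)] tail2[OF whisk_br_cancel_left(2)])

lemma whisk_br_cancel_right [simp]:
  assumes [simp]: "ob w" "ob v" "ob z"
  shows "(br w v \<parallel> \<iota> z) \<bullet> (bri w v \<parallel> \<iota> z) = \<iota> (v @ w @ z)"
    "(bri w v \<parallel> \<iota> z) \<bullet> (br w v \<parallel> \<iota> z) = \<iota> (w @ v @ z)"
  using whisk[OF br_bri[OF assms(1,2)], of "[]" z] whisk[OF bri_br[OF assms(1,2)], of "[]" z]
  by (simp_all del: br_bri bri_br)

lemma whisk_br_cancel_right_tail [simp]:
  assumes [simp]: "ob w" "ob v" "ob z" "arr k"
  shows "cod k = v @ w @ z \<Longrightarrow> (br w v \<parallel> \<iota> z) \<bullet> (bri w v \<parallel> \<iota> z) \<bullet> k = k"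
    "cod k = w @ v @ z \<Longrightarrow> (bri w v \<parallel> \<iota> z) \<bullet> (br w v \<parallel> \<iota> z) \<bullet> k = k"
  by (simp_all add: tail2[OF whisk_br_cancel_right(1)] tail2[OF whisk_br_cancel_right(2)])

lemma whisk_br_cancel_both [simp]:
  assumes [simp]: "ob w" "ob v" "ob u" "ob z"
  shows "(\<iota> u \<parallel> br w v \<parallel> \<iota> z) \<bullet> (\<iota> u \<parallel> bri w v \<parallel> \<iota> z) = \<iota> (u @ v @ w @ z)"
    "(\<iota> u \<parallel> bri w v \<parallel> \<iota> z) \<bullet> (\<iota> u \<parallel> br w v \<parallel> \<iota> z) = \<iota> (u @ w @ v @ z)"
  using whisk[OF br_bri[OF assms(1,2)], of u z] whisk[OF bri_br[OF assms(1,2)], of u z]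
  by (simp_all del: br_bri bri_br whisk_br_cancel_left whisk_br_cancel_right)

lemma whisk_br_cancel_both_tail [simp]:
  assumes [simp]: "ob w" "ob v" "ob u" "ob z" "arr k"
  shows "cod k = u @ v @ w @ z \<Longrightarrow> (\<iota> u \<parallel> br w v \<parallel> \<iota> z) \<bullet> (\<iota> u \<parallel> bri w v \<parallel> \<iota> z) \<bullet> k = k"
    "cod k = u @ w @ v @ z \<Longrightarrow> (\<iota> u \<parallel> bri w v \<parallel> \<iota> z) \<bullet> (\<iota> u \<parallel> br w v \<parallel> \<iota> z) \<bullet> k = k"
  by (simp_all add: tail2[OF whisk_br_cancel_both(1)] tail2[OF whisk_br_cancel_both(2)])

lemma br_mono_epi:
  assumes [simp]: "ob w" "ob v" "arr f" "arr g"
  shows "br w v \<bullet> f = br w v \<bullet> g \<Longrightarrow> cod f = w @ v \<Longrightarrow> cod g = w @ v \<Longrightarrow> f = g"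
    "f \<bullet> br w v = g \<bullet> br w v \<Longrightarrow> dom f = v @ w \<Longrightarrow> dom g = v @ w \<Longrightarrow> f = g"
proof -
  show "f = g" if "br w v \<bullet> f = br w v \<bullet> g" "cod f = w @ v" "cod g = w @ v"
    using arg_cong[OF that(1), of "\<lambda>t. bri w v \<bullet> t"] that(2,3) by simp
  show "f = g" if "f \<bullet> br w v = g \<bullet> br w v" "dom f = v @ w" "dom g = v @ w"
    using arg_cong[OF that(1), of "\<lambda>t. t \<bullet> bri w v"] that(2,3) by simp
qed

text \<open>
  By the hexagon these braidings are idempotent, and they are invertible.
\<close>

lemma br_Nil [simp]: assumes [simp]: "ob w" shows "br [] w = \<iota> w" "br w [] = \<iota> w"
proof -
  have "br [] w \<bullet> br [] w = br [] w" using br_append_left[of "[]" "[]" w] by (simp del: br_append_left)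
  then show "br [] w = \<iota> w" using br_mono_epi(1)[of "[]" w "br [] w" "\<iota> w"] by simp
  have "br w [] \<bullet> br w [] = br w []" using br_append_right[of w "[]" "[]"] by (simp del: br_append_right)
  then show "br w [] = \<iota> w" using br_mono_epi(1)[of w "[]" "br w []" "\<iota> w"] by simp
qed

lemma bri_unique:
  assumes [simp]: "ob w" "ob v" and "arr g" "dom g = v @ w" "cod g = w @ v" "br w v \<bullet> g = \<iota> (v @ w)"
  shows "bri w v = g"
  using br_mono_epi(1)[of w v "bri w v" g] assms by simp

lemma bri_Nil [simp]: "ob w \<Longrightarrow> bri [] w = \<iota> w" "ob w \<Longrightarrow> bri w [] = \<iota> w"
  by (rule bri_unique; simp)+

lemma bri_append_right [simp]:
  "ob u \<Longrightarrow> ob v \<Longrightarrow> ob w \<Longrightarrow> bri u (v @ w) = (bri u v \<parallel> \<iota> w) \<bullet> (\<iota> v \<parallel> bri u w)"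
  by (rule bri_unique) simp_all

lemma bri_append_left [simp]:
  "ob u \<Longrightarrow> ob v \<Longrightarrow> ob w \<Longrightarrow> bri (u @ v) w = (\<iota> u \<parallel> bri v w) \<bullet> (bri u w \<parallel> \<iota> v)"
  by (rule bri_unique) simp_all

lemma br_nat_left: "arr f \<Longrightarrow> ob w \<Longrightarrow> br (cod f) w \<bullet> (f \<parallel> \<iota> w) = (\<iota> w \<parallel> f) \<bullet> br (dom f) w"
  using br_nat[of f "\<iota> w"] by simp

lemma br_nat_right: "arr f \<Longrightarrow> ob w \<Longrightarrow> br w (cod f) \<bullet> (\<iota> w \<parallel> f) = (f \<parallel> \<iota> w) \<bullet> br w (dom f)"
  using br_nat[of "\<iota> w" f] by simp

lemma bri_nat_left: assumes [simp]: "arr f" "ob w"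
  shows "bri (cod f) w \<bullet> (\<iota> w \<parallel> f) = (f \<parallel> \<iota> w) \<bullet> bri (dom f) w"
proof (rule br_mono_epi(1)[of "cod f" w])
  show "br (cod f) w \<bullet> bri (cod f) w \<bullet> (\<iota> w \<parallel> f) = br (cod f) w \<bullet> (f \<parallel> \<iota> w) \<bullet> bri (dom f) w"
    using tail2[OF br_nat_left[of f w], of "bri (dom f) w"] by simp
qed simp_all

lemma bri_nat_right: assumes [simp]: "arr f" "ob w"
  shows "bri w (cod f) \<bullet> (f \<parallel> \<iota> w) = (\<iota> w \<parallel> f) \<bullet> bri w (dom f)"
proof (rule br_mono_epi(1)[of w "cod f"])
  show "br w (cod f) \<bullet> bri w (cod f) \<bullet> (f \<parallel> \<iota> w) = br w (cod f) \<bullet> (\<iota> w \<parallel> f) \<bullet> bri w (dom f)"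
    using tail2[OF br_nat_right[of f w], of "bri w (dom f)"] by simp
qed simp_all

subsection \<open>Sliding strands past each other\<close>

text \<open>
  Composition of the trace on representatives: \<open>\<phi>\<close> has the strand \<open>a\<close>, \<open>\<psi>\<close> the strand \<open>b\<close>, and the
  composite the strand \<open>b @ a\<close>.
\<close>

definition comp_strand :: "'w list \<Rightarrow> 'w list \<Rightarrow> 'b \<Rightarrow> 'b \<Rightarrow> 'b" where
  "comp_strand b a \<psi> \<phi> = (\<psi> \<parallel> \<iota> a) \<bullet> (\<iota> b \<parallel> \<phi>)"

text \<open>
  The tensor product of \<open>\<phi>\<close> with the identity of \<open>y\<close> on the right; the strand has to pass \<open>y\<close> at the
  end.
\<close>

definition right_strand :: "'w list \<Rightarrow> 'w list \<Rightarrow> 'w list \<Rightarrow> 'b \<Rightarrow> 'b" where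
  "right_strand x' a y \<phi> = (\<iota> x' \<parallel> bri y a) \<bullet> (\<phi> \<parallel> \<iota> y)"

text \<open>
  The tensor product of the identity of \<open>x\<close> with \<open>\<psi>\<close>; the strand has to pass \<open>x\<close> at the beginning.
\<close>

definition left_strand :: "'w list \<Rightarrow> 'w list \<Rightarrow> 'w list \<Rightarrow> 'b \<Rightarrow> 'b" where
  "left_strand x b y \<psi> = (\<iota> x \<parallel> \<psi>) \<bullet> (br b x \<parallel> \<iota> y)"

lemma right_strand_simps [simp]:
  "ob x' \<Longrightarrow> ob y \<Longrightarrow> ob a \<Longrightarrow> arr \<phi> \<Longrightarrow> cod \<phi> = x' @ a \<Longrightarrow> arr (right_strand x' a y \<phi>)"
  "dom (right_strand x' a y \<phi>) = dom \<phi> @ y" "cod (right_strand x' a y \<phi>) = x' @ y @ a"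
  by (simp_all add: right_strand_def)

lemma left_strand_simps [simp]:
  "ob x \<Longrightarrow> ob y \<Longrightarrow> ob b \<Longrightarrow> arr \<psi> \<Longrightarrow> dom \<psi> = b @ y \<Longrightarrow> arr (left_strand x b y \<psi>)"
  "dom (left_strand x b y \<psi>) = b @ x @ y" "cod (left_strand x b y \<psi>) = x @ cod \<psi>"
  by (simp_all add: left_strand_def)

lemma comp_strand_simps [simp]:
  "ob a \<Longrightarrow> ob b \<Longrightarrow> arr \<phi> \<Longrightarrow> arr \<psi> \<Longrightarrow> dom \<psi> @ a = b @ cod \<phi> \<Longrightarrow> arr (comp_strand b a \<psi> \<phi>)"
  "dom (comp_strand b a \<psi> \<phi>) = b @ dom \<phi>" "cod (comp_strand b a \<psi> \<phi>) = cod \<psi> @ a"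
  by (simp_all add: comp_strand_def)

lemma right_strand_slide:
  assumes [simp]: "ob x" "ob x'" "ob y" "arr f" "dom f = a" "cod f = a'" "arr \<phi>" "dom \<phi> = a' @ x" "cod \<phi> = x' @ a"
  shows "right_strand x' a y (\<phi> \<bullet> (f \<parallel> \<iota> x)) = right_strand x' a y \<phi> \<bullet> (f \<parallel> \<iota> (x @ y))"
    "right_strand x' a' y ((\<iota> x' \<parallel> f) \<bullet> \<phi>) = (\<iota> (x' @ y) \<parallel> f) \<bullet> right_strand x' a y \<phi>"
proof -
  have [simp]: "ob a" "ob a'" using arr_ob[of f] by simp_all
  show "right_strand x' a y (\<phi> \<bullet> (f \<parallel> \<iota> x)) = right_strand x' a y \<phi> \<bullet> (f \<parallel> \<iota> (x @ y))"
    by (simp add: right_strand_def)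
  have "bri y a' \<bullet> (f \<parallel> \<iota> y) = (\<iota> y \<parallel> f) \<bullet> bri y a" using bri_nat_right[of f y] by simp
  note E = whisk[OF this, of x' "[]", simplified]
  show "right_strand x' a' y ((\<iota> x' \<parallel> f) \<bullet> \<phi>) = (\<iota> (x' @ y) \<parallel> f) \<bullet> right_strand x' a y \<phi>"
    by (simp add: right_strand_def E tail2[OF E])
qed

lemma left_strand_slide:
  assumes [simp]: "ob x" "ob y" "ob y'" "arr f" "dom f = b" "cod f = b'" "arr \<psi>" "dom \<psi> = b' @ y" "cod \<psi> = y' @ b"
  shows "left_strand x b y (\<psi> \<bullet> (f \<parallel> \<iota> y)) = left_strand x b' y \<psi> \<bullet> (f \<parallel> \<iota> (x @ y))"
    "left_strand x b' y ((\<iota> y' \<parallel> f) \<bullet> \<psi>) = (\<iota> (x @ y') \<parallel> f) \<bullet> left_strand x b' y \<psi>"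
proof -
  have [simp]: "ob b" "ob b'" using arr_ob[of f] by simp_all
  have "(\<iota> x \<parallel> f) \<bullet> br b x = br b' x \<bullet> (f \<parallel> \<iota> x)" using br_nat_left[of f x] by simp
  note E = whisk[OF this, of "[]" y, simplified]
  show "left_strand x b y (\<psi> \<bullet> (f \<parallel> \<iota> y)) = left_strand x b' y \<psi> \<bullet> (f \<parallel> \<iota> (x @ y))"
    by (simp add: left_strand_def E tail2[OF E])
  show "left_strand x b' y ((\<iota> y' \<parallel> f) \<bullet> \<psi>) = (\<iota> (x @ y') \<parallel> f) \<bullet> left_strand x b' y \<psi>"
    by (simp add: left_strand_def)
qed

text \<open>
  A slide of the strand of one factor is a slide of the composite strand.
\<close>

lemma stack_slide_inner:
  assumes [simp]: "arr f" "dom f = a" "cod f = a'" "ob b" "ob x" "ob x'" "ob x''"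
    "arr \<phi>" "dom \<phi> = a' @ x" "cod \<phi> = x' @ a" "arr \<psi>" "dom \<psi> = b @ x'" "cod \<psi> = x'' @ b"
  shows "(\<psi> \<parallel> \<iota> a) \<bullet> (\<iota> b \<parallel> (\<phi> \<bullet> (f \<parallel> \<iota> x))) = ((\<psi> \<parallel> \<iota> a) \<bullet> (\<iota> b \<parallel> \<phi>)) \<bullet> ((\<iota> b \<parallel> f) \<parallel> \<iota> x)"
    "(\<psi> \<parallel> \<iota> a') \<bullet> (\<iota> b \<parallel> ((\<iota> x' \<parallel> f) \<bullet> \<phi>)) = (\<iota> x'' \<parallel> (\<iota> b \<parallel> f)) \<bullet> ((\<psi> \<parallel> \<iota> a) \<bullet> (\<iota> b \<parallel> \<phi>))"
proof -
  have [simp]: "ob a" "ob a'" using arr_ob[of f] by simp_all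
  show "(\<psi> \<parallel> \<iota> a) \<bullet> (\<iota> b \<parallel> (\<phi> \<bullet> (f \<parallel> \<iota> x))) = ((\<psi> \<parallel> \<iota> a) \<bullet> (\<iota> b \<parallel> \<phi>)) \<bullet> ((\<iota> b \<parallel> f) \<parallel> \<iota> x)" by simp
  note E = exchange[of \<psi> f "[]" "[]" "[]", simplified]
  show "(\<psi> \<parallel> \<iota> a') \<bullet> (\<iota> b \<parallel> ((\<iota> x' \<parallel> f) \<bullet> \<phi>)) = (\<iota> x'' \<parallel> (\<iota> b \<parallel> f)) \<bullet> ((\<psi> \<parallel> \<iota> a) \<bullet> (\<iota> b \<parallel> \<phi>))"
    by (simp add: E tail2[OF E])
qed

lemma stack_slide_outer:
  assumes [simp]: "arr f" "dom f = b" "cod f = b'" "ob a" "ob x" "ob x'" "ob x''"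
    "arr \<phi>" "dom \<phi> = a @ x" "cod \<phi> = x' @ a" "arr \<psi>" "dom \<psi> = b' @ x'" "cod \<psi> = x'' @ b"
  shows "((\<psi> \<bullet> (f \<parallel> \<iota> x')) \<parallel> \<iota> a) \<bullet> (\<iota> b \<parallel> \<phi>) = ((\<psi> \<parallel> \<iota> a) \<bullet> (\<iota> b' \<parallel> \<phi>)) \<bullet> ((f \<parallel> \<iota> a) \<parallel> \<iota> x)"
    "(((\<iota> x'' \<parallel> f) \<bullet> \<psi>) \<parallel> \<iota> a) \<bullet> (\<iota> b' \<parallel> \<phi>) = (\<iota> x'' \<parallel> (f \<parallel> \<iota> a)) \<bullet> ((\<psi> \<parallel> \<iota> a) \<bullet> (\<iota> b' \<parallel> \<phi>))"
proof -
  have [simp]: "ob b" "ob b'" using arr_ob[of f] by simp_all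
  note E = exchange[of f \<phi> "[]" "[]" "[]", simplified]
  show "((\<psi> \<bullet> (f \<parallel> \<iota> x')) \<parallel> \<iota> a) \<bullet> (\<iota> b \<parallel> \<phi>) = ((\<psi> \<parallel> \<iota> a) \<bullet> (\<iota> b' \<parallel> \<phi>)) \<bullet> ((f \<parallel> \<iota> a) \<parallel> \<iota> x)"
    by (simp add: E tail2[OF E])
  show "(((\<iota> x'' \<parallel> f) \<bullet> \<psi>) \<parallel> \<iota> a) \<bullet> (\<iota> b' \<parallel> \<phi>) = (\<iota> x'' \<parallel> (f \<parallel> \<iota> a)) \<bullet> ((\<psi> \<parallel> \<iota> a) \<bullet> (\<iota> b' \<parallel> \<phi>))"
    by simp
qed

lemma right_strand_comp:
  assumes [simp]: "ob a" "ob a'" "ob x" "ob x'" "ob x''" "ob y" "arr \<phi>" "dom \<phi> = a @ x" "cod \<phi> = x' @ a"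
    "arr \<phi>'" "dom \<phi>' = a' @ x'" "cod \<phi>' = x'' @ a'"
  shows "right_strand x'' (a' @ a) y (comp_strand a' a \<phi>' \<phi>)
       = comp_strand a' a (right_strand x'' a' y \<phi>') (right_strand x' a y \<phi>)"
proof -
  note E = exchange[of \<phi>' "bri y a" "[]" "[]" "[]", simplified]
  show ?thesis by (simp add: right_strand_def comp_strand_def E tail2[OF E])
qed

lemma left_strand_comp:
  assumes [simp]: "ob b" "ob b'" "ob x" "ob y" "ob y'" "ob y''" "arr \<psi>" "dom \<psi> = b @ y" "cod \<psi> = y' @ b"
    "arr \<psi>'" "dom \<psi>' = b' @ y'" "cod \<psi>' = y'' @ b'"
  shows "left_strand x (b' @ b) y (comp_strand b' b \<psi>' \<psi>)
       = comp_strand b' b (left_strand x b' y' \<psi>') (left_strand x b y \<psi>)"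
proof -
  note E = exchange[of "br b' x" \<psi> "[]" "[]" "[]", simplified]
  show ?thesis by (simp add: left_strand_def comp_strand_def E tail2[OF E])
qed

lemma strand_idn [simp]:
  "ob x \<Longrightarrow> ob y \<Longrightarrow> right_strand x [] y (\<iota> x) = \<iota> (x @ y)"
  "ob x \<Longrightarrow> ob y \<Longrightarrow> left_strand x [] y (\<iota> y) = \<iota> (x @ y)"
  "arr \<phi> \<Longrightarrow> cod \<phi> = x' \<Longrightarrow> ob y \<Longrightarrow> right_strand x' [] y \<phi> = \<phi> \<parallel> \<iota> y"
  "arr \<psi> \<Longrightarrow> dom \<psi> = y \<Longrightarrow> ob x \<Longrightarrow> left_strand x [] y \<psi> = \<iota> x \<parallel> \<psi>"
  by (auto simp: right_strand_def left_strand_def)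

lemma right_right_strand:
  assumes [simp]: "ob x'" "ob y" "ob z" "ob a" "arr \<phi>" "cod \<phi> = x' @ a"
  shows "right_strand (x' @ y) a z (right_strand x' a y \<phi>) = right_strand x' a (y @ z) \<phi>"
  by (simp add: right_strand_def)

lemma left_left_strand:
  assumes [simp]: "ob x" "ob y" "ob z" "ob b" "arr \<psi>" "dom \<psi> = b @ z"
  shows "left_strand x b (y @ z) (left_strand y b z \<psi>) = left_strand (x @ y) b z \<psi>"
  by (simp add: left_strand_def)

lemma right_left_strand:
  assumes [simp]: "ob x" "ob y" "ob y'" "ob z" "ob b" "arr \<psi>" "dom \<psi> = b @ y" "cod \<psi> = y' @ b"
  shows "right_strand (x @ y') b z (left_strand x b y \<psi>) = left_strand x b (y @ z) (right_strand y' b z \<psi>)"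
  by (simp add: left_strand_def right_strand_def)

lemma comp_strand_assoc:
  assumes [simp]: "ob a" "ob b" "ob c" "arr \<phi>" "arr \<psi>" "arr \<xi>" "dom \<psi> @ a = b @ cod \<phi>" "dom \<xi> @ b = c @ cod \<psi>"
  shows "comp_strand (c @ b) a (comp_strand c b \<xi> \<psi>) \<phi> = comp_strand c (b @ a) \<xi> (comp_strand b a \<psi> \<phi>)"
proof -
  have [simp]: "dom \<xi> @ b @ a = c @ cod \<psi> @ a" using arg_cong[OF assms(8), of "\<lambda>w. w @ a"] by simp
  show ?thesis by (simp add: comp_strand_def)
qed

text \<open>
  The two ways of tensoring \<open>\<phi>\<close> and \<open>\<psi>\<close> one after the other differ by the braiding of the two strands.
  This is the interchange law of the trace.
\<close>

lemma left_right_strand_commute: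
  assumes [simp]: "ob a" "ob b" "ob x" "ob x'" "ob y" "ob y'"
    and [simp]: "arr \<phi>" "dom \<phi> = a @ x" "cod \<phi> = x' @ a" "arr \<psi>" "dom \<psi> = b @ y" "cod \<psi> = y' @ b"
  shows "comp_strand a b (right_strand x' a y' \<phi>) (left_strand x b y \<psi>) \<bullet> (br b a \<parallel> \<iota> (x @ y))
       = (\<iota> (x' @ y') \<parallel> br b a) \<bullet> comp_strand b a (left_strand x' b y \<psi>) (right_strand x' a y \<phi>)"
proof -
  have A: "(\<phi> \<parallel> \<iota> b) \<bullet> (\<iota> a \<parallel> br b x) \<bullet> (br b a \<parallel> \<iota> x) = (\<iota> x' \<parallel> br b a) \<bullet> (br b x' \<parallel> \<iota> a) \<bullet> (\<iota> b \<parallel> \<phi>)"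
    using br_nat_right[of \<phi> b] by simp
  have "(br y' a \<parallel> \<iota> b) \<bullet> (\<iota> y' \<parallel> br b a) \<bullet> (\<psi> \<parallel> \<iota> a) = (\<iota> a \<parallel> \<psi>) \<bullet> (br b a \<parallel> \<iota> y) \<bullet> (\<iota> b \<parallel> br y a)"
    using br_nat_left[of \<psi> a] by simp
  from arg_cong[OF this, of "\<lambda>t. (bri y' a \<parallel> \<iota> b) \<bullet> t \<bullet> (\<iota> b \<parallel> bri y a)"]
  have B: "(bri y' a \<parallel> \<iota> b) \<bullet> (\<iota> a \<parallel> \<psi>) \<bullet> (br b a \<parallel> \<iota> y) = (\<iota> y' \<parallel> br b a) \<bullet> (\<psi> \<parallel> \<iota> a) \<bullet> (\<iota> b \<parallel> bri y a)"
    by simp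
  note A' = whisk[OF A, of "[]" y, simplified]
  note B' = whisk[OF B, of x' "[]", simplified]
  note X1 = exchange[of \<phi> \<psi> "[]" "[]" "[]", simplified]
  note X2 = exchange[of "br b x'" "bri y a" "[]" "[]" "[]", simplified]
  show ?thesis unfolding comp_strand_def right_strand_def left_strand_def
    by (simp add: X1 tail2[OF X1] A' tail3[OF A'] B' tail3[OF B'] X2 tail2[OF X2])
qed

subsection \<open>Duals\<close>

definition right_dual :: "'w list \<Rightarrow> 'w list \<Rightarrow> 'b \<Rightarrow> 'b \<Rightarrow> bool" where
  "right_dual a d ev cv \<longleftrightarrow> ob a \<and> ob d \<and> arr ev \<and> dom ev = a @ d \<and> cod ev = [] \<and>
     arr cv \<and> dom cv = [] \<and> cod cv = d @ a \<and>
     (ev \<parallel> \<iota> a) \<bullet> (\<iota> a \<parallel> cv) = \<iota> a \<and> (\<iota> d \<parallel> ev) \<bullet> (cv \<parallel> \<iota> d) = \<iota> d"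

lemma right_dual_append:
  assumes "right_dual a d ev cv" "right_dual b e ev' cv'"
  shows "right_dual (b @ a) (d @ e) (ev' \<bullet> (\<iota> b \<parallel> ev \<parallel> \<iota> e)) ((\<iota> d \<parallel> cv' \<parallel> \<iota> a) \<bullet> cv)"
proof -
  note D1 = assms(1)[unfolded right_dual_def] and D2 = assms(2)[unfolded right_dual_def]
  have [simp]: "ob a" "ob d" "arr ev" "dom ev = a @ d" "cod ev = []" "arr cv" "dom cv = []" "cod cv = d @ a"
    and Z1: "(ev \<parallel> \<iota> a) \<bullet> (\<iota> a \<parallel> cv) = \<iota> a" "(\<iota> d \<parallel> ev) \<bullet> (cv \<parallel> \<iota> d) = \<iota> d" using D1 by auto
  have [simp]: "ob b" "ob e" "arr ev'" "dom ev' = b @ e" "cod ev' = []" "arr cv'" "dom cv' = []" "cod cv' = e @ b"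
    and Z2: "(ev' \<parallel> \<iota> b) \<bullet> (\<iota> b \<parallel> cv') = \<iota> b" "(\<iota> e \<parallel> ev') \<bullet> (cv' \<parallel> \<iota> e) = \<iota> e" using D2 by auto
  note X1 = exchange[of ev cv' b "[]" a, simplified]
  note Z1' = whisk[OF Z1(1), of b "[]", simplified] whisk[OF Z1(2), of "[]" e, simplified]
  note Z2' = whisk[OF Z2(1), of "[]" a, simplified] whisk[OF Z2(2), of d "[]", simplified]
  note X2 = exchange[of cv' ev d "[]" e, simplified]
  have "(ev' \<parallel> \<iota> (b @ a)) \<bullet> (\<iota> b \<parallel> ev \<parallel> \<iota> (e @ b @ a)) \<bullet> (\<iota> (b @ a @ d) \<parallel> cv' \<parallel> \<iota> a) \<bullet> (\<iota> (b @ a) \<parallel> cv) = \<iota> (b @ a)"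
    by (simp add: X1 tail2[OF X1] Z1' Z2' tail2[OF Z1'(1)] tail2[OF Z2'(1)])
  moreover have "(\<iota> (d @ e) \<parallel> ev') \<bullet> (\<iota> (d @ e @ b) \<parallel> ev \<parallel> \<iota> e) \<bullet> (\<iota> d \<parallel> cv' \<parallel> \<iota> (a @ d @ e)) \<bullet> (cv \<parallel> \<iota> (d @ e)) = \<iota> (d @ e)"
    by (simp add: X2[symmetric] tail2[OF X2[symmetric]] Z1' Z2' tail2[OF Z1'(2)] tail2[OF Z2'(2)])
  ultimately show ?thesis by (simp add: right_dual_def)
qed

text \<open>
  The zigzags cancel in pairs.  By symmetry the other composite is an identity as well, so two
  words with a common dual are isomorphic.
\<close>

lemma right_dual_compare:
  assumes "right_dual a d ev cv" "right_dual b d ev' cv'"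
  shows "((ev' \<parallel> \<iota> a) \<bullet> (\<iota> b \<parallel> cv)) \<bullet> ((ev \<parallel> \<iota> b) \<bullet> (\<iota> a \<parallel> cv')) = \<iota> a"
proof -
  note D1 = assms(1)[unfolded right_dual_def] and D2 = assms(2)[unfolded right_dual_def]
  have [simp]: "ob a" "ob d" "arr ev" "dom ev = a @ d" "cod ev = []" "arr cv" "dom cv = []" "cod cv = d @ a"
    and Z1: "(ev \<parallel> \<iota> a) \<bullet> (\<iota> a \<parallel> cv) = \<iota> a" using D1 by auto
  have [simp]: "ob b" "arr ev'" "dom ev' = b @ d" "cod ev' = []" "arr cv'" "dom cv' = []" "cod cv' = d @ b"
    and Z2: "(\<iota> d \<parallel> ev') \<bullet> (cv' \<parallel> \<iota> d) = \<iota> d" using D2 by auto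
  note X1 = exchange[of ev cv "[]" b "[]", simplified, symmetric]
  note X2 = exchange[of cv' cv a "[]" "[]", simplified, symmetric]
  note X3 = exchange[of ev ev' "[]" "[]" a, simplified, symmetric]
  note Z2' = whisk[OF Z2, of a a, simplified]
  show ?thesis
    by (simp add: X1 tail2[OF X1] X2 tail2[OF X2] X3 tail2[OF X3] Z2' tail2[OF Z2'] Z1)
qed

lemma right_dual_transport:
  assumes "right_dual b d ev cv" and [simp]: "arr f" "dom f = a" "cod f = b" "arr g" "dom g = b" "cod g = a"
    and gf: "g \<bullet> f = \<iota> a" and fg: "f \<bullet> g = \<iota> b"
  shows "right_dual a d (ev \<bullet> (f \<parallel> \<iota> d)) ((\<iota> d \<parallel> g) \<bullet> cv)"
proof -
  have [simp]: "ob b" "ob d" "arr ev" "dom ev = b @ d" "cod ev = []" "arr cv" "dom cv = []" "cod cv = d @ b"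
    and Z: "(ev \<parallel> \<iota> b) \<bullet> (\<iota> b \<parallel> cv) = \<iota> b" "(\<iota> d \<parallel> ev) \<bullet> (cv \<parallel> \<iota> d) = \<iota> d"
    using assms(1) by (auto simp: right_dual_def)
  have [simp]: "ob a" using arr_ob(1)[of f] by simp
  note X1 = exchange[of f g "[]" d "[]", simplified]
  note X2 = exchange[of ev g "[]" "[]" "[]", simplified]
  note X3 = exchange[of f cv "[]" "[]" "[]", simplified]
  note F1 = whisk[OF fg, of d d, simplified]
  have "(ev \<parallel> \<iota> a) \<bullet> (f \<parallel> \<iota> (d @ a)) \<bullet> (\<iota> (a @ d) \<parallel> g) \<bullet> (\<iota> a \<parallel> cv) = \<iota> a"
    by (simp add: X1 tail2[OF X1] X2 tail2[OF X2] X3 tail2[OF X3] tail2[OF Z(1)] gf)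
  moreover have "(\<iota> d \<parallel> ev) \<bullet> (\<iota> d \<parallel> f \<parallel> \<iota> d) \<bullet> (\<iota> d \<parallel> g \<parallel> \<iota> d) \<bullet> (cv \<parallel> \<iota> d) = \<iota> d"
    by (simp add: F1 tail2[OF F1] Z)
  ultimately show ?thesis by (simp add: right_dual_def)
qed

text \<open>
  The braiding makes a dual on one side a dual on the other side.  The second equation is the move
  behind it: a strand passes the turned evaluation.
\<close>

lemma right_dual_braided:
  assumes "right_dual a d ev cv"
  shows "right_dual d a (ev \<bullet> br d a) (bri a d \<bullet> cv)"
    and "(\<iota> a \<parallel> ev) \<bullet> (\<iota> a \<parallel> br d a) \<bullet> (bri a d \<parallel> \<iota> a) = (ev \<parallel> \<iota> a) \<bullet> (br d a \<parallel> \<iota> a) \<bullet> (\<iota> d \<parallel> br a a)"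
proof -
  note D1 = assms(1)[unfolded right_dual_def]
  have [simp]: "ob a" "ob d" "arr ev" "dom ev = a @ d" "cod ev = []" "arr cv" "dom cv = []" "cod cv = d @ a"
    and Z: "(ev \<parallel> \<iota> a) \<bullet> (\<iota> a \<parallel> cv) = \<iota> a" "(\<iota> d \<parallel> ev) \<bullet> (cv \<parallel> \<iota> d) = \<iota> d"
    using D1 by auto
  have "(\<iota> a \<parallel> br d d) \<bullet> (br d a \<parallel> \<iota> d) \<bullet> (\<iota> d \<parallel> bri a d) \<bullet> (\<iota> d \<parallel> cv) = (bri a d \<parallel> \<iota> d) \<bullet> (cv \<parallel> \<iota> d)"
    using br_nat_right[of "bri a d \<bullet> cv" d] by simp
  from arg_cong[OF this, of "\<lambda>t. (\<iota> a \<parallel> bri d d) \<bullet> t"]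
  have A1: "(br d a \<parallel> \<iota> d) \<bullet> (\<iota> d \<parallel> bri a d) \<bullet> (\<iota> d \<parallel> cv) = (\<iota> a \<parallel> bri d d) \<bullet> (bri a d \<parallel> \<iota> d) \<bullet> (cv \<parallel> \<iota> d)"
    by simp
  have A2: "(ev \<parallel> \<iota> d) \<bullet> (\<iota> a \<parallel> bri d d) \<bullet> (bri a d \<parallel> \<iota> d) = \<iota> d \<parallel> ev"
    using bri_nat_left[of ev d] by simp
  have P: "(\<iota> a \<parallel> br d a) \<bullet> (bri a d \<parallel> \<iota> a) = (bri a a \<parallel> \<iota> d) \<bullet> (\<iota> a \<parallel> bri a d) \<bullet> (br d a \<parallel> \<iota> a) \<bullet> (\<iota> d \<parallel> br a a)"
  proof -
    have "(bri a a \<parallel> \<iota> d) \<bullet> (\<iota> a \<parallel> bri a d) \<bullet> (br d a \<parallel> \<iota> a) = (\<iota> a \<parallel> br d a) \<bullet> (bri a d \<parallel> \<iota> a) \<bullet> (\<iota> d \<parallel> bri a a)"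
      using bri_nat_right[of "br d a" a] by simp
    from arg_cong[OF this, of "\<lambda>t. t \<bullet> (\<iota> d \<parallel> br a a)"] show ?thesis by simp
  qed
  have Q: "(\<iota> a \<parallel> ev) \<bullet> (bri a a \<parallel> \<iota> d) \<bullet> (\<iota> a \<parallel> bri a d) = ev \<parallel> \<iota> a"
    using bri_nat_right[of ev a] by simp
  have R: "(br d a \<parallel> \<iota> a) \<bullet> (\<iota> d \<parallel> br a a) \<bullet> (cv \<parallel> \<iota> a) = \<iota> a \<parallel> cv"
    using br_nat_left[of cv a] by simp
  show S: "(\<iota> a \<parallel> ev) \<bullet> (\<iota> a \<parallel> br d a) \<bullet> (bri a d \<parallel> \<iota> a) = (ev \<parallel> \<iota> a) \<bullet> (br d a \<parallel> \<iota> a) \<bullet> (\<iota> d \<parallel> br a a)"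
    by (simp add: P tail3[OF Q])
  have "(ev \<parallel> \<iota> d) \<bullet> (br d a \<parallel> \<iota> d) \<bullet> (\<iota> d \<parallel> bri a d) \<bullet> (\<iota> d \<parallel> cv) = \<iota> d"
    by (simp add: A1 tail3[OF A2] Z)
  moreover have "(\<iota> a \<parallel> ev) \<bullet> (\<iota> a \<parallel> br d a) \<bullet> (bri a d \<parallel> \<iota> a) \<bullet> (cv \<parallel> \<iota> a) = \<iota> a"
    by (simp add: tail3[OF S] R Z)
  ultimately show "right_dual d a (ev \<bullet> br d a) (bri a d \<bullet> cv)" by (simp add: right_dual_def)
qed

subsection \<open>Rotating a strand\<close>

text \<open>
  The strand of \<open>\<psi>\<close> is bent around: it enters on the right of \<open>x\<close> and leaves on the left of \<open>x'\<close>.  The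
  words \<open>e\<close> and \<open>d\<close> at the two ends may differ; this occurs halfway through a slide.
\<close>

definition rotate :: "'w list \<Rightarrow> 'w list \<Rightarrow> 'w list \<Rightarrow> 'b \<Rightarrow> 'w list \<Rightarrow> 'b \<Rightarrow> 'b \<Rightarrow> 'b" where
  "rotate x x' e cv d ev \<psi> = (\<iota> (e @ x') \<parallel> ev) \<bullet> (\<iota> e \<parallel> \<psi> \<parallel> \<iota> d) \<bullet> (cv \<parallel> \<iota> (x @ d))"

text \<open>
  An arrow \<open>f\<close> on the strand can be carried around either bend and becomes the same dual arrow (the
  mate), pointing in the opposite direction.
\<close>

lemma rotate_slide:
  assumes "right_dual a d ev cv" "right_dual b e ev' cv'"
    and [simp]: "ob x" "ob x'" "arr f" "dom f = a" "cod f = b"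
      "arr \<psi>" "dom \<psi> = b @ x" "cod \<psi> = x' @ a"
  defines "mate \<equiv> (\<iota> d \<parallel> ev') \<bullet> (\<iota> d \<parallel> f \<parallel> \<iota> e) \<bullet> (cv \<parallel> \<iota> e)"
  shows "rotate x x' d cv d ev (\<psi> \<bullet> (f \<parallel> \<iota> x)) = (mate \<parallel> \<iota> x') \<bullet> rotate x x' e cv' d ev \<psi>"
    "rotate x x' e cv' e ev' ((\<iota> x' \<parallel> f) \<bullet> \<psi>) = rotate x x' e cv' d ev \<psi> \<bullet> (\<iota> x \<parallel> mate)"
    "arr mate" "dom mate = e" "cod mate = d"
proof -
  note D1 = assms(1)[unfolded right_dual_def] and D2 = assms(2)[unfolded right_dual_def]
  have [simp]: "ob a" "ob d" "arr ev" "dom ev = a @ d" "cod ev = []" "arr cv" "dom cv = []" "cod cv = d @ a"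
    and Z1: "(ev \<parallel> \<iota> a) \<bullet> (\<iota> a \<parallel> cv) = \<iota> a" "(\<iota> d \<parallel> ev) \<bullet> (cv \<parallel> \<iota> d) = \<iota> d" using D1 by auto
  have [simp]: "ob b" "ob e" "arr ev'" "dom ev' = b @ e" "cod ev' = []" "arr cv'" "dom cv' = []" "cod cv' = e @ b"
    and Z2: "(ev' \<parallel> \<iota> b) \<bullet> (\<iota> b \<parallel> cv') = \<iota> b" "(\<iota> e \<parallel> ev') \<bullet> (cv' \<parallel> \<iota> e) = \<iota> e" using D2 by auto
  show [simp]: "arr mate" "dom mate = e" "cod mate = d" by (simp_all add: mate_def)
  have m1: "(mate \<parallel> \<iota> b) \<bullet> cv' = (\<iota> d \<parallel> f) \<bullet> cv"
  proof -
    note X1 = exchange[of cv cv' "[]" "[]" "[]", simplified]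
    note X2 = exchange[of f cv' d "[]" "[]", simplified]
    note Z = whisk[OF Z2(1), of d "[]", simplified]
    show ?thesis unfolding mate_def
      by (simp add: X1 tail2[OF X1] X2 tail2[OF X2] Z tail2[OF Z])
  qed
  have m2: "ev \<bullet> (\<iota> a \<parallel> mate) = ev' \<bullet> (f \<parallel> \<iota> e)"
  proof -
    note X1 = exchange[of ev ev' "[]" "[]" "[]", simplified]
    note X2 = exchange[of ev f "[]" "[]" e, simplified]
    note Z = whisk[OF Z1(1), of "[]" e, simplified]
    show ?thesis unfolding mate_def
      by (simp add: X1 tail2[OF X1] X2 tail2[OF X2] Z tail2[OF Z])
  qed
  show "rotate x x' d cv d ev (\<psi> \<bullet> (f \<parallel> \<iota> x)) = (mate \<parallel> \<iota> x') \<bullet> rotate x x' e cv' d ev \<psi>"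
  proof -
    note m1' = whisk[OF m1, of "[]" "x @ d", simplified]
    note X1 = exchange[of mate \<psi> "[]" "[]" d, simplified]
    note X2 = exchange[of mate ev "[]" x' "[]", simplified]
    show ?thesis unfolding rotate_def
      by (simp add: m1'[symmetric] X1 tail2[OF X1] X2 tail2[OF X2])
  qed
  show "rotate x x' e cv' e ev' ((\<iota> x' \<parallel> f) \<bullet> \<psi>) = rotate x x' e cv' d ev \<psi> \<bullet> (\<iota> x \<parallel> mate)"
  proof -
    note m2' = whisk[OF m2, of "e @ x'" "[]", simplified]
    note X1 = exchange[of \<psi> mate e "[]" "[]", simplified]
    note X2 = exchange[of cv' mate "[]" x "[]", simplified]
    show ?thesis unfolding rotate_def
      by (simp add: X2 tail2[OF X2] X1 tail2[OF X1] m2' tail2[OF m2'])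
  qed
qed

text \<open>
  Bending reverses the order of the strands.
\<close>

lemma rotate_comp:
  assumes "right_dual a d ev cv" "right_dual b e ev' cv'"
    and [simp]: "ob x" "ob x'" "ob x''" "arr \<phi>" "dom \<phi> = a @ x" "cod \<phi> = x' @ a"
      "arr \<psi>" "dom \<psi> = b @ x'" "cod \<psi> = x'' @ b"
  shows "rotate x x'' (d @ e) ((\<iota> d \<parallel> cv' \<parallel> \<iota> a) \<bullet> cv) (d @ e) (ev' \<bullet> (\<iota> b \<parallel> ev \<parallel> \<iota> e)) (comp_strand b a \<psi> \<phi>)
       = (\<iota> d \<parallel> rotate x' x'' e cv' e ev' \<psi>) \<bullet> (rotate x x' d cv d ev \<phi> \<parallel> \<iota> e)"
proof -
  note D1 = assms(1)[unfolded right_dual_def] and D2 = assms(2)[unfolded right_dual_def]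
  have [simp]: "ob a" "ob d" "arr ev" "dom ev = a @ d" "cod ev = []" "arr cv" "dom cv = []" "cod cv = d @ a"
    using D1 by auto
  have [simp]: "ob b" "ob e" "arr ev'" "dom ev' = b @ e" "cod ev' = []" "arr cv'" "dom cv' = []" "cod cv' = e @ b"
    using D2 by auto
  note X1 = exchange[of cv' \<phi> d "[]" "d @ e", simplified]
  note X2 = exchange[of cv' ev d x' e, simplified]
  note X3 = exchange[of \<psi> ev "d @ e" "[]" e, simplified]
  show ?thesis unfolding rotate_def comp_strand_def
    by (simp add: X1[symmetric] tail2[OF X1[symmetric]]
       X2[symmetric] tail2[OF X2[symmetric]] X3[symmetric] tail2[OF X3[symmetric]])
qed

text \<open>
  Naturality of the braiding with respect to the evaluation pulls \<open>y\<close> out of the bend.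
\<close>

lemma rotate_right_strand:
  assumes "right_dual a d ev cv"
    and [simp]: "ob x" "ob x'" "ob y" "arr \<phi>" "dom \<phi> = a @ x" "cod \<phi> = x' @ a"
  shows "rotate (x @ y) (x' @ y) d cv d ev (right_strand x' a y \<phi>)
       = (rotate x x' d cv d ev \<phi> \<parallel> \<iota> y) \<bullet> (\<iota> x \<parallel> br y d)"
proof -
  note D1 = assms(1)[unfolded right_dual_def]
  have [simp]: "ob a" "ob d" "arr ev" "dom ev = a @ d" "cod ev = []" "arr cv" "dom cv = []" "cod cv = d @ a"
    using D1 by auto
  have "ev \<parallel> \<iota> y = (\<iota> y \<parallel> ev) \<bullet> (bri y a \<parallel> \<iota> d) \<bullet> (\<iota> a \<parallel> bri y d)"
    using bri_nat_right[of ev y] by simp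
  from arg_cong[OF this, of "\<lambda>t. t \<bullet> (\<iota> a \<parallel> br y d)"]
  have E: "(\<iota> y \<parallel> ev) \<bullet> (bri y a \<parallel> \<iota> d) = (ev \<parallel> \<iota> y) \<bullet> (\<iota> a \<parallel> br y d)" by simp
  note E' = whisk[OF E, of "d @ x'" "[]", simplified]
  note X1 = exchange[of \<phi> "br y d" d "[]" "[]", simplified, symmetric]
  note X2 = exchange[of cv "br y d" "[]" x "[]", simplified, symmetric]
  show ?thesis unfolding rotate_def right_strand_def
    by (simp add: E' tail2[OF E'] X1 tail2[OF X1] X2 tail2[OF X2])
qed

lemma rotate_left_strand:
  assumes "right_dual b e ev cv"
    and [simp]: "ob x" "ob y" "ob y'" "arr \<psi>" "dom \<psi> = b @ y" "cod \<psi> = y' @ b"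
  shows "rotate (x @ y) (x @ y') e cv e ev (left_strand x b y \<psi>)
       = (bri e x \<parallel> \<iota> y') \<bullet> (\<iota> x \<parallel> rotate y y' e cv e ev \<psi>)"
proof -
  note D1 = assms(1)[unfolded right_dual_def]
  have [simp]: "ob b" "ob e" "arr ev" "dom ev = b @ e" "cod ev = []" "arr cv" "dom cv = []" "cod cv = e @ b"
    using D1 by auto
  have "(br e x \<parallel> \<iota> b) \<bullet> (\<iota> e \<parallel> br b x) \<bullet> (cv \<parallel> \<iota> x) = \<iota> x \<parallel> cv"
    using br_nat_left[of cv x] by simp
  from arg_cong[OF this, of "\<lambda>t. (bri e x \<parallel> \<iota> b) \<bullet> t"]
  have E: "(\<iota> e \<parallel> br b x) \<bullet> (cv \<parallel> \<iota> x) = (bri e x \<parallel> \<iota> b) \<bullet> (\<iota> x \<parallel> cv)" by simp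
  note E' = whisk[OF E, of "[]" "y @ e", simplified]
  note X1 = exchange[of "bri e x" \<psi> "[]" "[]" e, simplified, symmetric]
  note X2 = exchange[of "bri e x" ev "[]" y' "[]", simplified, symmetric]
  show ?thesis unfolding rotate_def left_strand_def
    by (simp add: E' tail2[OF E'] X1 tail2[OF X1] X2 tail2[OF X2])
qed

lemma rotate_simps [simp]:
  assumes "right_dual a d ev cv" "ob x" "ob x'" "arr \<psi>" "dom \<psi> = a @ x" "cod \<psi> = x' @ a"
  shows "arr (rotate x x' d cv d ev \<psi>)" "dom (rotate x x' d cv d ev \<psi>) = x @ d"
    "cod (rotate x x' d cv d ev \<psi>) = d @ x'"
  using assms by (auto simp: right_dual_def rotate_def)

text \<open>
  The zigzag identity on both ends of the strand.
\<close>

lemma unrotate: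
  assumes "right_dual a d ev cv"
    and [simp]: "ob x" "ob x'" "arr \<psi>" "dom \<psi> = a @ x" "cod \<psi> = x' @ a"
  shows "(ev \<parallel> \<iota> (x' @ a)) \<bullet> (\<iota> a \<parallel> rotate x x' d cv d ev \<psi> \<parallel> \<iota> a) \<bullet> (\<iota> (a @ x) \<parallel> cv) = \<psi>"
proof -
  note D1 = assms(1)[unfolded right_dual_def]
  have [simp]: "ob a" "ob d" "arr ev" "dom ev = a @ d" "cod ev = []" "arr cv" "dom cv = []" "cod cv = d @ a"
    and Z: "(ev \<parallel> \<iota> a) \<bullet> (\<iota> a \<parallel> cv) = \<iota> a" "(\<iota> d \<parallel> ev) \<bullet> (cv \<parallel> \<iota> d) = \<iota> d"
    using D1 by auto
  note X1 = exchange[of cv cv a x "[]", simplified]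
  note X2 = exchange[of \<psi> cv "a @ d" "[]" "[]", simplified]
  note X3 = exchange[of ev \<psi> "[]" "[]" "[]", simplified]
  note Z1 = whisk[OF Z(1), of "a @ d @ x'" "[]", simplified]
  note Z2 = whisk[OF Z(1), of "[]" x, simplified]
  show ?thesis unfolding rotate_def
    by (simp add: X1 tail2[OF X1] X2 tail2[OF X2] Z1 tail2[OF Z1] X3 tail2[OF X3] Z2 tail2[OF Z2])
qed

subsection \<open>Turning a strand back by the braiding\<close>

text \<open>
  Moves the strand of a bent arrow back to the left of \<open>x\<close> and to the right of \<open>x'\<close>.
\<close>

definition flip_strand :: "'w list \<Rightarrow> 'w list \<Rightarrow> 'w list \<Rightarrow> 'w list \<Rightarrow> 'b \<Rightarrow> 'b" where
  "flip_strand x x' d e \<chi> = bri x' e \<bullet> \<chi> \<bullet> br d x"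

lemma flip_strand_simps [simp]:
  assumes "ob x" "ob x'" "ob d" "ob e" "arr \<chi>" "dom \<chi> = x @ d" "cod \<chi> = e @ x'"
  shows "arr (flip_strand x x' d e \<chi>)" "dom (flip_strand x x' d e \<chi>) = d @ x"
    "cod (flip_strand x x' d e \<chi>) = x' @ e"
  using assms by (simp_all add: flip_strand_def)

text \<open>
  Bent arrows compose in the reverse order of strands; braiding them back restores the order up to
  the braiding of the two strands.
\<close>

lemma flip_strand_comp:
  assumes [simp]: "ob d" "ob e" "ob x" "ob x'" "ob x''"
    and [simp]: "arr \<chi>" "dom \<chi> = x @ d" "cod \<chi> = d @ x'" "arr \<xi>" "dom \<xi> = x' @ e" "cod \<xi> = e @ x''"
  shows "flip_strand x x'' (d @ e) (d @ e) ((\<iota> d \<parallel> \<xi>) \<bullet> (\<chi> \<parallel> \<iota> e)) \<bullet> (br e d \<parallel> \<iota> x)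
       = (\<iota> x'' \<parallel> br e d) \<bullet> comp_strand e d (flip_strand x' x'' e e \<xi>) (flip_strand x x' d d \<chi>)"
proof -
  have Y1: "(br d x \<parallel> \<iota> e) \<bullet> (\<iota> d \<parallel> br e x) \<bullet> (br e d \<parallel> \<iota> x)
      = (\<iota> x \<parallel> br e d) \<bullet> (br e x \<parallel> \<iota> d) \<bullet> (\<iota> e \<parallel> br d x)"
    using br_nat_left[of "br e d" x] by simp
  have Y2: "(\<chi> \<parallel> \<iota> e) \<bullet> (\<iota> x \<parallel> br e d) \<bullet> (br e x \<parallel> \<iota> d)
      = (\<iota> d \<parallel> br e x') \<bullet> (br e d \<parallel> \<iota> x') \<bullet> (\<iota> e \<parallel> \<chi>)"
    using br_nat_right[of \<chi> e] by simp
  have "(br e d \<parallel> \<iota> x'') \<bullet> (\<iota> e \<parallel> br x'' d) \<bullet> (\<xi> \<parallel> \<iota> d) \<bullet> (br e x' \<parallel> \<iota> d)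
      = (\<iota> d \<parallel> \<xi>) \<bullet> (\<iota> d \<parallel> br e x') \<bullet> (br e d \<parallel> \<iota> x') \<bullet> (\<iota> e \<parallel> br x' d)"
    using br_nat_left[of "\<xi> \<bullet> br e x'" d] by simp
  from arg_cong[OF this, of "\<lambda>t. t \<bullet> (\<iota> e \<parallel> bri x' d)"]
  have Y3: "(\<iota> d \<parallel> \<xi>) \<bullet> (\<iota> d \<parallel> br e x') \<bullet> (br e d \<parallel> \<iota> x')
      = (br e d \<parallel> \<iota> x'') \<bullet> (\<iota> e \<parallel> br x'' d) \<bullet> (\<xi> \<parallel> \<iota> d) \<bullet> (br e x' \<parallel> \<iota> d) \<bullet> (\<iota> e \<parallel> bri x' d)"
    by simp
  have Y4: "(bri x'' d \<parallel> \<iota> e) \<bullet> (\<iota> d \<parallel> bri x'' e) \<bullet> (br e d \<parallel> \<iota> x'')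
      = (\<iota> x'' \<parallel> br e d) \<bullet> (bri x'' e \<parallel> \<iota> d) \<bullet> (\<iota> e \<parallel> bri x'' d)"
    using bri_nat_right[of "br e d" x''] by simp
  show ?thesis unfolding comp_strand_def flip_strand_def
    by (simp add: Y1 tail3[OF Y1] Y2 tail3[OF Y2] Y3 tail3[OF Y3] Y4 tail3[OF Y4])
qed

lemma flip_right_strand:
  assumes [simp]: "ob d" "ob x" "ob x'" "ob y" "arr \<chi>" "dom \<chi> = x @ d" "cod \<chi> = d @ x'"
  shows "(br y x' \<parallel> \<iota> d) \<bullet> left_strand y d x (flip_strand x x' d d \<chi>)
       = flip_strand (x @ y) (x' @ y) d d ((\<chi> \<parallel> \<iota> y) \<bullet> (\<iota> x \<parallel> br y d)) \<bullet> (\<iota> d \<parallel> br y x)"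
proof -
  have Y1: "(\<iota> x \<parallel> br d y) \<bullet> (br d x \<parallel> \<iota> y) \<bullet> (\<iota> d \<parallel> br y x)
      = (br y x \<parallel> \<iota> d) \<bullet> (\<iota> y \<parallel> br d x) \<bullet> (br d y \<parallel> \<iota> x)"
    using br_nat_right[of "br y x" d] by simp
  have Y2: "(\<chi> \<parallel> \<iota> y) \<bullet> (\<iota> x \<parallel> br y d) \<bullet> (br y x \<parallel> \<iota> d)
      = (\<iota> d \<parallel> br y x') \<bullet> (br y d \<parallel> \<iota> x') \<bullet> (\<iota> y \<parallel> \<chi>)"
    using br_nat_right[of \<chi> y] by simp
  have "(\<iota> x' \<parallel> bri y d) \<bullet> (bri x' d \<parallel> \<iota> y) \<bullet> (\<iota> d \<parallel> br y x')
      = (br y x' \<parallel> \<iota> d) \<bullet> (\<iota> y \<parallel> bri x' d) \<bullet> (bri y d \<parallel> \<iota> x')"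
    using bri_nat_left[of "br y x'" d] by simp
  from arg_cong[OF this, of "\<lambda>t. t \<bullet> (br y d \<parallel> \<iota> x')"]
  have Y3: "(\<iota> x' \<parallel> bri y d) \<bullet> (bri x' d \<parallel> \<iota> y) \<bullet> (\<iota> d \<parallel> br y x') \<bullet> (br y d \<parallel> \<iota> x')
      = (br y x' \<parallel> \<iota> d) \<bullet> (\<iota> y \<parallel> bri x' d)"
    by simp
  show ?thesis unfolding left_strand_def flip_strand_def
    by (simp add: Y1 tail3[OF Y1] Y2 tail3[OF Y2] Y3 tail4[OF Y3])
qed

lemma flip_left_strand:
  assumes [simp]: "ob e" "ob x" "ob y" "ob y'" "arr \<xi>" "dom \<xi> = y @ e" "cod \<xi> = e @ y'"
  shows "(br y' x \<parallel> \<iota> e) \<bullet> right_strand y' e x (flip_strand y y' e e \<xi>)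
       = flip_strand (x @ y) (x @ y') e e ((bri e x \<parallel> \<iota> y') \<bullet> (\<iota> x \<parallel> \<xi>)) \<bullet> (\<iota> e \<parallel> br y x)"
proof -
  have Y1: "(\<iota> x \<parallel> br e y) \<bullet> (br e x \<parallel> \<iota> y) \<bullet> (\<iota> e \<parallel> br y x)
      = (br y x \<parallel> \<iota> e) \<bullet> (\<iota> y \<parallel> br e x) \<bullet> (br e y \<parallel> \<iota> x)"
    using br_nat_right[of "br y x" e] by simp
  have Y2: "(\<iota> x \<parallel> \<xi>) \<bullet> (br y x \<parallel> \<iota> e) \<bullet> (\<iota> y \<parallel> br e x)
      = (br e x \<parallel> \<iota> y') \<bullet> (\<iota> e \<parallel> br y' x) \<bullet> (\<xi> \<parallel> \<iota> x)"
    using br_nat_left[of \<xi> x] by simp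
  have Y3: "(\<iota> x \<parallel> bri y' e) \<bullet> (bri x e \<parallel> \<iota> y') \<bullet> (\<iota> e \<parallel> br y' x)
      = (br y' x \<parallel> \<iota> e) \<bullet> (\<iota> y' \<parallel> bri x e) \<bullet> (bri y' e \<parallel> \<iota> x)"
    using bri_nat_left[of "br y' x" e] by simp
  show ?thesis unfolding right_strand_def flip_strand_def
    by (simp add: Y1 tail3[OF Y1] Y2 tail3[OF Y2] Y3 tail3[OF Y3])
qed

text \<open>
  With the dual from \<open>right_dual_braided\<close> the second bend undoes the first, and of the flip in
  between only crossings of the strand with \<open>x\<close> and \<open>x'\<close> survive.  A second flip turns them into the
  double braidings.
\<close>

lemma rotate_flip_rotate:
  assumes du: "right_dual a d ev cv"
    and [simp]: "ob x" "ob x'" "arr \<psi>" "dom \<psi> = a @ x" "cod \<psi> = x' @ a"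
  shows "rotate x x' a (bri a d \<bullet> cv) a (ev \<bullet> br d a) (flip_strand x x' d d (rotate x x' d cv d ev \<psi>))
       = bri a x' \<bullet> \<psi> \<bullet> br x a"
proof -
  note D1 = assms(1)[unfolded right_dual_def]
  have [simp]: "ob a" "ob d" "arr ev" "dom ev = a @ d" "cod ev = []" "arr cv" "dom cv = []" "cod cv = d @ a"
    using D1 by auto
  define \<chi> where "\<chi> = rotate x x' d cv d ev \<psi>"
  have [simp]: "arr \<chi>" "dom \<chi> = x @ d" "cod \<chi> = d @ x'" using du by (simp_all add: \<chi>_def)
  have "(br a x \<parallel> \<iota> d) \<bullet> (\<iota> a \<parallel> br d x) \<bullet> (bri a d \<parallel> \<iota> x) \<bullet> (cv \<parallel> \<iota> x) = (\<iota> x \<parallel> bri a d) \<bullet> (\<iota> x \<parallel> cv)"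
    using br_nat_left[of "bri a d \<bullet> cv" x] by simp
  from arg_cong[OF this, of "\<lambda>t. (bri a x \<parallel> \<iota> d) \<bullet> t"]
  have E1: "(\<iota> a \<parallel> br d x) \<bullet> (bri a d \<parallel> \<iota> x) \<bullet> (cv \<parallel> \<iota> x) = (bri a x \<parallel> \<iota> d) \<bullet> (\<iota> x \<parallel> bri a d) \<bullet> (\<iota> x \<parallel> cv)"
    by simp
  have E2: "(\<iota> a \<parallel> \<chi>) \<bullet> (bri a x \<parallel> \<iota> d) \<bullet> (\<iota> x \<parallel> bri a d) = (bri a d \<parallel> \<iota> x') \<bullet> (\<iota> d \<parallel> bri a x') \<bullet> (\<chi> \<parallel> \<iota> a)"
    using bri_nat_right[of \<chi> a] by simp
  have "(ev \<parallel> \<iota> x') \<bullet> (br d a \<parallel> \<iota> x') = (\<iota> x' \<parallel> ev) \<bullet> (\<iota> x' \<parallel> br d a) \<bullet> (bri x' d \<parallel> \<iota> a) \<bullet> (\<iota> d \<parallel> bri x' a)"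
    using bri_nat_right[of "ev \<bullet> br d a" x'] by simp
  from arg_cong[OF this, of "\<lambda>t. t \<bullet> (\<iota> d \<parallel> br x' a)"]
  have E3: "(\<iota> x' \<parallel> ev) \<bullet> (\<iota> x' \<parallel> br d a) \<bullet> (bri x' d \<parallel> \<iota> a) = (ev \<parallel> \<iota> x') \<bullet> (br d a \<parallel> \<iota> x') \<bullet> (\<iota> d \<parallel> br x' a)"
    by simp
  note E4 = right_dual_braided(2)[OF du]
  have E5: "(br d a \<parallel> \<iota> (a @ x')) \<bullet> (\<iota> d \<parallel> br a a \<parallel> \<iota> x') \<bullet> (\<iota> (d @ a) \<parallel> br x' a) \<bullet> (\<iota> d \<parallel> bri a x' \<parallel> \<iota> a)
      \<bullet> (\<chi> \<parallel> \<iota> (a @ a)) \<bullet> (\<iota> x \<parallel> cv \<parallel> \<iota> a) = (\<iota> (a @ d) \<parallel> bri a x') \<bullet> (\<iota> a \<parallel> \<chi> \<parallel> \<iota> a) \<bullet> (\<iota> (a @ x) \<parallel> cv) \<bullet> br x a"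
    using br_nat_left[of "(\<iota> d \<parallel> bri a x') \<bullet> (\<chi> \<parallel> \<iota> a) \<bullet> (\<iota> x \<parallel> cv)" a] by simp
  have E6: "(ev \<parallel> \<iota> (x' @ a)) \<bullet> (\<iota> a \<parallel> \<chi> \<parallel> \<iota> a) \<bullet> (\<iota> (a @ x) \<parallel> cv) = \<psi>"
    unfolding \<chi>_def by (rule unrotate[OF du]) simp_all
  note E1' = whisk[OF E1, of "[]" a, simplified]
  note E2' = whisk[OF E2, of "[]" a, simplified]
  note E3' = whisk[OF E3, of a "[]", simplified]
  note E4' = whisk[OF E4, of "[]" x', simplified]
  note X1 = exchange[of "bri a d" "br x' a" "[]" "[]" "[]", simplified, symmetric]
  note X2 = exchange[of ev "bri a x'" "[]" "[]" "[]", simplified]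
  show ?thesis unfolding \<chi>_def[symmetric] unfolding rotate_def flip_strand_def
    by (simp add: E1' E2' tail3[OF E2'] E3' tail3[OF E3'] X1 tail2[OF X1] E4' tail3[OF E4'] E5 X2 tail2[OF X2]
        E6 tail3[OF E6])
qed

definition tilde_strand :: "'w list \<Rightarrow> 'w list \<Rightarrow> 'w list \<Rightarrow> 'b \<Rightarrow> 'b \<Rightarrow> 'b \<Rightarrow> 'b" where
  "tilde_strand x x' d ev cv \<psi> = flip_strand x x' d d (rotate x x' d cv d ev \<psi>)"

lemma tilde_strand_simps [simp]:
  assumes "right_dual a d ev cv" "ob x" "ob x'" "arr \<psi>" "dom \<psi> = a @ x" "cod \<psi> = x' @ a"
  shows "arr (tilde_strand x x' d ev cv \<psi>)" "dom (tilde_strand x x' d ev cv \<psi>) = d @ x"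
    "cod (tilde_strand x x' d ev cv \<psi>) = x' @ d"
proof -
  have "ob d" using assms(1) by (simp add: right_dual_def)
  then show "arr (tilde_strand x x' d ev cv \<psi>)" "dom (tilde_strand x x' d ev cv \<psi>) = d @ x"
    "cod (tilde_strand x x' d ev cv \<psi>) = x' @ d" unfolding tilde_strand_def using assms by simp_all
qed

text \<open>
  Sliding \<open>f\<close> turns into sliding its mate in the opposite direction, which is again a slide.
\<close>

lemma tilde_strand_slide:
  assumes "right_dual a d ev cv" "right_dual b e ev' cv'"
    and [simp]: "ob x" "ob x'" "arr f" "dom f = a" "cod f = b"
      "arr \<psi>" "dom \<psi> = b @ x" "cod \<psi> = x' @ a"
  obtains g \<Theta> where "arr g" "dom g = e" "cod g = d" "arr \<Theta>" "dom \<Theta> = d @ x" "cod \<Theta> = x' @ e"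
    "tilde_strand x x' d ev cv (\<psi> \<bullet> (f \<parallel> \<iota> x)) = (\<iota> x' \<parallel> g) \<bullet> \<Theta>"
    "tilde_strand x x' e ev' cv' ((\<iota> x' \<parallel> f) \<bullet> \<psi>) = \<Theta> \<bullet> (g \<parallel> \<iota> x)"
proof -
  define g where "g = (\<iota> d \<parallel> ev') \<bullet> (\<iota> d \<parallel> f \<parallel> \<iota> e) \<bullet> (cv \<parallel> \<iota> e)"
  define R where "R = rotate x x' e cv' d ev \<psi>"
  have [simp]: "ob d" "ob e" "ob a" "ob b" using assms(1,2) by (auto simp: right_dual_def)
  note S = rotate_slide[OF assms, folded g_def R_def]
  have [simp]: "arr R" "dom R = x @ d" "cod R = e @ x'"
    using assms(1,2) by (auto simp: R_def rotate_def right_dual_def)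
  note [simp] = S(3-5)
  show thesis
  proof (rule that[of g "flip_strand x x' d e R"])
    show "tilde_strand x x' d ev cv (\<psi> \<bullet> (f \<parallel> \<iota> x)) = (\<iota> x' \<parallel> g) \<bullet> flip_strand x x' d e R"
      using tail2[OF bri_nat_right[of g x'], of "R \<bullet> br d x"]
      by (simp add: tilde_strand_def S(1) flip_strand_def)
    show "tilde_strand x x' e ev' cv' ((\<iota> x' \<parallel> f) \<bullet> \<psi>) = flip_strand x x' d e R \<bullet> (g \<parallel> \<iota> x)"
      using br_nat_left[of g x] by (simp add: tilde_strand_def S(2) flip_strand_def)
  qed simp_all
qed

end

section \<open>Strictification\<close>

context monoidal_category
begin

definition words :: "'o list \<Rightarrow> bool" where "words w \<longleftrightarrow> set w \<subseteq> Obj C"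

lemma words_simps [simp]: "words []" "words (X # w) \<longleftrightarrow> X \<in> Obj C \<and> words w"
  "words (w @ v) \<longleftrightarrow> words w \<and> words v"
  by (auto simp: words_def)

text \<open>
  Words are bracketed to the right and end with the unit, so that no case distinction on singleton
  words is needed.
\<close>

primrec wob :: "'o list \<Rightarrow> 'o" where
  "wob [] = \<I>"
| "wob (X # w) = X \<boxtimes> wob w"

text \<open>
  The comparison isomorphism from \<open>wob w \<boxtimes> wob v\<close> to \<open>wob (w @ v)\<close>.
\<close>

primrec join :: "'o list \<Rightarrow> 'o list \<Rightarrow> 'a" where
  "join [] v = LUn C (wob v)"
| "join (X # w) v = (Idt C X \<star> join w v) \<cdot> Asc C X (wob w) (wob v)"

lemma wob_Obj [simp]: "words w \<Longrightarrow> wob w \<in> Obj C"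
  by (induction w) simp_all

lemma join_simps [simp]:
  assumes "words w" "words v"
  shows "join w v \<in> Arr C" "Dom C (join w v) = wob w \<boxtimes> wob v" "Cod C (join w v) = wob (w @ v)"
    "iso_arr C (join w v)"
  using assms by (induction w) simp_all

text \<open>
  Induction on the first word, by the pentagon.  This makes the tensor product of the
  strictification associative.
\<close>

lemma join_assoc:
  assumes "words u" "words v" "words w"
  shows "join (u @ v) w \<cdot> (join u v \<star> Idt C (wob w)) =
         join u (v @ w) \<cdot> (Idt C (wob u) \<star> join v w) \<cdot> Asc C (wob u) (wob v) (wob w)"
  using assms(1)
proof (induction u)
  case Nil
  note [simp] = assms(2,3)
  show ?case using Cmp_tail[OF LUn_nat[of "join v w"], of "Asc C \<I> (wob v) (wob w)"]
    by (simp add: LUn_TenO)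
next
  case (Cons X u)
  note [simp] = assms(2,3)
  have [simp]: "X \<in> Obj C" "words u" using Cons.prems by simp_all
  let ?X = "Idt C X" and ?u = "wob u" and ?v = "wob v" and ?w = "wob w"
  have "join ((X # u) @ v) w \<cdot> (join (X # u) v \<star> Idt C ?w)
      = (?X \<star> join (u @ v) w) \<cdot> Asc C X (wob (u @ v)) ?w \<cdot> ((?X \<star> join u v) \<star> Idt C ?w) \<cdot> (Asc C X ?u ?v \<star> Idt C ?w)"
    by (simp add: interchange)
  also have "\<dots> = (?X \<star> (join (u @ v) w \<cdot> (join u v \<star> Idt C ?w))) \<cdot> Asc C X (?u \<boxtimes> ?v) ?w \<cdot> (Asc C X ?u ?v \<star> Idt C ?w)"
    using Cmp_tail[OF Asc_nat[of ?X "join u v" "Idt C ?w"], of "Asc C X ?u ?v \<star> Idt C ?w"]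
    by (simp add: interchange_tail)
  also have "\<dots> = (?X \<star> (join u (v @ w) \<cdot> (Idt C ?u \<star> join v w) \<cdot> Asc C ?u ?v ?w)) \<cdot> Asc C X (?u \<boxtimes> ?v) ?w \<cdot> (Asc C X ?u ?v \<star> Idt C ?w)"
    using Cons.IH by simp
  also have "\<dots> = (?X \<star> join u (v @ w)) \<cdot> (?X \<star> (Idt C ?u \<star> join v w)) \<cdot>
      ((?X \<star> Asc C ?u ?v ?w) \<cdot> Asc C X (?u \<boxtimes> ?v) ?w \<cdot> (Asc C X ?u ?v \<star> Idt C ?w))"
    by (simp add: interchange_tail interchange)
  also have "\<dots> = (?X \<star> join u (v @ w)) \<cdot> (?X \<star> (Idt C ?u \<star> join v w)) \<cdot>
      (Asc C X ?u (?v \<boxtimes> ?w) \<cdot> Asc C (X \<boxtimes> ?u) ?v ?w)"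
    by (simp add: pentagon)
  also have "\<dots> = join (X # u) (v @ w) \<cdot> (Idt C (wob (X # u)) \<star> join v w) \<cdot> Asc C (wob (X # u)) ?v ?w"
    using Cmp_tail[OF Asc_nat[of ?X "Idt C ?u" "join v w"], of "Asc C (X \<boxtimes> ?u) ?v ?w"] by simp
  finally show ?case .
qed

lemma join_Nil_right: "words w \<Longrightarrow> join w [] = RUn C (wob w)"
  by (induction w) (simp_all add: LUn_Unit RUn_TenO)

text \<open>
  Arrows carry their words, since different words may be bracketed to the same object.
\<close>

type_synonym ('x, 'y) strict_arr = "'x list \<times> 'x list \<times> 'y"

definition sdom :: "('o, 'a) strict_arr \<Rightarrow> 'o list" where "sdom F = fst F"

definition scod :: "('o, 'a) strict_arr \<Rightarrow> 'o list" where "scod F = fst (snd F)"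

definition sarr :: "('o, 'a) strict_arr \<Rightarrow> bool" where
  "sarr F \<longleftrightarrow> words (sdom F) \<and> words (scod F) \<and> snd (snd F) \<in> Mor C (wob (sdom F)) (wob (scod F))"

definition sidn :: "'o list \<Rightarrow> ('o, 'a) strict_arr" (\<open>\<iota>\<close>) where
  "\<iota> w = (w, w, Idt C (wob w))"

definition scmp :: "('o, 'a) strict_arr \<Rightarrow> ('o, 'a) strict_arr \<Rightarrow> ('o, 'a) strict_arr" (infixr \<open>\<bullet>\<close> 55) where
  "G \<bullet> F = (sdom F, scod G, snd (snd G) \<cdot> snd (snd F))"

definition sten :: "('o, 'a) strict_arr \<Rightarrow> ('o, 'a) strict_arr \<Rightarrow> ('o, 'a) strict_arr" (infixr \<open>\<parallel>\<close> 70) where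
  "F \<parallel> G = (sdom F @ sdom G, scod F @ scod G,
     join (scod F) (scod G) \<cdot> (snd (snd F) \<star> snd (snd G)) \<cdot> inv_arr C (join (sdom F) (sdom G)))"

text \<open>
  An object with a word and an isomorphism from the object to the bracketed word.  With explicit
  presentations one word can stand for several objects, such as the two ends of an associator.
\<close>

type_synonym ('x, 'y) presentation = "'x \<times> 'x list \<times> 'y"

abbreviation po :: "('o, 'a) presentation \<Rightarrow> 'o" where "po p \<equiv> fst p"

abbreviation pw :: "('o, 'a) presentation \<Rightarrow> 'o list" where "pw p \<equiv> fst (snd p)"

abbreviation pk :: "('o, 'a) presentation \<Rightarrow> 'a" where "pk p \<equiv> snd (snd p)"

definition pres :: "('o, 'a) presentation \<Rightarrow> bool" where
  "pres p \<longleftrightarrow> words (pw p) \<and> pk p \<in> Mor C (po p) (wob (pw p)) \<and> iso_arr C (pk p)"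

definition pten :: "('o, 'a) presentation \<Rightarrow> ('o, 'a) presentation \<Rightarrow> ('o, 'a) presentation" (infixr \<open>\<odot>\<odot>\<close> 70)
  where "p \<odot>\<odot> q = (po p \<boxtimes> po q, pw p @ pw q, join (pw p) (pw q) \<cdot> (pk p \<star> pk q))"

definition pword :: "'o list \<Rightarrow> ('o, 'a) presentation" where
  "pword w = (wob w, w, Idt C (wob w))"

text \<open>
  The word \<open>[X]\<close> is bracketed to \<open>X \<boxtimes> \<I>\<close>, hence the unitor.
\<close>

definition pleaf :: "'o \<Rightarrow> ('o, 'a) presentation" where
  "pleaf X = (X, [X], inv_arr C (RUn C X))"

definition pone :: "('o, 'a) presentation" where "pone = (\<I>, [], Idt C \<I>)"

text \<open>
  \<open>F\<close> is \<open>f\<close> transported along the presentations of source and target.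
\<close>

definition rep :: "('o, 'a) presentation \<Rightarrow> ('o, 'a) presentation \<Rightarrow> 'a \<Rightarrow> ('o, 'a) strict_arr \<Rightarrow> bool" where
  "rep p q f F \<longleftrightarrow> pres p \<and> pres q \<and> f \<in> Mor C (po p) (po q) \<and>
     F = (pw p, pw q, pk q \<cdot> f \<cdot> inv_arr C (pk p))"

lemma pres_simps [simp]:
  assumes "pres p"
  shows "words (pw p)" "pk p \<in> Arr C" "Dom C (pk p) = po p" "Cod C (pk p) = wob (pw p)" "iso_arr C (pk p)"
  using assms by (auto simp: pres_def Mor_iff)

lemma po_Obj [simp]: "pres p \<Longrightarrow> po p \<in> Obj C"
  using Dom_Obj[of "pk p"] by simp

lemma pten_simps [simp]: "po (p \<odot>\<odot> q) = po p \<boxtimes> po q" "pw (p \<odot>\<odot> q) = pw p @ pw q"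
  by (simp_all add: pten_def)

lemma pres_pten [simp]: "pres p \<Longrightarrow> pres q \<Longrightarrow> pres (p \<odot>\<odot> q)"
  by (simp add: pres_def[of "p \<odot>\<odot> q"]) (simp add: pten_def Mor_iff)

lemma pword_simps [simp]: "po (pword w) = wob w" "pw (pword w) = w" "words w \<Longrightarrow> pres (pword w)"
  by (simp_all add: pres_def pword_def Mor_iff)

lemma pone_simps [simp]: "po pone = \<I>" "pw pone = []" "pres pone"
  by (simp_all add: pres_def pone_def Mor_iff)

lemma pleaf_simps [simp]: "po (pleaf X) = X" "pw (pleaf X) = [X]" "X \<in> Obj C \<Longrightarrow> pres (pleaf X)"
  by (simp_all add: pres_def pleaf_def Mor_iff)

lemma repD: "rep p q f F \<Longrightarrow> pres p \<and> pres q \<and> f \<in> Mor C (po p) (po q)"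
  by (simp add: rep_def)

lemma rep_simps:
  assumes "rep p q f F"
  shows "sarr F" "sdom F = pw p" "scod F = pw q"
  using assms by (auto simp: rep_def sarr_def sdom_def scod_def Mor_iff)

lemma rep_inj: "rep p q f F \<Longrightarrow> rep p q g F \<Longrightarrow> f = g"
proof -
  assume a: "rep p q f F" "rep p q g F"
  then have [simp]: "pres p" "pres q" and f [simp]: "f \<in> Arr C" "Dom C f = po p" "Cod C f = po q"
    and g [simp]: "g \<in> Arr C" "Dom C g = po p" "Cod C g = po q" by (auto simp: rep_def Mor_iff)
  have "pk q \<cdot> (f \<cdot> inv_arr C (pk p)) = pk q \<cdot> (g \<cdot> inv_arr C (pk p))" using a by (simp add: rep_def)
  then have "f \<cdot> inv_arr C (pk p) = g \<cdot> inv_arr C (pk p)" by (rule iso_cancel_left[rotated -1]) simp_all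
  then show "f = g" by (rule iso_cancel_right[rotated -1]) simp_all
qed

lemma rep_exists:
  assumes [simp]: "pres p" "pres q" and F: "sarr F" "sdom F = pw p" "scod F = pw q"
  obtains f where "rep p q f F"
proof
  have [simp]: "snd (snd F) \<in> Arr C" "Dom C (snd (snd F)) = wob (pw p)" "Cod C (snd (snd F)) = wob (pw q)"
    using F by (auto simp: sarr_def Mor_iff)
  show "rep p q (inv_arr C (pk q) \<cdot> snd (snd F) \<cdot> pk p) F"
    using F(2,3) by (simp add: rep_def Mor_iff sdom_def scod_def prod_eq_iff)
qed

lemma rep_Idt: "pres p \<Longrightarrow> rep p p (Idt C (po p)) (\<iota> (pw p))"
  by (simp add: rep_def sidn_def Mor_iff)

lemma rep_Cmp: "rep p q f F \<Longrightarrow> rep q r g G \<Longrightarrow> rep p r (g \<cdot> f) (G \<bullet> F)"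
  by (auto simp: rep_def scmp_def Mor_iff sdom_def scod_def)

lemma rep_TenA:
  assumes "rep p q f F" "rep p' q' f' F'"
  shows "rep (p \<odot>\<odot> p') (q \<odot>\<odot> q') (f \<star> f') (F \<parallel> F')"
proof -
  have [simp]: "pres p" "pres q" "f \<in> Arr C" "Dom C f = po p" "Cod C f = po q"
    "pres p'" "pres q'" "f' \<in> Arr C" "Dom C f' = po p'" "Cod C f' = po q'"
    and F: "F = (pw p, pw q, pk q \<cdot> f \<cdot> inv_arr C (pk p))" "F' = (pw p', pw q', pk q' \<cdot> f' \<cdot> inv_arr C (pk p'))"
    using assms by (auto simp: rep_def Mor_iff)
  show ?thesis
    by (simp add: rep_def Mor_iff F sten_def sdom_def scod_def)
      (simp add: pten_def interchange[symmetric] interchange_tail[symmetric])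
qed

text \<open>
  An isomorphism that is compatible with the presentations is transported to an identity.
  Associators and unitors are of this kind, which is coherence in the form used below.
\<close>

lemma rep_coherence:
  assumes "pres p" "pres q" "f \<in> Mor C (po p) (po q)" "pw q = pw p" "pk q \<cdot> f = pk p"
  shows "rep p q f (\<iota> (pw p))" "iso_arr C f" "rep q p (inv_arr C f) (\<iota> (pw p))"
proof -
  note [simp] = assms(1,2,4)
  have [simp]: "f \<in> Arr C" "Dom C f = po p" "Cod C f = po q" using assms(3) by (auto simp: Mor_iff)
  have f: "f = inv_arr C (pk q) \<cdot> pk p" by (simp flip: assms(5))
  show i [simp]: "iso_arr C f" unfolding f by simp
  show "rep p q f (\<iota> (pw p))" by (simp add: rep_def Mor_iff sidn_def Cmp_tail[OF assms(5)])
  show "rep q p (inv_arr C f) (\<iota> (pw p))" by (simp add: rep_def Mor_iff sidn_def) (simp add: f)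
qed

lemma rep_Asc:
  assumes [simp]: "pres p" "pres q" "pres r"
  shows "rep ((p \<odot>\<odot> q) \<odot>\<odot> r) (p \<odot>\<odot> (q \<odot>\<odot> r)) (Asc C (po p) (po q) (po r)) (\<iota> (pw p @ pw q @ pw r))"
    "rep (p \<odot>\<odot> (q \<odot>\<odot> r)) ((p \<odot>\<odot> q) \<odot>\<odot> r) (inv_arr C (Asc C (po p) (po q) (po r))) (\<iota> (pw p @ pw q @ pw r))"
proof -
  have "pk (p \<odot>\<odot> (q \<odot>\<odot> r)) \<cdot> Asc C (po p) (po q) (po r)
      = join (pw p) (pw q @ pw r) \<cdot> (Idt C (wob (pw p)) \<star> join (pw q) (pw r)) \<cdot> (pk p \<star> (pk q \<star> pk r)) \<cdot> Asc C (po p) (po q) (po r)"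
    by (simp add: pten_def interchange_tail)
  also have "\<dots> = (join (pw p) (pw q @ pw r) \<cdot> (Idt C (wob (pw p)) \<star> join (pw q) (pw r)) \<cdot> Asc C (wob (pw p)) (wob (pw q)) (wob (pw r))) \<cdot> ((pk p \<star> pk q) \<star> pk r)"
    using Asc_nat[of "pk p" "pk q" "pk r"] by simp
  also have "\<dots> = pk ((p \<odot>\<odot> q) \<odot>\<odot> r)"
    unfolding join_assoc[OF pres_simps(1) pres_simps(1) pres_simps(1), OF assms, symmetric]
    by (simp add: pten_def interchange)
  finally have *: "pk (p \<odot>\<odot> (q \<odot>\<odot> r)) \<cdot> Asc C (po p) (po q) (po r) = pk ((p \<odot>\<odot> q) \<odot>\<odot> r)" .
  show "rep ((p \<odot>\<odot> q) \<odot>\<odot> r) (p \<odot>\<odot> (q \<odot>\<odot> r)) (Asc C (po p) (po q) (po r)) (\<iota> (pw p @ pw q @ pw r))"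
    "rep (p \<odot>\<odot> (q \<odot>\<odot> r)) ((p \<odot>\<odot> q) \<odot>\<odot> r) (inv_arr C (Asc C (po p) (po q) (po r))) (\<iota> (pw p @ pw q @ pw r))"
    using rep_coherence[OF _ _ _ _ *] by (simp_all add: Mor_iff)
qed

lemma rep_LUn:
  assumes [simp]: "pres p"
  shows "rep (pone \<odot>\<odot> p) p (LUn C (po p)) (\<iota> (pw p))" "rep p (pone \<odot>\<odot> p) (inv_arr C (LUn C (po p))) (\<iota> (pw p))"
proof -
  have *: "pk p \<cdot> LUn C (po p) = pk (pone \<odot>\<odot> p)"
    using LUn_nat[of "pk p"] by (simp add: pten_def pone_def)
  show "rep (pone \<odot>\<odot> p) p (LUn C (po p)) (\<iota> (pw p))" "rep p (pone \<odot>\<odot> p) (inv_arr C (LUn C (po p))) (\<iota> (pw p))"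
    using rep_coherence[OF _ _ _ _ *] by (simp_all add: Mor_iff)
qed

lemma rep_RUn:
  assumes [simp]: "pres p"
  shows "rep (p \<odot>\<odot> pone) p (RUn C (po p)) (\<iota> (pw p))" "rep p (p \<odot>\<odot> pone) (inv_arr C (RUn C (po p))) (\<iota> (pw p))"
proof -
  have *: "pk p \<cdot> RUn C (po p) = pk (p \<odot>\<odot> pone)"
    using RUn_nat[of "pk p"] by (simp add: pten_def pone_def join_Nil_right)
  show "rep (p \<odot>\<odot> pone) p (RUn C (po p)) (\<iota> (pw p))" "rep p (p \<odot>\<odot> pone) (inv_arr C (RUn C (po p))) (\<iota> (pw p))"
    using rep_coherence[OF _ _ _ _ *] by (simp_all add: Mor_iff)
qed

lemma strict_arr_rep:
  assumes "sarr F"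
  obtains f where "rep (pword (sdom F)) (pword (scod F)) f F"
  using rep_exists[of "pword (sdom F)" "pword (scod F)" F] assms by (auto simp: sarr_def)

lemma sarr_words [simp]: "sarr F \<Longrightarrow> words (sdom F)" "sarr F \<Longrightarrow> words (scod F)"
  by (simp_all add: sarr_def)

lemma strict_simps [simp]:
  "words w \<Longrightarrow> sarr (\<iota> w)" "sdom (\<iota> w) = w" "scod (\<iota> w) = w"
  "sdom (G \<bullet> F) = sdom F" "scod (G \<bullet> F) = scod G"
  "sdom (F \<parallel> G) = sdom F @ sdom G" "scod (F \<parallel> G) = scod F @ scod G"
  using rep_simps(1)[OF rep_Idt, of "pword w"]
  by (simp_all add: sidn_def scmp_def sten_def sdom_def scod_def)

lemma sarr_cmp [simp]: "sarr F \<Longrightarrow> sarr G \<Longrightarrow> sdom G = scod F \<Longrightarrow> sarr (G \<bullet> F)"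
  by (metis strict_arr_rep rep_Cmp rep_simps(1))

lemma sarr_ten [simp]: "sarr F \<Longrightarrow> sarr G \<Longrightarrow> sarr (F \<parallel> G)"
  by (metis strict_arr_rep rep_TenA rep_simps(1))

lemma sarr_eqI:
  assumes "rep p q f F" "rep p q f G"
  shows "F = G"
  using assms by (simp add: rep_def)

lemma scmp_idn [simp]: "sarr F \<Longrightarrow> sdom F = w \<Longrightarrow> F \<bullet> \<iota> w = F" "sarr F \<Longrightarrow> scod F = w \<Longrightarrow> \<iota> w \<bullet> F = F"
  by (auto simp: sarr_def scmp_def sidn_def Mor_iff sdom_def scod_def prod_eq_iff)

lemma scmp_assoc [simp]:
  "sarr F \<Longrightarrow> sarr G \<Longrightarrow> sarr H \<Longrightarrow> sdom G = scod F \<Longrightarrow> sdom H = scod G \<Longrightarrow> (H \<bullet> G) \<bullet> F = H \<bullet> G \<bullet> F"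
  by (auto simp: sarr_def scmp_def Mor_iff sdom_def scod_def prod_eq_iff)

lemma sten_idn [simp]: "words w \<Longrightarrow> words v \<Longrightarrow> \<iota> w \<parallel> \<iota> v = \<iota> (w @ v)"
  by (simp add: sten_def sidn_def sdom_def scod_def)

lemma sten_cmp:
  assumes "sarr F" "sarr F'" "sarr G" "sarr G'" "sdom F' = scod F" "sdom G' = scod G"
  shows "(F' \<bullet> F) \<parallel> (G' \<bullet> G) = (F' \<parallel> G') \<bullet> (F \<parallel> G)"
  using assms by (simp add: sarr_def scmp_def sten_def Mor_iff sdom_def scod_def interchange interchange_tail)

lemma sten_assoc [simp]:
  assumes "sarr F" "sarr G" "sarr H" shows "(F \<parallel> G) \<parallel> H = F \<parallel> G \<parallel> H"
proof -
  obtain f g h where r: "rep (pword (sdom F)) (pword (scod F)) f F" "rep (pword (sdom G)) (pword (scod G)) g G"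
    "rep (pword (sdom H)) (pword (scod H)) h H" using assms strict_arr_rep by metis
  have m: "f \<in> Mor C (wob (sdom F)) (wob (scod F))" "g \<in> Mor C (wob (sdom G)) (wob (scod G))" "h \<in> Mor C (wob (sdom H)) (wob (scod H))"
    using r by (auto simp: rep_def)
  note [simp] = assms
  have "\<iota> (scod F @ scod G @ scod H) \<bullet> ((F \<parallel> G) \<parallel> H) = (F \<parallel> G \<parallel> H) \<bullet> \<iota> (sdom F @ sdom G @ sdom H)"
    using rep_Cmp[OF rep_TenA[OF rep_TenA[OF r(1,2)] r(3)] rep_Asc(1)]
      rep_Cmp[OF rep_Asc(1) rep_TenA[OF r(1) rep_TenA[OF r(2,3)]]] Asc_natural[OF m]
    by (auto intro: sarr_eqI)
  then show ?thesis by simp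
qed

lemma sten_unit [simp]: assumes [simp]: "sarr F" shows "\<iota> [] \<parallel> F = F" "F \<parallel> \<iota> [] = F"
proof -
  obtain f where r: "rep (pword (sdom F)) (pword (scod F)) f F" using strict_arr_rep assms by blast
  have m: "f \<in> Mor C (wob (sdom F)) (wob (scod F))" using r by (auto simp: rep_def)
  have i: "rep pone pone (Idt C \<I>) (\<iota> [])" using rep_Idt[of pone] by simp
  have "rep (pone \<odot>\<odot> pword (sdom F)) (pword (scod F)) (LUn C (wob (scod F)) \<cdot> (Idt C \<I> \<star> f)) (\<iota> (scod F) \<bullet> (\<iota> [] \<parallel> F))"
    using rep_Cmp[OF rep_TenA[OF i r] rep_LUn(1)[of "pword (scod F)"]] by simp
  moreover have "rep (pone \<odot>\<odot> pword (sdom F)) (pword (scod F)) (LUn C (wob (scod F)) \<cdot> (Idt C \<I> \<star> f)) (F \<bullet> \<iota> (sdom F))"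
    using rep_Cmp[OF rep_LUn(1)[of "pword (sdom F)"] r] by (simp add: LUn_natural[OF m])
  ultimately have "\<iota> (scod F) \<bullet> (\<iota> [] \<parallel> F) = F \<bullet> \<iota> (sdom F)" by (rule sarr_eqI)
  then show "\<iota> [] \<parallel> F = F" by simp
  have "rep (pword (sdom F) \<odot>\<odot> pone) (pword (scod F)) (RUn C (wob (scod F)) \<cdot> (f \<star> Idt C \<I>)) (\<iota> (scod F) \<bullet> (F \<parallel> \<iota> []))"
    using rep_Cmp[OF rep_TenA[OF r i] rep_RUn(1)[of "pword (scod F)"]] by simp
  moreover have "rep (pword (sdom F) \<odot>\<odot> pone) (pword (scod F)) (RUn C (wob (scod F)) \<cdot> (f \<star> Idt C \<I>)) (F \<bullet> \<iota> (sdom F))"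
    using rep_Cmp[OF rep_RUn(1)[of "pword (sdom F)"] r] by (simp add: RUn_natural[OF m])
  ultimately have "\<iota> (scod F) \<bullet> (F \<parallel> \<iota> []) = F \<bullet> \<iota> (sdom F)" by (rule sarr_eqI)
  then show "F \<parallel> \<iota> [] = F" by simp
qed

end

context premodular_category
begin

text \<open>
  Braidings of words are those of the bracketed words, transported along \<open>join\<close>.
\<close>

definition sbr :: "'o list \<Rightarrow> 'o list \<Rightarrow> ('o, 'a) strict_arr" where
  "sbr w v = (w @ v, v @ w, join v w \<cdot> Brd C (wob w) (wob v) \<cdot> inv_arr C (join w v))"

definition sbri :: "'o list \<Rightarrow> 'o list \<Rightarrow> ('o, 'a) strict_arr" where
  "sbri w v = (v @ w, w @ v, join w v \<cdot> inv_arr C (Brd C (wob w) (wob v)) \<cdot> inv_arr C (join v w))"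

definition stw :: "'o list \<Rightarrow> ('o, 'a) strict_arr" where
  "stw w = (w, w, Twist C (wob w))"

definition stwi :: "'o list \<Rightarrow> ('o, 'a) strict_arr" where
  "stwi w = (w, w, inv_arr C (Twist C (wob w)))"

lemma Brd_simps [simp]:
  assumes "X \<in> Obj C" "Y \<in> Obj C"
  shows "Brd C X Y \<in> Arr C" "Dom C (Brd C X Y) = X \<boxtimes> Y" "Cod C (Brd C X Y) = Y \<boxtimes> X" "iso_arr C (Brd C X Y)"
  using Brd_Mor[OF assms] by (auto simp: Mor_iff)

lemma Twist_simps [simp]:
  assumes "X \<in> Obj C"
  shows "Twist C X \<in> Arr C" "Dom C (Twist C X) = X" "Cod C (Twist C X) = X" "iso_arr C (Twist C X)"
  using Twist_Mor[OF assms] by (auto simp: Mor_iff)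

lemma Brd_nat: "f \<in> Arr C \<Longrightarrow> g \<in> Arr C \<Longrightarrow>
  Brd C (Cod C f) (Cod C g) \<cdot> (f \<star> g) = (g \<star> f) \<cdot> Brd C (Dom C f) (Dom C g)"
  using Brd_natural[of f "Dom C f" "Cod C f" g "Dom C g" "Cod C g"] by (simp add: Mor_iff)

text \<open>
  By naturality of the braiding the presentations may be arbitrary.
\<close>

lemma rep_Brd:
  assumes [simp]: "pres p" "pres q"
  shows "rep (p \<odot>\<odot> q) (q \<odot>\<odot> p) (Brd C (po p) (po q)) (sbr (pw p) (pw q))"
proof -
  have "(pk q \<star> pk p) \<cdot> Brd C (po p) (po q) = Brd C (wob (pw p)) (wob (pw q)) \<cdot> (pk p \<star> pk q)"
    using Brd_nat[of "pk p" "pk q"] by simp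
  then show ?thesis
    by (simp add: rep_def Mor_iff sbr_def)
       (simp add: pten_def Cmp_tail[of "pk q \<star> pk p" "Brd C (po p) (po q)"] interchange_tail)
qed

lemma rep_Brd_inv:
  assumes [simp]: "pres p" "pres q"
  shows "rep (q \<odot>\<odot> p) (p \<odot>\<odot> q) (inv_arr C (Brd C (po p) (po q))) (sbri (pw p) (pw q))"
proof -
  have "inv_arr C ((pk q \<star> pk p) \<cdot> Brd C (po p) (po q)) = inv_arr C (Brd C (wob (pw p)) (wob (pw q)) \<cdot> (pk p \<star> pk q))"
    using Brd_nat[of "pk p" "pk q"] by simp
  then have *: "inv_arr C (Brd C (po p) (po q)) \<cdot> (inv_arr C (pk q) \<star> inv_arr C (pk p))
      = (inv_arr C (pk p) \<star> inv_arr C (pk q)) \<cdot> inv_arr C (Brd C (wob (pw p)) (wob (pw q)))"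
    by simp
  show ?thesis
    by (simp add: rep_def Mor_iff sbri_def)
       (simp add: pten_def Cmp_tail[OF *] interchange_tail)
qed

lemma rep_Twist:
  assumes [simp]: "pres p"
  shows "rep p p (Twist C (po p)) (stw (pw p))"
proof -
  have "pk p \<cdot> Twist C (po p) = Twist C (wob (pw p)) \<cdot> pk p"
    using Twist_natural[of "pk p" "po p" "wob (pw p)"] by (simp add: Mor_iff)
  then show ?thesis by (simp add: rep_def Mor_iff stw_def Cmp_tail[of "pk p" "Twist C (po p)"])
qed

lemma rep_Twist_inv:
  assumes [simp]: "pres p"
  shows "rep p p (inv_arr C (Twist C (po p))) (stwi (pw p))"
proof -
  have "inv_arr C (pk p \<cdot> Twist C (po p)) = inv_arr C (Twist C (wob (pw p)) \<cdot> pk p)"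
    using Twist_natural[of "pk p" "po p" "wob (pw p)"] by (simp add: Mor_iff)
  then have *: "inv_arr C (Twist C (po p)) \<cdot> inv_arr C (pk p) = inv_arr C (pk p) \<cdot> inv_arr C (Twist C (wob (pw p)))"
    by simp
  show ?thesis by (simp add: rep_def Mor_iff stwi_def *)
qed

lemma rep_Mor: "rep p q f F \<Longrightarrow> f \<in> Mor C (po p) (po q)"
  by (simp add: rep_def)

sublocale strict: strict_braided words sarr sdom scod sidn scmp sten sbr sbri
proof
  fix w v u :: "'o list"
  note R = rep_simps[OF rep_Brd, of "pword w" "pword v"] rep_simps[OF rep_Brd_inv, of "pword w" "pword v"]
  show "words w \<Longrightarrow> words v \<Longrightarrow> sarr (sbr w v)" "sdom (sbr w v) = w @ v" "scod (sbr w v) = v @ w"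
    "words w \<Longrightarrow> words v \<Longrightarrow> sarr (sbri w v)" "sdom (sbri w v) = v @ w" "scod (sbri w v) = w @ v"
    using R by (simp_all add: sbr_def sbri_def sdom_def scod_def)
  show "words w \<Longrightarrow> words v \<Longrightarrow> sbr w v \<bullet> sbri w v = \<iota> (v @ w)"
    "words w \<Longrightarrow> words v \<Longrightarrow> sbri w v \<bullet> sbr w v = \<iota> (w @ v)"
    by (simp_all add: sbr_def sbri_def scmp_def sidn_def sdom_def scod_def)
  show "sbr w (v @ u) = (\<iota> v \<parallel> sbr w u) \<bullet> (sbr w v \<parallel> \<iota> u)" if [simp]: "words w" "words v" "words u"
  proof -
    let ?x = "pword w" and ?y = "pword v" and ?z = "pword u"
    have 1: "rep ((?x \<odot>\<odot> ?y) \<odot>\<odot> ?z) (?y \<odot>\<odot> (?z \<odot>\<odot> ?x)) (Asc C (po ?y) (po ?z) (po ?x) \<cdot> Brd C (po ?x) (po (?y \<odot>\<odot> ?z)) \<cdot> Asc C (po ?x) (po ?y) (po ?z))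
      (\<iota> (pw ?y @ pw ?z @ pw ?x) \<bullet> sbr (pw ?x) (pw (?y \<odot>\<odot> ?z)) \<bullet> \<iota> (pw ?x @ pw ?y @ pw ?z))"
      by (rule rep_Cmp[OF rep_Cmp[OF rep_Asc(1) rep_Brd] rep_Asc(1)]) simp_all
    have 2: "rep ((?x \<odot>\<odot> ?y) \<odot>\<odot> ?z) (?y \<odot>\<odot> (?z \<odot>\<odot> ?x)) ((Idt C (po ?y) \<star> Brd C (po ?x) (po ?z)) \<cdot> Asc C (po ?y) (po ?x) (po ?z) \<cdot> (Brd C (po ?x) (po ?y) \<star> Idt C (po ?z)))
      ((\<iota> (pw ?y) \<parallel> sbr (pw ?x) (pw ?z)) \<bullet> \<iota> (pw ?y @ pw ?x @ pw ?z) \<bullet> (sbr (pw ?x) (pw ?y) \<parallel> \<iota> (pw ?z)))"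
      by (rule rep_Cmp[OF rep_Cmp[OF rep_TenA[OF rep_Brd rep_Idt] rep_Asc(1)] rep_TenA[OF rep_Idt rep_Brd]]) simp_all
    have eq: "\<iota> (v @ u @ w) \<bullet> sbr w (v @ u) \<bullet> \<iota> (w @ v @ u) = (\<iota> v \<parallel> sbr w u) \<bullet> \<iota> (v @ w @ u) \<bullet> (sbr w v \<parallel> \<iota> u)"
      using sarr_eqI[OF 1] 2 hexagon1[of "wob w" "wob v" "wob u"] by simp
    have [simp]: "sarr (sbr a b)" "sdom (sbr a b) = a @ b" "scod (sbr a b) = b @ a" if "words a" "words b" for a b
      using rep_simps[OF rep_Brd, of "pword a" "pword b"] that by simp_all
    show ?thesis using eq by simp
  qed
  show "sbr (w @ v) u = (sbr w u \<parallel> \<iota> v) \<bullet> (\<iota> w \<parallel> sbr v u)" if [simp]: "words w" "words v" "words u"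
  proof -
    let ?x = "pword w" and ?y = "pword v" and ?z = "pword u"
    have 1: "rep (?x \<odot>\<odot> (?y \<odot>\<odot> ?z)) ((?z \<odot>\<odot> ?x) \<odot>\<odot> ?y) (inv_arr C (Asc C (po ?z) (po ?x) (po ?y)) \<cdot> Brd C (po (?x \<odot>\<odot> ?y)) (po ?z) \<cdot> inv_arr C (Asc C (po ?x) (po ?y) (po ?z)))
      (\<iota> (pw ?z @ pw ?x @ pw ?y) \<bullet> sbr (pw (?x \<odot>\<odot> ?y)) (pw ?z) \<bullet> \<iota> (pw ?x @ pw ?y @ pw ?z))"
      by (rule rep_Cmp[OF rep_Cmp[OF rep_Asc(2) rep_Brd] rep_Asc(2)]) simp_all
    have 2: "rep (?x \<odot>\<odot> (?y \<odot>\<odot> ?z)) ((?z \<odot>\<odot> ?x) \<odot>\<odot> ?y) ((Brd C (po ?x) (po ?z) \<star> Idt C (po ?y)) \<cdot> inv_arr C (Asc C (po ?x) (po ?z) (po ?y)) \<cdot> (Idt C (po ?x) \<star> Brd C (po ?y) (po ?z)))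
      ((sbr (pw ?x) (pw ?z) \<parallel> \<iota> (pw ?y)) \<bullet> \<iota> (pw ?x @ pw ?z @ pw ?y) \<bullet> (\<iota> (pw ?x) \<parallel> sbr (pw ?y) (pw ?z)))"
      by (rule rep_Cmp[OF rep_Cmp[OF rep_TenA[OF rep_Idt rep_Brd] rep_Asc(2)] rep_TenA[OF rep_Brd rep_Idt]]) simp_all
    have eq: "\<iota> (u @ w @ v) \<bullet> sbr (w @ v) u \<bullet> \<iota> (w @ v @ u) = (sbr w u \<parallel> \<iota> v) \<bullet> \<iota> (w @ u @ v) \<bullet> (\<iota> w \<parallel> sbr v u)"
      using sarr_eqI[OF 1] 2 hexagon2[of "wob w" "wob v" "wob u"] by simp
    have [simp]: "sarr (sbr a b)" "sdom (sbr a b) = a @ b" "scod (sbr a b) = b @ a" if "words a" "words b" for a b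
      using rep_simps[OF rep_Brd, of "pword a" "pword b"] that by simp_all
    show ?thesis using eq by simp
  qed
next
  fix F G :: "('o, 'a) strict_arr"
  assume "sarr F" "sarr G"
  then obtain f g where r: "rep (pword (sdom F)) (pword (scod F)) f F" "rep (pword (sdom G)) (pword (scod G)) g G"
    using strict_arr_rep by metis
  note [simp] = \<open>sarr F\<close> \<open>sarr G\<close>
  show "sbr (scod F) (scod G) \<bullet> (F \<parallel> G) = (G \<parallel> F) \<bullet> sbr (sdom F) (sdom G)"
    using rep_Cmp[OF rep_TenA[OF r] rep_Brd] rep_Cmp[OF rep_Brd rep_TenA[OF r(2,1)]]
      Brd_natural[OF rep_Mor[OF r(1)] rep_Mor[OF r(2)]]
    by (auto intro: sarr_eqI)
qed (simp_all add: sten_cmp)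

end

section \<open>Quotients of modules\<close>

lemma scalars_simps [simp]:
  "carrier scalars = UNIV" "monoid.mult scalars = (*)" "one scalars = 1" "ring.zero scalars = 0" "add scalars = (+)"
  by (simp_all add: scalars_def)

lemma scalars_cring: "cring (scalars :: 'k::field ring)"
proof (rule cringI)
  show "abelian_group (scalars :: 'k ring)"
    by (rule abelian_groupI) (auto simp: algebra_simps intro: exI[of _ "- x" for x])
  show "Group.comm_monoid (scalars :: 'k ring)"
    by (rule comm_monoidI) (auto simp: algebra_simps)
qed (simp add: algebra_simps)

locale quotient_module = module R M + submodule N R M for R M N
begin

lemma abelian_subgroup: "abelian_subgroup N M"
  by (rule abelian_subgroupI3) (auto simp: additive_subgroup_def subgroup_axioms abelian_group_axioms)

lemma N_zero: "\<zero>\<^bsub>M\<^esub> \<in> N"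
  and N_add: "x \<in> N \<Longrightarrow> y \<in> N \<Longrightarrow> x \<oplus>\<^bsub>M\<^esub> y \<in> N"
  and N_carrier: "x \<in> N \<Longrightarrow> x \<in> carrier M"
  and N_minus: "x \<in> N \<Longrightarrow> \<ominus>\<^bsub>M\<^esub> x \<in> N"
proof -
  interpret abelian_subgroup N M by (rule abelian_subgroup)
  show "\<zero>\<^bsub>M\<^esub> \<in> N" "x \<in> N \<Longrightarrow> y \<in> N \<Longrightarrow> x \<oplus>\<^bsub>M\<^esub> y \<in> N" "x \<in> N \<Longrightarrow> x \<in> carrier M"
    "x \<in> N \<Longrightarrow> \<ominus>\<^bsub>M\<^esub> x \<in> N" by auto
qed

lemma coset_eq_iff:
  assumes "x \<in> carrier M" "y \<in> carrier M"
  shows "N +>\<^bsub>M\<^esub> x = N +>\<^bsub>M\<^esub> y \<longleftrightarrow> x \<ominus>\<^bsub>M\<^esub> y \<in> N"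
proof -
  interpret abelian_subgroup N M by (rule abelian_subgroup)
  show ?thesis using assms a_rcos_module[of y x] a_repr_independence'[of x y] a_repr_independenceD[of x y]
    unfolding a_minus_def by metis
qed

lemma coset_mem_iff:
  assumes "x \<in> carrier M" "y \<in> carrier M"
  shows "x \<in> N +>\<^bsub>M\<^esub> y \<longleftrightarrow> N +>\<^bsub>M\<^esub> x = N +>\<^bsub>M\<^esub> y"
proof -
  interpret abelian_subgroup N M by (rule abelian_subgroup)
  show ?thesis using assms a_rcos_module[of y x] by (simp add: coset_eq_iff a_minus_def)
qed

lemma coset_self: "x \<in> carrier M \<Longrightarrow> x \<in> N +>\<^bsub>M\<^esub> x"
  by (simp add: coset_mem_iff)

lemma coset_carrier: "x \<in> N +>\<^bsub>M\<^esub> y \<Longrightarrow> y \<in> carrier M \<Longrightarrow> x \<in> carrier M"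
  using a_r_coset_subset_G[of N y] N_carrier by blast

lemma coset_zero: "N +>\<^bsub>M\<^esub> \<zero>\<^bsub>M\<^esub> = N"
  by (rule a_coset_add_zero) (auto intro: N_carrier)

lemma coset_add:
  "x \<in> carrier M \<Longrightarrow> y \<in> carrier M \<Longrightarrow> (N +>\<^bsub>M\<^esub> x) <+>\<^bsub>M\<^esub> (N +>\<^bsub>M\<^esub> y) = N +>\<^bsub>M\<^esub> (x \<oplus>\<^bsub>M\<^esub> y)"
  by (rule abelian_subgroup.a_rcos_sum[OF abelian_subgroup])

lemma coset_addI:
  assumes "x \<in> carrier M" "x' \<in> carrier M" "y \<in> carrier M" "y' \<in> carrier M"
    "N +>\<^bsub>M\<^esub> x = N +>\<^bsub>M\<^esub> x'" "N +>\<^bsub>M\<^esub> y = N +>\<^bsub>M\<^esub> y'"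
  shows "N +>\<^bsub>M\<^esub> (x \<oplus>\<^bsub>M\<^esub> y) = N +>\<^bsub>M\<^esub> (x' \<oplus>\<^bsub>M\<^esub> y')"
  using assms coset_add by metis

text \<open>
  Operations on cosets are unions over all representatives; if the operation respects the
  submodule, any representative gives the value.
\<close>

lemma coset_UN:
  assumes x: "x \<in> carrier M" and f: "\<And>y. y \<in> carrier M \<Longrightarrow> y \<ominus>\<^bsub>M\<^esub> x \<in> N \<Longrightarrow> f y = f x"
  shows "(\<Union>y\<in>N +>\<^bsub>M\<^esub> x. f y) = f x"
proof -
  have "f y = f x" if "y \<in> N +>\<^bsub>M\<^esub> x" for y
    using that f x coset_carrier coset_mem_iff coset_eq_iff by metis
  then show ?thesis by (intro equalityI UN_least UN_upper[OF coset_self[OF x]]) blast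
qed

lemma coset_smult:
  assumes "a \<in> carrier R" "x \<in> carrier M"
  shows "(\<Union>y\<in>N +>\<^bsub>M\<^esub> x. N +>\<^bsub>M\<^esub> (a \<odot>\<^bsub>M\<^esub> y)) = N +>\<^bsub>M\<^esub> (a \<odot>\<^bsub>M\<^esub> x)"
proof (rule coset_UN[OF assms(2)])
  fix y assume y: "y \<in> carrier M" "y \<ominus>\<^bsub>M\<^esub> x \<in> N"
  have "a \<odot>\<^bsub>M\<^esub> y \<ominus>\<^bsub>M\<^esub> a \<odot>\<^bsub>M\<^esub> x = a \<odot>\<^bsub>M\<^esub> (y \<ominus>\<^bsub>M\<^esub> x)"
    using assms y(1) by (simp add: a_minus_def smult_r_distr smult_r_minus)
  then show "N +>\<^bsub>M\<^esub> (a \<odot>\<^bsub>M\<^esub> y) = N +>\<^bsub>M\<^esub> (a \<odot>\<^bsub>M\<^esub> x)"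
    using assms y by (simp add: coset_eq_iff submodule.smult_closed[OF submodule_axioms])
qed

lemma coset_absorb:
  assumes "n \<in> N" "y \<in> carrier M"
  shows "N +>\<^bsub>M\<^esub> (n \<oplus>\<^bsub>M\<^esub> y) = N +>\<^bsub>M\<^esub> y"
proof -
  have "(n \<oplus>\<^bsub>M\<^esub> y) \<ominus>\<^bsub>M\<^esub> y = n" using assms N_carrier by (simp add: a_minus_def M.a_assoc M.r_neg)
  then show ?thesis using assms N_carrier by (simp add: coset_eq_iff)
qed

lemma coset_finsum:
  assumes "finite I" "\<And>i. i \<in> I \<Longrightarrow> f i \<in> carrier M" "\<And>i. i \<in> I \<Longrightarrow> g i \<in> carrier M"
    "\<And>i. i \<in> I \<Longrightarrow> N +>\<^bsub>M\<^esub> f i = N +>\<^bsub>M\<^esub> g i"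
  shows "N +>\<^bsub>M\<^esub> finsum M f I = N +>\<^bsub>M\<^esub> finsum M g I"
  using assms
proof (induction I rule: finite_induct)
  case (insert i I)
  have "finsum M f (insert i I) = f i \<oplus>\<^bsub>M\<^esub> finsum M f I" "finsum M g (insert i I) = g i \<oplus>\<^bsub>M\<^esub> finsum M g I"
    using insert by (auto intro!: M.finsum_insert)
  then show ?case using insert by (simp add: coset_addI M.finsum_closed Pi_def)
qed simp

end

lemma (in module) generated_submodule_is_submodule:
  assumes "S \<subseteq> carrier M"
  shows "submodule (generated_submodule R M S) R M"
proof (rule submoduleI)
  have "submodule (carrier M) R M" by (rule carrier_is_submodule)
  then show "generated_submodule R M S \<subseteq> carrier M" using assms by (auto simp: generated_submodule_def)
next
  show "\<zero>\<^bsub>M\<^esub> \<in> generated_submodule R M S"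
    unfolding generated_submodule_def
    by (auto intro!: additive_subgroup.zero_closed simp: additive_subgroup_def dest: submodule.axioms(1))
qed (auto simp: generated_submodule_def dest: submoduleE)

lemma generated_submodule_least: "submodule H R M \<Longrightarrow> S \<subseteq> H \<Longrightarrow> generated_submodule R M S \<subseteq> H"
  by (auto simp: generated_submodule_def)

lemma generated_submodule_superset: "S \<subseteq> generated_submodule R M S"
  by (auto simp: generated_submodule_def)

section \<open>Linear structure of hom spaces\<close>

context linear_category
begin

lemma Mor_linear:
  assumes X: "X \<in> Obj C" and Y: "Y \<in> Obj C"
  shows Zer_Mor: "Zer C X Y \<in> Mor C X Y"
    and Add_Mor: "f \<in> Mor C X Y \<Longrightarrow> g \<in> Mor C X Y \<Longrightarrow> Add C f g \<in> Mor C X Y"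
    and Scl_Mor: "f \<in> Mor C X Y \<Longrightarrow> Scl C a f \<in> Mor C X Y"
    and Add_assoc: "f \<in> Mor C X Y \<Longrightarrow> g \<in> Mor C X Y \<Longrightarrow> h \<in> Mor C X Y \<Longrightarrow>
      Add C (Add C f g) h = Add C f (Add C g h)"
    and Add_comm: "f \<in> Mor C X Y \<Longrightarrow> g \<in> Mor C X Y \<Longrightarrow> Add C f g = Add C g f"
    and Zer_Add: "f \<in> Mor C X Y \<Longrightarrow> Add C (Zer C X Y) f = f"
    and Scl_Add: "f \<in> Mor C X Y \<Longrightarrow> g \<in> Mor C X Y \<Longrightarrow> Scl C a (Add C f g) = Add C (Scl C a f) (Scl C a g)"
    and Add_Scl: "f \<in> Mor C X Y \<Longrightarrow> Scl C (a + b) f = Add C (Scl C a f) (Scl C b f)"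
    and Scl_Scl: "f \<in> Mor C X Y \<Longrightarrow> Scl C (a * b) f = Scl C a (Scl C b f)"
    and Scl_one: "f \<in> Mor C X Y \<Longrightarrow> Scl C 1 f = f"
    and Scl_zero: "f \<in> Mor C X Y \<Longrightarrow> Scl C 0 f = Zer C X Y"
    and Scl_Zer: "Scl C a (Zer C X Y) = Zer C X Y"
    and neg_Add: "f \<in> Mor C X Y \<Longrightarrow> Add C (Scl C (- 1) f) f = Zer C X Y"
proof -
  interpret module "scalars :: 'k ring" "hom_space C X Y" by (rule hom_space_module[OF X Y])
  have [simp]: "carrier (hom_space C X Y) = Mor C X Y" "ring.zero (hom_space C X Y) = Zer C X Y"
    "add (hom_space C X Y) = Add C" "smult (hom_space C X Y) = Scl C" by (simp_all add: hom_space_def)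
  show "Zer C X Y \<in> Mor C X Y" using M.zero_closed by simp
  show "f \<in> Mor C X Y \<Longrightarrow> g \<in> Mor C X Y \<Longrightarrow> Add C f g \<in> Mor C X Y" for f g using M.a_closed[of f g] by simp
  show "f \<in> Mor C X Y \<Longrightarrow> Scl C a f \<in> Mor C X Y" for f a using smult_closed[of a f] by simp
  show "f \<in> Mor C X Y \<Longrightarrow> g \<in> Mor C X Y \<Longrightarrow> h \<in> Mor C X Y \<Longrightarrow>
      Add C (Add C f g) h = Add C f (Add C g h)" for f g h using M.a_assoc[of f g h] by simp
  show "f \<in> Mor C X Y \<Longrightarrow> g \<in> Mor C X Y \<Longrightarrow> Add C f g = Add C g f" for f g using M.a_comm[of f g] by simp
  show "f \<in> Mor C X Y \<Longrightarrow> Add C (Zer C X Y) f = f" for f using M.l_zero[of f] by simp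
  show "f \<in> Mor C X Y \<Longrightarrow> g \<in> Mor C X Y \<Longrightarrow> Scl C a (Add C f g) = Add C (Scl C a f) (Scl C a g)" for a f g
    using smult_r_distr[of a f g] by simp
  show AS: "f \<in> Mor C X Y \<Longrightarrow> Scl C (a + b) f = Add C (Scl C a f) (Scl C b f)" for a b f
    using smult_l_distr[of a b f] by simp
  show "f \<in> Mor C X Y \<Longrightarrow> Scl C (a * b) f = Scl C a (Scl C b f)" for a b f using smult_assoc1[of a b f] by simp
  show S1: "f \<in> Mor C X Y \<Longrightarrow> Scl C 1 f = f" for f using smult_one[of f] by simp
  show S0: "f \<in> Mor C X Y \<Longrightarrow> Scl C 0 f = Zer C X Y" for f using smult_l_null[of f] by simp
  show "Scl C a (Zer C X Y) = Zer C X Y" for a using smult_r_null[of a] by simp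
  show "f \<in> Mor C X Y \<Longrightarrow> Add C (Scl C (- 1) f) f = Zer C X Y" for f
    using AS[of f "-1" 1] S1[of f] S0[of f] by simp
qed

lemma Add_simps:
  assumes "f \<in> Arr C" "g \<in> Arr C" "Dom C g = Dom C f" "Cod C g = Cod C f"
  shows "Add C f g \<in> Arr C" "Dom C (Add C f g) = Dom C f" "Cod C (Add C f g) = Cod C f"
  using Add_Mor[of "Dom C f" "Cod C f" f g] assms by (auto simp: Mor_iff)

lemma Scl_simps:
  assumes "f \<in> Arr C"
  shows "Scl C a f \<in> Arr C" "Dom C (Scl C a f) = Dom C f" "Cod C (Scl C a f) = Cod C f"
  using Scl_Mor[of "Dom C f" "Cod C f" f a] assms by (auto simp: Mor_iff)

lemma Cmp_linear:
  assumes "f \<in> Arr C" "g \<in> Arr C" "Dom C g = Cod C f"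
  shows "f' \<in> Arr C \<Longrightarrow> Dom C f' = Dom C f \<Longrightarrow> Cod C f' = Cod C f \<Longrightarrow> g \<cdot> Add C f f' = Add C (g \<cdot> f) (g \<cdot> f')"
    "g' \<in> Arr C \<Longrightarrow> Dom C g' = Dom C g \<Longrightarrow> Cod C g' = Cod C g \<Longrightarrow> Add C g g' \<cdot> f = Add C (g \<cdot> f) (g' \<cdot> f)"
    "g \<cdot> Scl C a f = Scl C a (g \<cdot> f)" "Scl C a g \<cdot> f = Scl C a (g \<cdot> f)"
  using Cmp_Add_right[of f "Dom C f" "Cod C f" f' g "Cod C g"] Cmp_Add_left[of f "Dom C f" "Cod C f" g "Cod C g" g']
    Cmp_Scl_right[of f "Dom C f" "Cod C f" g "Cod C g" a] Cmp_Scl_left[of f "Dom C f" "Cod C f" g "Cod C g" a] assms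
  by (auto simp: Mor_iff)

lemmas linear_simps = Add_simps Scl_simps Cmp_linear

end

context monoidal_category
begin

lemma TenA_linear:
  assumes "f \<in> Arr C" "g \<in> Arr C"
  shows "f' \<in> Arr C \<Longrightarrow> Dom C f' = Dom C f \<Longrightarrow> Cod C f' = Cod C f \<Longrightarrow> Add C f f' \<star> g = Add C (f \<star> g) (f' \<star> g)"
    "g' \<in> Arr C \<Longrightarrow> Dom C g' = Dom C g \<Longrightarrow> Cod C g' = Cod C g \<Longrightarrow> f \<star> Add C g g' = Add C (f \<star> g) (f \<star> g')"
    "Scl C a f \<star> g = Scl C a (f \<star> g)" "f \<star> Scl C a g = Scl C a (f \<star> g)"
  using TenA_Add_left[of f "Dom C f" "Cod C f" f' g "Dom C g" "Cod C g"] TenA_Add_right[of f "Dom C f" "Cod C f" g "Dom C g" "Cod C g" g']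
    TenA_Scl_left[of f "Dom C f" "Cod C f" g "Dom C g" "Cod C g" a] TenA_Scl_right[of f "Dom C f" "Cod C f" g "Dom C g" "Cod C g" a] assms
  by (auto simp: Mor_iff)

end

section \<open>Direct sums over all strands\<close>

context monoidal_category
begin

lemma trace_sum_sel:
  "p \<in> carrier (trace_sum C X X') \<longleftrightarrow>
     p \<in> extensional (Obj C) \<and> (\<forall>A\<in>Obj C. p A \<in> Mor C (A \<boxtimes> X) (X' \<boxtimes> A)) \<and> finite (trace_supp C X X' p)"
  "\<zero>\<^bsub>trace_sum C X X'\<^esub> = (\<lambda>A \<in> Obj C. Zer C (A \<boxtimes> X) (X' \<boxtimes> A))"
  "p \<oplus>\<^bsub>trace_sum C X X'\<^esub> q = (\<lambda>A \<in> Obj C. Add C (p A) (q A))"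
  "a \<odot>\<^bsub>trace_sum C X X'\<^esub> p = (\<lambda>A \<in> Obj C. Scl C a (p A))"
  by (auto simp: trace_sum_def trace_supp_def PiE_def Pi_def)

lemma trace_sum_module:
  assumes [simp]: "X \<in> Obj C" "X' \<in> Obj C"
  shows "module (scalars :: 'k ring) (trace_sum C X X')"
proof (rule moduleI)
  let ?S = "trace_sum C X X'"
  have Mp: "p A \<in> Mor C (A \<boxtimes> X) (X' \<boxtimes> A)" if "p \<in> carrier ?S" "A \<in> Obj C" for p A
    using that by (simp add: trace_sum_sel)
  have supp_add: "finite (trace_supp C X X' (\<lambda>A \<in> Obj C. Add C (p A) (q A)))"
    if "p \<in> carrier ?S" "q \<in> carrier ?S" for p q
  proof (rule finite_subset)
    show "trace_supp C X X' (\<lambda>A \<in> Obj C. Add C (p A) (q A)) \<subseteq> trace_supp C X X' p \<union> trace_supp C X X' q"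
      using that by (auto simp: trace_supp_def Zer_Add Zer_Mor)
  qed (use that in \<open>auto simp: trace_sum_sel\<close>)
  have supp_scl: "finite (trace_supp C X X' (\<lambda>A \<in> Obj C. Scl C a (p A)))"
    if "p \<in> carrier ?S" for p a
  proof (rule finite_subset)
    show "trace_supp C X X' (\<lambda>A \<in> Obj C. Scl C a (p A)) \<subseteq> trace_supp C X X' p"
      using that by (auto simp: trace_supp_def Scl_Zer)
  qed (use that in \<open>auto simp: trace_sum_sel\<close>)
  have supp_zero: "trace_supp C X X' (\<lambda>A \<in> Obj C. Zer C (A \<boxtimes> X) (X' \<boxtimes> A)) = {}"
    by (auto simp: trace_supp_def)
  show scl: "a \<odot>\<^bsub>?S\<^esub> p \<in> carrier ?S" if "p \<in> carrier ?S" for a p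
    using that supp_scl[OF that, of a] by (auto simp: trace_sum_sel Scl_Mor)
  show "cring (scalars :: 'k ring)" by (rule scalars_cring)
  show "abelian_group ?S"
  proof (rule abelian_groupI)
    fix p q r assume p: "p \<in> carrier ?S" and q: "q \<in> carrier ?S" and r: "r \<in> carrier ?S"
    note pm = Mp[OF p] and qm = Mp[OF q] and rm = Mp[OF r]
    show "p \<oplus>\<^bsub>?S\<^esub> q \<in> carrier ?S" using p q supp_add[OF p q] by (auto simp: trace_sum_sel Add_Mor)
    show "(p \<oplus>\<^bsub>?S\<^esub> q) \<oplus>\<^bsub>?S\<^esub> r = p \<oplus>\<^bsub>?S\<^esub> (q \<oplus>\<^bsub>?S\<^esub> r)" using p q r
      by (auto simp: trace_sum_sel intro!: restrict_ext Add_assoc[OF _ _ pm qm rm])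
    show "p \<oplus>\<^bsub>?S\<^esub> q = q \<oplus>\<^bsub>?S\<^esub> p" using p q by (auto simp: trace_sum_sel intro!: restrict_ext Add_comm[OF _ _ pm qm])
  next
    show "\<zero>\<^bsub>?S\<^esub> \<in> carrier ?S" using supp_zero by (auto simp: trace_sum_sel Zer_Mor)
  next
    fix p assume p: "p \<in> carrier ?S"
    show "\<zero>\<^bsub>?S\<^esub> \<oplus>\<^bsub>?S\<^esub> p = p" using p
      by (auto simp: trace_sum_sel Zer_Add intro!: extensionalityI[of _ "Obj C"])
    show "\<exists>q\<in>carrier ?S. q \<oplus>\<^bsub>?S\<^esub> p = \<zero>\<^bsub>?S\<^esub>"
      by (rule bexI[OF _ scl[OF p, of "- 1"]]) (use p in \<open>auto simp: trace_sum_sel neg_Add intro!: restrict_ext\<close>)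
  qed
  fix a b :: 'k and p q assume p: "p \<in> carrier ?S" and q: "q \<in> carrier ?S"
  show "(a \<oplus>\<^bsub>scalars\<^esub> b) \<odot>\<^bsub>?S\<^esub> p = a \<odot>\<^bsub>?S\<^esub> p \<oplus>\<^bsub>?S\<^esub> b \<odot>\<^bsub>?S\<^esub> p"
    using p by (auto simp: trace_sum_sel intro!: restrict_ext Add_Scl[OF _ _ Mp[OF p]])
  show "a \<odot>\<^bsub>?S\<^esub> (p \<oplus>\<^bsub>?S\<^esub> q) = a \<odot>\<^bsub>?S\<^esub> p \<oplus>\<^bsub>?S\<^esub> a \<odot>\<^bsub>?S\<^esub> q"
    using p q by (auto simp: trace_sum_sel intro!: restrict_ext Scl_Add[OF _ _ Mp[OF p] Mp[OF q]])
  show "(a \<otimes>\<^bsub>scalars\<^esub> b) \<odot>\<^bsub>?S\<^esub> p = a \<odot>\<^bsub>?S\<^esub> (b \<odot>\<^bsub>?S\<^esub> p)"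
    using p by (auto simp: trace_sum_sel intro!: restrict_ext Scl_Scl[OF _ _ Mp[OF p]])
  show "\<one>\<^bsub>scalars\<^esub> \<odot>\<^bsub>?S\<^esub> p = p"
    using p by (auto simp: trace_sum_sel Scl_one[OF _ _ Mp[OF p]] intro!: extensionalityI[of _ "Obj C"])
qed

lemma trace_single_carrier [simp]:
  assumes "X \<in> Obj C" "X' \<in> Obj C" "\<psi> \<in> Mor C (A \<boxtimes> X) (X' \<boxtimes> A)"
  shows "trace_single C X X' A \<psi> \<in> carrier (trace_sum C X X')"
proof -
  have "trace_supp C X X' (trace_single C X X' A \<psi>) \<subseteq> {A}"
    by (auto simp: trace_supp_def trace_single_def split: if_splits)
  then have "finite (trace_supp C X X' (trace_single C X X' A \<psi>))" by (rule finite_subset) simp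
  then show ?thesis using assms by (auto simp: trace_sum_sel trace_single_def Zer_Mor)
qed

lemma trace_single_Add:
  assumes "X \<in> Obj C" "X' \<in> Obj C" "A \<in> Obj C" "\<psi> \<in> Mor C (A \<boxtimes> X) (X' \<boxtimes> A)" "\<phi> \<in> Mor C (A \<boxtimes> X) (X' \<boxtimes> A)"
  shows "trace_single C X X' A (Add C \<psi> \<phi>)
       = trace_single C X X' A \<psi> \<oplus>\<^bsub>trace_sum C X X'\<^esub> trace_single C X X' A \<phi>"
  using assms by (auto simp: trace_sum_sel trace_single_def Zer_Add Zer_Mor intro!: restrict_ext)

lemma trace_single_Scl:
  assumes "X \<in> Obj C" "X' \<in> Obj C" "A \<in> Obj C" "\<psi> \<in> Mor C (A \<boxtimes> X) (X' \<boxtimes> A)"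
  shows "trace_single C X X' A (Scl C a \<psi>) = a \<odot>\<^bsub>trace_sum C X X'\<^esub> trace_single C X X' A \<psi>"
  using assms by (auto simp: trace_sum_sel trace_single_def Scl_Zer intro!: restrict_ext)

lemma trace_single_Zer:
  "trace_single C X X' A (Zer C (A \<boxtimes> X) (X' \<boxtimes> A)) = \<zero>\<^bsub>trace_sum C X X'\<^esub>"
  by (auto simp: trace_sum_sel trace_single_def intro!: restrict_ext)

definition slide_gens :: "'o \<Rightarrow> 'o \<Rightarrow> ('o \<Rightarrow> 'a) set" where
  "slide_gens X X' = {trace_single C X X' A (\<psi> \<cdot> (f \<star> Idt C X))
          \<ominus>\<^bsub>trace_sum C X X'\<^esub> trace_single C X X' B ((Idt C X' \<star> f) \<cdot> \<psi>)
        | A B f \<psi>. A \<in> Obj C \<and> B \<in> Obj C \<and> f \<in> Mor C A B \<and> \<psi> \<in> Mor C (B \<boxtimes> X) (X' \<boxtimes> A)}"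

lemma slide_Mor:
  assumes "X \<in> Obj C" "X' \<in> Obj C" "f \<in> Mor C A B" "\<psi> \<in> Mor C (B \<boxtimes> X) (X' \<boxtimes> A)"
  shows "\<psi> \<cdot> (f \<star> Idt C X) \<in> Mor C (A \<boxtimes> X) (X' \<boxtimes> A)" "(Idt C X' \<star> f) \<cdot> \<psi> \<in> Mor C (B \<boxtimes> X) (X' \<boxtimes> B)"
  using assms by (auto simp: Mor_iff)

lemma slide_gens_carrier:
  assumes "X \<in> Obj C" "X' \<in> Obj C"
  shows "slide_gens X X' \<subseteq> carrier (trace_sum C X X')"
proof -
  interpret module "scalars :: 'k ring" "trace_sum C X X'" using assms by (rule trace_sum_module)
  show ?thesis using slide_Mor[OF assms] assms by (auto simp: slide_gens_def)
qed

lemma trace_quotient: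
  assumes "X \<in> Obj C" "X' \<in> Obj C"
  shows "quotient_module (scalars :: 'k ring) (trace_sum C X X') (trace_rel C X X')"
proof -
  interpret module "scalars :: 'k ring" "trace_sum C X X'" using assms by (rule trace_sum_module)
  have "submodule (trace_rel C X X') scalars (trace_sum C X X')"
    unfolding trace_rel_def slide_gens_def[symmetric]
    by (rule generated_submodule_is_submodule[OF slide_gens_carrier[OF assms]])
  then show ?thesis by (simp add: quotient_module_def module_axioms)
qed

end

section \<open>Linear extension to the direct sum of strands\<close>

context monoidal_category
begin

definition strand_linear ::
    "('k, 'v) module \<Rightarrow> 'o \<Rightarrow> 'o \<Rightarrow> ('o \<Rightarrow> 'a \<Rightarrow> 'v) \<Rightarrow> bool" where
  "strand_linear M X X' L \<longleftrightarrow>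
     (\<forall>A\<in>Obj C. \<forall>\<phi>\<in>Mor C (A \<boxtimes> X) (X' \<boxtimes> A). L A \<phi> \<in> carrier M \<and>
        (\<forall>\<psi>\<in>Mor C (A \<boxtimes> X) (X' \<boxtimes> A). L A (Add C \<phi> \<psi>) = L A \<phi> \<oplus>\<^bsub>M\<^esub> L A \<psi>) \<and>
        (\<forall>a. L A (Scl C a \<phi>) = a \<odot>\<^bsub>M\<^esub> L A \<phi>))"

definition ext_sum :: "('k, 'v) module \<Rightarrow> 'o \<Rightarrow> 'o \<Rightarrow> ('o \<Rightarrow> 'a \<Rightarrow> 'v) \<Rightarrow> ('o \<Rightarrow> 'a) \<Rightarrow> 'v" where
  "ext_sum M X X' L p = (\<Oplus>\<^bsub>M\<^esub>A \<in> trace_supp C X X' p. L A (p A))"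

lemma strand_linearD:
  assumes "strand_linear M X X' L" "A \<in> Obj C" "\<phi> \<in> Mor C (A \<boxtimes> X) (X' \<boxtimes> A)"
  shows "L A \<phi> \<in> carrier M"
    "\<psi> \<in> Mor C (A \<boxtimes> X) (X' \<boxtimes> A) \<Longrightarrow> L A (Add C \<phi> \<psi>) = L A \<phi> \<oplus>\<^bsub>M\<^esub> L A \<psi>"
    "L A (Scl C a \<phi>) = a \<odot>\<^bsub>M\<^esub> L A \<phi>"
  using assms by (auto simp: strand_linear_def)

context
  fixes M :: "('k, 'v) module" and X X' :: 'o
  assumes M: "module (scalars :: 'k ring) M" and X: "X \<in> Obj C" and X': "X' \<in> Obj C"
begin

interpretation M: module "scalars :: 'k ring" M by (rule M)
interpretation S: module "scalars :: 'k ring" "trace_sum C X X'" by (rule trace_sum_module[OF X X'])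

lemma strand_linear_Zer:
  assumes "strand_linear M X X' L" "A \<in> Obj C"
  shows "L A (Zer C (A \<boxtimes> X) (X' \<boxtimes> A)) = \<zero>\<^bsub>M\<^esub>"
proof -
  have Z: "Zer C (A \<boxtimes> X) (X' \<boxtimes> A) \<in> Mor C (A \<boxtimes> X) (X' \<boxtimes> A)" using assms X X' by (simp add: Zer_Mor)
  have "L A (Scl C 0 (Zer C (A \<boxtimes> X) (X' \<boxtimes> A))) = 0 \<odot>\<^bsub>M\<^esub> L A (Zer C (A \<boxtimes> X) (X' \<boxtimes> A))"
    by (rule strand_linearD(3)[OF assms Z])
  also have "\<dots> = \<zero>\<^bsub>M\<^esub>" using M.smult_l_null strand_linearD(1)[OF assms Z] by simp
  finally show ?thesis using assms X X' by (simp add: Scl_Zer)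
qed

lemma ext_sum_superset:
  assumes L: "strand_linear M X X' L" and p: "p \<in> carrier (trace_sum C X X')"
    and S: "finite S" "trace_supp C X X' p \<subseteq> S" "S \<subseteq> Obj C"
  shows "ext_sum M X X' L p = (\<Oplus>\<^bsub>M\<^esub>A \<in> S. L A (p A))"
  unfolding ext_sum_def
proof (rule M.add.finprod_mono_neutral_cong_left)
  show "L A (p A) = \<zero>\<^bsub>M\<^esub>" if "A \<in> S - trace_supp C X X' p" for A
    using that S strand_linear_Zer[OF L, of A] by (auto simp: trace_supp_def)
  show "(\<lambda>A. L A (p A)) \<in> S \<rightarrow> carrier M"
    using S p L by (auto simp: trace_sum_sel intro!: strand_linearD(1)[OF L])
qed (use S in auto)

lemma trace_suppD: "p \<in> carrier (trace_sum C X X') \<Longrightarrow> finite (trace_supp C X X' p) \<and> trace_supp C X X' p \<subseteq> Obj C"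
  by (auto simp: trace_sum_sel trace_supp_def)

lemma ext_sum_closed [simp]:
  assumes "strand_linear M X X' L" "p \<in> carrier (trace_sum C X X')"
  shows "ext_sum M X X' L p \<in> carrier M"
  unfolding ext_sum_def using assms
  by (auto simp: trace_sum_sel trace_supp_def intro!: M.finsum_closed strand_linearD(1)[OF assms(1)])

lemma ext_sum_add:
  assumes L: "strand_linear M X X' L" and p: "p \<in> carrier (trace_sum C X X')" and q: "q \<in> carrier (trace_sum C X X')"
  shows "ext_sum M X X' L (p \<oplus>\<^bsub>trace_sum C X X'\<^esub> q) = ext_sum M X X' L p \<oplus>\<^bsub>M\<^esub> ext_sum M X X' L q"
proof -
  let ?r = "p \<oplus>\<^bsub>trace_sum C X X'\<^esub> q"
  define S where "S = trace_supp C X X' p \<union> trace_supp C X X' q \<union> trace_supp C X X' ?r"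
  have r: "?r \<in> carrier (trace_sum C X X')" using p q by simp
  have S: "finite S" "S \<subseteq> Obj C" using trace_suppD[OF p] trace_suppD[OF q] trace_suppD[OF r] by (auto simp: S_def)
  have sub: "trace_supp C X X' p \<subseteq> S" "trace_supp C X X' q \<subseteq> S" "trace_supp C X X' ?r \<subseteq> S" by (auto simp: S_def)
  have m: "p A \<in> Mor C (A \<boxtimes> X) (X' \<boxtimes> A)" "q A \<in> Mor C (A \<boxtimes> X) (X' \<boxtimes> A)" if "A \<in> S" for A
    using that S p q by (auto simp: trace_sum_sel)
  have "ext_sum M X X' L ?r = (\<Oplus>\<^bsub>M\<^esub>A \<in> S. L A (?r A))" by (rule ext_sum_superset[OF L r S(1) sub(3) S(2)])
  also have "\<dots> = (\<Oplus>\<^bsub>M\<^esub>A \<in> S. L A (p A) \<oplus>\<^bsub>M\<^esub> L A (q A))"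
  proof (rule M.add.finprod_cong')
    show "L A (?r A) = L A (p A) \<oplus>\<^bsub>M\<^esub> L A (q A)" if "A \<in> S" for A
      using that S m[OF that] strand_linearD(2)[OF L, of A "p A" "q A"] by (auto simp: trace_sum_sel)
  qed (use S m in \<open>auto intro!: strand_linearD(1)[OF L]\<close>)
  also have "\<dots> = (\<Oplus>\<^bsub>M\<^esub>A \<in> S. L A (p A)) \<oplus>\<^bsub>M\<^esub> (\<Oplus>\<^bsub>M\<^esub>A \<in> S. L A (q A))"
    using S m by (intro M.finsum_addf) (auto intro!: strand_linearD(1)[OF L])
  finally show ?thesis
    using ext_sum_superset[OF L p S(1) sub(1) S(2)] ext_sum_superset[OF L q S(1) sub(2) S(2)] by simp
qed

lemma ext_sum_scl:
  assumes L: "strand_linear M X X' L" and p: "p \<in> carrier (trace_sum C X X')"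
  shows "ext_sum M X X' L (a \<odot>\<^bsub>trace_sum C X X'\<^esub> p) = a \<odot>\<^bsub>M\<^esub> ext_sum M X X' L p"
proof -
  let ?r = "a \<odot>\<^bsub>trace_sum C X X'\<^esub> p"
  define S where "S = trace_supp C X X' p \<union> trace_supp C X X' ?r"
  have r: "?r \<in> carrier (trace_sum C X X')" using p by simp
  have S: "finite S" "S \<subseteq> Obj C" using trace_suppD[OF p] trace_suppD[OF r] by (auto simp: S_def)
  have sub: "trace_supp C X X' p \<subseteq> S" "trace_supp C X X' ?r \<subseteq> S" by (auto simp: S_def)
  have m: "p A \<in> Mor C (A \<boxtimes> X) (X' \<boxtimes> A)" if "A \<in> S" for A
    using that S p by (auto simp: trace_sum_sel)
  have "ext_sum M X X' L ?r = (\<Oplus>\<^bsub>M\<^esub>A \<in> S. L A (?r A))" by (rule ext_sum_superset[OF L r S(1) sub(2) S(2)])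
  also have "\<dots> = (\<Oplus>\<^bsub>M\<^esub>A \<in> S. a \<odot>\<^bsub>M\<^esub> L A (p A))"
  proof (rule M.add.finprod_cong')
    show "L A (?r A) = a \<odot>\<^bsub>M\<^esub> L A (p A)" if "A \<in> S" for A
      using that S m[OF that] strand_linearD(3)[OF L, of A "p A" a] by (auto simp: trace_sum_sel)
  qed (use S m in \<open>auto intro!: M.smult_closed strand_linearD(1)[OF L]\<close>)
  also have "\<dots> = a \<odot>\<^bsub>M\<^esub> (\<Oplus>\<^bsub>M\<^esub>A \<in> S. L A (p A))"
    using S m by (subst M.finsum_smult_ldistr) (auto intro!: strand_linearD(1)[OF L])
  finally show ?thesis using ext_sum_superset[OF L p S(1) sub(1) S(2)] by simp
qed

lemma ext_sum_single:
  assumes L: "strand_linear M X X' L" and A: "A \<in> Obj C" and \<psi>: "\<psi> \<in> Mor C (A \<boxtimes> X) (X' \<boxtimes> A)"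
  shows "ext_sum M X X' L (trace_single C X X' A \<psi>) = L A \<psi>"
proof -
  have "ext_sum M X X' L (trace_single C X X' A \<psi>) = (\<Oplus>\<^bsub>M\<^esub>B \<in> {A}. L B (trace_single C X X' A \<psi> B))"
    using A by (intro ext_sum_superset[OF L trace_single_carrier[OF X X' \<psi>]])
      (auto simp: trace_supp_def trace_single_def split: if_splits)
  also have "\<dots> = L A \<psi>" using A strand_linearD(1)[OF L A \<psi>] by (simp add: trace_single_def)
  finally show ?thesis .
qed

text \<open>
  The tuples sent into \<open>N\<close> form a submodule, so only the generators of the slide relation have to be
  considered.
\<close>

lemma ext_sum_rel:
  assumes L: "strand_linear M X X' L" and N: "submodule N (scalars :: 'k ring) M"
    and slide: "\<And>A B f \<psi>. A \<in> Obj C \<Longrightarrow> B \<in> Obj C \<Longrightarrow> f \<in> Mor C A B \<Longrightarrow> \<psi> \<in> Mor C (B \<boxtimes> X) (X' \<boxtimes> A) \<Longrightarrow>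
      N +>\<^bsub>M\<^esub> L A (\<psi> \<cdot> (f \<star> Idt C X)) = N +>\<^bsub>M\<^esub> L B ((Idt C X' \<star> f) \<cdot> \<psi>)"
    and p: "p \<in> trace_rel C X X'"
  shows "ext_sum M X X' L p \<in> N"
proof -
  interpret quotient_module "scalars :: 'k ring" M N by (simp add: quotient_module_def M N)
  let ?H = "{p \<in> carrier (trace_sum C X X'). ext_sum M X X' L p \<in> N}"
  let ?e = "ext_sum M X X' L"
  have sub: "submodule ?H (scalars :: 'k ring) (trace_sum C X X')"
  proof (rule S.submoduleI)
    have "?e (0 \<odot>\<^bsub>trace_sum C X X'\<^esub> \<zero>\<^bsub>trace_sum C X X'\<^esub>) = 0 \<odot>\<^bsub>M\<^esub> ?e \<zero>\<^bsub>trace_sum C X X'\<^esub>"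
      by (rule ext_sum_scl[OF L S.M.zero_closed])
    then show "\<zero>\<^bsub>trace_sum C X X'\<^esub> \<in> ?H" using L N_zero by (simp add: M.smult_l_null[simplified] S.smult_r_null[simplified])
    show scl: "a \<odot>\<^bsub>trace_sum C X X'\<^esub> q \<in> ?H" if "q \<in> ?H" for a q
      using that submodule.smult_closed[OF N, of a] by (simp add: ext_sum_scl[OF L])
    show "\<ominus>\<^bsub>trace_sum C X X'\<^esub> q \<in> ?H" if "q \<in> ?H" for q
    proof -
      have "\<ominus>\<^bsub>trace_sum C X X'\<^esub> q = (- 1) \<odot>\<^bsub>trace_sum C X X'\<^esub> q"
      proof (rule S.M.minus_equality)
        show "(- 1) \<odot>\<^bsub>trace_sum C X X'\<^esub> q \<oplus>\<^bsub>trace_sum C X X'\<^esub> q = \<zero>\<^bsub>trace_sum C X X'\<^esub>"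
          using S.smult_l_distr[of "- 1" 1 q] S.smult_one[of q] S.smult_l_null[of q] that by simp
      qed (use that in auto)
      then show ?thesis using scl[OF that, of "- 1"] by simp
    qed
    show "q \<oplus>\<^bsub>trace_sum C X X'\<^esub> r \<in> ?H" if "q \<in> ?H" "r \<in> ?H" for q r
      using that by (simp add: ext_sum_add[OF L] N_add)
  qed auto
  have "slide_gens X X' \<subseteq> ?H"
  proof
    fix g assume g: "g \<in> slide_gens X X'"
    then obtain A B f \<psi> where g_def: "g = trace_single C X X' A (\<psi> \<cdot> (f \<star> Idt C X))
          \<ominus>\<^bsub>trace_sum C X X'\<^esub> trace_single C X X' B ((Idt C X' \<star> f) \<cdot> \<psi>)"
      and AB: "A \<in> Obj C" "B \<in> Obj C" and f: "f \<in> Mor C A B" and \<psi>: "\<psi> \<in> Mor C (B \<boxtimes> X) (X' \<boxtimes> A)"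
      by (auto simp: slide_gens_def)
    let ?u = "trace_single C X X' A (\<psi> \<cdot> (f \<star> Idt C X))" and ?v = "trace_single C X X' B ((Idt C X' \<star> f) \<cdot> \<psi>)"
    note sm = slide_Mor[OF X X' f \<psi>]
    have c: "?u \<in> carrier (trace_sum C X X')" "?v \<in> carrier (trace_sum C X X')" "g \<in> carrier (trace_sum C X X')"
      using sm X X' g slide_gens_carrier[OF X X'] by auto
    have "?u = g \<oplus>\<^bsub>trace_sum C X X'\<^esub> ?v" unfolding g_def using c by (simp add: a_minus_def S.M.a_assoc S.M.l_neg)
    then have "L A (\<psi> \<cdot> (f \<star> Idt C X)) = ?e g \<oplus>\<^bsub>M\<^esub> L B ((Idt C X' \<star> f) \<cdot> \<psi>)"
      using ext_sum_add[OF L c(3,2)] ext_sum_single[OF L AB(1) sm(1)] ext_sum_single[OF L AB(2) sm(2)] by simp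
    then have "?e g = L A (\<psi> \<cdot> (f \<star> Idt C X)) \<ominus>\<^bsub>M\<^esub> L B ((Idt C X' \<star> f) \<cdot> \<psi>)"
      using c L strand_linearD(1)[OF L AB(2) sm(2)] by (simp add: a_minus_def M.M.a_assoc M.M.r_neg)
    then have "?e g \<in> N" using slide[OF AB f \<psi>] coset_eq_iff strand_linearD(1)[OF L] AB sm by simp
    then show "g \<in> ?H" using c by simp
  qed
  from generated_submodule_least[OF sub this] p show ?thesis
    by (auto simp: trace_rel_def slide_gens_def)
qed

lemma ext_sum_coset:
  assumes L: "strand_linear M X X' L" and N: "submodule N (scalars :: 'k ring) M"
    and slide: "\<And>A B f \<psi>. A \<in> Obj C \<Longrightarrow> B \<in> Obj C \<Longrightarrow> f \<in> Mor C A B \<Longrightarrow> \<psi> \<in> Mor C (B \<boxtimes> X) (X' \<boxtimes> A) \<Longrightarrow>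
      N +>\<^bsub>M\<^esub> L A (\<psi> \<cdot> (f \<star> Idt C X)) = N +>\<^bsub>M\<^esub> L B ((Idt C X' \<star> f) \<cdot> \<psi>)"
    and p: "p \<in> carrier (trace_sum C X X')" "q \<in> carrier (trace_sum C X X')" "p \<ominus>\<^bsub>trace_sum C X X'\<^esub> q \<in> trace_rel C X X'"
  shows "N +>\<^bsub>M\<^esub> ext_sum M X X' L p = N +>\<^bsub>M\<^esub> ext_sum M X X' L q"
proof -
  interpret quotient_module "scalars :: 'k ring" M N by (simp add: quotient_module_def M N)
  have r: "p \<ominus>\<^bsub>trace_sum C X X'\<^esub> q \<in> carrier (trace_sum C X X')" using p by simp
  have "p = (p \<ominus>\<^bsub>trace_sum C X X'\<^esub> q) \<oplus>\<^bsub>trace_sum C X X'\<^esub> q"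
    using p by (simp add: a_minus_def S.M.a_assoc S.M.l_neg)
  then have "ext_sum M X X' L p = ext_sum M X X' L (p \<ominus>\<^bsub>trace_sum C X X'\<^esub> q) \<oplus>\<^bsub>M\<^esub> ext_sum M X X' L q"
    using ext_sum_add[OF L r p(2)] by simp
  then show ?thesis using coset_absorb[OF ext_sum_rel[OF L N slide p(3)]] L p by simp
qed

end

end

context monoidal_category
begin

abbreviation strand :: "'o \<Rightarrow> 'o \<Rightarrow> 'o \<Rightarrow> 'a set" where
  "strand X X' A \<equiv> Mor C (A \<boxtimes> X) (X' \<boxtimes> A)"

definition single_class :: "'o \<Rightarrow> 'o \<Rightarrow> 'o \<Rightarrow> 'a \<Rightarrow> ('o \<Rightarrow> 'a) set" where
  "single_class X X' A \<psi> = trace_class C X X' (trace_single C X X' A \<psi>)"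

lemma strand_linear_single:
  assumes Z: "Z \<in> Obj C" "Z' \<in> Obj C" and d: "\<And>A. A \<in> Obj C \<Longrightarrow> d A \<in> Obj C"
    and s: "\<And>A \<phi>. A \<in> Obj C \<Longrightarrow> \<phi> \<in> strand X X' A \<Longrightarrow> s A \<phi> \<in> strand Z Z' (d A)"
    and add: "\<And>A \<phi> \<psi>. A \<in> Obj C \<Longrightarrow> \<phi> \<in> strand X X' A \<Longrightarrow> \<psi> \<in> strand X X' A \<Longrightarrow> s A (Add C \<phi> \<psi>) = Add C (s A \<phi>) (s A \<psi>)"
    and scl: "\<And>A \<phi> a. A \<in> Obj C \<Longrightarrow> \<phi> \<in> strand X X' A \<Longrightarrow> s A (Scl C a \<phi>) = Scl C a (s A \<phi>)"
  shows "strand_linear (trace_sum C Z Z') X X' (\<lambda>A \<phi>. trace_single C Z Z' (d A) (s A \<phi>))"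
  unfolding strand_linear_def
  using s by (auto simp: add scl trace_single_Add[OF Z d] trace_single_Scl[OF Z d] intro!: trace_single_carrier[OF Z])

text \<open>
  The universal property of the trace, in the form of the unions that define operations on arrows.
  A linear operation \<open>s\<close> on strands that respects slides up to slides is well defined, and its value
  on the class of a single strand is the class of the result.
\<close>

lemma linear_extension_coset:
  fixes X X' Z Z' :: 'o and d :: "'o \<Rightarrow> 'o" and s :: "'o \<Rightarrow> 'a \<Rightarrow> 'a"
  assumes X: "X \<in> Obj C" "X' \<in> Obj C" and Z: "Z \<in> Obj C" "Z' \<in> Obj C" and d: "\<And>A. A \<in> Obj C \<Longrightarrow> d A \<in> Obj C"
    and s: "\<And>A \<phi>. A \<in> Obj C \<Longrightarrow> \<phi> \<in> strand X X' A \<Longrightarrow> s A \<phi> \<in> strand Z Z' (d A)"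
    and add: "\<And>A \<phi> \<psi>. A \<in> Obj C \<Longrightarrow> \<phi> \<in> strand X X' A \<Longrightarrow> \<psi> \<in> strand X X' A \<Longrightarrow> s A (Add C \<phi> \<psi>) = Add C (s A \<phi>) (s A \<psi>)"
    and scl: "\<And>A \<phi> a. A \<in> Obj C \<Longrightarrow> \<phi> \<in> strand X X' A \<Longrightarrow> s A (Scl C a \<phi>) = Scl C a (s A \<phi>)"
    and slide: "\<And>A B f \<psi>. A \<in> Obj C \<Longrightarrow> B \<in> Obj C \<Longrightarrow> f \<in> Mor C A B \<Longrightarrow> \<psi> \<in> Mor C (B \<boxtimes> X) (X' \<boxtimes> A) \<Longrightarrow>
      single_class Z Z' (d A) (s A (\<psi> \<cdot> (f \<star> Idt C X))) = single_class Z Z' (d B) (s B ((Idt C X' \<star> f) \<cdot> \<psi>))"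
    and A: "A \<in> Obj C" and \<phi>: "\<phi> \<in> strand X X' A"
  shows "(\<Union>p\<in>single_class X X' A \<phi>. trace_class C Z Z'
        (\<Oplus>\<^bsub>trace_sum C Z Z'\<^esub>A \<in> trace_supp C X X' p. trace_single C Z Z' (d A) (s A (p A))))
     = single_class Z Z' (d A) (s A \<phi>)"
proof -
  let ?L = "\<lambda>A \<phi>. trace_single C Z Z' (d A) (s A \<phi>)"
  let ?M = "trace_sum C Z Z'"
  interpret X: quotient_module "scalars :: 'k ring" "trace_sum C X X'" "trace_rel C X X'" by (rule trace_quotient[OF X])
  interpret Z: quotient_module "scalars :: 'k ring" ?M "trace_rel C Z Z'" by (rule trace_quotient[OF Z])
  note [simp] = X
  have L: "strand_linear ?M X X' ?L" by (rule strand_linear_single[OF Z d s add scl])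
  have "(\<Union>p\<in>single_class X X' A \<phi>. trace_class C Z Z' (ext_sum ?M X X' ?L p))
      = trace_class C Z Z' (ext_sum ?M X X' ?L (trace_single C X X' A \<phi>))"
    unfolding single_class_def trace_class_def
  proof (rule X.coset_UN)
    show c: "trace_single C X X' A \<phi> \<in> carrier (trace_sum C X X')" using X \<phi> by simp
    fix q assume "q \<in> carrier (trace_sum C X X')" "q \<ominus>\<^bsub>trace_sum C X X'\<^esub> trace_single C X X' A \<phi> \<in> trace_rel C X X'"
    then show "trace_rel C Z Z' +>\<^bsub>?M\<^esub> ext_sum ?M X X' ?L q = trace_rel C Z Z' +>\<^bsub>?M\<^esub> ext_sum ?M X X' ?L (trace_single C X X' A \<phi>)"
      using c slide by (intro ext_sum_coset[OF Z.module_axioms X L Z.submodule_axioms])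
        (auto simp: single_class_def trace_class_def)
  qed
  also have "ext_sum ?M X X' ?L (trace_single C X X' A \<phi>) = ?L A \<phi>"
    by (rule ext_sum_single[OF Z.module_axioms X L A \<phi>])
  finally show ?thesis by (simp add: ext_sum_def single_class_def)
qed

text \<open>
  Freeze one argument at a time and extend linearly in the other.
\<close>

lemma bilinear_extension_coset:
  fixes X X' Y Y' Z Z' :: 'o and d :: "'o \<Rightarrow> 'o \<Rightarrow> 'o" and s :: "'o \<Rightarrow> 'o \<Rightarrow> 'a \<Rightarrow> 'a \<Rightarrow> 'a"
  assumes X: "X \<in> Obj C" "X' \<in> Obj C" and Y: "Y \<in> Obj C" "Y' \<in> Obj C" and Z: "Z \<in> Obj C" "Z' \<in> Obj C"
    and d: "\<And>A B. A \<in> Obj C \<Longrightarrow> B \<in> Obj C \<Longrightarrow> d A B \<in> Obj C"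
    and s: "\<And>A B \<phi> \<psi>. A \<in> Obj C \<Longrightarrow> B \<in> Obj C \<Longrightarrow> \<phi> \<in> strand X X' A \<Longrightarrow> \<psi> \<in> strand Y Y' B \<Longrightarrow>
      s A B \<phi> \<psi> \<in> strand Z Z' (d A B)"
    and add1: "\<And>A B \<phi> \<phi>' \<psi>. A \<in> Obj C \<Longrightarrow> B \<in> Obj C \<Longrightarrow> \<phi> \<in> strand X X' A \<Longrightarrow> \<phi>' \<in> strand X X' A \<Longrightarrow> \<psi> \<in> strand Y Y' B \<Longrightarrow>
      s A B (Add C \<phi> \<phi>') \<psi> = Add C (s A B \<phi> \<psi>) (s A B \<phi>' \<psi>)"
    and add2: "\<And>A B \<phi> \<psi> \<psi>'. A \<in> Obj C \<Longrightarrow> B \<in> Obj C \<Longrightarrow> \<phi> \<in> strand X X' A \<Longrightarrow> \<psi> \<in> strand Y Y' B \<Longrightarrow> \<psi>' \<in> strand Y Y' B \<Longrightarrow>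
      s A B \<phi> (Add C \<psi> \<psi>') = Add C (s A B \<phi> \<psi>) (s A B \<phi> \<psi>')"
    and scl1: "\<And>A B \<phi> \<psi> a. A \<in> Obj C \<Longrightarrow> B \<in> Obj C \<Longrightarrow> \<phi> \<in> strand X X' A \<Longrightarrow> \<psi> \<in> strand Y Y' B \<Longrightarrow>
      s A B (Scl C a \<phi>) \<psi> = Scl C a (s A B \<phi> \<psi>)"
    and scl2: "\<And>A B \<phi> \<psi> a. A \<in> Obj C \<Longrightarrow> B \<in> Obj C \<Longrightarrow> \<phi> \<in> strand X X' A \<Longrightarrow> \<psi> \<in> strand Y Y' B \<Longrightarrow>
      s A B \<phi> (Scl C a \<psi>) = Scl C a (s A B \<phi> \<psi>)"
    and slide1: "\<And>A A' B f \<phi> \<psi>. A \<in> Obj C \<Longrightarrow> A' \<in> Obj C \<Longrightarrow> B \<in> Obj C \<Longrightarrow> f \<in> Mor C A A' \<Longrightarrow>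
      \<phi> \<in> Mor C (A' \<boxtimes> X) (X' \<boxtimes> A) \<Longrightarrow> \<psi> \<in> strand Y Y' B \<Longrightarrow>
      single_class Z Z' (d A B) (s A B (\<phi> \<cdot> (f \<star> Idt C X)) \<psi>) = single_class Z Z' (d A' B) (s A' B ((Idt C X' \<star> f) \<cdot> \<phi>) \<psi>)"
    and slide2: "\<And>A B B' f \<phi> \<psi>. A \<in> Obj C \<Longrightarrow> B \<in> Obj C \<Longrightarrow> B' \<in> Obj C \<Longrightarrow> f \<in> Mor C B B' \<Longrightarrow>
      \<phi> \<in> strand X X' A \<Longrightarrow> \<psi> \<in> Mor C (B' \<boxtimes> Y) (Y' \<boxtimes> B) \<Longrightarrow>
      single_class Z Z' (d A B) (s A B \<phi> (\<psi> \<cdot> (f \<star> Idt C Y))) = single_class Z Z' (d A B') (s A B' \<phi> ((Idt C Y' \<star> f) \<cdot> \<psi>))"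
    and A: "A \<in> Obj C" and B: "B \<in> Obj C" and \<phi>: "\<phi> \<in> strand X X' A" and \<psi>: "\<psi> \<in> strand Y Y' B"
  shows "(\<Union>p\<in>single_class X X' A \<phi>. \<Union>q\<in>single_class Y Y' B \<psi>. trace_class C Z Z'
        (\<Oplus>\<^bsub>trace_sum C Z Z'\<^esub>A \<in> trace_supp C X X' p. \<Oplus>\<^bsub>trace_sum C Z Z'\<^esub>B \<in> trace_supp C Y Y' q.
           trace_single C Z Z' (d A B) (s A B (p A) (q B))))
     = single_class Z Z' (d A B) (s A B \<phi> \<psi>)"
proof -
  let ?M = "trace_sum C Z Z'" and ?N = "trace_rel C Z Z'"
  let ?\<beta> = "\<lambda>A B \<phi> \<psi>. trace_single C Z Z' (d A B) (s A B \<phi> \<psi>)"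
  interpret X: quotient_module "scalars :: 'k ring" "trace_sum C X X'" "trace_rel C X X'" by (rule trace_quotient[OF X])
  interpret Y: quotient_module "scalars :: 'k ring" "trace_sum C Y Y'" "trace_rel C Y Y'" by (rule trace_quotient[OF Y])
  interpret Z: quotient_module "scalars :: 'k ring" ?M ?N by (rule trace_quotient[OF Z])
  have L2: "strand_linear ?M Y Y' (\<lambda>B \<psi>. ?\<beta> A B \<phi> \<psi>)" if "A \<in> Obj C" "\<phi> \<in> strand X X' A" for A \<phi>
    by (rule strand_linear_single[OF Z d[OF that(1)]]) (use that s add2 scl2 in auto)
  have L1: "strand_linear ?M X X' (\<lambda>A \<phi>. ?\<beta> A B \<phi> \<psi>)" if "B \<in> Obj C" "\<psi> \<in> strand Y Y' B" for B \<psi>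
    by (rule strand_linear_single[OF Z d[OF _ that(1)]]) (use that s add1 scl1 in auto)
  define L where "L q A \<phi> = ext_sum ?M Y Y' (\<lambda>B \<psi>. ?\<beta> A B \<phi> \<psi>) q" for q A \<phi>
  note sup = trace_suppD[OF Z.module_axioms Y]
  have qB: "q B \<in> strand Y Y' B" "B \<in> Obj C" "finite (trace_supp C Y Y' q)"
    if "q \<in> carrier (trace_sum C Y Y')" "B \<in> trace_supp C Y Y' q" for q B
    using that sup by (auto simp: trace_sum_sel trace_supp_def)
  have \<beta>c: "?\<beta> A B \<phi> \<psi> \<in> carrier ?M" if "A \<in> Obj C" "B \<in> Obj C" "\<phi> \<in> strand X X' A" "\<psi> \<in> strand Y Y' B" for A B \<phi> \<psi>
    using that by (intro trace_single_carrier Z s)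
  have LL: "strand_linear ?M X X' (L q)" if q: "q \<in> carrier (trace_sum C Y Y')" for q
    unfolding strand_linear_def
  proof (intro ballI allI conjI)
    fix A \<phi> assume A: "A \<in> Obj C" and \<phi>: "\<phi> \<in> strand X X' A"
    show "L q A \<phi> \<in> carrier ?M" unfolding L_def by (rule ext_sum_closed[OF Z.module_axioms Y L2[OF A \<phi>] q])
    show "L q A (Scl C a \<phi>) = a \<odot>\<^bsub>?M\<^esub> L q A \<phi>" for a
    proof -
      have "L q A (Scl C a \<phi>) = (\<Oplus>\<^bsub>?M\<^esub>B \<in> trace_supp C Y Y' q. a \<odot>\<^bsub>?M\<^esub> ?\<beta> A B \<phi> (q B))"
        unfolding L_def ext_sum_def
        by (rule Z.M.add.finprod_cong') (use qB[OF q] A \<phi> \<beta>c in \<open>auto simp: strand_linearD(3)[OF L1]\<close>)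
      also have "\<dots> = a \<odot>\<^bsub>?M\<^esub> L q A \<phi>" unfolding L_def ext_sum_def
        by (subst Z.finsum_smult_ldistr) (use q qB[OF q] A \<phi> \<beta>c in \<open>auto simp: trace_sum_sel\<close>)
      finally show ?thesis .
    qed
    fix \<phi>' assume \<phi>': "\<phi>' \<in> strand X X' A"
    have "L q A (Add C \<phi> \<phi>') = (\<Oplus>\<^bsub>?M\<^esub>B \<in> trace_supp C Y Y' q. ?\<beta> A B \<phi> (q B) \<oplus>\<^bsub>?M\<^esub> ?\<beta> A B \<phi>' (q B))"
      unfolding L_def ext_sum_def
      by (rule Z.M.add.finprod_cong') (use qB[OF q] A \<phi> \<phi>' \<beta>c in \<open>auto simp: strand_linearD(2)[OF L1]\<close>)
    also have "\<dots> = L q A \<phi> \<oplus>\<^bsub>?M\<^esub> L q A \<phi>'" unfolding L_def ext_sum_def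
      by (rule Z.M.finsum_addf) (use qB[OF q] A \<phi> \<phi>' \<beta>c in auto)
    finally show "L q A (Add C \<phi> \<phi>') = L q A \<phi> \<oplus>\<^bsub>?M\<^esub> L q A \<phi>'" .
  qed
  have slideL: "?N +>\<^bsub>?M\<^esub> L q A (\<phi> \<cdot> (f \<star> Idt C X)) = ?N +>\<^bsub>?M\<^esub> L q A' ((Idt C X' \<star> f) \<cdot> \<phi>)"
    if q: "q \<in> carrier (trace_sum C Y Y')" and "A \<in> Obj C" "A' \<in> Obj C" "f \<in> Mor C A A'" "\<phi> \<in> Mor C (A' \<boxtimes> X) (X' \<boxtimes> A)"
    for q A A' f \<phi>
    unfolding L_def ext_sum_def
    using that slide_Mor[OF X that(4,5)] qB[OF q] q
    by (intro Z.coset_finsum \<beta>c slide1[unfolded single_class_def trace_class_def]) (auto simp: trace_sum_sel)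
  let ?p = "trace_single C X X' A \<phi>" and ?q = "trace_single C Y Y' B \<psi>"
  have pc: "?p \<in> carrier (trace_sum C X X')" and qc: "?q \<in> carrier (trace_sum C Y Y')" using X Y \<phi> \<psi> by simp_all
  have 1: "(\<Union>p\<in>single_class X X' A \<phi>. ?N +>\<^bsub>?M\<^esub> ext_sum ?M X X' (L q) p) = ?N +>\<^bsub>?M\<^esub> L q A \<phi>"
    if q: "q \<in> carrier (trace_sum C Y Y')" for q
  proof -
    have "(\<Union>p\<in>single_class X X' A \<phi>. ?N +>\<^bsub>?M\<^esub> ext_sum ?M X X' (L q) p) = ?N +>\<^bsub>?M\<^esub> ext_sum ?M X X' (L q) ?p"
      unfolding single_class_def trace_class_def
      by (rule X.coset_UN[OF pc]) (rule ext_sum_coset[OF Z.module_axioms X LL[OF q] Z.submodule_axioms slideL[OF q] _ pc])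
    then show ?thesis using ext_sum_single[OF Z.module_axioms X LL[OF q] A \<phi>] by simp
  qed
  have 2: "(\<Union>q\<in>single_class Y Y' B \<psi>. ?N +>\<^bsub>?M\<^esub> L q A \<phi>) = ?N +>\<^bsub>?M\<^esub> ?\<beta> A B \<phi> \<psi>"
  proof -
    have "(\<Union>q\<in>single_class Y Y' B \<psi>. ?N +>\<^bsub>?M\<^esub> L q A \<phi>) = ?N +>\<^bsub>?M\<^esub> L ?q A \<phi>"
      unfolding single_class_def trace_class_def L_def
      by (rule Y.coset_UN[OF qc], rule ext_sum_coset[OF Z.module_axioms Y L2[OF A \<phi>] Z.submodule_axioms _ _ qc])
        (use slide2 A \<phi> in \<open>auto simp: single_class_def trace_class_def\<close>)
    then show ?thesis using ext_sum_single[OF Z.module_axioms Y L2[OF A \<phi>] B \<psi>] by (simp add: L_def)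
  qed
  have "(\<Union>p\<in>single_class X X' A \<phi>. \<Union>q\<in>single_class Y Y' B \<psi>. ?N +>\<^bsub>?M\<^esub> ext_sum ?M X X' (L q) p)
      = (\<Union>q\<in>single_class Y Y' B \<psi>. \<Union>p\<in>single_class X X' A \<phi>. ?N +>\<^bsub>?M\<^esub> ext_sum ?M X X' (L q) p)"
    by blast
  also have "\<dots> = (\<Union>q\<in>single_class Y Y' B \<psi>. ?N +>\<^bsub>?M\<^esub> L q A \<phi>)"
    by (rule SUP_cong[OF refl], rule 1, rule Y.coset_carrier[OF _ qc]) (simp add: single_class_def trace_class_def)
  finally show ?thesis unfolding 2 by (simp add: ext_sum_def L_def trace_class_def single_class_def)
qed

lemma single_class_slide:
  assumes "X \<in> Obj C" "X' \<in> Obj C" "f \<in> Mor C A B" "\<psi> \<in> Mor C (B \<boxtimes> X) (X' \<boxtimes> A)"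
  shows "single_class X X' A (\<psi> \<cdot> (f \<star> Idt C X)) = single_class X X' B ((Idt C X' \<star> f) \<cdot> \<psi>)"
proof -
  interpret X: quotient_module "scalars :: 'k ring" "trace_sum C X X'" "trace_rel C X X'" by (rule trace_quotient[OF assms(1,2)])
  have "A \<in> Obj C" "B \<in> Obj C" using Mor_Obj[OF assms(3)] by auto
  then have "trace_single C X X' A (\<psi> \<cdot> (f \<star> Idt C X)) \<ominus>\<^bsub>trace_sum C X X'\<^esub> trace_single C X X' B ((Idt C X' \<star> f) \<cdot> \<psi>)
      \<in> slide_gens X X'" using assms by (auto simp: slide_gens_def)
  then have "trace_single C X X' A (\<psi> \<cdot> (f \<star> Idt C X)) \<ominus>\<^bsub>trace_sum C X X'\<^esub> trace_single C X X' B ((Idt C X' \<star> f) \<cdot> \<psi>)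
      \<in> trace_rel C X X'"
    unfolding trace_rel_def slide_gens_def[symmetric, of X X'] by (rule subsetD[OF generated_submodule_superset])
  then show ?thesis using slide_Mor[OF assms] assms by (simp add: single_class_def trace_class_def X.coset_eq_iff)
qed

end

context premodular_category
begin

lemma binary_sum:
  assumes [simp]: "A \<in> Obj C" "B \<in> Obj C"
  obtains D i j r s where "D \<in> Obj C" "i \<in> Mor C A D" "j \<in> Mor C B D" "r \<in> Mor C D A" "s \<in> Mor C D B"
    "r \<cdot> i = Idt C A" "s \<cdot> j = Idt C B"
proof -
  have "\<forall>i<2. (if i = 0 then A else B) \<in> Obj C" by simp
  from direct_sums[OF this] obtain D ins prj where D: "is_direct_sum C 2 (\<lambda>i. if i = 0 then A else B) D ins prj"
    by blast
  have "D \<in> Obj C" "\<forall>i<2. ins i \<in> Mor C (if i = 0 then A else B) D \<and> prj i \<in> Mor C D (if i = 0 then A else B)"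
    "\<forall>i<2. prj i \<cdot> ins i = Idt C (if i = 0 then A else B)"
    using D by (auto simp: is_direct_sum_def)
  from this(1) this(2)[rule_format, of 0] this(2)[rule_format, of 1] this(3)[rule_format, of 0] this(3)[rule_format, of 1]
  show thesis by (intro that[of D "ins 0" "ins 1" "prj 0" "prj 1"]) simp_all
qed

text \<open>
  For \<open>i : A \<rightarrow> D\<close> and \<open>r : D \<rightarrow> A\<close> with \<open>r \<cdot> i = id\<close>, sliding \<open>r\<close> around the strand shows that \<open>\<phi>\<close> and
  \<open>(id \<star> i) \<cdot> \<phi> \<cdot> (r \<star> id)\<close> have the same class.  With \<open>D\<close> a direct sum this applies to both strands.
\<close>

lemma single_class_common_strand:
  assumes X: "X \<in> Obj C" "X' \<in> Obj C" and AB: "A \<in> Obj C" "B \<in> Obj C"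
    and \<phi>: "\<phi> \<in> strand X X' A" and \<psi>: "\<psi> \<in> strand X X' B"
  obtains D \<phi>' \<psi>' where "D \<in> Obj C" "\<phi>' \<in> strand X X' D" "\<psi>' \<in> strand X X' D"
    "single_class X X' A \<phi> = single_class X X' D \<phi>'" "single_class X X' B \<psi> = single_class X X' D \<psi>'"
proof -
  note [simp] = X AB
  have retract: "single_class X X' A \<phi> = single_class X X' D ((Idt C X' \<star> i) \<cdot> \<phi> \<cdot> (r \<star> Idt C X)) \<and>
      (Idt C X' \<star> i) \<cdot> \<phi> \<cdot> (r \<star> Idt C X) \<in> strand X X' D"
    if "D \<in> Obj C" "A \<in> Obj C" "i \<in> Mor C A D" "r \<in> Mor C D A" "r \<cdot> i = Idt C A" "\<phi> \<in> strand X X' A" for A D i r \<phi>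
  proof -
    note [simp] = that(1,2,3,4,6)[unfolded Mor_iff] that(5)
    have "single_class X X' D (((Idt C X' \<star> i) \<cdot> \<phi>) \<cdot> (r \<star> Idt C X))
        = single_class X X' A ((Idt C X' \<star> r) \<cdot> (Idt C X' \<star> i) \<cdot> \<phi>)"
      using that by (intro single_class_slide) (auto simp: Mor_iff)
    then show ?thesis by (simp add: Mor_iff interchange_tail)
  qed
  obtain D i j r s where D: "D \<in> Obj C" "i \<in> Mor C A D" "j \<in> Mor C B D" "r \<in> Mor C D A" "s \<in> Mor C D B"
    "r \<cdot> i = Idt C A" "s \<cdot> j = Idt C B" using binary_sum[OF AB] .
  show thesis
    using that[OF D(1)] retract[OF D(1) AB(1) D(2,4,6) \<phi>] retract[OF D(1) AB(2) D(3,5,7) \<psi>] by blast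
qed

text \<open>
  Split off one summand at a time and add the classes on a common strand.
\<close>

lemma trace_class_single:
  assumes X: "X \<in> Obj C" "X' \<in> Obj C" and p: "p \<in> carrier (trace_sum C X X')"
  shows "\<exists>A\<in>Obj C. \<exists>\<psi>\<in>strand X X' A. trace_class C X X' p = single_class X X' A \<psi>"
proof -
  interpret X: quotient_module "scalars :: 'k ring" "trace_sum C X X'" "trace_rel C X X'" by (rule trace_quotient[OF X])
  let ?S = "trace_sum C X X'"
  note [simp] = X
  have "finite (trace_supp C X X' p)" using p by (simp add: trace_sum_sel)
  then show ?thesis using p
  proof (induction "trace_supp C X X' p" arbitrary: p rule: finite_induct)
    case empty
    then have "p = \<zero>\<^bsub>?S\<^esub>" by (auto simp: trace_sum_sel trace_supp_def intro!: extensionalityI[of _ "Obj C"])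
    then show ?case using trace_single_Zer[of X X' \<I>] unfolding single_class_def
      by (intro bexI[of _ \<I>] bexI[of _ "Zer C (\<I> \<boxtimes> X) (X' \<boxtimes> \<I>)"]) (simp_all add: Zer_Mor)
  next
    case (insert A S p)
    have A: "A \<in> Obj C" "A \<in> trace_supp C X X' p" using insert.hyps(4) by (auto simp: trace_supp_def)
    have pA: "p A \<in> strand X X' A" using insert.prems A by (simp add: trace_sum_sel)
    define p' where "p' = (\<lambda>B\<in>Obj C. if B = A then Zer C (B \<boxtimes> X) (X' \<boxtimes> B) else p B)"
    have S: "S = trace_supp C X X' p'" using insert.hyps(2,4) by (auto simp: trace_supp_def p'_def)
    have p': "p' \<in> carrier ?S" using insert.prems insert.hyps(1) unfolding trace_sum_sel S[symmetric]
      by (auto simp: p'_def Zer_Mor)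
    have p: "p = trace_single C X X' A (p A) \<oplus>\<^bsub>?S\<^esub> p'"
    proof (rule extensionalityI[of _ "Obj C"])
      fix B assume B: "B \<in> Obj C"
      have "Add C (p B) (Zer C (B \<boxtimes> X) (X' \<boxtimes> B)) = p B" "Add C (Zer C (B \<boxtimes> X) (X' \<boxtimes> B)) (p B) = p B"
        using insert.prems B Add_comm[of "B \<boxtimes> X" "X' \<boxtimes> B" "p B" "Zer C (B \<boxtimes> X) (X' \<boxtimes> B)"]
        by (auto simp: trace_sum_sel Zer_Add Zer_Mor)
      then show "p B = (trace_single C X X' A (p A) \<oplus>\<^bsub>?S\<^esub> p') B"
        using B by (auto simp: trace_sum_sel trace_single_def p'_def)
    qed (use insert.prems in \<open>auto simp: trace_sum_sel\<close>)
    obtain B \<psi> where B: "B \<in> Obj C" "\<psi> \<in> strand X X' B" "trace_class C X X' p' = single_class X X' B \<psi>"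
      using insert.hyps(3)[OF S p'] by auto
    obtain D \<phi>' \<psi>' where D: "D \<in> Obj C" "\<phi>' \<in> strand X X' D" "\<psi>' \<in> strand X X' D"
      "single_class X X' A (p A) = single_class X X' D \<phi>'" "single_class X X' B \<psi> = single_class X X' D \<psi>'"
      using single_class_common_strand[OF X A(1) B(1) pA B(2)] .
    have "trace_class C X X' p = trace_class C X X' (trace_single C X X' D \<phi>' \<oplus>\<^bsub>?S\<^esub> trace_single C X X' D \<psi>')"
      unfolding trace_class_def
      by (subst p, rule X.coset_addI) (use pA p' B D in \<open>simp_all add: single_class_def trace_class_def\<close>)
    also have "\<dots> = single_class X X' D (Add C \<phi>' \<psi>')"
      using D by (simp add: single_class_def trace_single_Add)
    finally show ?case using D by (intro bexI[of _ D] bexI[of _ "Add C \<phi>' \<psi>'"]) (auto intro: Add_Mor)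
  qed
qed

end

section \<open>Strict form of the trace operations\<close>

context premodular_category
begin

text \<open>
  In this way the inverse of the pivot is transported.
\<close>

lemma rep_inv:
  assumes "rep p q f F" "sarr G" "sdom G = pw q" "scod G = pw p" "G \<bullet> F = \<iota> (pw p)" "F \<bullet> G = \<iota> (pw q)"
  shows "iso_arr C f" "rep q p (inv_arr C f) G"
proof -
  have pq: "pres p" "pres q" using assms(1) by (auto simp: rep_def)
  obtain g where g: "rep q p g G" using rep_exists[OF pq(2,1) assms(2-4)] .
  have gf: "g \<cdot> f = Idt C (po p)" using rep_Cmp[OF assms(1) g] rep_Idt[OF pq(1)] rep_inj assms(5) by metis
  have fg: "f \<cdot> g = Idt C (po q)" using rep_Cmp[OF g assms(1)] rep_Idt[OF pq(2)] rep_inj assms(6) by metis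
  show "iso_arr C f" "rep q p (inv_arr C f) G"
    using inv_arrI[OF rep_Mor[OF assms(1)] rep_Mor[OF g] gf fg] g by simp_all
qed

lemma rep_inv_idn: "rep p q f (\<iota> w) \<Longrightarrow> rep q p (inv_arr C f) (\<iota> w)"
proof -
  assume r: "rep p q f (\<iota> w)"
  have "pw p = w" "pw q = w" "words w" using rep_simps[OF r] repD[OF r] by auto
  then show ?thesis using rep_inv(2)[OF r, of "\<iota> w"] by simp
qed

lemma rep_ex: "pres p \<Longrightarrow> pres q \<Longrightarrow> f \<in> Mor C (po p) (po q) \<Longrightarrow> \<exists>F. rep p q f F"
  by (simp add: rep_def)

lemma rep_cong: "rep p q f F \<Longrightarrow> F = G \<Longrightarrow> rep p q f G" by simp

lemma rep_middle:
  assumes [simp]: "pres w" "pres z" and f: "rep (x \<odot>\<odot> y) (x' \<odot>\<odot> y') f F" and [simp]: "pres x" "pres y" "pres x'" "pres y'"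
  shows "rep ((w \<odot>\<odot> x) \<odot>\<odot> (y \<odot>\<odot> z)) ((w \<odot>\<odot> x') \<odot>\<odot> (y' \<odot>\<odot> z))
     (middle C (po w) (po x) (po y) (po x') (po y') (po z) f) (\<iota> (pw w) \<parallel> F \<parallel> \<iota> (pw z))"
proof -
  have g: "rep ((w \<odot>\<odot> x) \<odot>\<odot> (y \<odot>\<odot> z)) (w \<odot>\<odot> ((x \<odot>\<odot> y) \<odot>\<odot> z)) (group_middle C (po w) (po x) (po y) (po z))
      (\<iota> (pw w @ pw x @ pw y @ pw z))" if [simp]: "pres x" "pres y" for x y
  proof -
    have "rep ((w \<odot>\<odot> x) \<odot>\<odot> (y \<odot>\<odot> z)) (w \<odot>\<odot> ((x \<odot>\<odot> y) \<odot>\<odot> z)) (group_middle C (po w) (po x) (po y) (po z))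
      ((\<iota> (pw w) \<parallel> \<iota> (pw x @ pw y @ pw z)) \<bullet> \<iota> (pw w @ pw x @ pw (y \<odot>\<odot> z)))"
      unfolding group_middle_def pten_simps(1)[symmetric]
      by (rule rep_Cmp[OF rep_Asc(1) rep_TenA[OF rep_Idt rep_Asc(2)]]) simp_all
    then show ?thesis by simp
  qed
  have [simp]: "sarr F" "sdom F = pw x @ pw y" "scod F = pw x' @ pw y'" using rep_simps[OF f] by simp_all
  show ?thesis unfolding middle_def
    by (rule rep_cong, rule rep_Cmp[OF rep_Cmp[OF g rep_TenA[OF rep_Idt rep_TenA[OF f rep_Idt]]] rep_inv_idn[OF g]]) simp_all
qed

text \<open>
  All associators in the definition of the composite become identities.
\<close>

lemma rep_strand_comp:
  assumes [simp]: "pres x" "pres x'" "pres x''" "pres a" "pres b" "pres a'" "pres b'"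
    and \<phi>: "rep (a \<odot>\<odot> x) (x' \<odot>\<odot> a') \<phi> \<Phi>" and \<psi>: "rep (b \<odot>\<odot> x') (x'' \<odot>\<odot> b') \<psi> \<Psi>"
    and po: "po a' = po a" "po b' = po b"
  shows "rep ((b \<odot>\<odot> a) \<odot>\<odot> x) (x'' \<odot>\<odot> (b' \<odot>\<odot> a')) (strand_comp C (po x) (po x') (po x'') (po a) (po b) \<phi> \<psi>)
     ((\<Psi> \<parallel> \<iota> (pw a')) \<bullet> (\<iota> (pw b) \<parallel> \<Phi>))"
proof -
  have [simp]: "sarr \<Phi>" "sdom \<Phi> = pw a @ pw x" "scod \<Phi> = pw x' @ pw a'"
    "sarr \<Psi>" "sdom \<Psi> = pw b @ pw x'" "scod \<Psi> = pw x'' @ pw b'" using rep_simps[OF \<phi>] rep_simps[OF \<psi>] by simp_all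
  have *: "strand_comp C (po x) (po x') (po x'') (po a) (po b) \<phi> \<psi>
    = Asc C (po x'') (po b') (po a') \<cdot> (\<psi> \<star> Idt C (po a')) \<cdot> inv_arr C (Asc C (po b) (po x') (po a')) \<cdot> (Idt C (po b) \<star> \<phi>) \<cdot> Asc C (po b) (po a) (po x)"
    by (simp add: strand_comp_def po)
  show ?thesis unfolding *
    by (rule rep_cong, rule rep_Cmp[OF rep_Cmp[OF rep_Cmp[OF rep_Cmp[OF rep_Asc(1) rep_TenA[OF rep_Idt \<phi>]] rep_Asc(2)] rep_TenA[OF \<psi> rep_Idt]] rep_Asc(1)])
      simp_all
qed

definition tensor_strand where
  "tensor_strand x x' y y' a b \<Phi> \<Psi> =
     strict.comp_strand a b (strict.right_strand x' a y' \<Phi>) (strict.left_strand x b y \<Psi>)"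

lemma rep_strand_tensor:
  assumes [simp]: "pres x" "pres x'" "pres y" "pres y'" "pres a" "pres b"
    and \<phi>: "rep (a \<odot>\<odot> x) (x' \<odot>\<odot> a) \<phi> \<Phi>" and \<psi>: "rep (b \<odot>\<odot> y) (y' \<odot>\<odot> b) \<psi> \<Psi>"
  shows "rep ((a \<odot>\<odot> b) \<odot>\<odot> (x \<odot>\<odot> y)) ((x' \<odot>\<odot> y') \<odot>\<odot> (a \<odot>\<odot> b))
     (strand_tensor C (po x) (po x') (po y) (po y') (po a) (po b) \<phi> \<psi>)
     (tensor_strand (pw x) (pw x') (pw y) (pw y') (pw a) (pw b) \<Phi> \<Psi>)"
proof -
  have [simp]: "sarr \<Phi>" "sdom \<Phi> = pw a @ pw x" "scod \<Phi> = pw x' @ pw a"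
    "sarr \<Psi>" "sdom \<Psi> = pw b @ pw y" "scod \<Psi> = pw y' @ pw b" using rep_simps[OF \<phi>] rep_simps[OF \<psi>] by simp_all
  show ?thesis unfolding strand_tensor_def
    by (rule rep_cong, rule rep_Cmp[OF rep_Cmp[OF rep_middle[OF _ _ rep_Brd] rep_TenA[OF \<phi> \<psi>]] rep_middle[OF _ _ rep_Brd_inv]])
      (simp_all add: tensor_strand_def strict.comp_strand_def strict.right_strand_def strict.left_strand_def strict.ten_split1[of \<Phi> \<Psi>])
qed

text \<open>
  The zigzag identities of \<open>is_left_dual\<close> contain associators and unitors; transport removes them.
\<close>

lemma left_dual_strict:
  assumes [simp]: "pres a" "pres d" and "is_left_dual C (po a) (po d) ev cv"
  obtains EV CV where "rep (d \<odot>\<odot> a) pone ev EV" "rep pone (a \<odot>\<odot> d) cv CV" "strict.right_dual (pw d) (pw a) EV CV"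
proof -
  have ev: "ev \<in> Mor C (po d \<boxtimes> po a) \<I>" and cv: "cv \<in> Mor C \<I> (po a \<boxtimes> po d)"
    and z1: "RUn C (po a) \<cdot> (Idt C (po a) \<star> ev) \<cdot> Asc C (po a) (po d) (po a) \<cdot> (cv \<star> Idt C (po a)) \<cdot> inv_arr C (LUn C (po a)) = Idt C (po a)"
    and z2: "LUn C (po d) \<cdot> (ev \<star> Idt C (po d)) \<cdot> inv_arr C (Asc C (po d) (po a) (po d)) \<cdot> (Idt C (po d) \<star> cv) \<cdot> inv_arr C (RUn C (po d)) = Idt C (po d)"
    using assms(3) by (simp_all add: is_left_dual_def)
  obtain EV where EV: "rep (d \<odot>\<odot> a) pone ev EV" using rep_ex[of "d \<odot>\<odot> a" pone ev] ev by auto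
  obtain CV where CV: "rep pone (a \<odot>\<odot> d) cv CV" using rep_ex[of pone "a \<odot>\<odot> d" cv] cv by auto
  have [simp]: "sarr EV" "sdom EV = pw d @ pw a" "scod EV = []" "sarr CV" "sdom CV = []" "scod CV = pw a @ pw d"
    using rep_simps[OF EV] rep_simps[OF CV] by simp_all
  have "rep a a (RUn C (po a) \<cdot> (Idt C (po a) \<star> ev) \<cdot> Asc C (po a) (po d) (po a) \<cdot> (cv \<star> Idt C (po a)) \<cdot> inv_arr C (LUn C (po a)))
     ((\<iota> (pw a) \<parallel> EV) \<bullet> (CV \<parallel> \<iota> (pw a)))"
    by (rule rep_cong, rule rep_Cmp[OF rep_Cmp[OF rep_Cmp[OF rep_Cmp[OF rep_LUn(2) rep_TenA[OF CV rep_Idt]] rep_Asc(1)] rep_TenA[OF rep_Idt EV]] rep_RUn(1)])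
      simp_all
  then have 1: "(\<iota> (pw a) \<parallel> EV) \<bullet> (CV \<parallel> \<iota> (pw a)) = \<iota> (pw a)" unfolding z1 using sarr_eqI rep_Idt by auto
  have "rep d d (LUn C (po d) \<cdot> (ev \<star> Idt C (po d)) \<cdot> inv_arr C (Asc C (po d) (po a) (po d)) \<cdot> (Idt C (po d) \<star> cv) \<cdot> inv_arr C (RUn C (po d)))
     ((EV \<parallel> \<iota> (pw d)) \<bullet> (\<iota> (pw d) \<parallel> CV))"
    by (rule rep_cong, rule rep_Cmp[OF rep_Cmp[OF rep_Cmp[OF rep_Cmp[OF rep_RUn(2) rep_TenA[OF rep_Idt CV]] rep_Asc(2)] rep_TenA[OF EV rep_Idt]] rep_LUn(1)])
      simp_all
  then have 2: "(EV \<parallel> \<iota> (pw d)) \<bullet> (\<iota> (pw d) \<parallel> CV) = \<iota> (pw d)" unfolding z2 using sarr_eqI rep_Idt by auto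
  show thesis using that[OF EV CV] 1 2 by (simp add: strict.right_dual_def)
qed

lemma stw_simps [simp]:
  assumes "words w"
  shows "sarr (stw w)" "sarr (stwi w)" "stw w \<bullet> stwi w = \<iota> w" "stwi w \<bullet> stw w = \<iota> w"
  using assms rep_simps(1)[OF rep_Twist, of "pword w"] rep_simps(1)[OF rep_Twist_inv, of "pword w"]
  by (simp_all add: stw_def stwi_def scmp_def sidn_def sdom_def scod_def)

lemma stw_dom [simp]: "sdom (stw w) = w" "scod (stw w) = w" "sdom (stwi w) = w" "scod (stwi w) = w"
  by (simp_all add: stw_def stwi_def sdom_def scod_def)

lemma stw_nat: assumes "sarr F" shows "stw (scod F) \<bullet> F = F \<bullet> stw (sdom F)"
proof -
  obtain f where r: "rep (pword (sdom F)) (pword (scod F)) f F" using strict_arr_rep assms by blast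
  have p: "pres (pword (sdom F))" "pres (pword (scod F))" using r by (simp_all add: rep_def)
  from sarr_eqI[of _ _ _ "stw (scod F) \<bullet> F" "F \<bullet> stw (sdom F)"] show ?thesis
    using rep_Cmp[OF r rep_Twist[OF p(2)]] rep_Cmp[OF rep_Twist[OF p(1)] r] Twist_natural[OF rep_Mor[OF r]]
    by (metis pword_simps(1,2))
qed

lemma stw_append:
  assumes [simp]: "words w" "words v"
  shows "stw (w @ v) = sbr v w \<bullet> sbr w v \<bullet> (stw w \<parallel> stw v)"
proof -
  let ?p = "pword w" and ?q = "pword v"
  have 1: "rep (?p \<odot>\<odot> ?q) (?p \<odot>\<odot> ?q) (Twist C (wob w \<boxtimes> wob v)) (stw (w @ v))"
    using rep_Twist[of "?p \<odot>\<odot> ?q"] by simp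
  have "rep (?p \<odot>\<odot> ?q) (?p \<odot>\<odot> ?q) (Brd C (po ?q) (po ?p) \<cdot> Brd C (po ?p) (po ?q) \<cdot> (Twist C (po ?p) \<star> Twist C (po ?q)))
      (sbr (pw ?q) (pw ?p) \<bullet> sbr (pw ?p) (pw ?q) \<bullet> (stw (pw ?p) \<parallel> stw (pw ?q)))"
    by (rule rep_Cmp[OF rep_Cmp[OF rep_TenA[OF rep_Twist rep_Twist] rep_Brd] rep_Brd]) simp_all
  then show ?thesis using sarr_eqI[OF 1] by (simp add: balancing)
qed

text \<open>
  By definition \<open>A*\<close> is a right dual of \<open>A**\<close>, and the braiding makes it a right dual of \<open>A\<close> as well, so
  \<open>right_dual_compare\<close> gives an isomorphism from \<open>A\<close> to \<open>A**\<close>.  The pivot is this isomorphism after the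
  twist, and the pivotal evaluation and coevaluation are the duality of \<open>A**\<close> and \<open>A*\<close> transported
  along it.
\<close>

lemma pivot_strict:
  assumes [simp]: "pres a" "pres d" and d: "po d = Dual C (po a)"
  obtains EV CV where "rep (a \<odot>\<odot> d) pone (piv_ev C (po a)) EV" "rep pone (d \<odot>\<odot> a) (piv_coev C (po a)) CV"
    "strict.right_dual (pw a) (pw d) EV CV"
proof -
  have lda: "is_left_dual C (po a) (po d) (Ev C (po a)) (Coev C (po a))" using left_duals[of "po a"] by (simp add: d)
  have ldd: "is_left_dual C (po d) (Dual C (po d)) (Ev C (po d)) (Coev C (po d))" using left_duals[of "po d"] by simp
  then have D2: "Dual C (po d) \<in> Obj C" by (simp add: is_left_dual_def)
  define e where "e = pleaf (Dual C (po d))"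
  have [simp]: "pres e" "po e = Dual C (po d)" using D2 by (simp_all add: e_def)
  obtain EV1 CV1 where 1: "rep (d \<odot>\<odot> a) pone (Ev C (po a)) EV1" "rep pone (a \<odot>\<odot> d) (Coev C (po a)) CV1"
    "strict.right_dual (pw d) (pw a) EV1 CV1" by (rule left_dual_strict[OF assms(1,2) lda])
  obtain EV2 CV2 where 2: "rep (e \<odot>\<odot> d) pone (Ev C (po d)) EV2" "rep pone (d \<odot>\<odot> e) (Coev C (po d)) CV2"
    "strict.right_dual (pw e) (pw d) EV2 CV2"
    by (rule left_dual_strict[of d e "Ev C (po d)" "Coev C (po d)"]) (use ldd in simp_all)
  note D1 = strict.right_dual_braided(1)[OF 1(3)]
  note [simp] = 1(3)[unfolded strict.right_dual_def] 2(3)[unfolded strict.right_dual_def]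
  define P where "P = ((EV1 \<bullet> sbr (pw a) (pw d)) \<parallel> \<iota> (pw e)) \<bullet> (\<iota> (pw a) \<parallel> CV2)"
  define Q where "Q = (EV2 \<parallel> \<iota> (pw a)) \<bullet> (\<iota> (pw e) \<parallel> (sbri (pw d) (pw a) \<bullet> CV1))"
  have PQ: "Q \<bullet> P = \<iota> (pw a)" "P \<bullet> Q = \<iota> (pw e)"
    using strict.right_dual_compare[OF D1 2(3)] strict.right_dual_compare[OF 2(3) D1] by (simp_all only: P_def Q_def)
  have [simp]: "sarr P" "sdom P = pw a" "scod P = pw e" "sarr Q" "sdom Q = pw e" "scod Q = pw a"
    by (simp_all add: P_def Q_def)
  have p: "rep a e (pivot C (po a)) (P \<bullet> stw (pw a))"
  proof -
    have *: "pivot C (po a) = LUn C (po e) \<cdot> (Ev C (po a) \<star> Idt C (po e)) \<cdot> (Brd C (po a) (po d) \<star> Idt C (po e)) \<cdot>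
       inv_arr C (Asc C (po a) (po d) (po e)) \<cdot> (Idt C (po a) \<star> Coev C (po d)) \<cdot> inv_arr C (RUn C (po a)) \<cdot> Twist C (po a)"
      by (simp add: pivot_def Let_def d)
    show ?thesis unfolding *
      by (rule rep_cong, rule rep_Cmp[OF rep_Cmp[OF rep_Cmp[OF rep_Cmp[OF rep_Cmp[OF rep_Cmp[OF rep_Twist rep_RUn(2)]
          rep_TenA[OF rep_Idt 2(2)]] rep_Asc(2)] rep_TenA[OF rep_Brd rep_Idt]] rep_TenA[OF 1(1) rep_Idt]] rep_LUn(1)])
        (simp_all add: P_def)
  qed
  have inv: "(stwi (pw a) \<bullet> Q) \<bullet> (P \<bullet> stw (pw a)) = \<iota> (pw a)" "(P \<bullet> stw (pw a)) \<bullet> (stwi (pw a) \<bullet> Q) = \<iota> (pw e)"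
    by (simp_all add: strict.tail2[OF PQ(1)] strict.tail2[OF stw_simps(3)] PQ)
  have pi: "rep e a (inv_arr C (pivot C (po a))) (stwi (pw a) \<bullet> Q)"
    using rep_inv(2)[OF p _ _ _ inv] by simp
  have r1: "rep (a \<odot>\<odot> d) pone (piv_ev C (po a)) (EV2 \<bullet> ((P \<bullet> stw (pw a)) \<parallel> \<iota> (pw d)))"
    unfolding piv_ev_def d[symmetric] by (rule rep_Cmp[OF rep_TenA[OF p rep_Idt] 2(1)]) simp
  have r2: "rep pone (d \<odot>\<odot> a) (piv_coev C (po a)) ((\<iota> (pw d) \<parallel> (stwi (pw a) \<bullet> Q)) \<bullet> CV2)"
    unfolding piv_coev_def d[symmetric] by (rule rep_Cmp[OF 2(2) rep_TenA[OF rep_Idt pi]]) simp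
  have "strict.right_dual (pw a) (pw d) (EV2 \<bullet> ((P \<bullet> stw (pw a)) \<parallel> \<iota> (pw d))) ((\<iota> (pw d) \<parallel> (stwi (pw a) \<bullet> Q)) \<bullet> CV2)"
    by (rule strict.right_dual_transport[OF 2(3) _ _ _ _ _ _ inv]) simp_all
  then show thesis using that[OF r1 r2] by simp
qed

text \<open>
  The associators and unitors disappear and the tilde becomes a rotation followed by a flip.
\<close>

lemma rep_strand_tilde:
  assumes [simp]: "pres x" "pres x'" "pres a" "pres d" and d: "po d = Dual C (po a)"
    and \<psi>: "rep (a \<odot>\<odot> x) (x' \<odot>\<odot> a) \<psi> \<Psi>"
    and ev: "rep (a \<odot>\<odot> d) pone (piv_ev C (po a)) EV" and cv: "rep pone (d \<odot>\<odot> a) (piv_coev C (po a)) CV"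
    and dual: "strict.right_dual (pw a) (pw d) EV CV"
  shows "rep (d \<odot>\<odot> x) (x' \<odot>\<odot> d) (strand_tilde C (po x) (po x') (po a) \<psi>)
     (strict.tilde_strand (pw x) (pw x') (pw d) EV CV \<Psi>)"
proof -
  have [simp]: "sarr \<Psi>" "sdom \<Psi> = pw a @ pw x" "scod \<Psi> = pw x' @ pw a" using rep_simps[OF \<psi>] by simp_all
  note [simp] = dual[unfolded strict.right_dual_def]
  have *: "strand_tilde C (po x) (po x') (po a) \<psi> =
     inv_arr C (Brd C (po x') (po d)) \<cdot> RUn C (po (d \<odot>\<odot> x')) \<cdot> (Idt C (po (d \<odot>\<odot> x')) \<star> piv_ev C (po a)) \<cdot>
       middle C (po d) (po a) (po x) (po x') (po a) (po d) \<psi> \<cdot>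
       (piv_coev C (po a) \<star> Idt C (po (x \<odot>\<odot> d))) \<cdot> inv_arr C (LUn C (po (x \<odot>\<odot> d))) \<cdot> Brd C (po d) (po x)"
    by (simp add: strand_tilde_def Let_def d)
  show ?thesis unfolding *
    by (rule rep_cong, rule rep_Cmp[OF rep_Cmp[OF rep_Cmp[OF rep_Cmp[OF rep_Cmp[OF rep_Cmp[OF rep_Brd rep_LUn(2)]
        rep_TenA[OF cv rep_Idt]] rep_middle[OF _ _ \<psi>]] rep_TenA[OF rep_Idt ev]] rep_RUn(1)] rep_Brd_inv])
      (simp_all add: strict.tilde_strand_def strict.flip_strand_def strict.rotate_def)
qed

end

context premodular_category
begin

section \<open>Arrows of the horizontal trace\<close>

abbreviation \<T> where "\<T> \<equiv> horizontal_trace C"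

definition tarr :: "'o \<Rightarrow> 'o \<Rightarrow> 'o \<Rightarrow> 'a \<Rightarrow> ('o, 'a) trace_arr" where
  "tarr X X' A \<psi> = (X, X', single_class X X' A \<psi>)"

lemma trace_sel [simp]:
  "Obj \<T> = Obj C" "Dom \<T> (X, X', P) = X" "Cod \<T> (X, X', P) = X'" "Idt \<T> X = trace_embed C (Idt C X)"
  "Cmp \<T> = trace_comp C" "TenO \<T> = TenO C" "TenA \<T> = trace_tensor C" "Unit \<T> = \<I>"
  "Asc \<T> X Y Z = trace_embed C (Asc C X Y Z)" "LUn \<T> X = trace_embed C (LUn C X)" "RUn \<T> X = trace_embed C (RUn C X)"
  by (simp_all add: horizontal_trace_def)

lemma tarr_sel [simp]: "Dom \<T> (tarr X X' A \<psi>) = X" "Cod \<T> (tarr X X' A \<psi>) = X'"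
  by (simp_all add: tarr_def)

lemma trace_Mor_coset:
  "F \<in> Mor \<T> X X' \<longleftrightarrow> X \<in> Obj C \<and> X' \<in> Obj C \<and> (\<exists>p\<in>carrier (trace_sum C X X'). F = (X, X', trace_class C X X' p))"
  by (cases F) (auto simp: Mor_def horizontal_trace_def A_RCOSETS_def' trace_class_def)

lemma trace_Mor_iff:
  "F \<in> Mor \<T> X X' \<longleftrightarrow> X \<in> Obj C \<and> X' \<in> Obj C \<and> (\<exists>A\<in>Obj C. \<exists>\<psi>\<in>strand X X' A. F = tarr X X' A \<psi>)"
proof -
  have "(\<exists>p\<in>carrier (trace_sum C X X'). F = (X, X', trace_class C X X' p)) \<longleftrightarrow>
      (\<exists>A\<in>Obj C. \<exists>\<psi>\<in>strand X X' A. F = tarr X X' A \<psi>)" if X: "X \<in> Obj C" "X' \<in> Obj C"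
  proof
    assume "\<exists>p\<in>carrier (trace_sum C X X'). F = (X, X', trace_class C X X' p)"
    then obtain p where p: "p \<in> carrier (trace_sum C X X')" "F = (X, X', trace_class C X X' p)" by blast
    from trace_class_single[OF X p(1)] show "\<exists>A\<in>Obj C. \<exists>\<psi>\<in>strand X X' A. F = tarr X X' A \<psi>"
      by (auto simp: p(2) tarr_def)
  next
    assume "\<exists>A\<in>Obj C. \<exists>\<psi>\<in>strand X X' A. F = tarr X X' A \<psi>"
    then obtain A \<psi> where "\<psi> \<in> strand X X' A" "F = tarr X X' A \<psi>" by blast
    then show "\<exists>p\<in>carrier (trace_sum C X X'). F = (X, X', trace_class C X X' p)"
      using X by (intro bexI[of _ "trace_single C X X' A \<psi>"]) (simp_all add: tarr_def single_class_def)
  qed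
  then show ?thesis unfolding trace_Mor_coset by blast
qed

lemma trace_Arr_iff: "F \<in> Arr \<T> \<longleftrightarrow> (\<exists>X X'. F \<in> Mor \<T> X X')"
  by (auto simp: Mor_def)

lemma tarr_linear:
  assumes X: "X \<in> Obj C" "X' \<in> Obj C" and A: "A \<in> Obj C" and \<psi>: "\<psi> \<in> strand X X' A"
  shows tarr_Add: "\<phi> \<in> strand X X' A \<Longrightarrow> Add \<T> (tarr X X' A \<psi>) (tarr X X' A \<phi>) = tarr X X' A (Add C \<psi> \<phi>)"
    and tarr_Scl: "Scl \<T> a (tarr X X' A \<psi>) = tarr X X' A (Scl C a \<psi>)"
    and tarr_Zer: "tarr X X' A (Zer C (A \<boxtimes> X) (X' \<boxtimes> A)) = Zer \<T> X X'"
proof -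
  interpret X: quotient_module "scalars :: 'k ring" "trace_sum C X X'" "trace_rel C X X'" by (rule trace_quotient[OF X])
  show "Add \<T> (tarr X X' A \<psi>) (tarr X X' A \<phi>) = tarr X X' A (Add C \<psi> \<phi>)" if "\<phi> \<in> strand X X' A"
    using that X A \<psi> by (simp add: horizontal_trace_def tarr_def single_class_def trace_class_def X.coset_add trace_single_Add)
  show "Scl \<T> a (tarr X X' A \<psi>) = tarr X X' A (Scl C a \<psi>)"
    using X A \<psi> X.coset_smult[of a "trace_single C X X' A \<psi>"]
    by (simp add: horizontal_trace_def tarr_def single_class_def trace_class_def trace_single_Scl)
  show "tarr X X' A (Zer C (A \<boxtimes> X) (X' \<boxtimes> A)) = Zer \<T> X X'"
    by (simp add: horizontal_trace_def tarr_def single_class_def trace_class_def trace_single_Zer X.coset_zero)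
qed

lemma trace_hom_module:
  assumes X: "X \<in> Obj C" "X' \<in> Obj C"
  shows "module (scalars :: 'k ring) (hom_space \<T> X X')"
proof -
  interpret X: quotient_module "scalars :: 'k ring" "trace_sum C X X'" "trace_rel C X X'" by (rule trace_quotient[OF X])
  let ?S = "trace_sum C X X'" and ?H = "hom_space \<T> X X'"
  define q where "q p = (X, X', trace_class C X X' p)" for p
  have [simp]: "add ?H = Add \<T>" "smult ?H = Scl \<T>" "ring.zero ?H = Zer \<T> X X'" by (simp_all add: hom_space_def)
  have carr: "F \<in> carrier ?H \<longleftrightarrow> (\<exists>p\<in>carrier ?S. F = q p)" for F
    using X by (simp add: hom_space_def trace_Mor_coset q_def)
  have add: "Add \<T> (q p) (q r) = q (p \<oplus>\<^bsub>?S\<^esub> r)" if "p \<in> carrier ?S" "r \<in> carrier ?S" for p r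
    using that by (simp add: q_def horizontal_trace_def trace_class_def X.coset_add)
  have scl: "Scl \<T> a (q p) = q (a \<odot>\<^bsub>?S\<^esub> p)" if "p \<in> carrier ?S" for a p
    using that X.coset_smult[of a p] by (simp add: q_def horizontal_trace_def trace_class_def)
  have zer: "Zer \<T> X X' = q \<zero>\<^bsub>?S\<^esub>"
    by (simp add: q_def horizontal_trace_def trace_class_def X.coset_zero)
  have cl: "p \<in> carrier ?S \<Longrightarrow> q p \<in> carrier ?H" for p by (auto simp: carr)
  show ?thesis
  proof (rule moduleI)
    show "abelian_group ?H"
    proof (rule abelian_groupI)
      fix F assume "F \<in> carrier ?H"
      then obtain p where p: "p \<in> carrier ?S" "F = q p" by (auto simp: carr)
      show "\<exists>G\<in>carrier ?H. G \<oplus>\<^bsub>?H\<^esub> F = \<zero>\<^bsub>?H\<^esub>"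
        using p by (intro bexI[OF _ cl[of "\<ominus>\<^bsub>?S\<^esub> p"]]) (simp_all add: add zer X.M.l_neg)
    qed (auto simp: carr add zer X.M.a_ac intro!: bexI)
  qed (auto simp: carr add zer scl scalars_cring X.smult_r_distr X.smult_l_distr[simplified] X.smult_assoc1[simplified] X.smult_one[simplified]
      intro: bexI X.smult_closed[simplified])
qed

text \<open>
  That composition respects slides is a statement about diagrams; this lemma only reduces the
  composition of cosets to that of strands.
\<close>

lemma trace_comp_tarr:
  assumes X: "X \<in> Obj C" "X' \<in> Obj C" "X'' \<in> Obj C"
    and slide1: "\<And>A A' B f \<phi> \<psi>. A \<in> Obj C \<Longrightarrow> A' \<in> Obj C \<Longrightarrow> B \<in> Obj C \<Longrightarrow> f \<in> Mor C A A' \<Longrightarrow>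
      \<phi> \<in> Mor C (A' \<boxtimes> X) (X' \<boxtimes> A) \<Longrightarrow> \<psi> \<in> strand X' X'' B \<Longrightarrow>
      single_class X X'' (B \<boxtimes> A) (strand_comp C X X' X'' A B (\<phi> \<cdot> (f \<star> Idt C X)) \<psi>)
      = single_class X X'' (B \<boxtimes> A') (strand_comp C X X' X'' A' B ((Idt C X' \<star> f) \<cdot> \<phi>) \<psi>)"
    and slide2: "\<And>A B B' f \<phi> \<psi>. A \<in> Obj C \<Longrightarrow> B \<in> Obj C \<Longrightarrow> B' \<in> Obj C \<Longrightarrow> f \<in> Mor C B B' \<Longrightarrow>
      \<phi> \<in> strand X X' A \<Longrightarrow> \<psi> \<in> Mor C (B' \<boxtimes> X') (X'' \<boxtimes> B) \<Longrightarrow>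
      single_class X X'' (B \<boxtimes> A) (strand_comp C X X' X'' A B \<phi> (\<psi> \<cdot> (f \<star> Idt C X')))
      = single_class X X'' (B' \<boxtimes> A) (strand_comp C X X' X'' A B' \<phi> ((Idt C X'' \<star> f) \<cdot> \<psi>))"
    and A: "A \<in> Obj C" and B: "B \<in> Obj C" and \<phi>: "\<phi> \<in> strand X X' A" and \<psi>: "\<psi> \<in> strand X' X'' B"
  shows "trace_comp C (tarr X' X'' B \<psi>) (tarr X X' A \<phi>) = tarr X X'' (B \<boxtimes> A) (strand_comp C X X' X'' A B \<phi> \<psi>)"
proof -
  note [simp] = X
  show ?thesis unfolding trace_comp_def tarr_def prod.case
    by (rule arg_cong[of _ _ "\<lambda>P. (X, X'', P)"],
        rule bilinear_extension_coset[where s = "strand_comp C X X' X''" and d = "\<lambda>A B. B \<boxtimes> A"])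
      (use A B \<phi> \<psi> slide1 slide2 in \<open>simp_all add: strand_comp_def Mor_iff linear_simps TenA_linear\<close>)
qed

lemma middle_simps [simp]:
  assumes [simp]: "W \<in> Obj C" "X \<in> Obj C" "Y \<in> Obj C" "X' \<in> Obj C" "Y' \<in> Obj C" "Z \<in> Obj C"
    and "f \<in> Arr C" "Dom C f = X \<boxtimes> Y" "Cod C f = X' \<boxtimes> Y'"
  shows "middle C W X Y X' Y' Z f \<in> Arr C" "Dom C (middle C W X Y X' Y' Z f) = (W \<boxtimes> X) \<boxtimes> (Y \<boxtimes> Z)"
    "Cod C (middle C W X Y X' Y' Z f) = (W \<boxtimes> X') \<boxtimes> (Y' \<boxtimes> Z)"
  using assms(7-9) by (simp_all add: middle_def group_middle_def)

lemma trace_tensor_tarr: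
  assumes X: "X \<in> Obj C" "X' \<in> Obj C" "Y \<in> Obj C" "Y' \<in> Obj C"
    and slide1: "\<And>A A' B f \<phi> \<psi>. A \<in> Obj C \<Longrightarrow> A' \<in> Obj C \<Longrightarrow> B \<in> Obj C \<Longrightarrow> f \<in> Mor C A A' \<Longrightarrow>
      \<phi> \<in> Mor C (A' \<boxtimes> X) (X' \<boxtimes> A) \<Longrightarrow> \<psi> \<in> strand Y Y' B \<Longrightarrow>
      single_class (X \<boxtimes> Y) (X' \<boxtimes> Y') (A \<boxtimes> B) (strand_tensor C X X' Y Y' A B (\<phi> \<cdot> (f \<star> Idt C X)) \<psi>)
      = single_class (X \<boxtimes> Y) (X' \<boxtimes> Y') (A' \<boxtimes> B) (strand_tensor C X X' Y Y' A' B ((Idt C X' \<star> f) \<cdot> \<phi>) \<psi>)"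
    and slide2: "\<And>A B B' f \<phi> \<psi>. A \<in> Obj C \<Longrightarrow> B \<in> Obj C \<Longrightarrow> B' \<in> Obj C \<Longrightarrow> f \<in> Mor C B B' \<Longrightarrow>
      \<phi> \<in> strand X X' A \<Longrightarrow> \<psi> \<in> Mor C (B' \<boxtimes> Y) (Y' \<boxtimes> B) \<Longrightarrow>
      single_class (X \<boxtimes> Y) (X' \<boxtimes> Y') (A \<boxtimes> B) (strand_tensor C X X' Y Y' A B \<phi> (\<psi> \<cdot> (f \<star> Idt C Y)))
      = single_class (X \<boxtimes> Y) (X' \<boxtimes> Y') (A \<boxtimes> B') (strand_tensor C X X' Y Y' A B' \<phi> ((Idt C Y' \<star> f) \<cdot> \<psi>))"
    and A: "A \<in> Obj C" and B: "B \<in> Obj C" and \<phi>: "\<phi> \<in> strand X X' A" and \<psi>: "\<psi> \<in> strand Y Y' B"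
  shows "trace_tensor C (tarr X X' A \<phi>) (tarr Y Y' B \<psi>)
    = tarr (X \<boxtimes> Y) (X' \<boxtimes> Y') (A \<boxtimes> B) (strand_tensor C X X' Y Y' A B \<phi> \<psi>)"
proof -
  note [simp] = X
  show ?thesis unfolding trace_tensor_def tarr_def prod.case
    by (rule arg_cong[of _ _ "\<lambda>P. (X \<boxtimes> Y, X' \<boxtimes> Y', P)"],
        rule bilinear_extension_coset[where s = "strand_tensor C X X' Y Y'" and d = "\<lambda>A B. A \<boxtimes> B"])
      (use A B \<phi> \<psi> slide1 slide2 in \<open>simp_all add: strand_tensor_def Mor_iff linear_simps TenA_linear\<close>)
qed

lemma pivotal_simps [simp]:
  assumes [simp]: "A \<in> Obj C"
  shows "Dual C A \<in> Obj C" "piv_ev C A \<in> Arr C" "Dom C (piv_ev C A) = A \<boxtimes> Dual C A" "Cod C (piv_ev C A) = \<I>"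
    "piv_coev C A \<in> Arr C" "Dom C (piv_coev C A) = \<I>" "Cod C (piv_coev C A) = Dual C A \<boxtimes> A"
proof -
  show d [simp]: "Dual C A \<in> Obj C" using left_duals[of A] by (simp add: is_left_dual_def)
  obtain EV CV where "rep (pleaf A \<odot>\<odot> pleaf (Dual C A)) pone (piv_ev C A) EV"
    "rep pone (pleaf (Dual C A) \<odot>\<odot> pleaf A) (piv_coev C A) CV"
    by (rule pivot_strict[of "pleaf A" "pleaf (Dual C A)"]) simp_all
  from rep_Mor[OF this(1)] rep_Mor[OF this(2)]
  show "piv_ev C A \<in> Arr C" "Dom C (piv_ev C A) = A \<boxtimes> Dual C A" "Cod C (piv_ev C A) = \<I>"
    "piv_coev C A \<in> Arr C" "Dom C (piv_coev C A) = \<I>" "Cod C (piv_coev C A) = Dual C A \<boxtimes> A"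
    by (simp_all add: Mor_iff)
qed

text \<open>
  Closure under composition and tensoring with fixed arrows proves linearity of a long composite
  without computing the types of all its factors.
\<close>

definition linear_op :: "'o \<Rightarrow> 'o \<Rightarrow> 'o \<Rightarrow> 'o \<Rightarrow> ('a \<Rightarrow> 'a) \<Rightarrow> bool" where
  "linear_op X Y Z W F \<longleftrightarrow> (\<forall>\<phi>\<in>Mor C X Y. F \<phi> \<in> Mor C Z W \<and>
     (\<forall>\<psi>\<in>Mor C X Y. F (Add C \<phi> \<psi>) = Add C (F \<phi>) (F \<psi>)) \<and> (\<forall>a. F (Scl C a \<phi>) = Scl C a (F \<phi>)))"

lemma linear_op_intros:
  "linear_op X Y X Y (\<lambda>\<phi>. \<phi>)"
  "linear_op X Y Z W F \<Longrightarrow> g \<in> Mor C W V \<Longrightarrow> linear_op X Y Z V (\<lambda>\<phi>. g \<cdot> F \<phi>)"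
  "linear_op X Y Z W F \<Longrightarrow> g \<in> Mor C V Z \<Longrightarrow> linear_op X Y V W (\<lambda>\<phi>. F \<phi> \<cdot> g)"
  "linear_op X Y Z W F \<Longrightarrow> g \<in> Mor C V V' \<Longrightarrow> linear_op X Y (Z \<boxtimes> V) (W \<boxtimes> V') (\<lambda>\<phi>. F \<phi> \<star> g)"
  "linear_op X Y Z W F \<Longrightarrow> g \<in> Mor C V V' \<Longrightarrow> linear_op X Y (V \<boxtimes> Z) (V' \<boxtimes> W) (\<lambda>\<phi>. g \<star> F \<phi>)"
  by (auto simp: linear_op_def Mor_iff linear_simps TenA_linear)

lemma linear_op_tilde:
  assumes [simp]: "X \<in> Obj C" "X' \<in> Obj C" "A \<in> Obj C"
  shows "linear_op (A \<boxtimes> X) (X' \<boxtimes> A) (Dual C A \<boxtimes> X) (X' \<boxtimes> Dual C A) (strand_tilde C X X' A)"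
proof -
  let ?D = "Dual C A"
  have g: "group_middle C W X Y Z \<in> Mor C ((W \<boxtimes> X) \<boxtimes> (Y \<boxtimes> Z)) (W \<boxtimes> ((X \<boxtimes> Y) \<boxtimes> Z)) \<and> iso_arr C (group_middle C W X Y Z)"
    if "W \<in> Obj C" "X \<in> Obj C" "Y \<in> Obj C" "Z \<in> Obj C" for W X Y Z
    using that by (simp add: group_middle_def Mor_iff)
  have m: "linear_op (A \<boxtimes> X) (X' \<boxtimes> A) ((?D \<boxtimes> A) \<boxtimes> (X \<boxtimes> ?D)) ((?D \<boxtimes> X') \<boxtimes> (A \<boxtimes> ?D)) (middle C ?D A X X' A ?D)"
    unfolding middle_def
    by (rule linear_op_intros(2)[OF linear_op_intros(3)[OF linear_op_intros(5)[OF linear_op_intros(4)[OF linear_op_intros(1) Idt_Mor] Idt_Mor]]])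
      (use g in \<open>auto intro!: inv_arr_Mor\<close>)
  have r: "(piv_coev C A \<star> Idt C (X \<boxtimes> ?D)) \<cdot> inv_arr C (LUn C (X \<boxtimes> ?D)) \<cdot> Brd C ?D X \<in> Mor C (?D \<boxtimes> X) ((?D \<boxtimes> A) \<boxtimes> (X \<boxtimes> ?D))"
    by (simp add: Mor_iff)
  show ?thesis unfolding strand_tilde_def Let_def
    by (rule linear_op_intros(2)[OF linear_op_intros(2)[OF linear_op_intros(2)[OF linear_op_intros(3)[OF m r]]]])
      (simp_all add: Mor_iff)
qed

lemma strand_tilde_linear:
  assumes X: "X \<in> Obj C" "X' \<in> Obj C" and A: "A \<in> Obj C" and \<phi>: "\<phi> \<in> strand X X' A"
  shows "strand_tilde C X X' A \<phi> \<in> strand X X' (Dual C A)"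
    "\<psi> \<in> strand X X' A \<Longrightarrow> strand_tilde C X X' A (Add C \<phi> \<psi>) = Add C (strand_tilde C X X' A \<phi>) (strand_tilde C X X' A \<psi>)"
    "strand_tilde C X X' A (Scl C a \<phi>) = Scl C a (strand_tilde C X X' A \<phi>)"
  using linear_op_tilde[OF X A] \<phi> by (simp_all add: linear_op_def)

lemma trace_tilde_tarr:
  assumes X: "X \<in> Obj C" "X' \<in> Obj C"
    and slide: "\<And>A B f \<psi>. A \<in> Obj C \<Longrightarrow> B \<in> Obj C \<Longrightarrow> f \<in> Mor C A B \<Longrightarrow> \<psi> \<in> Mor C (B \<boxtimes> X) (X' \<boxtimes> A) \<Longrightarrow>
      single_class X X' (Dual C A) (strand_tilde C X X' A (\<psi> \<cdot> (f \<star> Idt C X)))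
      = single_class X X' (Dual C B) (strand_tilde C X X' B ((Idt C X' \<star> f) \<cdot> \<psi>))"
    and A: "A \<in> Obj C" and \<phi>: "\<phi> \<in> strand X X' A"
  shows "trace_tilde C (tarr X X' A \<phi>) = tarr X X' (Dual C A) (strand_tilde C X X' A \<phi>)"
proof -
  note [simp] = X
  show ?thesis unfolding trace_tilde_def tarr_def prod.case
    by (rule arg_cong[of _ _ "\<lambda>P. (X, X', P)"],
        rule linear_extension_coset[OF X X, where s = "strand_tilde C X X'" and d = "Dual C", OF _ _ _ _ slide A \<phi>])
      (simp_all add: strand_tilde_linear)
qed

end

context premodular_category
begin

section \<open>Trace operations on strict diagrams\<close>

text \<open>
  The arrow represented by \<open>F\<close>; it is unique by \<open>rep_inj\<close>.
\<close>

definition unstrict :: "('o, 'a) presentation \<Rightarrow> ('o, 'a) presentation \<Rightarrow> ('o, 'a) strict_arr \<Rightarrow> 'a" where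
  "unstrict p q F = (SOME f. rep p q f F)"

lemma unstrict_rep: "pres p \<Longrightarrow> pres q \<Longrightarrow> sarr F \<Longrightarrow> sdom F = pw p \<Longrightarrow> scod F = pw q \<Longrightarrow> rep p q (unstrict p q F) F"
  unfolding unstrict_def by (rule someI_ex) (metis rep_exists)

lemma unstrict_eq: "rep p q f F \<Longrightarrow> unstrict p q F = f"
  using rep_inj unstrict_def someI_ex by metis

text \<open>
  The arrow of the trace given by a strict diagram.  The strand is a presentation, because the
  diagram knows only its word.
\<close>

definition cl where
  "cl x x' a \<Phi> = tarr (po x) (po x') (po a) (unstrict (a \<odot>\<odot> x) (x' \<odot>\<odot> a) \<Phi>)"

definition sstrand where
  "sstrand x x' a \<Phi> \<longleftrightarrow> pres x \<and> pres x' \<and> pres a \<and> sarr \<Phi> \<and> sdom \<Phi> = pw a @ pw x \<and> scod \<Phi> = pw x' @ pw a"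

lemma cl_rep: "rep (a \<odot>\<odot> x) (x' \<odot>\<odot> a) \<phi> \<Phi> \<Longrightarrow> tarr (po x) (po x') (po a) \<phi> = cl x x' a \<Phi>"
  by (simp add: cl_def unstrict_eq)

lemma sstrand_rep:
  assumes "sstrand x x' a \<Phi>"
  obtains \<phi> where "rep (a \<odot>\<odot> x) (x' \<odot>\<odot> a) \<phi> \<Phi>" "cl x x' a \<Phi> = tarr (po x) (po x') (po a) \<phi>" "\<phi> \<in> strand (po x) (po x') (po a)"
proof -
  have r: "rep (a \<odot>\<odot> x) (x' \<odot>\<odot> a) (unstrict (a \<odot>\<odot> x) (x' \<odot>\<odot> a) \<Phi>) \<Phi>"
    using assms by (intro unstrict_rep) (auto simp: sstrand_def)
  then show thesis using that cl_rep[OF r] rep_Mor[OF r] by simp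
qed

lemma cl_Mor: assumes "sstrand x x' a \<Phi>" shows "cl x x' a \<Phi> \<in> Mor \<T> (po x) (po x')"
proof -
  obtain \<phi> where "cl x x' a \<Phi> = tarr (po x) (po x') (po a) \<phi>" "\<phi> \<in> strand (po x) (po x') (po a)"
    using assms by (rule sstrand_rep)
  then show ?thesis using assms by (auto simp: trace_Mor_iff sstrand_def)
qed

lemma cl_exists:
  assumes "F \<in> Mor \<T> (po x) (po x')" and [simp]: "pres x" "pres x'"
  obtains a \<Phi> where "sstrand x x' a \<Phi>" "F = cl x x' a \<Phi>"
proof -
  obtain A \<psi> where A: "A \<in> Obj C" "\<psi> \<in> strand (po x) (po x') A" "F = tarr (po x) (po x') A \<psi>"
    using assms by (auto simp: trace_Mor_iff)
  obtain \<Phi> where r: "rep (pleaf A \<odot>\<odot> x) (x' \<odot>\<odot> pleaf A) \<psi> \<Phi>"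
    using rep_ex[of "pleaf A \<odot>\<odot> x" "x' \<odot>\<odot> pleaf A" \<psi>] A by auto
  have "sstrand x x' (pleaf A) \<Phi>" using rep_simps[OF r] A by (simp add: sstrand_def)
  then show thesis using that cl_rep[OF r] A by simp
qed

lemma rep_slide:
  assumes [simp]: "pres x" "pres x'" "pres a" "pres b" "sarr g" "sdom g = pw a" "scod g = pw b"
      "sarr \<Theta>" "sdom \<Theta> = pw b @ pw x" "scod \<Theta> = pw x' @ pw a"
    and \<phi>: "rep (a \<odot>\<odot> x) (x' \<odot>\<odot> a) \<phi> (\<Theta> \<bullet> (g \<parallel> \<iota> (pw x)))" and \<psi>: "rep (b \<odot>\<odot> x) (x' \<odot>\<odot> b) \<psi> ((\<iota> (pw x') \<parallel> g) \<bullet> \<Theta>)"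
  shows "single_class (po x) (po x') (po a) \<phi> = single_class (po x) (po x') (po b) \<psi>"
proof -
  obtain f where f: "rep a b f g" by (rule rep_exists[of a b g]) simp_all
  obtain \<theta> where \<theta>: "rep (b \<odot>\<odot> x) (x' \<odot>\<odot> a) \<theta> \<Theta>" by (rule rep_exists[of "b \<odot>\<odot> x" "x' \<odot>\<odot> a" \<Theta>]) simp_all
  have "\<phi> = \<theta> \<cdot> (f \<star> Idt C (po x))" by (rule rep_inj[OF \<phi>], rule rep_Cmp[OF rep_TenA[OF f rep_Idt] \<theta>]) simp
  moreover have "\<psi> = (Idt C (po x') \<star> f) \<cdot> \<theta>" by (rule rep_inj[OF \<psi>], rule rep_Cmp[OF \<theta> rep_TenA[OF rep_Idt f]]) simp
  ultimately show ?thesis using single_class_slide[of "po x" "po x'" f "po a" "po b" \<theta>] rep_Mor[OF f] rep_Mor[OF \<theta>] by simp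
qed

lemma cl_slide:
  assumes [simp]: "pres x" "pres x'" "pres a" "pres b" "sarr g" "sdom g = pw a" "scod g = pw b"
      "sarr \<Theta>" "sdom \<Theta> = pw b @ pw x" "scod \<Theta> = pw x' @ pw a"
  shows "cl x x' a (\<Theta> \<bullet> (g \<parallel> \<iota> (pw x))) = cl x x' b ((\<iota> (pw x') \<parallel> g) \<bullet> \<Theta>)"
  using rep_slide[OF assms unstrict_rep unstrict_rep] by (simp add: cl_def tarr_def)

lemma strand_comp_slide_inner:
  assumes [simp]: "pres x" "pres x'" "pres x''" "pres a" "pres a'" "pres b"
    and f: "f \<in> Mor C (po a) (po a')" and \<phi>: "\<phi> \<in> Mor C (po a' \<boxtimes> po x) (po x' \<boxtimes> po a)" and \<psi>: "\<psi> \<in> strand (po x') (po x'') (po b)"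
  shows "single_class (po x) (po x'') (po b \<boxtimes> po a) (strand_comp C (po x) (po x') (po x'') (po a) (po b) (\<phi> \<cdot> (f \<star> Idt C (po x))) \<psi>)
    = single_class (po x) (po x'') (po b \<boxtimes> po a') (strand_comp C (po x) (po x') (po x'') (po a') (po b) ((Idt C (po x') \<star> f) \<cdot> \<phi>) \<psi>)"
proof -
  obtain F where F: "rep a a' f F" using rep_ex[of a a' f] f by auto
  obtain \<Phi> where \<Phi>: "rep (a' \<odot>\<odot> x) (x' \<odot>\<odot> a) \<phi> \<Phi>" using rep_ex[of "a' \<odot>\<odot> x" "x' \<odot>\<odot> a" \<phi>] \<phi> by auto
  obtain \<Psi> where \<Psi>: "rep (b \<odot>\<odot> x') (x'' \<odot>\<odot> b) \<psi> \<Psi>" using rep_ex[of "b \<odot>\<odot> x'" "x'' \<odot>\<odot> b" \<psi>] \<psi> by auto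
  note [simp] = rep_simps[OF F] rep_simps[OF \<Phi>] rep_simps[OF \<Psi>]
  note S = strict.stack_slide_inner[of F "pw a" "pw a'" "pw b" "pw x" "pw x'" "pw x''" \<Phi> \<Psi>]
  have 1: "rep ((b \<odot>\<odot> a) \<odot>\<odot> x) (x'' \<odot>\<odot> (b \<odot>\<odot> a)) (strand_comp C (po x) (po x') (po x'') (po a) (po b) (\<phi> \<cdot> (f \<star> Idt C (po x))) \<psi>)
     (((\<Psi> \<parallel> \<iota> (pw a)) \<bullet> (\<iota> (pw b) \<parallel> \<Phi>)) \<bullet> ((\<iota> (pw b) \<parallel> F) \<parallel> \<iota> (pw x)))"
    by (rule rep_cong[OF rep_strand_comp[OF _ _ _ _ _ _ _ rep_Cmp[OF rep_TenA[OF F rep_Idt] \<Phi>] \<Psi>] S(1)]) simp_all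
  have 2: "rep ((b \<odot>\<odot> a') \<odot>\<odot> x) (x'' \<odot>\<odot> (b \<odot>\<odot> a')) (strand_comp C (po x) (po x') (po x'') (po a') (po b) ((Idt C (po x') \<star> f) \<cdot> \<phi>) \<psi>)
     ((\<iota> (pw x'') \<parallel> (\<iota> (pw b) \<parallel> F)) \<bullet> ((\<Psi> \<parallel> \<iota> (pw a)) \<bullet> (\<iota> (pw b) \<parallel> \<Phi>)))"
    by (rule rep_cong[OF rep_strand_comp[OF _ _ _ _ _ _ _ rep_Cmp[OF \<Phi> rep_TenA[OF rep_Idt F]] \<Psi>] S(2)]) simp_all
  from rep_slide[OF _ _ _ _ _ _ _ _ _ _ 1 2] show ?thesis by simp
qed

lemma strand_comp_slide_outer:
  assumes [simp]: "pres x" "pres x'" "pres x''" "pres a" "pres b" "pres b'"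
    and f: "f \<in> Mor C (po b) (po b')" and \<phi>: "\<phi> \<in> strand (po x) (po x') (po a)" and \<psi>: "\<psi> \<in> Mor C (po b' \<boxtimes> po x') (po x'' \<boxtimes> po b)"
  shows "single_class (po x) (po x'') (po b \<boxtimes> po a) (strand_comp C (po x) (po x') (po x'') (po a) (po b) \<phi> (\<psi> \<cdot> (f \<star> Idt C (po x'))))
    = single_class (po x) (po x'') (po b' \<boxtimes> po a) (strand_comp C (po x) (po x') (po x'') (po a) (po b') \<phi> ((Idt C (po x'') \<star> f) \<cdot> \<psi>))"
proof -
  obtain F where F: "rep b b' f F" using rep_ex[of b b' f] f by auto
  obtain \<Phi> where \<Phi>: "rep (a \<odot>\<odot> x) (x' \<odot>\<odot> a) \<phi> \<Phi>" using rep_ex[of "a \<odot>\<odot> x" "x' \<odot>\<odot> a" \<phi>] \<phi> by auto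
  obtain \<Psi> where \<Psi>: "rep (b' \<odot>\<odot> x') (x'' \<odot>\<odot> b) \<psi> \<Psi>" using rep_ex[of "b' \<odot>\<odot> x'" "x'' \<odot>\<odot> b" \<psi>] \<psi> by auto
  note [simp] = rep_simps[OF F] rep_simps[OF \<Phi>] rep_simps[OF \<Psi>]
  note S = strict.stack_slide_outer[of F "pw b" "pw b'" "pw a" "pw x" "pw x'" "pw x''" \<Phi> \<Psi>]
  have 1: "rep ((b \<odot>\<odot> a) \<odot>\<odot> x) (x'' \<odot>\<odot> (b \<odot>\<odot> a)) (strand_comp C (po x) (po x') (po x'') (po a) (po b) \<phi> (\<psi> \<cdot> (f \<star> Idt C (po x'))))
     (((\<Psi> \<parallel> \<iota> (pw a)) \<bullet> (\<iota> (pw b') \<parallel> \<Phi>)) \<bullet> ((F \<parallel> \<iota> (pw a)) \<parallel> \<iota> (pw x)))"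
    by (rule rep_cong[OF rep_strand_comp[OF _ _ _ _ _ _ _ \<Phi> rep_Cmp[OF rep_TenA[OF F rep_Idt] \<Psi>]] S(1)]) simp_all
  have 2: "rep ((b' \<odot>\<odot> a) \<odot>\<odot> x) (x'' \<odot>\<odot> (b' \<odot>\<odot> a)) (strand_comp C (po x) (po x') (po x'') (po a) (po b') \<phi> ((Idt C (po x'') \<star> f) \<cdot> \<psi>))
     ((\<iota> (pw x'') \<parallel> (F \<parallel> \<iota> (pw a))) \<bullet> ((\<Psi> \<parallel> \<iota> (pw a)) \<bullet> (\<iota> (pw b') \<parallel> \<Phi>)))"
    by (rule rep_cong[OF rep_strand_comp[OF _ _ _ _ _ _ _ \<Phi> rep_Cmp[OF \<Psi> rep_TenA[OF rep_Idt F]]] S(2)]) simp_all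
  from rep_slide[OF _ _ _ _ _ _ _ _ _ _ 1 2] show ?thesis by simp
qed

lemma trace_comp_single:
  assumes [simp]: "X \<in> Obj C" "X' \<in> Obj C" "X'' \<in> Obj C"
    and "A \<in> Obj C" "B \<in> Obj C" "\<phi> \<in> strand X X' A" "\<psi> \<in> strand X' X'' B"
  shows "trace_comp C (tarr X' X'' B \<psi>) (tarr X X' A \<phi>) = tarr X X'' (B \<boxtimes> A) (strand_comp C X X' X'' A B \<phi> \<psi>)"
proof (rule trace_comp_tarr)
  show "single_class X X'' (B \<boxtimes> A) (strand_comp C X X' X'' A B (\<phi> \<cdot> (f \<star> Idt C X)) \<psi>)
    = single_class X X'' (B \<boxtimes> A') (strand_comp C X X' X'' A' B ((Idt C X' \<star> f) \<cdot> \<phi>) \<psi>)"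
    if "A \<in> Obj C" "A' \<in> Obj C" "B \<in> Obj C" "f \<in> Mor C A A'" "\<phi> \<in> Mor C (A' \<boxtimes> X) (X' \<boxtimes> A)" "\<psi> \<in> strand X' X'' B"
    for A A' B f \<phi> \<psi>
    using strand_comp_slide_inner[of "pleaf X" "pleaf X'" "pleaf X''" "pleaf A" "pleaf A'" "pleaf B" f \<phi> \<psi>] that by simp
  show "single_class X X'' (B \<boxtimes> A) (strand_comp C X X' X'' A B \<phi> (\<psi> \<cdot> (f \<star> Idt C X')))
    = single_class X X'' (B' \<boxtimes> A) (strand_comp C X X' X'' A B' \<phi> ((Idt C X'' \<star> f) \<cdot> \<psi>))"
    if "A \<in> Obj C" "B \<in> Obj C" "B' \<in> Obj C" "f \<in> Mor C B B'" "\<phi> \<in> strand X X' A" "\<psi> \<in> Mor C (B' \<boxtimes> X') (X'' \<boxtimes> B)"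
    for A B B' f \<phi> \<psi>
    using strand_comp_slide_outer[of "pleaf X" "pleaf X'" "pleaf X''" "pleaf A" "pleaf B" "pleaf B'" f \<phi> \<psi>] that by simp
qed (use assms in simp_all)

lemma cl_comp:
  assumes \<Phi>: "sstrand x x' a \<Phi>" and \<Psi>: "sstrand x' x'' b \<Psi>"
  shows "trace_comp C (cl x' x'' b \<Psi>) (cl x x' a \<Phi>) = cl x x'' (b \<odot>\<odot> a) (strict.comp_strand (pw b) (pw a) \<Psi> \<Phi>)"
    "sstrand x x'' (b \<odot>\<odot> a) (strict.comp_strand (pw b) (pw a) \<Psi> \<Phi>)"
proof -
  have [simp]: "pres x" "pres x'" "pres x''" "pres a" "pres b" using assms by (auto simp: sstrand_def)
  show "sstrand x x'' (b \<odot>\<odot> a) (strict.comp_strand (pw b) (pw a) \<Psi> \<Phi>)" using assms by (auto simp: sstrand_def)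
  obtain \<phi> where \<phi>: "rep (a \<odot>\<odot> x) (x' \<odot>\<odot> a) \<phi> \<Phi>" "cl x x' a \<Phi> = tarr (po x) (po x') (po a) \<phi>" "\<phi> \<in> strand (po x) (po x') (po a)"
    using \<Phi> by (rule sstrand_rep)
  obtain \<psi> where \<psi>: "rep (b \<odot>\<odot> x') (x'' \<odot>\<odot> b) \<psi> \<Psi>" "cl x' x'' b \<Psi> = tarr (po x') (po x'') (po b) \<psi>" "\<psi> \<in> strand (po x') (po x'') (po b)"
    using \<Psi> by (rule sstrand_rep)
  have "trace_comp C (tarr (po x') (po x'') (po b) \<psi>) (tarr (po x) (po x') (po a) \<phi>)
      = tarr (po x) (po x'') (po b \<boxtimes> po a) (strand_comp C (po x) (po x') (po x'') (po a) (po b) \<phi> \<psi>)"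
    by (rule trace_comp_single) (use \<phi> \<psi> in simp_all)
  then show "trace_comp C (cl x' x'' b \<Psi>) (cl x x' a \<Phi>) = cl x x'' (b \<odot>\<odot> a) (strict.comp_strand (pw b) (pw a) \<Psi> \<Phi>)"
    using cl_rep[OF rep_strand_comp[OF _ _ _ _ _ _ _ \<phi>(1) \<psi>(1)]] by (simp add: \<phi>(2) \<psi>(2) strict.comp_strand_def)
qed

lemma strand_tensor_slide_first:
  assumes [simp]: "pres x" "pres x'" "pres y" "pres y'" "pres a" "pres a'" "pres b"
    and f: "f \<in> Mor C (po a) (po a')" and \<phi>: "\<phi> \<in> Mor C (po a' \<boxtimes> po x) (po x' \<boxtimes> po a)" and \<psi>: "\<psi> \<in> strand (po y) (po y') (po b)"
  shows "single_class (po x \<boxtimes> po y) (po x' \<boxtimes> po y') (po a \<boxtimes> po b) (strand_tensor C (po x) (po x') (po y) (po y') (po a) (po b) (\<phi> \<cdot> (f \<star> Idt C (po x))) \<psi>)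
    = single_class (po x \<boxtimes> po y) (po x' \<boxtimes> po y') (po a' \<boxtimes> po b) (strand_tensor C (po x) (po x') (po y) (po y') (po a') (po b) ((Idt C (po x') \<star> f) \<cdot> \<phi>) \<psi>)"
proof -
  obtain F where F: "rep a a' f F" using rep_ex[of a a' f] f by auto
  obtain \<Phi> where \<Phi>: "rep (a' \<odot>\<odot> x) (x' \<odot>\<odot> a) \<phi> \<Phi>" using rep_ex[of "a' \<odot>\<odot> x" "x' \<odot>\<odot> a" \<phi>] \<phi> by auto
  obtain \<Psi> where \<Psi>: "rep (b \<odot>\<odot> y) (y' \<odot>\<odot> b) \<psi> \<Psi>" using rep_ex[of "b \<odot>\<odot> y" "y' \<odot>\<odot> b" \<psi>] \<psi> by auto
  note [simp] = rep_simps[OF F] rep_simps[OF \<Phi>] rep_simps[OF \<Psi>]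
  let ?R = "strict.right_strand (pw x') (pw a) (pw y') \<Phi>" and ?L = "strict.left_strand (pw x) (pw b) (pw y) \<Psi>"
  let ?\<Theta> = "(?R \<parallel> \<iota> (pw b)) \<bullet> (\<iota> (pw a') \<parallel> ?L)"
  note R = strict.right_strand_slide[of "pw x" "pw x'" "pw y'" F "pw a" "pw a'" \<Phi>]
  note S = strict.stack_slide_outer[of F "pw a" "pw a'" "pw b" "pw x @ pw y" "pw x @ pw y'" "pw x' @ pw y'" ?L ?R]
  have 1: "rep ((a \<odot>\<odot> b) \<odot>\<odot> (x \<odot>\<odot> y)) ((x' \<odot>\<odot> y') \<odot>\<odot> (a \<odot>\<odot> b)) (strand_tensor C (po x) (po x') (po y) (po y') (po a) (po b) (\<phi> \<cdot> (f \<star> Idt C (po x))) \<psi>)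
     (?\<Theta> \<bullet> ((F \<parallel> \<iota> (pw b)) \<parallel> \<iota> (pw (x \<odot>\<odot> y))))"
  proof (rule rep_cong[OF rep_strand_tensor[OF _ _ _ _ _ _ rep_Cmp[OF rep_TenA[OF F rep_Idt] \<Phi>] \<Psi>]])
    show "tensor_strand (pw x) (pw x') (pw y) (pw y') (pw a) (pw b) (\<Phi> \<bullet> (F \<parallel> \<iota> (pw x))) \<Psi> = ?\<Theta> \<bullet> ((F \<parallel> \<iota> (pw b)) \<parallel> \<iota> (pw (x \<odot>\<odot> y)))"
      using R(1) S(1) by (simp add: tensor_strand_def strict.comp_strand_def)
  qed simp_all
  have 2: "rep ((a' \<odot>\<odot> b) \<odot>\<odot> (x \<odot>\<odot> y)) ((x' \<odot>\<odot> y') \<odot>\<odot> (a' \<odot>\<odot> b)) (strand_tensor C (po x) (po x') (po y) (po y') (po a') (po b) ((Idt C (po x') \<star> f) \<cdot> \<phi>) \<psi>)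
     ((\<iota> (pw (x' \<odot>\<odot> y')) \<parallel> (F \<parallel> \<iota> (pw b))) \<bullet> ?\<Theta>)"
  proof (rule rep_cong[OF rep_strand_tensor[OF _ _ _ _ _ _ rep_Cmp[OF \<Phi> rep_TenA[OF rep_Idt F]] \<Psi>]])
    show "tensor_strand (pw x) (pw x') (pw y) (pw y') (pw a') (pw b) ((\<iota> (pw x') \<parallel> F) \<bullet> \<Phi>) \<Psi> = (\<iota> (pw (x' \<odot>\<odot> y')) \<parallel> (F \<parallel> \<iota> (pw b))) \<bullet> ?\<Theta>"
      using R(2) S(2) by (simp add: tensor_strand_def strict.comp_strand_def)
  qed simp_all
  from rep_slide[OF _ _ _ _ _ _ _ _ _ _ 1 2] show ?thesis by simp
qed

lemma strand_tensor_slide_second: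
  assumes [simp]: "pres x" "pres x'" "pres y" "pres y'" "pres a" "pres b" "pres b'"
    and f: "f \<in> Mor C (po b) (po b')" and \<phi>: "\<phi> \<in> strand (po x) (po x') (po a)" and \<psi>: "\<psi> \<in> Mor C (po b' \<boxtimes> po y) (po y' \<boxtimes> po b)"
  shows "single_class (po x \<boxtimes> po y) (po x' \<boxtimes> po y') (po a \<boxtimes> po b) (strand_tensor C (po x) (po x') (po y) (po y') (po a) (po b) \<phi> (\<psi> \<cdot> (f \<star> Idt C (po y))))
    = single_class (po x \<boxtimes> po y) (po x' \<boxtimes> po y') (po a \<boxtimes> po b') (strand_tensor C (po x) (po x') (po y) (po y') (po a) (po b') \<phi> ((Idt C (po y') \<star> f) \<cdot> \<psi>))"
proof -
  obtain F where F: "rep b b' f F" using rep_ex[of b b' f] f by auto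
  obtain \<Phi> where \<Phi>: "rep (a \<odot>\<odot> x) (x' \<odot>\<odot> a) \<phi> \<Phi>" using rep_ex[of "a \<odot>\<odot> x" "x' \<odot>\<odot> a" \<phi>] \<phi> by auto
  obtain \<Psi> where \<Psi>: "rep (b' \<odot>\<odot> y) (y' \<odot>\<odot> b) \<psi> \<Psi>" using rep_ex[of "b' \<odot>\<odot> y" "y' \<odot>\<odot> b" \<psi>] \<psi> by auto
  note [simp] = rep_simps[OF F] rep_simps[OF \<Phi>] rep_simps[OF \<Psi>]
  let ?R = "strict.right_strand (pw x') (pw a) (pw y') \<Phi>" and ?L = "strict.left_strand (pw x) (pw b') (pw y) \<Psi>"
  let ?\<Theta> = "(?R \<parallel> \<iota> (pw b)) \<bullet> (\<iota> (pw a) \<parallel> ?L)"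
  note L = strict.left_strand_slide[of "pw x" "pw y" "pw y'" F "pw b" "pw b'" \<Psi>]
  note S = strict.stack_slide_inner[of F "pw b" "pw b'" "pw a" "pw x @ pw y" "pw x @ pw y'" "pw x' @ pw y'" ?L ?R]
  have 1: "rep ((a \<odot>\<odot> b) \<odot>\<odot> (x \<odot>\<odot> y)) ((x' \<odot>\<odot> y') \<odot>\<odot> (a \<odot>\<odot> b)) (strand_tensor C (po x) (po x') (po y) (po y') (po a) (po b) \<phi> (\<psi> \<cdot> (f \<star> Idt C (po y))))
     (?\<Theta> \<bullet> ((\<iota> (pw a) \<parallel> F) \<parallel> \<iota> (pw (x \<odot>\<odot> y))))"
  proof (rule rep_cong[OF rep_strand_tensor[OF _ _ _ _ _ _ \<Phi> rep_Cmp[OF rep_TenA[OF F rep_Idt] \<Psi>]]])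
    show "tensor_strand (pw x) (pw x') (pw y) (pw y') (pw a) (pw b) \<Phi> (\<Psi> \<bullet> (F \<parallel> \<iota> (pw y))) = ?\<Theta> \<bullet> ((\<iota> (pw a) \<parallel> F) \<parallel> \<iota> (pw (x \<odot>\<odot> y)))"
      using L(1) S(1) by (simp add: tensor_strand_def strict.comp_strand_def)
  qed simp_all
  have 2: "rep ((a \<odot>\<odot> b') \<odot>\<odot> (x \<odot>\<odot> y)) ((x' \<odot>\<odot> y') \<odot>\<odot> (a \<odot>\<odot> b')) (strand_tensor C (po x) (po x') (po y) (po y') (po a) (po b') \<phi> ((Idt C (po y') \<star> f) \<cdot> \<psi>))
     ((\<iota> (pw (x' \<odot>\<odot> y')) \<parallel> (\<iota> (pw a) \<parallel> F)) \<bullet> ?\<Theta>)"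
  proof (rule rep_cong[OF rep_strand_tensor[OF _ _ _ _ _ _ \<Phi> rep_Cmp[OF \<Psi> rep_TenA[OF rep_Idt F]]]])
    show "tensor_strand (pw x) (pw x') (pw y) (pw y') (pw a) (pw b') \<Phi> ((\<iota> (pw y') \<parallel> F) \<bullet> \<Psi>) = (\<iota> (pw (x' \<odot>\<odot> y')) \<parallel> (\<iota> (pw a) \<parallel> F)) \<bullet> ?\<Theta>"
      using L(2) S(2) by (simp add: tensor_strand_def strict.comp_strand_def)
  qed simp_all
  from rep_slide[OF _ _ _ _ _ _ _ _ _ _ 1 2] show ?thesis by simp
qed

lemma trace_tensor_single:
  assumes [simp]: "X \<in> Obj C" "X' \<in> Obj C" "Y \<in> Obj C" "Y' \<in> Obj C"
    and "A \<in> Obj C" "B \<in> Obj C" "\<phi> \<in> strand X X' A" "\<psi> \<in> strand Y Y' B"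
  shows "trace_tensor C (tarr X X' A \<phi>) (tarr Y Y' B \<psi>)
    = tarr (X \<boxtimes> Y) (X' \<boxtimes> Y') (A \<boxtimes> B) (strand_tensor C X X' Y Y' A B \<phi> \<psi>)"
proof (rule trace_tensor_tarr)
  show "single_class (X \<boxtimes> Y) (X' \<boxtimes> Y') (A \<boxtimes> B) (strand_tensor C X X' Y Y' A B (\<phi> \<cdot> (f \<star> Idt C X)) \<psi>)
    = single_class (X \<boxtimes> Y) (X' \<boxtimes> Y') (A' \<boxtimes> B) (strand_tensor C X X' Y Y' A' B ((Idt C X' \<star> f) \<cdot> \<phi>) \<psi>)"
    if "A \<in> Obj C" "A' \<in> Obj C" "B \<in> Obj C" "f \<in> Mor C A A'" "\<phi> \<in> Mor C (A' \<boxtimes> X) (X' \<boxtimes> A)" "\<psi> \<in> strand Y Y' B"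
    for A A' B f \<phi> \<psi>
    using strand_tensor_slide_first[of "pleaf X" "pleaf X'" "pleaf Y" "pleaf Y'" "pleaf A" "pleaf A'" "pleaf B" f \<phi> \<psi>] that by simp
  show "single_class (X \<boxtimes> Y) (X' \<boxtimes> Y') (A \<boxtimes> B) (strand_tensor C X X' Y Y' A B \<phi> (\<psi> \<cdot> (f \<star> Idt C Y)))
    = single_class (X \<boxtimes> Y) (X' \<boxtimes> Y') (A \<boxtimes> B') (strand_tensor C X X' Y Y' A B' \<phi> ((Idt C Y' \<star> f) \<cdot> \<psi>))"
    if "A \<in> Obj C" "B \<in> Obj C" "B' \<in> Obj C" "f \<in> Mor C B B'" "\<phi> \<in> strand X X' A" "\<psi> \<in> Mor C (B' \<boxtimes> Y) (Y' \<boxtimes> B)"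
    for A B B' f \<phi> \<psi>
    using strand_tensor_slide_second[of "pleaf X" "pleaf X'" "pleaf Y" "pleaf Y'" "pleaf A" "pleaf B" "pleaf B'" f \<phi> \<psi>] that by simp
qed (use assms in simp_all)

lemma cl_tensor:
  assumes \<Phi>: "sstrand x x' a \<Phi>" and \<Psi>: "sstrand y y' b \<Psi>"
  shows "trace_tensor C (cl x x' a \<Phi>) (cl y y' b \<Psi>)
     = cl (x \<odot>\<odot> y) (x' \<odot>\<odot> y') (a \<odot>\<odot> b) (tensor_strand (pw x) (pw x') (pw y) (pw y') (pw a) (pw b) \<Phi> \<Psi>)"
    "sstrand (x \<odot>\<odot> y) (x' \<odot>\<odot> y') (a \<odot>\<odot> b) (tensor_strand (pw x) (pw x') (pw y) (pw y') (pw a) (pw b) \<Phi> \<Psi>)"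
proof -
  have [simp]: "pres x" "pres x'" "pres y" "pres y'" "pres a" "pres b" using assms by (auto simp: sstrand_def)
  obtain \<phi> where \<phi>: "rep (a \<odot>\<odot> x) (x' \<odot>\<odot> a) \<phi> \<Phi>" "cl x x' a \<Phi> = tarr (po x) (po x') (po a) \<phi>" "\<phi> \<in> strand (po x) (po x') (po a)"
    using \<Phi> by (rule sstrand_rep)
  obtain \<psi> where \<psi>: "rep (b \<odot>\<odot> y) (y' \<odot>\<odot> b) \<psi> \<Psi>" "cl y y' b \<Psi> = tarr (po y) (po y') (po b) \<psi>" "\<psi> \<in> strand (po y) (po y') (po b)"
    using \<Psi> by (rule sstrand_rep)
  have r: "rep ((a \<odot>\<odot> b) \<odot>\<odot> (x \<odot>\<odot> y)) ((x' \<odot>\<odot> y') \<odot>\<odot> (a \<odot>\<odot> b))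
     (strand_tensor C (po x) (po x') (po y) (po y') (po a) (po b) \<phi> \<psi>)
     (tensor_strand (pw x) (pw x') (pw y) (pw y') (pw a) (pw b) \<Phi> \<Psi>)"
    by (rule rep_strand_tensor[OF _ _ _ _ _ _ \<phi>(1) \<psi>(1)]) simp_all
  show "sstrand (x \<odot>\<odot> y) (x' \<odot>\<odot> y') (a \<odot>\<odot> b) (tensor_strand (pw x) (pw x') (pw y) (pw y') (pw a) (pw b) \<Phi> \<Psi>)"
    using rep_simps[OF r] by (simp add: sstrand_def)
  have "trace_tensor C (tarr (po x) (po x') (po a) \<phi>) (tarr (po y) (po y') (po b) \<psi>)
      = tarr (po x \<boxtimes> po y) (po x' \<boxtimes> po y') (po a \<boxtimes> po b) (strand_tensor C (po x) (po x') (po y) (po y') (po a) (po b) \<phi> \<psi>)"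
    by (rule trace_tensor_single) (use \<phi> \<psi> in simp_all)
  then show "trace_tensor C (cl x x' a \<Phi>) (cl y y' b \<Psi>)
     = cl (x \<odot>\<odot> y) (x' \<odot>\<odot> y') (a \<odot>\<odot> b) (tensor_strand (pw x) (pw x') (pw y) (pw y') (pw a) (pw b) \<Phi> \<Psi>)"
    using cl_rep[OF r] by (simp add: \<phi>(2) \<psi>(2))
qed

lemma cl_embed:
  assumes r: "rep x x' f F"
  shows "trace_embed C f = cl x x' pone F" "sstrand x x' pone F"
proof -
  have [simp]: "pres x" "pres x'" "sarr F" "sdom F = pw x" "scod F = pw x'" using repD[OF r] rep_simps[OF r] by auto
  have [simp]: "Dom C f = po x" "Cod C f = po x'" using rep_Mor[OF r] by (simp_all add: Mor_iff)
  have "rep (pone \<odot>\<odot> x) (x' \<odot>\<odot> pone) (inv_arr C (RUn C (po x')) \<cdot> f \<cdot> LUn C (po x)) F"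
    by (rule rep_cong, rule rep_Cmp[OF rep_Cmp[OF rep_LUn(1) r] rep_RUn(2)]) simp_all
  from cl_rep[OF this] show "trace_embed C f = cl x x' pone F"
    by (simp add: trace_embed_def Let_def tarr_def single_class_def)
  show "sstrand x x' pone F" by (simp add: sstrand_def)
qed

lemma strand_tilde_slide:
  assumes [simp]: "pres x" "pres x'" "pres a" "pres b"
    and f: "f \<in> Mor C (po a) (po b)" and \<psi>: "\<psi> \<in> Mor C (po b \<boxtimes> po x) (po x' \<boxtimes> po a)"
  shows "single_class (po x) (po x') (Dual C (po a)) (strand_tilde C (po x) (po x') (po a) (\<psi> \<cdot> (f \<star> Idt C (po x))))
    = single_class (po x) (po x') (Dual C (po b)) (strand_tilde C (po x) (po x') (po b) ((Idt C (po x') \<star> f) \<cdot> \<psi>))"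
proof -
  define d e where "d = pleaf (Dual C (po a))" and "e = pleaf (Dual C (po b))"
  have [simp]: "pres d" "pres e" "po d = Dual C (po a)" "po e = Dual C (po b)" by (simp_all add: d_def e_def)
  obtain F where F: "rep a b f F" using rep_ex[of a b f] f by auto
  obtain \<Psi> where \<Psi>: "rep (b \<odot>\<odot> x) (x' \<odot>\<odot> a) \<psi> \<Psi>" using rep_ex[of "b \<odot>\<odot> x" "x' \<odot>\<odot> a" \<psi>] \<psi> by auto
  note [simp] = rep_simps[OF F] rep_simps[OF \<Psi>]
  obtain EV CV where D: "rep (a \<odot>\<odot> d) pone (piv_ev C (po a)) EV" "rep pone (d \<odot>\<odot> a) (piv_coev C (po a)) CV"
    "strict.right_dual (pw a) (pw d) EV CV" by (rule pivot_strict[of a d]) simp_all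
  obtain EV' CV' where E: "rep (b \<odot>\<odot> e) pone (piv_ev C (po b)) EV'" "rep pone (e \<odot>\<odot> b) (piv_coev C (po b)) CV'"
    "strict.right_dual (pw b) (pw e) EV' CV'" by (rule pivot_strict[of b e]) simp_all
  obtain g \<Theta> where g: "sarr g" "sdom g = pw e" "scod g = pw d" "sarr \<Theta>" "sdom \<Theta> = pw d @ pw x" "scod \<Theta> = pw x' @ pw e"
    "strict.tilde_strand (pw x) (pw x') (pw d) EV CV (\<Psi> \<bullet> (F \<parallel> \<iota> (pw x))) = (\<iota> (pw x') \<parallel> g) \<bullet> \<Theta>"
    "strict.tilde_strand (pw x) (pw x') (pw e) EV' CV' ((\<iota> (pw x') \<parallel> F) \<bullet> \<Psi>) = \<Theta> \<bullet> (g \<parallel> \<iota> (pw x))"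
    by (rule strict.tilde_strand_slide[OF D(3) E(3), of "pw x" "pw x'" F \<Psi>]) simp_all
  have 1: "rep (d \<odot>\<odot> x) (x' \<odot>\<odot> d) (strand_tilde C (po x) (po x') (po a) (\<psi> \<cdot> (f \<star> Idt C (po x)))) ((\<iota> (pw x') \<parallel> g) \<bullet> \<Theta>)"
    by (rule rep_cong[OF rep_strand_tilde[OF _ _ _ _ _ rep_Cmp[OF rep_TenA[OF F rep_Idt] \<Psi>] D] g(7)]) simp_all
  have 2: "rep (e \<odot>\<odot> x) (x' \<odot>\<odot> e) (strand_tilde C (po x) (po x') (po b) ((Idt C (po x') \<star> f) \<cdot> \<psi>)) (\<Theta> \<bullet> (g \<parallel> \<iota> (pw x)))"
    by (rule rep_cong[OF rep_strand_tilde[OF _ _ _ _ _ rep_Cmp[OF \<Psi> rep_TenA[OF rep_Idt F]] E] g(8)]) simp_all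
  from rep_slide[OF _ _ _ _ g(1-6) 2 1] show ?thesis by simp
qed

lemma trace_tilde_single:
  assumes [simp]: "X \<in> Obj C" "X' \<in> Obj C" and "A \<in> Obj C" "\<phi> \<in> strand X X' A"
  shows "trace_tilde C (tarr X X' A \<phi>) = tarr X X' (Dual C A) (strand_tilde C X X' A \<phi>)"
proof (rule trace_tilde_tarr)
  show "single_class X X' (Dual C A) (strand_tilde C X X' A (\<psi> \<cdot> (f \<star> Idt C X)))
    = single_class X X' (Dual C B) (strand_tilde C X X' B ((Idt C X' \<star> f) \<cdot> \<psi>))"
    if "A \<in> Obj C" "B \<in> Obj C" "f \<in> Mor C A B" "\<psi> \<in> Mor C (B \<boxtimes> X) (X' \<boxtimes> A)" for A B f \<psi>
    using strand_tilde_slide[of "pleaf X" "pleaf X'" "pleaf A" "pleaf B" f \<psi>] that by simp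
qed (use assms in simp_all)

text \<open>
  Tilde may be computed with any dual of the strand: sliding the identity of \<open>a\<close> from the chosen
  dual to the pivotal one gives a mate between the two duals, and the mate slides.
\<close>

lemma cl_tilde:
  assumes \<Phi>: "sstrand x x' a \<Phi>" and d: "pres d" "strict.right_dual (pw a) (pw d) ev cv"
  shows "trace_tilde C (cl x x' a \<Phi>) = cl x x' d (strict.tilde_strand (pw x) (pw x') (pw d) ev cv \<Phi>)"
    "sstrand x x' d (strict.tilde_strand (pw x) (pw x') (pw d) ev cv \<Phi>)"
proof -
  have [simp]: "pres x" "pres x'" "pres a" "pres d" and \<Phi>s [simp]: "sarr \<Phi>" "sdom \<Phi> = pw a @ pw x" "scod \<Phi> = pw x' @ pw a"
    using assms by (auto simp: sstrand_def)
  show "sstrand x x' d (strict.tilde_strand (pw x) (pw x') (pw d) ev cv \<Phi>)"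
    using strict.tilde_strand_simps[OF d(2), of "pw x" "pw x'" \<Phi>] by (simp add: sstrand_def)
  define e where "e = pleaf (Dual C (po a))"
  have [simp]: "pres e" "po e = Dual C (po a)" by (simp_all add: e_def)
  obtain EV CV where E: "rep (a \<odot>\<odot> e) pone (piv_ev C (po a)) EV" "rep pone (e \<odot>\<odot> a) (piv_coev C (po a)) CV"
    "strict.right_dual (pw a) (pw e) EV CV" by (rule pivot_strict[of a e]) simp_all
  obtain \<phi> where \<phi>: "rep (a \<odot>\<odot> x) (x' \<odot>\<odot> a) \<phi> \<Phi>" "cl x x' a \<Phi> = tarr (po x) (po x') (po a) \<phi>" "\<phi> \<in> strand (po x) (po x') (po a)"
    using \<Phi> by (rule sstrand_rep)
  have "trace_tilde C (tarr (po x) (po x') (po a) \<phi>) = tarr (po x) (po x') (Dual C (po a)) (strand_tilde C (po x) (po x') (po a) \<phi>)"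
    by (rule trace_tilde_single) (use \<phi> in simp_all)
  also have "\<dots> = cl x x' e (strict.tilde_strand (pw x) (pw x') (pw e) EV CV \<Phi>)"
    using cl_rep[OF rep_strand_tilde[OF _ _ _ _ _ \<phi>(1) E]] by simp
  finally have 1: "trace_tilde C (cl x x' a \<Phi>) = cl x x' e (strict.tilde_strand (pw x) (pw x') (pw e) EV CV \<Phi>)"
    by (simp add: \<phi>(2))
  obtain g \<Theta> where g: "sarr g" "sdom g = pw e" "scod g = pw d" "sarr \<Theta>" "sdom \<Theta> = pw d @ pw x" "scod \<Theta> = pw x' @ pw e"
    "strict.tilde_strand (pw x) (pw x') (pw d) ev cv (\<Phi> \<bullet> (\<iota> (pw a) \<parallel> \<iota> (pw x))) = (\<iota> (pw x') \<parallel> g) \<bullet> \<Theta>"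
    "strict.tilde_strand (pw x) (pw x') (pw e) EV CV ((\<iota> (pw x') \<parallel> \<iota> (pw a)) \<bullet> \<Phi>) = \<Theta> \<bullet> (g \<parallel> \<iota> (pw x))"
    by (rule strict.tilde_strand_slide[OF d(2) E(3), of "pw x" "pw x'" "\<iota> (pw a)" \<Phi>]) simp_all
  show "trace_tilde C (cl x x' a \<Phi>) = cl x x' d (strict.tilde_strand (pw x) (pw x') (pw d) ev cv \<Phi>)"
    using cl_slide[OF _ _ _ _ g(1-6)] g(7,8) by (simp add: 1)
qed

end

context premodular_category
begin

section \<open>The horizontal trace as a monoidal category\<close>

text \<open>
  Slide along the identity of the common word: the class depends on the strand only through its
  word.  So the associators between iterated strands do not matter.
\<close>

lemma cl_word:
  assumes "sstrand x x' a \<Phi>" "pres b" "pw b = pw a"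
  shows "cl x x' a \<Phi> = cl x x' b \<Phi>"
  using cl_slide[of x x' a b "\<iota> (pw a)" \<Phi>] assms by (simp add: sstrand_def)

lemma sstrand_word: "sstrand x x' a \<Phi> \<Longrightarrow> pres b \<Longrightarrow> pw b = pw a \<Longrightarrow> sstrand x x' b \<Phi>"
  by (simp add: sstrand_def)

lemma cl_slideI:
  assumes "sstrand x x' a \<Phi>" "sstrand x x' b \<Psi>" "sarr g" "sdom g = pw a" "scod g = pw b"
    "sarr \<Theta>" "sdom \<Theta> = pw b @ pw x" "scod \<Theta> = pw x' @ pw a"
    "\<Phi> = \<Theta> \<bullet> (g \<parallel> \<iota> (pw x))" "\<Psi> = (\<iota> (pw x') \<parallel> g) \<bullet> \<Theta>"
  shows "cl x x' a \<Phi> = cl x x' b \<Psi>"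
  using cl_slide[of x x' a b g \<Theta>] assms by (simp add: sstrand_def)

text \<open>
  An isomorphism of strands can be moved once around.
\<close>

lemma cl_conj:
  assumes P: "sstrand x x' a P" and Q: "sstrand x x' b Q"
    and g: "sarr g" "sdom g = pw b" "scod g = pw a" and h: "sarr h" "sdom h = pw a" "scod h = pw b"
    and hg: "h \<bullet> g = \<iota> (pw b)" "g \<bullet> h = \<iota> (pw a)" and e: "P \<bullet> (g \<parallel> \<iota> (pw x)) = (\<iota> (pw x') \<parallel> g) \<bullet> Q"
  shows "cl x x' a P = cl x x' b Q"
proof -
  note [simp] = P[unfolded sstrand_def] Q[unfolded sstrand_def] g h
  have gh': "(g \<parallel> \<iota> (pw x)) \<bullet> (h \<parallel> \<iota> (pw x)) = \<iota> (pw a @ pw x)" "(h \<parallel> \<iota> (pw x)) \<bullet> (g \<parallel> \<iota> (pw x)) = \<iota> (pw b @ pw x)"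
    using strict.whisk[OF hg(2), of "[]" "pw x"] strict.whisk[OF hg(1), of "[]" "pw x"] by simp_all
  have "P = P \<bullet> (g \<parallel> \<iota> (pw x)) \<bullet> (h \<parallel> \<iota> (pw x))" by (simp add: gh')
  also have "\<dots> = ((\<iota> (pw x') \<parallel> g) \<bullet> Q) \<bullet> (h \<parallel> \<iota> (pw x))" by (rule strict.tail2[OF e]) simp_all
  finally have R: "P = (\<iota> (pw x') \<parallel> g) \<bullet> Q \<bullet> (h \<parallel> \<iota> (pw x))" by simp
  have L: "Q = (Q \<bullet> (h \<parallel> \<iota> (pw x))) \<bullet> (g \<parallel> \<iota> (pw x))" by (simp add: gh')
  show ?thesis by (rule cl_slideI[OF Q P _ _ _ _ _ _ L R, symmetric]) simp_all
qed

lemma trace_cl: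
  assumes "F \<in> Mor \<T> X X'"
  obtains a \<Phi> where "sstrand (pleaf X) (pleaf X') a \<Phi>" "F = cl (pleaf X) (pleaf X') a \<Phi>"
proof -
  have "X \<in> Obj C" "X' \<in> Obj C" using assms by (auto simp: trace_Mor_iff)
  then show thesis by (intro cl_exists[of F "pleaf X" "pleaf X'", OF _ _ _ that]) (use assms in simp_all)
qed

lemma embed_Idt: "pres x \<Longrightarrow> trace_embed C (Idt C (po x)) = cl x x pone (\<iota> (pw x))"
  "pres x \<Longrightarrow> sstrand x x pone (\<iota> (pw x))"
  using cl_embed[OF rep_Idt] by auto

lemma trace_comp_idn:
  assumes F: "sstrand x x' a \<Phi>"
  shows "trace_comp C (cl x' x' pone (\<iota> (pw x'))) (cl x x' a \<Phi>) = cl x x' a \<Phi>"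
    "trace_comp C (cl x x' a \<Phi>) (cl x x pone (\<iota> (pw x))) = cl x x' a \<Phi>"
proof -
  note [simp] = F[unfolded sstrand_def]
  have [simp]: "sstrand x' x' pone (\<iota> (pw x'))" "sstrand x x pone (\<iota> (pw x))" by (simp_all add: sstrand_def)
  show "trace_comp C (cl x' x' pone (\<iota> (pw x'))) (cl x x' a \<Phi>) = cl x x' a \<Phi>"
    using cl_comp(1)[OF F, of x' pone "\<iota> (pw x')"] cl_word[OF F, of "pone \<odot>\<odot> a", symmetric]
    by (simp add: strict.comp_strand_def)
  show "trace_comp C (cl x x' a \<Phi>) (cl x x pone (\<iota> (pw x))) = cl x x' a \<Phi>"
    using cl_comp(1)[OF _ F, of x pone "\<iota> (pw x)"] cl_word[OF F, of "a \<odot>\<odot> pone", symmetric]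
    by (simp add: strict.comp_strand_def)
qed

lemma trace_comp_assoc:
  assumes "sstrand x x' a \<Phi>" "sstrand x' x'' b \<Psi>" "sstrand x'' x''' c \<Xi>"
  shows "trace_comp C (trace_comp C (cl x'' x''' c \<Xi>) (cl x' x'' b \<Psi>)) (cl x x' a \<Phi>)
    = trace_comp C (cl x'' x''' c \<Xi>) (trace_comp C (cl x' x'' b \<Psi>) (cl x x' a \<Phi>))"
proof -
  note [simp] = assms[unfolded sstrand_def]
  note 1 = cl_comp[OF cl_comp(2)[OF assms(1,2)] assms(3)]
  note 2 = cl_comp[OF assms(1) cl_comp(2)[OF assms(2,3)]]
  have "strict.comp_strand (pw c) (pw (b \<odot>\<odot> a)) \<Xi> (strict.comp_strand (pw b) (pw a) \<Psi> \<Phi>)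
      = strict.comp_strand (pw (c \<odot>\<odot> b)) (pw a) (strict.comp_strand (pw c) (pw b) \<Xi> \<Psi>) \<Phi>"
    by (simp add: strict.comp_strand_def)
  then show ?thesis
    using cl_word[OF 1(2), of "(c \<odot>\<odot> b) \<odot>\<odot> a"] by (simp add: cl_comp(1)[OF assms(1,2)] cl_comp(1)[OF assms(2,3)] 1(1) 2(1))
qed

lemma common_strand:
  assumes "F \<in> Mor \<T> X X'" "G \<in> Mor \<T> X X'"
  obtains A \<phi> \<psi> where "A \<in> Obj C" "\<phi> \<in> strand X X' A" "\<psi> \<in> strand X X' A" "F = tarr X X' A \<phi>" "G = tarr X X' A \<psi>"
proof -
  obtain A B \<phi> \<psi> where "X \<in> Obj C" "X' \<in> Obj C" "A \<in> Obj C" "B \<in> Obj C" "\<phi> \<in> strand X X' A" "\<psi> \<in> strand X X' B"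
    "F = tarr X X' A \<phi>" "G = tarr X X' B \<psi>" using assms by (auto simp: trace_Mor_iff)
  moreover from single_class_common_strand[OF this(1-6)] obtain D \<phi>' \<psi>' where "D \<in> Obj C" "\<phi>' \<in> strand X X' D" "\<psi>' \<in> strand X X' D"
    "single_class X X' A \<phi> = single_class X X' D \<phi>'" "single_class X X' B \<psi> = single_class X X' D \<psi>'" by blast
  ultimately show thesis using that[of D \<phi>' \<psi>'] by (simp add: tarr_def)
qed

lemma strand_comp_linear:
  assumes "X \<in> Obj C" "X' \<in> Obj C" "X'' \<in> Obj C" "A \<in> Obj C" "B \<in> Obj C" "\<phi> \<in> strand X X' A" "\<psi> \<in> strand X' X'' B"
  shows "strand_comp C X X' X'' A B \<phi> \<psi> \<in> strand X X'' (B \<boxtimes> A)"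
    "\<phi>' \<in> strand X X' A \<Longrightarrow> strand_comp C X X' X'' A B (Add C \<phi> \<phi>') \<psi> = Add C (strand_comp C X X' X'' A B \<phi> \<psi>) (strand_comp C X X' X'' A B \<phi>' \<psi>)"
    "\<psi>' \<in> strand X' X'' B \<Longrightarrow> strand_comp C X X' X'' A B \<phi> (Add C \<psi> \<psi>') = Add C (strand_comp C X X' X'' A B \<phi> \<psi>) (strand_comp C X X' X'' A B \<phi> \<psi>')"
    "strand_comp C X X' X'' A B (Scl C k \<phi>) \<psi> = Scl C k (strand_comp C X X' X'' A B \<phi> \<psi>)"
    "strand_comp C X X' X'' A B \<phi> (Scl C k \<psi>) = Scl C k (strand_comp C X X' X'' A B \<phi> \<psi>)"
  using assms by (simp_all add: strand_comp_def Mor_iff linear_simps TenA_linear)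

lemma strand_tensor_linear:
  assumes "X \<in> Obj C" "X' \<in> Obj C" "Y \<in> Obj C" "Y' \<in> Obj C" "A \<in> Obj C" "B \<in> Obj C" "\<phi> \<in> strand X X' A" "\<psi> \<in> strand Y Y' B"
  shows "strand_tensor C X X' Y Y' A B \<phi> \<psi> \<in> strand (X \<boxtimes> Y) (X' \<boxtimes> Y') (A \<boxtimes> B)"
    "\<phi>' \<in> strand X X' A \<Longrightarrow> strand_tensor C X X' Y Y' A B (Add C \<phi> \<phi>') \<psi> = Add C (strand_tensor C X X' Y Y' A B \<phi> \<psi>) (strand_tensor C X X' Y Y' A B \<phi>' \<psi>)"
    "\<psi>' \<in> strand Y Y' B \<Longrightarrow> strand_tensor C X X' Y Y' A B \<phi> (Add C \<psi> \<psi>') = Add C (strand_tensor C X X' Y Y' A B \<phi> \<psi>) (strand_tensor C X X' Y Y' A B \<phi> \<psi>')"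
    "strand_tensor C X X' Y Y' A B (Scl C k \<phi>) \<psi> = Scl C k (strand_tensor C X X' Y Y' A B \<phi> \<psi>)"
    "strand_tensor C X X' Y Y' A B \<phi> (Scl C k \<psi>) = Scl C k (strand_tensor C X X' Y Y' A B \<phi> \<psi>)"
  using assms by (simp_all add: strand_tensor_def Mor_iff linear_simps TenA_linear)

lemma trace_linear_category: "linear_category \<T>"
proof (rule linear_category.intro)
  fix F X X' assume F: "F \<in> Arr \<T>"
  then show "Dom \<T> F \<in> Obj \<T> \<and> Cod \<T> F \<in> Obj \<T>" by (auto simp: trace_Arr_iff trace_Mor_iff)
next
  fix X assume "X \<in> Obj \<T>"
  then show "Idt \<T> X \<in> Mor \<T> X X" using cl_Mor[OF embed_Idt(2), of "pleaf X"] embed_Idt(1)[of "pleaf X"] by simp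
next
  fix F G X X' X'' assume F: "F \<in> Mor \<T> X X'" and G: "G \<in> Mor \<T> X' X''"
  obtain a \<Phi> b \<Psi> where 1: "sstrand (pleaf X) (pleaf X') a \<Phi>" "F = cl (pleaf X) (pleaf X') a \<Phi>"
    "sstrand (pleaf X') (pleaf X'') b \<Psi>" "G = cl (pleaf X') (pleaf X'') b \<Psi>" using trace_cl[OF F] trace_cl[OF G] by metis
  show "G \<cdot>\<^bsub>\<T>\<^esub> F \<in> Mor \<T> X X''" using cl_Mor[OF cl_comp(2)[OF 1(1,3)]] cl_comp(1)[OF 1(1,3)] by (simp add: 1(2,4))
next
  fix F X X' assume F: "F \<in> Mor \<T> X X'"
  obtain a \<Phi> where 1: "sstrand (pleaf X) (pleaf X') a \<Phi>" "F = cl (pleaf X) (pleaf X') a \<Phi>" using trace_cl[OF F] .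
  have X: "X \<in> Obj C" "X' \<in> Obj C" using F by (auto simp: trace_Mor_iff)
  show "F \<cdot>\<^bsub>\<T>\<^esub> Idt \<T> X = F" "Idt \<T> X' \<cdot>\<^bsub>\<T>\<^esub> F = F"
    using trace_comp_idn[OF 1(1)] embed_Idt(1)[of "pleaf X"] embed_Idt(1)[of "pleaf X'"] X by (simp_all add: 1(2))
next
  fix F G H W X Y Z assume F: "F \<in> Mor \<T> W X" and G: "G \<in> Mor \<T> X Y" and H: "H \<in> Mor \<T> Y Z"
  obtain a \<Phi> where 1: "sstrand (pleaf W) (pleaf X) a \<Phi>" "F = cl (pleaf W) (pleaf X) a \<Phi>" using trace_cl[OF F] .
  obtain b \<Psi> where 2: "sstrand (pleaf X) (pleaf Y) b \<Psi>" "G = cl (pleaf X) (pleaf Y) b \<Psi>" using trace_cl[OF G] .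
  obtain c \<Xi> where 3: "sstrand (pleaf Y) (pleaf Z) c \<Xi>" "H = cl (pleaf Y) (pleaf Z) c \<Xi>" using trace_cl[OF H] .
  show "(H \<cdot>\<^bsub>\<T>\<^esub> G) \<cdot>\<^bsub>\<T>\<^esub> F = H \<cdot>\<^bsub>\<T>\<^esub> (G \<cdot>\<^bsub>\<T>\<^esub> F)" using trace_comp_assoc[OF 1(1) 2(1) 3(1)] by (simp add: 1(2) 2(2) 3(2))
next
  fix X Y assume "X \<in> Obj \<T>" "Y \<in> Obj \<T>"
  then show "module (scalars :: 'k ring) (hom_space \<T> X Y)" by (simp add: trace_hom_module)
next
  fix F F' G X Y Z assume F: "F \<in> Mor \<T> X Y" "F' \<in> Mor \<T> X Y" and G: "G \<in> Mor \<T> Y Z"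
  obtain A \<phi> \<phi>' where 1: "A \<in> Obj C" "\<phi> \<in> strand X Y A" "\<phi>' \<in> strand X Y A" "F = tarr X Y A \<phi>" "F' = tarr X Y A \<phi>'"
    using common_strand[OF F] .
  obtain B \<psi> where 2: "X \<in> Obj C" "Y \<in> Obj C" "Z \<in> Obj C" "B \<in> Obj C" "\<psi> \<in> strand Y Z B" "G = tarr Y Z B \<psi>"
    using F G by (auto simp: trace_Mor_iff)
  show "G \<cdot>\<^bsub>\<T>\<^esub> Add \<T> F F' = Add \<T> (G \<cdot>\<^bsub>\<T>\<^esub> F) (G \<cdot>\<^bsub>\<T>\<^esub> F')"
    using 1 2 by (simp add: tarr_Add trace_comp_single strand_comp_linear Add_Mor)
next
  fix F G G' X Y Z assume F: "F \<in> Mor \<T> X Y" and G: "G \<in> Mor \<T> Y Z" "G' \<in> Mor \<T> Y Z"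
  obtain B \<psi> \<psi>' where 1: "B \<in> Obj C" "\<psi> \<in> strand Y Z B" "\<psi>' \<in> strand Y Z B" "G = tarr Y Z B \<psi>" "G' = tarr Y Z B \<psi>'"
    using common_strand[OF G] .
  obtain A \<phi> where 2: "X \<in> Obj C" "Y \<in> Obj C" "Z \<in> Obj C" "A \<in> Obj C" "\<phi> \<in> strand X Y A" "F = tarr X Y A \<phi>"
    using F G by (auto simp: trace_Mor_iff)
  show "Add \<T> G G' \<cdot>\<^bsub>\<T>\<^esub> F = Add \<T> (G \<cdot>\<^bsub>\<T>\<^esub> F) (G' \<cdot>\<^bsub>\<T>\<^esub> F)"
    using 1 2 by (simp add: tarr_Add trace_comp_single strand_comp_linear Add_Mor)
next
  fix F G X Y Z k assume F: "F \<in> Mor \<T> X Y" and G: "G \<in> Mor \<T> Y Z"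
  obtain A \<phi> B \<psi> where 1: "X \<in> Obj C" "Y \<in> Obj C" "Z \<in> Obj C" "A \<in> Obj C" "\<phi> \<in> strand X Y A" "F = tarr X Y A \<phi>"
    "B \<in> Obj C" "\<psi> \<in> strand Y Z B" "G = tarr Y Z B \<psi>"
    using F G by (auto simp: trace_Mor_iff)
  show "G \<cdot>\<^bsub>\<T>\<^esub> Scl \<T> k F = Scl \<T> k (G \<cdot>\<^bsub>\<T>\<^esub> F)" "Scl \<T> k G \<cdot>\<^bsub>\<T>\<^esub> F = Scl \<T> k (G \<cdot>\<^bsub>\<T>\<^esub> F)"
    using 1 by (simp_all add: tarr_Scl trace_comp_single strand_comp_linear Scl_Mor)
qed

lemma tensor_idn_cl:
  assumes F: "sstrand x x' a \<Phi>" and [simp]: "pres y"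
  shows "trace_tensor C (cl x x' a \<Phi>) (cl y y pone (\<iota> (pw y))) = cl (x \<odot>\<odot> y) (x' \<odot>\<odot> y) a (strict.right_strand (pw x') (pw a) (pw y) \<Phi>)"
    "sstrand (x \<odot>\<odot> y) (x' \<odot>\<odot> y) a (strict.right_strand (pw x') (pw a) (pw y) \<Phi>)"
    "trace_tensor C (cl y y pone (\<iota> (pw y))) (cl x x' a \<Phi>) = cl (y \<odot>\<odot> x) (y \<odot>\<odot> x') a (strict.left_strand (pw y) (pw a) (pw x) \<Phi>)"
    "sstrand (y \<odot>\<odot> x) (y \<odot>\<odot> x') a (strict.left_strand (pw y) (pw a) (pw x) \<Phi>)"
proof -
  note [simp] = F[unfolded sstrand_def]
  have y: "sstrand y y pone (\<iota> (pw y))" by (simp add: sstrand_def)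
  have "tensor_strand (pw x) (pw x') (pw y) (pw y) (pw a) [] \<Phi> (\<iota> (pw y)) = strict.right_strand (pw x') (pw a) (pw y) \<Phi>"
    by (simp add: tensor_strand_def strict.comp_strand_def)
  then show "trace_tensor C (cl x x' a \<Phi>) (cl y y pone (\<iota> (pw y))) = cl (x \<odot>\<odot> y) (x' \<odot>\<odot> y) a (strict.right_strand (pw x') (pw a) (pw y) \<Phi>)"
    using cl_tensor[OF F y] cl_word[OF cl_tensor(2)[OF F y], of a] by simp
  show "sstrand (x \<odot>\<odot> y) (x' \<odot>\<odot> y) a (strict.right_strand (pw x') (pw a) (pw y) \<Phi>)" by (simp add: sstrand_def)
  have "tensor_strand (pw y) (pw y) (pw x) (pw x') [] (pw a) (\<iota> (pw y)) \<Phi> = strict.left_strand (pw y) (pw a) (pw x) \<Phi>"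
    by (simp add: tensor_strand_def strict.comp_strand_def)
  then show "trace_tensor C (cl y y pone (\<iota> (pw y))) (cl x x' a \<Phi>) = cl (y \<odot>\<odot> x) (y \<odot>\<odot> x') a (strict.left_strand (pw y) (pw a) (pw x) \<Phi>)"
    using cl_tensor[OF y F] cl_word[OF cl_tensor(2)[OF y F], of a] by simp
  show "sstrand (y \<odot>\<odot> x) (y \<odot>\<odot> x') a (strict.left_strand (pw y) (pw a) (pw x) \<Phi>)" by (simp add: sstrand_def)
qed

text \<open>
  The first factorisation is the definition of the tensor product; the second one has the strands
  in the opposite order, and the braiding of the strands conjugates one into the other.
\<close>

lemma tensor_factor_cl:
  assumes F: "sstrand x x' a \<Phi>" and G: "sstrand y y' b \<Psi>"
  shows "trace_tensor C (cl x x' a \<Phi>) (cl y y' b \<Psi>)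
      = trace_comp C (trace_tensor C (cl x x' a \<Phi>) (cl y' y' pone (\<iota> (pw y')))) (trace_tensor C (cl x x pone (\<iota> (pw x))) (cl y y' b \<Psi>))"
    "trace_tensor C (cl x x' a \<Phi>) (cl y y' b \<Psi>)
      = trace_comp C (trace_tensor C (cl x' x' pone (\<iota> (pw x'))) (cl y y' b \<Psi>)) (trace_tensor C (cl x x' a \<Phi>) (cl y y pone (\<iota> (pw y))))"
proof -
  note [simp] = F[unfolded sstrand_def] G[unfolded sstrand_def]
  have y: "pres y" "pres y'" "pres x" "pres x'" by simp_all
  note 1 = cl_comp[OF tensor_idn_cl(4)[OF G y(3)] tensor_idn_cl(2)[OF F y(2)]]
  note 2 = cl_comp[OF tensor_idn_cl(2)[OF F y(1)] tensor_idn_cl(4)[OF G y(4)]]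
  show "trace_tensor C (cl x x' a \<Phi>) (cl y y' b \<Psi>)
      = trace_comp C (trace_tensor C (cl x x' a \<Phi>) (cl y' y' pone (\<iota> (pw y')))) (trace_tensor C (cl x x pone (\<iota> (pw x))) (cl y y' b \<Psi>))"
    unfolding tensor_idn_cl(1)[OF F y(2)] tensor_idn_cl(3)[OF G y(3)] 1(1) cl_tensor(1)[OF F G] tensor_strand_def ..
  have "cl (x \<odot>\<odot> y) (x' \<odot>\<odot> y') (b \<odot>\<odot> a) (strict.comp_strand (pw b) (pw a) (strict.left_strand (pw x') (pw b) (pw y) \<Psi>) (strict.right_strand (pw x') (pw a) (pw y) \<Phi>))
      = cl (x \<odot>\<odot> y) (x' \<odot>\<odot> y') (a \<odot>\<odot> b) (strict.comp_strand (pw a) (pw b) (strict.right_strand (pw x') (pw a) (pw y') \<Phi>) (strict.left_strand (pw x) (pw b) (pw y) \<Psi>))"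
  proof -
    let ?L = "strict.comp_strand (pw b) (pw a) (strict.left_strand (pw x') (pw b) (pw y) \<Psi>) (strict.right_strand (pw x') (pw a) (pw y) \<Phi>)"
    let ?R = "strict.comp_strand (pw a) (pw b) (strict.right_strand (pw x') (pw a) (pw y') \<Phi>) (strict.left_strand (pw x) (pw b) (pw y) \<Psi>)"
    have e: "?R \<bullet> (sbr (pw b) (pw a) \<parallel> \<iota> (pw x @ pw y)) = (\<iota> (pw x' @ pw y') \<parallel> sbr (pw b) (pw a)) \<bullet> ?L"
      by (rule strict.left_right_strand_commute) simp_all
    show ?thesis
      by (rule cl_conj[OF 1(2) 2(2), where g = "sbr (pw b) (pw a)" and h = "sbri (pw b) (pw a)", symmetric]) (use e in simp_all)
  qed
  then show "trace_tensor C (cl x x' a \<Phi>) (cl y y' b \<Psi>)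
      = trace_comp C (trace_tensor C (cl x' x' pone (\<iota> (pw x'))) (cl y y' b \<Psi>)) (trace_tensor C (cl x x' a \<Phi>) (cl y y pone (\<iota> (pw y))))"
    unfolding tensor_idn_cl(1)[OF F y(1)] tensor_idn_cl(3)[OF G y(4)] 2(1) cl_tensor(1)[OF F G] tensor_strand_def by simp
qed

end

context premodular_category
begin

sublocale trace: linear_category \<T> by (rule trace_linear_category)

lemma cl_comp_embed:
  assumes F: "sstrand x x' a \<Phi>"
  shows "rep x' x'' g G \<Longrightarrow> trace_comp C (trace_embed C g) (cl x x' a \<Phi>) = cl x x'' a ((G \<parallel> \<iota> (pw a)) \<bullet> \<Phi>)"
    "rep y x g G \<Longrightarrow> trace_comp C (cl x x' a \<Phi>) (trace_embed C g) = cl y x' a (\<Phi> \<bullet> (\<iota> (pw a) \<parallel> G))"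
proof -
  note [simp] = F[unfolded sstrand_def]
  show "trace_comp C (trace_embed C g) (cl x x' a \<Phi>) = cl x x'' a ((G \<parallel> \<iota> (pw a)) \<bullet> \<Phi>)" if r: "rep x' x'' g G"
  proof -
    note [simp] = rep_simps[OF r] cl_embed(2)[OF r]
    note c = cl_comp[OF F cl_embed(2)[OF r]]
    show ?thesis using cl_word[OF c(2), of a] by (simp add: cl_embed(1)[OF r] c(1) strict.comp_strand_def)
  qed
  show "trace_comp C (cl x x' a \<Phi>) (trace_embed C g) = cl y x' a (\<Phi> \<bullet> (\<iota> (pw a) \<parallel> G))" if r: "rep y x g G"
  proof -
    note [simp] = rep_simps[OF r] cl_embed(2)[OF r]
    note c = cl_comp[OF cl_embed(2)[OF r] F]
    show ?thesis using cl_word[OF c(2), of a] by (simp add: cl_embed(1)[OF r] c(1) strict.comp_strand_def)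
  qed
qed

text \<open>
  Arrows of the trace induced by coherence isomorphisms change the presentations only.
\<close>

lemma cl_comp_coherence:
  assumes F: "sstrand x x' a \<Phi>"
  shows "rep x' x'' g (\<iota> w) \<Longrightarrow> trace_comp C (trace_embed C g) (cl x x' a \<Phi>) = cl x x'' a \<Phi>"
    "rep y x g (\<iota> w) \<Longrightarrow> trace_comp C (cl x x' a \<Phi>) (trace_embed C g) = cl y x' a \<Phi>"
proof -
  note [simp] = F[unfolded sstrand_def]
  show "trace_comp C (trace_embed C g) (cl x x' a \<Phi>) = cl x x'' a \<Phi>" if r: "rep x' x'' g (\<iota> w)"
    using rep_simps[OF r] repD[OF r] by (simp add: cl_comp_embed(1)[OF F r])
  show "trace_comp C (cl x x' a \<Phi>) (trace_embed C g) = cl y x' a \<Phi>" if r: "rep y x g (\<iota> w)"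
    using rep_simps[OF r] repD[OF r] by (simp add: cl_comp_embed(2)[OF F r])
qed

lemma embed_rep:
  assumes "f \<in> Mor C X Y"
  obtains F where "rep (pleaf X) (pleaf Y) f F"
  using rep_ex[of "pleaf X" "pleaf Y" f] assms Mor_Obj[OF assms] by auto

lemma embed_Mor: "f \<in> Mor C X Y \<Longrightarrow> trace_embed C f \<in> Mor \<T> X Y"
  using embed_rep[of f X Y] cl_embed cl_Mor by (metis pleaf_simps(1))

lemma embed_Cmp:
  assumes "f \<in> Mor C X Y" "g \<in> Mor C Y Z"
  shows "trace_embed C (g \<cdot> f) = trace_embed C g \<cdot>\<^bsub>\<T>\<^esub> trace_embed C f"
proof -
  obtain F where F: "rep (pleaf X) (pleaf Y) f F" using assms(1) by (rule embed_rep)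
  obtain G where G: "rep (pleaf Y) (pleaf Z) g G" using assms(2) by (rule embed_rep)
  have "pres (pleaf X)" "pres (pleaf Z)" using F G by (auto simp: rep_def)
  then show ?thesis
    using rep_simps[OF F] rep_simps[OF G]
    by (simp add: cl_embed(1)[OF rep_Cmp[OF F G]] cl_embed(1)[OF F] cl_comp_embed(1)[OF cl_embed(2)[OF F] G])
qed

lemma embed_iso:
  assumes "f \<in> Mor C X Y" "iso_arr C f"
  shows "iso_arr \<T> (trace_embed C f)" "inv_arr \<T> (trace_embed C f) = trace_embed C (inv_arr C f)"
proof -
  have [simp]: "f \<in> Arr C" "Dom C f = X" "Cod C f = Y" using assms by (auto simp: Mor_iff)
  have i: "inv_arr C f \<in> Mor C Y X" using inv_arr_Mor[OF assms] .
  have e: "trace_embed C (inv_arr C f) \<cdot>\<^bsub>\<T>\<^esub> trace_embed C f = Idt \<T> X" "trace_embed C f \<cdot>\<^bsub>\<T>\<^esub> trace_embed C (inv_arr C f) = Idt \<T> Y"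
    using embed_Cmp[OF assms(1) i] embed_Cmp[OF i assms(1)] assms(2) by simp_all
  show "iso_arr \<T> (trace_embed C f)" "inv_arr \<T> (trace_embed C f) = trace_embed C (inv_arr C f)"
    using trace.inv_arrI[OF embed_Mor[OF assms(1)] embed_Mor[OF i] e] by simp_all
qed

lemma embed_TenA:
  assumes "f \<in> Mor C X X'" "g \<in> Mor C Y Y'"
  shows "trace_embed C (f \<star> g) = trace_embed C f \<star>\<^bsub>\<T>\<^esub> trace_embed C g"
proof -
  obtain F where F: "rep (pleaf X) (pleaf X') f F" using assms(1) by (rule embed_rep)
  obtain G where G: "rep (pleaf Y) (pleaf Y') g G" using assms(2) by (rule embed_rep)
  note [simp] = rep_simps[OF F, simplified] rep_simps[OF G, simplified]
  have [simp]: "X \<in> Obj C" "Y \<in> Obj C" "X' \<in> Obj C" "Y' \<in> Obj C" using assms Mor_Obj by auto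
  have "tensor_strand (pw (pleaf X)) (pw (pleaf X')) (pw (pleaf Y)) (pw (pleaf Y')) [] [] F G = F \<parallel> G"
    by (simp add: tensor_strand_def strict.comp_strand_def strict.ten_split1[of F G])
  then show ?thesis
    using cl_tensor[OF cl_embed(2)[OF F] cl_embed(2)[OF G]]
      cl_word[OF cl_tensor(2)[OF cl_embed(2)[OF F] cl_embed(2)[OF G]], of pone]
    by (simp add: cl_embed(1)[OF rep_TenA[OF F G]] cl_embed(1)[OF F] cl_embed(1)[OF G])
qed

lemma trace_TenA_Mor:
  assumes "F \<in> Mor \<T> X X'" "G \<in> Mor \<T> Y Y'"
  shows "F \<star>\<^bsub>\<T>\<^esub> G \<in> Mor \<T> (X \<boxtimes> Y) (X' \<boxtimes> Y')"
proof -
  obtain a \<Phi> where 1: "sstrand (pleaf X) (pleaf X') a \<Phi>" "F = cl (pleaf X) (pleaf X') a \<Phi>" using trace_cl[OF assms(1)] .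
  obtain b \<Psi> where 2: "sstrand (pleaf Y) (pleaf Y') b \<Psi>" "G = cl (pleaf Y) (pleaf Y') b \<Psi>" using trace_cl[OF assms(2)] .
  show ?thesis using cl_Mor[OF cl_tensor(2)[OF 1(1) 2(1)]] cl_tensor(1)[OF 1(1) 2(1)] by (simp add: 1(2) 2(2))
qed

lemma trace_tensor_factor:
  assumes "F \<in> Mor \<T> X X'" "G \<in> Mor \<T> Y Y'"
  shows "F \<star>\<^bsub>\<T>\<^esub> G = (F \<star>\<^bsub>\<T>\<^esub> Idt \<T> Y') \<cdot>\<^bsub>\<T>\<^esub> (Idt \<T> X \<star>\<^bsub>\<T>\<^esub> G)"
    "F \<star>\<^bsub>\<T>\<^esub> G = (Idt \<T> X' \<star>\<^bsub>\<T>\<^esub> G) \<cdot>\<^bsub>\<T>\<^esub> (F \<star>\<^bsub>\<T>\<^esub> Idt \<T> Y)"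
proof -
  obtain a \<Phi> where 1: "sstrand (pleaf X) (pleaf X') a \<Phi>" "F = cl (pleaf X) (pleaf X') a \<Phi>" using trace_cl[OF assms(1)] .
  obtain b \<Psi> where 2: "sstrand (pleaf Y) (pleaf Y') b \<Psi>" "G = cl (pleaf Y) (pleaf Y') b \<Psi>" using trace_cl[OF assms(2)] .
  have "pres (pleaf X)" "pres (pleaf X')" "pres (pleaf Y)" "pres (pleaf Y')" using 1(1) 2(1) by (auto simp: sstrand_def)
  note i = this[THEN embed_Idt(1)]
  show "F \<star>\<^bsub>\<T>\<^esub> G = (F \<star>\<^bsub>\<T>\<^esub> Idt \<T> Y') \<cdot>\<^bsub>\<T>\<^esub> (Idt \<T> X \<star>\<^bsub>\<T>\<^esub> G)"
    "F \<star>\<^bsub>\<T>\<^esub> G = (Idt \<T> X' \<star>\<^bsub>\<T>\<^esub> G) \<cdot>\<^bsub>\<T>\<^esub> (F \<star>\<^bsub>\<T>\<^esub> Idt \<T> Y)"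
    using tensor_factor_cl[OF 1(1) 2(1)] i by (simp_all add: 1(2) 2(2))
qed

lemma trace_whisker_comp:
  assumes F: "F \<in> Mor \<T> X X'" and G: "G \<in> Mor \<T> X' X''" and Y: "Y \<in> Obj C"
  shows "(G \<cdot>\<^bsub>\<T>\<^esub> F) \<star>\<^bsub>\<T>\<^esub> Idt \<T> Y = (G \<star>\<^bsub>\<T>\<^esub> Idt \<T> Y) \<cdot>\<^bsub>\<T>\<^esub> (F \<star>\<^bsub>\<T>\<^esub> Idt \<T> Y)"
    "Idt \<T> Y \<star>\<^bsub>\<T>\<^esub> (G \<cdot>\<^bsub>\<T>\<^esub> F) = (Idt \<T> Y \<star>\<^bsub>\<T>\<^esub> G) \<cdot>\<^bsub>\<T>\<^esub> (Idt \<T> Y \<star>\<^bsub>\<T>\<^esub> F)"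
proof -
  obtain a \<Phi> where 1: "sstrand (pleaf X) (pleaf X') a \<Phi>" "F = cl (pleaf X) (pleaf X') a \<Phi>" using trace_cl[OF F] .
  obtain b \<Psi> where 2: "sstrand (pleaf X') (pleaf X'') b \<Psi>" "G = cl (pleaf X') (pleaf X'') b \<Psi>" using trace_cl[OF G] .
  define x x' x'' y where d: "x = pleaf X" "x' = pleaf X'" "x'' = pleaf X''" "y = pleaf Y"
  have [simp]: "pres y" using Y by (simp add: d)
  note s1 = 1(1)[folded d] and s2 = 2(1)[folded d]
  note [simp] = s1[unfolded sstrand_def] s2[unfolded sstrand_def]
  have i: "trace_embed C (Idt C Y) = cl y y pone (\<iota> (pw y))" using embed_Idt(1)[of y] Y by (simp add: d)
  have r: "strict.right_strand (pw x'') (pw b @ pw a) (pw y) (strict.comp_strand (pw b) (pw a) \<Psi> \<Phi>)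
     = strict.comp_strand (pw b) (pw a) (strict.right_strand (pw x'') (pw b) (pw y) \<Psi>) (strict.right_strand (pw x') (pw a) (pw y) \<Phi>)"
    by (rule strict.right_strand_comp[of _ _ "pw x"]) simp_all
  have l: "strict.left_strand (pw y) (pw b @ pw a) (pw x) (strict.comp_strand (pw b) (pw a) \<Psi> \<Phi>)
     = strict.comp_strand (pw b) (pw a) (strict.left_strand (pw y) (pw b) (pw x') \<Psi>) (strict.left_strand (pw y) (pw a) (pw x) \<Phi>)"
    by (rule strict.left_strand_comp[of _ _ _ _ _ "pw x''"]) simp_all
  note t1 = tensor_idn_cl[OF s1 \<open>pres y\<close>] and t2 = tensor_idn_cl[OF s2 \<open>pres y\<close>]
  show "(G \<cdot>\<^bsub>\<T>\<^esub> F) \<star>\<^bsub>\<T>\<^esub> Idt \<T> Y = (G \<star>\<^bsub>\<T>\<^esub> Idt \<T> Y) \<cdot>\<^bsub>\<T>\<^esub> (F \<star>\<^bsub>\<T>\<^esub> Idt \<T> Y)"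
    "Idt \<T> Y \<star>\<^bsub>\<T>\<^esub> (G \<cdot>\<^bsub>\<T>\<^esub> F) = (Idt \<T> Y \<star>\<^bsub>\<T>\<^esub> G) \<cdot>\<^bsub>\<T>\<^esub> (Idt \<T> Y \<star>\<^bsub>\<T>\<^esub> F)"
    unfolding i 1(2)[folded d] 2(2)[folded d] trace_sel cl_comp(1)[OF s1 s2] t1(1,3) t2(1,3)
      tensor_idn_cl(1,3)[OF cl_comp(2)[OF s1 s2] \<open>pres y\<close>] cl_comp(1)[OF t1(2) t2(2)] cl_comp(1)[OF t1(4) t2(4)]
    by (simp_all add: r l)
qed

lemma trace_Idt_Mor: "X \<in> Obj C \<Longrightarrow> Idt \<T> X \<in> Mor \<T> X X"
  using trace.Idt_Mor[of X] by simp

text \<open>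
  Follows from the two factorisations and from functoriality of tensoring with an identity.
\<close>

lemma trace_interchange:
  assumes F: "F \<in> Mor \<T> X X'" "F' \<in> Mor \<T> X' X''" and G: "G \<in> Mor \<T> Y Y'" "G' \<in> Mor \<T> Y' Y''"
  shows "(F' \<cdot>\<^bsub>\<T>\<^esub> F) \<star>\<^bsub>\<T>\<^esub> (G' \<cdot>\<^bsub>\<T>\<^esub> G) = (F' \<star>\<^bsub>\<T>\<^esub> G') \<cdot>\<^bsub>\<T>\<^esub> (F \<star>\<^bsub>\<T>\<^esub> G)"
proof -
  have o: "X \<in> Obj C" "X' \<in> Obj C" "Y' \<in> Obj C" "Y'' \<in> Obj C" using F G by (auto simp: trace_Mor_iff)
  note i = o[THEN trace_Idt_Mor]
  note fy = trace_TenA_Mor[OF F(1) i(3)] trace_TenA_Mor[OF F(1) i(4)] trace_TenA_Mor[OF F(2) i(4)]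
    and gx = trace_TenA_Mor[OF i(1) G(1)] trace_TenA_Mor[OF i(1) G(2)] trace_TenA_Mor[OF i(2) G(2)]
  have "(F' \<cdot>\<^bsub>\<T>\<^esub> F) \<star>\<^bsub>\<T>\<^esub> (G' \<cdot>\<^bsub>\<T>\<^esub> G)
      = ((F' \<star>\<^bsub>\<T>\<^esub> Idt \<T> Y'') \<cdot>\<^bsub>\<T>\<^esub> (F \<star>\<^bsub>\<T>\<^esub> Idt \<T> Y'')) \<cdot>\<^bsub>\<T>\<^esub> ((Idt \<T> X \<star>\<^bsub>\<T>\<^esub> G') \<cdot>\<^bsub>\<T>\<^esub> (Idt \<T> X \<star>\<^bsub>\<T>\<^esub> G))"
    unfolding trace_tensor_factor(1)[OF trace.Cmp_Mor[OF F] trace.Cmp_Mor[OF G]] trace_whisker_comp(1)[OF F o(4)] trace_whisker_comp(2)[OF G o(1)] ..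
  also have "\<dots> = (F' \<star>\<^bsub>\<T>\<^esub> Idt \<T> Y'') \<cdot>\<^bsub>\<T>\<^esub> ((F \<star>\<^bsub>\<T>\<^esub> Idt \<T> Y'') \<cdot>\<^bsub>\<T>\<^esub> (Idt \<T> X \<star>\<^bsub>\<T>\<^esub> G')) \<cdot>\<^bsub>\<T>\<^esub> (Idt \<T> X \<star>\<^bsub>\<T>\<^esub> G)"
    using trace.Cmp_assoc[OF trace.Cmp_Mor[OF gx(1,2)] fy(2,3)] trace.Cmp_assoc[OF gx(1,2) fy(2)] by (simp del: trace_sel)
  also have "(F \<star>\<^bsub>\<T>\<^esub> Idt \<T> Y'') \<cdot>\<^bsub>\<T>\<^esub> (Idt \<T> X \<star>\<^bsub>\<T>\<^esub> G') = (Idt \<T> X' \<star>\<^bsub>\<T>\<^esub> G') \<cdot>\<^bsub>\<T>\<^esub> (F \<star>\<^bsub>\<T>\<^esub> Idt \<T> Y')"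
    using trace_tensor_factor[OF F(1) G(2)] by metis
  also have "(F' \<star>\<^bsub>\<T>\<^esub> Idt \<T> Y'') \<cdot>\<^bsub>\<T>\<^esub> ((Idt \<T> X' \<star>\<^bsub>\<T>\<^esub> G') \<cdot>\<^bsub>\<T>\<^esub> (F \<star>\<^bsub>\<T>\<^esub> Idt \<T> Y')) \<cdot>\<^bsub>\<T>\<^esub> (Idt \<T> X \<star>\<^bsub>\<T>\<^esub> G)
      = ((F' \<star>\<^bsub>\<T>\<^esub> Idt \<T> Y'') \<cdot>\<^bsub>\<T>\<^esub> (Idt \<T> X' \<star>\<^bsub>\<T>\<^esub> G')) \<cdot>\<^bsub>\<T>\<^esub> ((F \<star>\<^bsub>\<T>\<^esub> Idt \<T> Y') \<cdot>\<^bsub>\<T>\<^esub> (Idt \<T> X \<star>\<^bsub>\<T>\<^esub> G))"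
    using trace.Cmp_assoc[OF trace.Cmp_Mor[OF gx(1) fy(1)] gx(3) fy(3)] trace.Cmp_assoc[OF gx(1) fy(1) gx(3)] by (simp del: trace_sel)
  also have "\<dots> = (F' \<star>\<^bsub>\<T>\<^esub> G') \<cdot>\<^bsub>\<T>\<^esub> (F \<star>\<^bsub>\<T>\<^esub> G)"
    unfolding trace_tensor_factor(1)[OF F(1) G(1)] trace_tensor_factor(1)[OF F(2) G(2)] ..
  finally show ?thesis .
qed

text \<open>
  Both sides are the composite of three whiskered strands.
\<close>

lemma tensor_strand_assoc:
  assumes F: "sstrand x x' a \<Phi>" and G: "sstrand y y' b \<Psi>" and H: "sstrand z z' c \<Xi>"
  shows "tensor_strand (pw x @ pw y) (pw x' @ pw y') (pw z) (pw z') (pw a @ pw b) (pw c)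
      (tensor_strand (pw x) (pw x') (pw y) (pw y') (pw a) (pw b) \<Phi> \<Psi>) \<Xi>
    = tensor_strand (pw x) (pw x') (pw y @ pw z) (pw y' @ pw z') (pw a) (pw b @ pw c) \<Phi>
      (tensor_strand (pw y) (pw y') (pw z) (pw z') (pw b) (pw c) \<Psi> \<Xi>)"
proof -
  note [simp] = F[unfolded sstrand_def] G[unfolded sstrand_def] H[unfolded sstrand_def]
  note r = strict.right_strand_comp[of "pw b" "pw a" "pw x @ pw y" "pw x @ pw y'" "pw x' @ pw y'" "pw z'"
      "strict.left_strand (pw x) (pw b) (pw y) \<Psi>" "strict.right_strand (pw x') (pw a) (pw y') \<Phi>"]
  note l = strict.left_strand_comp[of "pw c" "pw b" "pw x" "pw y @ pw z" "pw y @ pw z'" "pw y' @ pw z'"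
      "strict.left_strand (pw y) (pw c) (pw z) \<Xi>" "strict.right_strand (pw y') (pw b) (pw z') \<Psi>"]
  show ?thesis
    by (simp add: tensor_strand_def r l strict.right_right_strand strict.left_left_strand strict.right_left_strand[of _ _ "pw y'"]
        strict.comp_strand_assoc)
qed

text \<open>
  Naturality is a strict identity of diagrams.  The pentagon and the triangle are inherited from
  \<open>C\<close>, since the embedding preserves composition and tensor products.
\<close>

lemma trace_monoidal_category: "monoidal_category \<T>"
proof (rule monoidal_category.intro[OF trace_linear_category], rule monoidal_category_axioms.intro)
  show "Unit \<T> \<in> Obj \<T>" by simp
  show "X \<in> Obj \<T> \<Longrightarrow> Y \<in> Obj \<T> \<Longrightarrow> TenO \<T> X Y \<in> Obj \<T>" for X Y by simp
  show "F \<star>\<^bsub>\<T>\<^esub> G \<in> Mor \<T> (TenO \<T> X Y) (TenO \<T> X' Y')" if "F \<in> Mor \<T> X X'" "G \<in> Mor \<T> Y Y'" for F G X X' Y Y'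
    using trace_TenA_Mor[OF that] by simp
  show "Idt \<T> X \<star>\<^bsub>\<T>\<^esub> Idt \<T> Y = Idt \<T> (TenO \<T> X Y)" if "X \<in> Obj \<T>" "Y \<in> Obj \<T>" for X Y
    using that embed_TenA[of "Idt C X" X X "Idt C Y" Y Y] by (simp add: Mor_iff)
  show "(F' \<cdot>\<^bsub>\<T>\<^esub> F) \<star>\<^bsub>\<T>\<^esub> (G' \<cdot>\<^bsub>\<T>\<^esub> G) = (F' \<star>\<^bsub>\<T>\<^esub> G') \<cdot>\<^bsub>\<T>\<^esub> (F \<star>\<^bsub>\<T>\<^esub> G)"
    if "F \<in> Mor \<T> X X'" "F' \<in> Mor \<T> X' X''" "G \<in> Mor \<T> Y Y'" "G' \<in> Mor \<T> Y' Y''" for F F' G G' X X' X'' Y Y' Y''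
    by (rule trace_interchange[OF that])
next
  fix F F' G X X' Y Y' assume F: "F \<in> Mor \<T> X X'" "F' \<in> Mor \<T> X X'" and G: "G \<in> Mor \<T> Y Y'"
  obtain A \<phi> \<phi>' where 1: "A \<in> Obj C" "\<phi> \<in> strand X X' A" "\<phi>' \<in> strand X X' A" "F = tarr X X' A \<phi>" "F' = tarr X X' A \<phi>'"
    using common_strand[OF F] .
  obtain B \<psi> where 2: "X \<in> Obj C" "X' \<in> Obj C" "Y \<in> Obj C" "Y' \<in> Obj C" "B \<in> Obj C" "\<psi> \<in> strand Y Y' B" "G = tarr Y Y' B \<psi>"
    using F G by (auto simp: trace_Mor_iff)
  show "Add \<T> F F' \<star>\<^bsub>\<T>\<^esub> G = Add \<T> (F \<star>\<^bsub>\<T>\<^esub> G) (F' \<star>\<^bsub>\<T>\<^esub> G)"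
    using 1 2 by (simp add: tarr_Add trace_tensor_single strand_tensor_linear Add_Mor)
next
  fix F G G' X X' Y Y' assume F: "F \<in> Mor \<T> X X'" and G: "G \<in> Mor \<T> Y Y'" "G' \<in> Mor \<T> Y Y'"
  obtain B \<psi> \<psi>' where 1: "B \<in> Obj C" "\<psi> \<in> strand Y Y' B" "\<psi>' \<in> strand Y Y' B" "G = tarr Y Y' B \<psi>" "G' = tarr Y Y' B \<psi>'"
    using common_strand[OF G] .
  obtain A \<phi> where 2: "X \<in> Obj C" "X' \<in> Obj C" "Y \<in> Obj C" "Y' \<in> Obj C" "A \<in> Obj C" "\<phi> \<in> strand X X' A" "F = tarr X X' A \<phi>"
    using F G by (auto simp: trace_Mor_iff)
  show "F \<star>\<^bsub>\<T>\<^esub> Add \<T> G G' = Add \<T> (F \<star>\<^bsub>\<T>\<^esub> G) (F \<star>\<^bsub>\<T>\<^esub> G')"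
    using 1 2 by (simp add: tarr_Add trace_tensor_single strand_tensor_linear Add_Mor)
next
  fix F G X X' Y Y' k assume F: "F \<in> Mor \<T> X X'" and G: "G \<in> Mor \<T> Y Y'"
  obtain A \<phi> B \<psi> where "X \<in> Obj C" "X' \<in> Obj C" "Y \<in> Obj C" "Y' \<in> Obj C" "A \<in> Obj C" "\<phi> \<in> strand X X' A" "F = tarr X X' A \<phi>"
    "B \<in> Obj C" "\<psi> \<in> strand Y Y' B" "G = tarr Y Y' B \<psi>" using F G by (auto simp: trace_Mor_iff)
  then show "Scl \<T> k F \<star>\<^bsub>\<T>\<^esub> G = Scl \<T> k (F \<star>\<^bsub>\<T>\<^esub> G)" "F \<star>\<^bsub>\<T>\<^esub> Scl \<T> k G = Scl \<T> k (F \<star>\<^bsub>\<T>\<^esub> G)"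
    by (simp_all add: tarr_Scl trace_tensor_single strand_tensor_linear Scl_Mor)
next
  have iso: "trace_embed C f \<in> Mor \<T> X Y \<and> iso_arr \<T> (trace_embed C f)" if "f \<in> Mor C X Y" "iso_arr C f" for f X Y
    using embed_Mor embed_iso(1) that by blast
  show "Asc \<T> X Y Z \<in> Mor \<T> (TenO \<T> (TenO \<T> X Y) Z) (TenO \<T> X (TenO \<T> Y Z)) \<and> iso_arr \<T> (Asc \<T> X Y Z)"
    if "X \<in> Obj \<T>" "Y \<in> Obj \<T>" "Z \<in> Obj \<T>" for X Y Z using that iso Asc_Mor[of X Y Z] by simp
  show "LUn \<T> X \<in> Mor \<T> (TenO \<T> (Unit \<T>) X) X \<and> iso_arr \<T> (LUn \<T> X)" if "X \<in> Obj \<T>" for X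
    using that iso LUn_Mor[of X] by simp
  show "RUn \<T> X \<in> Mor \<T> (TenO \<T> X (Unit \<T>)) X \<and> iso_arr \<T> (RUn \<T> X)" if "X \<in> Obj \<T>" for X
    using that iso RUn_Mor[of X] by simp
next
  fix F G H X X' Y Y' Z Z' assume FGH: "F \<in> Mor \<T> X X'" "G \<in> Mor \<T> Y Y'" "H \<in> Mor \<T> Z Z'"
  obtain a \<Phi> where 1: "sstrand (pleaf X) (pleaf X') a \<Phi>" "F = cl (pleaf X) (pleaf X') a \<Phi>" using trace_cl[OF FGH(1)] .
  obtain b \<Psi> where 2: "sstrand (pleaf Y) (pleaf Y') b \<Psi>" "G = cl (pleaf Y) (pleaf Y') b \<Psi>" using trace_cl[OF FGH(2)] .
  obtain c \<Xi> where 3: "sstrand (pleaf Z) (pleaf Z') c \<Xi>" "H = cl (pleaf Z) (pleaf Z') c \<Xi>" using trace_cl[OF FGH(3)] .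
  define x x' y y' z z' where d: "x = pleaf X" "x' = pleaf X'" "y = pleaf Y" "y' = pleaf Y'" "z = pleaf Z" "z' = pleaf Z'"
  have po: "po x = X" "po x' = X'" "po y = Y" "po y' = Y'" "po z = Z" "po z' = Z'" by (simp_all add: d)
  note s = 1(1)[folded d] 2(1)[folded d] 3(1)[folded d]
  note [simp] = s[unfolded sstrand_def]
  note t1 = cl_tensor[OF cl_tensor(2)[OF s(1,2)] s(3)] and t2 = cl_tensor[OF s(1) cl_tensor(2)[OF s(2,3)]]
  have "trace_comp C (trace_embed C (Asc C (po x') (po y') (po z')))
        (trace_tensor C (trace_tensor C (cl x x' a \<Phi>) (cl y y' b \<Psi>)) (cl z z' c \<Xi>))
    = trace_comp C (trace_tensor C (cl x x' a \<Phi>) (trace_tensor C (cl y y' b \<Psi>) (cl z z' c \<Xi>)))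
        (trace_embed C (Asc C (po x) (po y) (po z)))"
    unfolding cl_tensor(1)[OF s(1,2)] cl_tensor(1)[OF s(2,3)] t1(1) t2(1)
    using cl_comp_coherence(1)[OF t1(2) rep_Asc(1)[of x' y' z']] cl_comp_coherence(2)[OF t2(2) rep_Asc(1)[of x y z]]
      cl_word[OF t1(2), of "a \<odot>\<odot> (b \<odot>\<odot> c)"] tensor_strand_assoc[OF s]
      sstrand_word[OF t1(2), of "a \<odot>\<odot> (b \<odot>\<odot> c)"] cl_comp_coherence(1)[of "(x \<odot>\<odot> y) \<odot>\<odot> z" "(x' \<odot>\<odot> y') \<odot>\<odot> z'" "a \<odot>\<odot> (b \<odot>\<odot> c)", OF _ rep_Asc(1)[of x' y' z']]
    by simp
  then show "Asc \<T> X' Y' Z' \<cdot>\<^bsub>\<T>\<^esub> ((F \<star>\<^bsub>\<T>\<^esub> G) \<star>\<^bsub>\<T>\<^esub> H) = (F \<star>\<^bsub>\<T>\<^esub> (G \<star>\<^bsub>\<T>\<^esub> H)) \<cdot>\<^bsub>\<T>\<^esub> Asc \<T> X Y Z"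
    unfolding po 1(2)[folded d] 2(2)[folded d] 3(2)[folded d] by simp
next
  fix F X Y assume F: "F \<in> Mor \<T> X Y"
  obtain a \<Phi> where 1: "sstrand (pleaf X) (pleaf Y) a \<Phi>" "F = cl (pleaf X) (pleaf Y) a \<Phi>" using trace_cl[OF F] .
  define x y where d: "x = pleaf X" "y = pleaf Y"
  have po: "po x = X" "po y = Y" by (simp_all add: d)
  note s = 1(1)[folded d]
  note [simp] = s[unfolded sstrand_def]
  have i: "trace_embed C (Idt C \<I>) = cl pone pone pone (\<iota> (pw pone))" using embed_Idt(1)[of pone] by simp
  have p: "pres pone" by simp
  have st: "strict.left_strand [] (pw a) (pw x) \<Phi> = \<Phi>" "strict.right_strand (pw y) (pw a) [] \<Phi> = \<Phi>"
    by (simp_all add: strict.left_strand_def strict.right_strand_def)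
  note t = tensor_idn_cl[OF s p]
  show "LUn \<T> Y \<cdot>\<^bsub>\<T>\<^esub> (Idt \<T> (Unit \<T>) \<star>\<^bsub>\<T>\<^esub> F) = F \<cdot>\<^bsub>\<T>\<^esub> LUn \<T> X"
    unfolding i 1(2)[folded d] trace_sel t
    using cl_comp_coherence(1)[OF t(4) rep_LUn(1)[of y, simplified]] cl_comp_coherence(2)[OF s rep_LUn(1)[of x]] by (simp add: po st)
  show "RUn \<T> Y \<cdot>\<^bsub>\<T>\<^esub> (F \<star>\<^bsub>\<T>\<^esub> Idt \<T> (Unit \<T>)) = F \<cdot>\<^bsub>\<T>\<^esub> RUn \<T> X"
    unfolding i 1(2)[folded d] trace_sel t
    using cl_comp_coherence(1)[OF t(2) rep_RUn(1)[of y, simplified]] cl_comp_coherence(2)[OF s rep_RUn(1)[of x]] by (simp add: po st)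
next
  fix W X Y Z assume "W \<in> Obj \<T>" "X \<in> Obj \<T>" "Y \<in> Obj \<T>" "Z \<in> Obj \<T>"
  then have [simp]: "W \<in> Obj C" "X \<in> Obj C" "Y \<in> Obj C" "Z \<in> Obj C" by simp_all
  note E = embed_Cmp[symmetric, simplified trace_sel] embed_TenA[symmetric, simplified trace_sel]
  have "trace_embed C (Asc C W X (Y \<boxtimes> Z) \<cdot> Asc C (W \<boxtimes> X) Y Z)
      = trace_embed C ((Idt C W \<star> Asc C X Y Z) \<cdot> Asc C W (X \<boxtimes> Y) Z \<cdot> (Asc C W X Y \<star> Idt C Z))" by (simp add: pentagon)
  also have "\<dots> = trace_embed C (Idt C W \<star> Asc C X Y Z) \<cdot>\<^bsub>\<T>\<^esub> trace_embed C (Asc C W (X \<boxtimes> Y) Z) \<cdot>\<^bsub>\<T>\<^esub> trace_embed C (Asc C W X Y \<star> Idt C Z)"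
    using embed_Cmp[of "Asc C W (X \<boxtimes> Y) Z \<cdot> (Asc C W X Y \<star> Idt C Z)" "((W \<boxtimes> X) \<boxtimes> Y) \<boxtimes> Z" _ "Idt C W \<star> Asc C X Y Z"]
      embed_Cmp[of "Asc C W X Y \<star> Idt C Z" "((W \<boxtimes> X) \<boxtimes> Y) \<boxtimes> Z" _ "Asc C W (X \<boxtimes> Y) Z"]
    by (simp add: Mor_iff)
  finally show "Asc \<T> W X (TenO \<T> Y Z) \<cdot>\<^bsub>\<T>\<^esub> Asc \<T> (TenO \<T> W X) Y Z
      = (Idt \<T> W \<star>\<^bsub>\<T>\<^esub> Asc \<T> X Y Z) \<cdot>\<^bsub>\<T>\<^esub> Asc \<T> W (TenO \<T> X Y) Z \<cdot>\<^bsub>\<T>\<^esub> (Asc \<T> W X Y \<star>\<^bsub>\<T>\<^esub> Idt \<T> Z)"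
    using embed_Cmp[of "Asc C (W \<boxtimes> X) Y Z" _ _ "Asc C W X (Y \<boxtimes> Z)"]
      embed_TenA[of "Idt C W" _ _ "Asc C X Y Z"] embed_TenA[of "Asc C W X Y" _ _ "Idt C Z"] by (simp add: Mor_iff)
  show "(Idt \<T> X \<star>\<^bsub>\<T>\<^esub> LUn \<T> Y) \<cdot>\<^bsub>\<T>\<^esub> Asc \<T> X (Unit \<T>) Y = RUn \<T> X \<star>\<^bsub>\<T>\<^esub> Idt \<T> Y"
    using embed_Cmp[of "Asc C X \<I> Y" _ _ "Idt C X \<star> LUn C Y"] embed_TenA[of "Idt C X" _ _ "LUn C Y"]
      embed_TenA[of "RUn C X" _ _ "Idt C Y"] triangle[of X Y] by (simp add: Mor_iff)
qed

end

section \<open>The reversed tensor product\<close>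

lemma rev_tensor_sel [simp]:
  "Obj (rev_tensor C) = Obj C" "Arr (rev_tensor C) = Arr C" "Dom (rev_tensor C) = Dom C" "Cod (rev_tensor C) = Cod C"
  "Idt (rev_tensor C) = Idt C" "Cmp (rev_tensor C) = Cmp C" "Zer (rev_tensor C) = Zer C" "Add (rev_tensor C) = Add C"
  "Scl (rev_tensor C) = Scl C" "Unit (rev_tensor C) = Unit C" "TenO (rev_tensor C) X Y = TenO C Y X"
  "TenA (rev_tensor C) f g = TenA C g f" "Asc (rev_tensor C) X Y Z = inv_arr C (Asc C Z Y X)"
  "LUn (rev_tensor C) = RUn C" "RUn (rev_tensor C) = LUn C"
  by (simp_all add: rev_tensor_def)

lemma rev_tensor_cat [simp]:
  "Mor (rev_tensor C) = Mor C" "hom_space (rev_tensor C) = hom_space C"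
  "iso_arr (rev_tensor C) = iso_arr C" "inv_arr (rev_tensor C) = inv_arr C"
  by (auto simp: fun_eq_iff Mor_def hom_space_def iso_arr_def inv_arr_def inverse_arrows_def)

context monoidal_category
begin

lemma rev_tensor_monoidal: "monoidal_category (rev_tensor C)"
proof (rule monoidal_category.intro)
  show "linear_category (rev_tensor C)"
    using linear_category_axioms unfolding linear_category_def by simp
  show "monoidal_category_axioms (rev_tensor C)"
  proof (rule monoidal_category_axioms.intro, unfold rev_tensor_sel rev_tensor_cat)
    fix X Y Z assume [simp]: "X \<in> Obj C" "Y \<in> Obj C" "Z \<in> Obj C"
    show "inv_arr C (Asc C Z Y X) \<in> Mor C (Z \<boxtimes> (Y \<boxtimes> X)) ((Z \<boxtimes> Y) \<boxtimes> X) \<and> iso_arr C (inv_arr C (Asc C Z Y X))"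
      by (simp add: Mor_iff)
  next
    fix f g h X X' Y Y' Z Z' assume m: "f \<in> Mor C X X'" "g \<in> Mor C Y Y'" "h \<in> Mor C Z Z'"
    have [simp]: "f \<in> Arr C" "g \<in> Arr C" "h \<in> Arr C" "X \<in> Obj C" "X' \<in> Obj C" "Y \<in> Obj C" "Y' \<in> Obj C" "Z \<in> Obj C" "Z' \<in> Obj C"
      "Dom C f = X" "Cod C f = X'" "Dom C g = Y" "Cod C g = Y'" "Dom C h = Z" "Cod C h = Z'"
      using m Mor_Obj by (auto simp: Mor_iff)
    have "inv_arr C (Asc C Z' Y' X') \<cdot> (h \<star> (g \<star> f)) \<cdot> Asc C Z Y X = (h \<star> g) \<star> f"
      using Asc_nat[of h g f, symmetric] by simp
    then have "(inv_arr C (Asc C Z' Y' X') \<cdot> (h \<star> (g \<star> f)) \<cdot> Asc C Z Y X) \<cdot> inv_arr C (Asc C Z Y X) = ((h \<star> g) \<star> f) \<cdot> inv_arr C (Asc C Z Y X)"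
      by simp
    then show "inv_arr C (Asc C Z' Y' X') \<cdot> (h \<star> (g \<star> f)) = ((h \<star> g) \<star> f) \<cdot> inv_arr C (Asc C Z Y X)" by simp
  next
    fix W X Y Z assume [simp]: "W \<in> Obj C" "X \<in> Obj C" "Y \<in> Obj C" "Z \<in> Obj C"
    have "inv_arr C (Asc C Z Y (X \<boxtimes> W) \<cdot> Asc C (Z \<boxtimes> Y) X W) =
        inv_arr C ((Idt C Z \<star> Asc C Y X W) \<cdot> Asc C Z (Y \<boxtimes> X) W \<cdot> (Asc C Z Y X \<star> Idt C W))"
      by (simp only: pentagon[OF \<open>Z \<in> Obj C\<close> \<open>Y \<in> Obj C\<close> \<open>X \<in> Obj C\<close> \<open>W \<in> Obj C\<close>])
    then show "inv_arr C (Asc C (Z \<boxtimes> Y) X W) \<cdot> inv_arr C (Asc C Z Y (X \<boxtimes> W)) =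
        (inv_arr C (Asc C Z Y X) \<star> Idt C W) \<cdot> inv_arr C (Asc C Z (Y \<boxtimes> X) W) \<cdot> (Idt C Z \<star> inv_arr C (Asc C Y X W))"
      by simp
  next
    fix X Y assume [simp]: "X \<in> Obj C" "Y \<in> Obj C"
    show "(RUn C Y \<star> Idt C X) \<cdot> inv_arr C (Asc C Y \<I> X) = Idt C Y \<star> LUn C X"
      using triangle[of Y X, symmetric] by simp
  qed (auto simp: Unit_Obj TenO_Obj TenA_Mor TenA_Idt TenA_Cmp TenA_Add_left TenA_Add_right TenA_Scl_left TenA_Scl_right
      LUn_Mor RUn_Mor LUn_natural RUn_natural)
qed

end

section \<open>The functor on the horizontal trace\<close>

context premodular_category
begin

sublocale trace: monoidal_category \<T> by (rule trace_monoidal_category)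

lemma trace_dual:
  assumes "pres a"
  obtains d ev cv where "pres d" "strict.right_dual (pw a) (pw d) ev cv"
proof -
  obtain EV CV where "strict.right_dual (pw a) (pw (pleaf (Dual C (po a)))) EV CV"
    by (rule pivot_strict[of a "pleaf (Dual C (po a))"]) (use assms in simp_all)
  then show thesis using that[of "pleaf (Dual C (po a))"] assms by simp
qed

lemma tilde_Mor:
  assumes "F \<in> Mor \<T> X X'" shows "trace_tilde C F \<in> Mor \<T> X X'"
proof -
  obtain a \<Phi> where 1: "sstrand (pleaf X) (pleaf X') a \<Phi>" "F = cl (pleaf X) (pleaf X') a \<Phi>" using trace_cl[OF assms] .
  then have "pres a" by (simp add: sstrand_def)
  then obtain d ev cv where d: "pres d" "strict.right_dual (pw a) (pw d) ev cv" by (rule trace_dual)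
  show ?thesis using cl_Mor[OF cl_tilde(2)[OF 1(1) d]] by (simp add: 1(2) cl_tilde(1)[OF 1(1) d])
qed

text \<open>
  The unit strand is its own dual, and neither bending nor braiding it does anything.
\<close>

lemma tilde_embed: assumes "f \<in> Mor C X Y" shows "trace_tilde C (trace_embed C f) = trace_embed C f"
proof -
  obtain F where F: "rep (pleaf X) (pleaf Y) f F" using assms by (rule embed_rep)
  have "strict.right_dual (pw pone) (pw pone) (\<iota> []) (\<iota> [])" by (simp add: strict.right_dual_def)
  moreover have "strict.tilde_strand (pw (pleaf X)) (pw (pleaf Y)) (pw pone) (\<iota> []) (\<iota> []) F = F"
    using rep_simps[OF F] Mor_Obj[OF assms] by (simp add: strict.tilde_strand_def strict.flip_strand_def strict.rotate_def)
  ultimately show ?thesis using cl_tilde(1)[OF cl_embed(2)[OF F], of pone] by (simp add: cl_embed(1)[OF F])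
qed

text \<open>
  Choose the dual of the composite strand to be the product of the duals in the reverse order;
  then bending and flipping both reverse the order, up to a braiding that \<open>cl_conj\<close> absorbs.
\<close>

lemma tilde_Cmp:
  assumes F: "F \<in> Mor \<T> X X'" and G: "G \<in> Mor \<T> X' X''"
  shows "trace_tilde C (G \<cdot>\<^bsub>\<T>\<^esub> F) = trace_tilde C G \<cdot>\<^bsub>\<T>\<^esub> trace_tilde C F"
proof -
  obtain a \<Phi> where 1: "sstrand (pleaf X) (pleaf X') a \<Phi>" "F = cl (pleaf X) (pleaf X') a \<Phi>" using trace_cl[OF F] .
  obtain b \<Psi> where 2: "sstrand (pleaf X') (pleaf X'') b \<Psi>" "G = cl (pleaf X') (pleaf X'') b \<Psi>" using trace_cl[OF G] .
  define x x' x'' where d: "x = pleaf X" "x' = pleaf X'" "x'' = pleaf X''"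
  note s = 1(1)[folded d] 2(1)[folded d]
  note [simp] = s[unfolded sstrand_def]
  obtain d ev cv where D: "pres d" "strict.right_dual (pw a) (pw d) ev cv" by (rule trace_dual[of a]) simp
  obtain e ev' cv' where E: "pres e" "strict.right_dual (pw b) (pw e) ev' cv'" by (rule trace_dual[of b]) simp
  note [simp] = D(1) E(1)
  note DE = strict.right_dual_append[OF D(2) E(2)]
  let ?ev = "ev' \<bullet> (\<iota> (pw b) \<parallel> ev \<parallel> \<iota> (pw e))" and ?cv = "(\<iota> (pw d) \<parallel> cv' \<parallel> \<iota> (pw a)) \<bullet> cv"
  have DE': "strict.right_dual (pw (b \<odot>\<odot> a)) (pw (d \<odot>\<odot> e)) ?ev ?cv" using DE by simp
  have de: "pres (d \<odot>\<odot> e)" by simp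
  note t = cl_tilde[OF cl_comp(2)[OF s] de DE'] and c = cl_comp[OF cl_tilde(2)[OF s(1) D] cl_tilde(2)[OF s(2) E]]
  let ?P = "strict.tilde_strand (pw x) (pw x'') (pw d @ pw e) ?ev ?cv (strict.comp_strand (pw b) (pw a) \<Psi> \<Phi>)"
  let ?Q = "strict.comp_strand (pw e) (pw d) (strict.tilde_strand (pw x') (pw x'') (pw e) ev' cv' \<Psi>) (strict.tilde_strand (pw x) (pw x') (pw d) ev cv \<Phi>)"
  have "?P \<bullet> (sbr (pw e) (pw d) \<parallel> \<iota> (pw x)) = (\<iota> (pw x'') \<parallel> sbr (pw e) (pw d)) \<bullet> ?Q"
  proof -
    have r: "strict.rotate (pw x) (pw x'') (pw d @ pw e) ?cv (pw d @ pw e) ?ev (strict.comp_strand (pw b) (pw a) \<Psi> \<Phi>)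
        = (\<iota> (pw d) \<parallel> strict.rotate (pw x') (pw x'') (pw e) cv' (pw e) ev' \<Psi>) \<bullet> (strict.rotate (pw x) (pw x') (pw d) cv (pw d) ev \<Phi> \<parallel> \<iota> (pw e))"
      by (rule strict.rotate_comp[OF D(2) E(2)]) simp_all
    show ?thesis unfolding strict.tilde_strand_def r
      by (rule strict.flip_strand_comp) (simp_all add: strict.rotate_simps[OF D(2)] strict.rotate_simps[OF E(2)])
  qed
  then have "cl x x'' (d \<odot>\<odot> e) ?P = cl x x'' (e \<odot>\<odot> d) ?Q"
    using t(2) c(2) by (intro cl_conj[where g = "sbr (pw e) (pw d)" and h = "sbri (pw e) (pw d)"]) simp_all
  then show ?thesis
    unfolding 1(2)[folded d] 2(2)[folded d] trace_sel cl_comp(1)[OF s] t(1) cl_tilde(1)[OF s(1) D] cl_tilde(1)[OF s(2) E] c(1) by simp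
qed

lemma tilde_linear_functor: "linear_functor \<T> \<T> id (trace_tilde C)"
proof (rule linear_functor.intro[OF trace_linear_category trace_linear_category], rule linear_functor_axioms.intro)
  show "trace_tilde C (Idt \<T> X) = Idt \<T> (id X)" if "X \<in> Obj \<T>" for X
    using that tilde_embed[of "Idt C X" X X] by (simp add: Idt_Mor)
next
  fix F G X Y assume FG: "F \<in> Mor \<T> X Y" "G \<in> Mor \<T> X Y"
  obtain A \<phi> \<psi> where 1: "A \<in> Obj C" "\<phi> \<in> strand X Y A" "\<psi> \<in> strand X Y A" "F = tarr X Y A \<phi>" "G = tarr X Y A \<psi>"
    using common_strand[OF FG] .
  have "X \<in> Obj C" "Y \<in> Obj C" using FG by (auto simp: trace_Mor_iff)
  then show "trace_tilde C (Add \<T> F G) = Add \<T> (trace_tilde C F) (trace_tilde C G)"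
    using 1 by (simp add: tarr_Add trace_tilde_single strand_tilde_linear Add_Mor)
next
  fix F X Y k assume "F \<in> Mor \<T> X Y"
  then obtain A \<phi> where "X \<in> Obj C" "Y \<in> Obj C" "A \<in> Obj C" "\<phi> \<in> strand X Y A" "F = tarr X Y A \<phi>" by (auto simp: trace_Mor_iff)
  then show "trace_tilde C (Scl \<T> k F) = Scl \<T> k (trace_tilde C F)"
    by (simp add: tarr_Scl trace_tilde_single strand_tilde_linear Scl_Mor)
qed (use tilde_Mor tilde_Cmp in auto)

text \<open>
  Move \<open>Y\<close> through the bend and then through the flip; the strand and its dual stay the same.
\<close>

lemma tilde_braid_right:
  assumes F: "F \<in> Mor \<T> X X'" and Y: "Y \<in> Obj C"
  shows "trace_embed C (Brd C Y X') \<cdot>\<^bsub>\<T>\<^esub> (Idt \<T> Y \<star>\<^bsub>\<T>\<^esub> trace_tilde C F)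
       = trace_tilde C (F \<star>\<^bsub>\<T>\<^esub> Idt \<T> Y) \<cdot>\<^bsub>\<T>\<^esub> trace_embed C (Brd C Y X)"
proof -
  obtain a \<Phi> where 1: "sstrand (pleaf X) (pleaf X') a \<Phi>" "F = cl (pleaf X) (pleaf X') a \<Phi>" using trace_cl[OF F] .
  define x x' y where d: "x = pleaf X" "x' = pleaf X'" "y = pleaf Y"
  note s = 1(1)[folded d]
  note [simp] = s[unfolded sstrand_def]
  have po: "X = po x" "X' = po x'" "Y = po y" and y [simp]: "pres y" using Y by (simp_all add: d)
  obtain d ev cv where D: "pres d" "strict.right_dual (pw a) (pw d) ev cv" by (rule trace_dual[of a]) simp
  note [simp] = D(1)
  have x: "pres x" "pres x'" by simp_all
  note t = cl_tilde[OF s D]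
  have e: "(sbr (pw y) (pw x') \<parallel> \<iota> (pw d)) \<bullet> strict.left_strand (pw y) (pw d) (pw x) (strict.tilde_strand (pw x) (pw x') (pw d) ev cv \<Phi>)
      = strict.tilde_strand (pw x @ pw y) (pw x' @ pw y) (pw d) ev cv (strict.right_strand (pw x') (pw a) (pw y) \<Phi>) \<bullet> (\<iota> (pw d) \<parallel> sbr (pw y) (pw x))"
    unfolding strict.tilde_strand_def
    by (subst strict.rotate_right_strand[OF D(2)]) (simp_all add: strict.flip_right_strand strict.rotate_simps[OF D(2)])
  note r = tensor_idn_cl[OF s y] and l = tensor_idn_cl[OF t(2) y]
  note tr = cl_tilde[OF r(2) D]
  show ?thesis
    unfolding trace_sel 1(2)[folded d] po t(1) embed_Idt(1)[OF y] r(1) l(3) tr(1)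
      cl_comp_embed(1)[OF l(4) rep_Brd[OF y x(2)]] cl_comp_embed(2)[OF tr(2) rep_Brd[OF y x(1)]]
    using e by simp
qed

lemma tilde_braid_left:
  assumes G: "G \<in> Mor \<T> Y Y'" and X: "X \<in> Obj C"
  shows "trace_embed C (Brd C Y' X) \<cdot>\<^bsub>\<T>\<^esub> (trace_tilde C G \<star>\<^bsub>\<T>\<^esub> Idt \<T> X)
       = trace_tilde C (Idt \<T> X \<star>\<^bsub>\<T>\<^esub> G) \<cdot>\<^bsub>\<T>\<^esub> trace_embed C (Brd C Y X)"
proof -
  obtain b \<Psi> where 1: "sstrand (pleaf Y) (pleaf Y') b \<Psi>" "G = cl (pleaf Y) (pleaf Y') b \<Psi>" using trace_cl[OF G] .
  define x y y' where d: "x = pleaf X" "y = pleaf Y" "y' = pleaf Y'"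
  note s = 1(1)[folded d]
  note [simp] = s[unfolded sstrand_def]
  have po: "Y = po y" "Y' = po y'" "X = po x" and x [simp]: "pres x" using X by (simp_all add: d)
  obtain e ev cv where D: "pres e" "strict.right_dual (pw b) (pw e) ev cv" by (rule trace_dual[of b]) simp
  note [simp] = D(1)
  have y: "pres y" "pres y'" by simp_all
  note t = cl_tilde[OF s D]
  have e: "(sbr (pw y') (pw x) \<parallel> \<iota> (pw e)) \<bullet> strict.right_strand (pw y') (pw e) (pw x) (strict.tilde_strand (pw y) (pw y') (pw e) ev cv \<Psi>)
      = strict.tilde_strand (pw x @ pw y) (pw x @ pw y') (pw e) ev cv (strict.left_strand (pw x) (pw b) (pw y) \<Psi>) \<bullet> (\<iota> (pw e) \<parallel> sbr (pw y) (pw x))"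
    unfolding strict.tilde_strand_def
    by (subst strict.rotate_left_strand[OF D(2)]) (simp_all add: strict.flip_left_strand strict.rotate_simps[OF D(2)])
  note l = tensor_idn_cl[OF s x] and r = tensor_idn_cl[OF t(2) x]
  note tl = cl_tilde[OF l(4) D]
  show ?thesis
    unfolding trace_sel 1(2)[folded d] po t(1) embed_Idt(1)[OF x] l(3) r(1) tl(1)
      cl_comp_embed(1)[OF r(2) rep_Brd[OF y(2) x]] cl_comp_embed(2)[OF tl(2) rep_Brd[OF y(1) x]]
    using e by simp
qed

text \<open>
  Naturality of the twist as an isomorphism from the identity to the square.
\<close>

lemma tilde_tilde:
  assumes F: "F \<in> Mor \<T> X X'"
  shows "trace_tilde C (trace_tilde C F) \<cdot>\<^bsub>\<T>\<^esub> trace_embed C (Twist C X) = trace_embed C (Twist C X') \<cdot>\<^bsub>\<T>\<^esub> F"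
proof -
  obtain a \<Phi> where 1: "sstrand (pleaf X) (pleaf X') a \<Phi>" "F = cl (pleaf X) (pleaf X') a \<Phi>" using trace_cl[OF F] .
  define x x' where d: "x = pleaf X" "x' = pleaf X'"
  note s = 1(1)[folded d]
  note [simp] = s[unfolded sstrand_def]
  have po: "X = po x" "X' = po x'" by (simp_all add: d)
  have x: "pres x" "pres x'" "pres a" by simp_all
  obtain d ev cv where D: "pres d" "strict.right_dual (pw a) (pw d) ev cv" by (rule trace_dual[of a]) simp
  note [simp] = D(1)
  note t = cl_tilde[OF s D]
  \<comment> \<open>dualise back to the strand \<open>a\<close>, with evaluation and coevaluation turned around by the braiding\<close>
  note tt = cl_tilde[OF t(2) x(3) strict.right_dual_braided(1)[OF D(2)]]
  let ?\<omega> = "sbri (pw x') (pw a) \<bullet> sbri (pw a) (pw x') \<bullet> \<Phi> \<bullet> sbr (pw x) (pw a) \<bullet> sbr (pw a) (pw x)"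
  have \<omega>: "strict.tilde_strand (pw x) (pw x') (pw a) (ev \<bullet> sbr (pw d) (pw a)) (sbri (pw a) (pw d) \<bullet> cv)
      (strict.tilde_strand (pw x) (pw x') (pw d) ev cv \<Phi>) = ?\<omega>"
    unfolding strict.tilde_strand_def
    by (subst strict.rotate_flip_rotate[OF D(2)]) (simp_all add: strict.flip_strand_def)
  \<comment> \<open>the twist of the strand slides along \<open>?\<Omega>\<close>: on the input it cancels the inverse twist, on the output it completes the balancing\<close>
  let ?\<Omega> = "(stw (pw x') \<parallel> \<iota> (pw a)) \<bullet> \<Phi> \<bullet> (stwi (pw a) \<parallel> \<iota> (pw x))"
  \<comment> \<open>the balancing axiom, with the twists of the factors in the order in which they cancel below\<close>
  have tw: "stw (pw a @ pw x) = sbr (pw x) (pw a) \<bullet> sbr (pw a) (pw x) \<bullet> (\<iota> (pw a) \<parallel> stw (pw x)) \<bullet> (stw (pw a) \<parallel> \<iota> (pw x))"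
    using stw_append[of "pw a" "pw x"] strict.ten_split2[of "stw (pw a)" "stw (pw x)"] by simp
  have tw': "stw (pw x' @ pw a) = sbr (pw a) (pw x') \<bullet> sbr (pw x') (pw a) \<bullet> (\<iota> (pw x') \<parallel> stw (pw a)) \<bullet> (stw (pw x') \<parallel> \<iota> (pw a))"
    using stw_append[of "pw x'" "pw a"] strict.ten_split2[of "stw (pw x')" "stw (pw a)"] by simp
  have c: "(stw (pw a) \<parallel> \<iota> (pw x)) \<bullet> (stwi (pw a) \<parallel> \<iota> (pw x)) = \<iota> (pw a @ pw x)"
    "(stwi (pw a) \<parallel> \<iota> (pw x)) \<bullet> (stw (pw a) \<parallel> \<iota> (pw x)) = \<iota> (pw a @ pw x)"
    using strict.whisk[OF stw_simps(3)[of "pw a"], of "[]" "pw x"] strict.whisk[OF stw_simps(4)[of "pw a"], of "[]" "pw x"]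
    by (simp_all del: stw_simps(3,4))
  have n: "\<Phi> \<bullet> stw (pw a @ pw x) = stw (pw x' @ pw a) \<bullet> \<Phi>" using stw_nat[of \<Phi>] by simp
  have L: "?\<omega> \<bullet> (\<iota> (pw a) \<parallel> stw (pw x)) = (\<iota> (pw x') \<parallel> stw (pw a)) \<bullet> ?\<Omega>"
  proof -
    have "?\<omega> \<bullet> (\<iota> (pw a) \<parallel> stw (pw x))
        = sbri (pw x') (pw a) \<bullet> sbri (pw a) (pw x') \<bullet> (\<Phi> \<bullet> stw (pw a @ pw x)) \<bullet> (stwi (pw a) \<parallel> \<iota> (pw x))"
      by (simp add: tw c)
    also have "\<dots> = (\<iota> (pw x') \<parallel> stw (pw a)) \<bullet> ?\<Omega>" unfolding n by (simp add: tw')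
    finally show ?thesis .
  qed
  have R: "?\<Omega> \<bullet> (stw (pw a) \<parallel> \<iota> (pw x)) = (stw (pw x') \<parallel> \<iota> (pw a)) \<bullet> \<Phi>" by (simp add: c)
  have "cl x x' a ((stw (pw x') \<parallel> \<iota> (pw a)) \<bullet> \<Phi>) = cl x x' a (?\<omega> \<bullet> (\<iota> (pw a) \<parallel> stw (pw x)))"
    unfolding L unfolding R[symmetric] by (rule cl_slide) simp_all
  then show ?thesis
    unfolding trace_sel 1(2)[folded d] po t(1) tt(1)[unfolded \<omega>] cl_comp_embed(2)[OF tt(2)[unfolded \<omega>] rep_Twist[OF x(1)]]
      cl_comp_embed(1)[OF s rep_Twist[OF x(2)]]
    by simp
qed

abbreviation \<J> where "\<J> \<equiv> (\<lambda>X Y. trace_embed C (Brd C Y X))"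

abbreviation \<eta> where "\<eta> \<equiv> (\<lambda>X. trace_embed C (inv_arr C (Twist C X)))"

lemma tilde_eta:
  "natural_iso \<T> \<T> (id \<circ> id) (trace_tilde C \<circ> trace_tilde C) id id \<eta>"
  "natural_iso \<T> \<T> id id (id \<circ> id) (trace_tilde C \<circ> trace_tilde C) (\<lambda>X. trace_embed C (Twist C X))"
proof -
  have tw: "Twist C X \<in> Mor C X X" "inv_arr C (Twist C X) \<in> Mor C X X" if "X \<in> Obj C" for X
    using that by (simp_all add: Mor_iff)
  show "natural_iso \<T> \<T> id id (id \<circ> id) (trace_tilde C \<circ> trace_tilde C) (\<lambda>X. trace_embed C (Twist C X))"
    unfolding natural_iso_def
    by (auto simp: embed_Mor[OF tw(1)] embed_iso[OF tw(1)] trace_Arr_iff tilde_tilde simp del: trace_sel(5))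
      (auto simp: trace.Mor_iff tilde_tilde[unfolded trace.Mor_iff] simp del: trace_sel(5) dest: trace_Mor_iff[THEN iffD1])
  show "natural_iso \<T> \<T> (id \<circ> id) (trace_tilde C \<circ> trace_tilde C) id id \<eta>"
    unfolding natural_iso_def
  proof (intro conjI ballI)
    fix X assume "X \<in> Obj \<T>"
    then show "\<eta> X \<in> Mor \<T> ((id \<circ> id) X) (id X)" "iso_arr \<T> (\<eta> X)"
      using embed_Mor[OF tw(2)] embed_iso(1)[OF tw(2)] by auto
  next
    fix F assume "F \<in> Arr \<T>"
    then obtain X X' where F: "F \<in> Mor \<T> X X'" by (auto simp: trace_Arr_iff)
    have o: "X \<in> Obj C" "X' \<in> Obj C" using F by (auto simp: trace_Mor_iff)
    have inv: "\<eta> Y \<cdot>\<^bsub>\<T>\<^esub> trace_embed C (Twist C Y) = Idt \<T> Y" "trace_embed C (Twist C Y) \<cdot>\<^bsub>\<T>\<^esub> \<eta> Y = Idt \<T> Y" if "Y \<in> Obj C" for Y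
      using embed_Cmp[OF tw[OF that]] embed_Cmp[OF tw(2,1)[OF that]] that by simp_all
    note m = embed_Mor[OF tw(1)[OF o(1)]] embed_Mor[OF tw(2)[OF o(1)]] embed_Mor[OF tw(1)[OF o(2)]] embed_Mor[OF tw(2)[OF o(2)]]
    note U = tilde_Mor[OF tilde_Mor[OF F]]
    have "\<eta> X' \<cdot>\<^bsub>\<T>\<^esub> trace_tilde C (trace_tilde C F)
        = \<eta> X' \<cdot>\<^bsub>\<T>\<^esub> (trace_tilde C (trace_tilde C F) \<cdot>\<^bsub>\<T>\<^esub> trace_embed C (Twist C X)) \<cdot>\<^bsub>\<T>\<^esub> \<eta> X"
      using trace.Cmp_assoc[OF m(2,1) U] inv(2)[OF o(1)] trace.Cmp_Idt[OF U] by (simp del: trace_sel)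
    also have "\<dots> = F \<cdot>\<^bsub>\<T>\<^esub> \<eta> X"
      unfolding tilde_tilde[OF F]
      using trace.Cmp_assoc[OF m(2) F m(3)] trace.Cmp_assoc[OF trace.Cmp_Mor[OF m(2) F] m(3,4)] inv(1)[OF o(2)]
        trace.Idt_Cmp[OF trace.Cmp_Mor[OF m(2) F]] by (simp del: trace_sel)
    finally show "\<eta> (Cod \<T> F) \<cdot>\<^bsub>\<T>\<^esub> (trace_tilde C \<circ> trace_tilde C) F = id F \<cdot>\<^bsub>\<T>\<^esub> \<eta> (Dom \<T> F)"
      using F by (simp add: trace.Mor_iff del: trace_sel)
  qed
qed

lemma trace_z2_action: "z2_action \<T> id (trace_tilde C) \<eta>"
  unfolding z2_action_def
  using tilde_linear_functor tilde_eta(1) tilde_embed[OF inv_arr_Mor[of "Twist C X" X X for X]] by (simp add: Mor_iff)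

text \<open>
  Both sides are half twists of three factors, so this is the Yang-Baxter equation.
\<close>

lemma trace_J_assoc:
  assumes "X \<in> Obj C" "Y \<in> Obj C" "Z \<in> Obj C"
  shows "Asc C X Y Z \<cdot> Brd C Z (X \<boxtimes> Y) \<cdot> (Idt C Z \<star> Brd C Y X)
       = Brd C (Y \<boxtimes> Z) X \<cdot> (Brd C Z Y \<star> Idt C X) \<cdot> inv_arr C (Asc C Z Y X)"
proof -
  define x y z where d: "x = pleaf X" "y = pleaf Y" "z = pleaf Z"
  have po: "X = po x" "Y = po y" "Z = po z" and [simp]: "pres x" "pres y" "pres z" using assms by (simp_all add: d)
  let ?x = "pw x" and ?y = "pw y" and ?z = "pw z"
  have 1: "rep (z \<odot>\<odot> (y \<odot>\<odot> x)) (x \<odot>\<odot> (y \<odot>\<odot> z)) (Asc C (po x) (po y) (po z) \<cdot> Brd C (po z) (po (x \<odot>\<odot> y)) \<cdot> (Idt C (po z) \<star> Brd C (po y) (po x)))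
      (sbr ?z (?x @ ?y) \<bullet> (\<iota> ?z \<parallel> sbr ?y ?x))"
    by (rule rep_cong, rule rep_Cmp[OF rep_Cmp[OF rep_TenA[OF rep_Idt rep_Brd] rep_Brd] rep_Asc(1)]) simp_all
  have 2: "rep (z \<odot>\<odot> (y \<odot>\<odot> x)) (x \<odot>\<odot> (y \<odot>\<odot> z)) (Brd C (po (y \<odot>\<odot> z)) (po x) \<cdot> (Brd C (po z) (po y) \<star> Idt C (po x)) \<cdot> inv_arr C (Asc C (po z) (po y) (po x)))
      (sbr (?y @ ?z) ?x \<bullet> (sbr ?z ?y \<parallel> \<iota> ?x))"
    by (rule rep_cong, rule rep_Cmp[OF rep_Cmp[OF rep_Asc(2) rep_TenA[OF rep_Brd rep_Idt]] rep_Brd]) simp_all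
  have "sbr ?z (?x @ ?y) \<bullet> (\<iota> ?z \<parallel> sbr ?y ?x) = sbr (?y @ ?z) ?x \<bullet> (sbr ?z ?y \<parallel> \<iota> ?x)"
    using strict.br_nat_right[of "sbr ?y ?x" ?z] by simp
  then have "rep (z \<odot>\<odot> (y \<odot>\<odot> x)) (x \<odot>\<odot> (y \<odot>\<odot> z)) (Brd C (po (y \<odot>\<odot> z)) (po x) \<cdot> (Brd C (po z) (po y) \<star> Idt C (po x)) \<cdot> inv_arr C (Asc C (po z) (po y) (po x)))
      (sbr ?z (?x @ ?y) \<bullet> (\<iota> ?z \<parallel> sbr ?y ?x))" using 2 by simp
  from rep_inj[OF 1 this] show ?thesis by (simp add: po)
qed

lemma Brd_Unit:
  assumes "X \<in> Obj C"
  shows "LUn C X \<cdot> Brd C X \<I> = RUn C X" "RUn C X \<cdot> Brd C \<I> X = LUn C X"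
proof -
  define x where "x = pleaf X"
  have po: "X = po x" and [simp]: "pres x" using assms by (simp_all add: x_def)
  have "rep (x \<odot>\<odot> pone) x (LUn C (po x) \<cdot> Brd C (po x) (po pone)) (\<iota> (pw x))"
    by (rule rep_cong, rule rep_Cmp[OF rep_Brd rep_LUn(1)]) simp_all
  from rep_inj[OF this rep_RUn(1)] show "LUn C X \<cdot> Brd C X \<I> = RUn C X" by (simp add: po)
  have "rep (pone \<odot>\<odot> x) x (RUn C (po x) \<cdot> Brd C (po pone) (po x)) (\<iota> (pw x))"
    by (rule rep_cong, rule rep_Cmp[OF rep_Brd rep_RUn(1)]) simp_all
  from rep_inj[OF this rep_LUn(1)] show "RUn C X \<cdot> Brd C \<I> X = LUn C X" by (simp add: po)
qed

text \<open>
  Split \<open>F \<star> G\<close> into two whiskered arrows and move the braiding past one after the other; the two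
  factorisations of the tensor product are used on the two sides.
\<close>

lemma trace_J_natural:
  assumes F: "F \<in> Mor \<T> X X'" and G: "G \<in> Mor \<T> Y Y'"
  shows "\<J> X' Y' \<cdot>\<^bsub>\<T>\<^esub> (trace_tilde C G \<star>\<^bsub>\<T>\<^esub> trace_tilde C F) = trace_tilde C (F \<star>\<^bsub>\<T>\<^esub> G) \<cdot>\<^bsub>\<T>\<^esub> \<J> X Y"
proof -
  have o: "X \<in> Obj C" "X' \<in> Obj C" "Y \<in> Obj C" "Y' \<in> Obj C" using F G by (auto simp: trace_Mor_iff)
  have B: "\<J> A B \<in> Mor \<T> (B \<boxtimes> A) (A \<boxtimes> B)" if "A \<in> Obj C" "B \<in> Obj C" for A B
    using that by (intro embed_Mor) (simp add: Mor_iff)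
  note UF = tilde_Mor[OF F] and UG = tilde_Mor[OF G]
  note i = o[THEN trace_Idt_Mor]
  note l = trace_TenA_Mor[OF i(3) UF] and r = trace_TenA_Mor[OF UG i(2)]
    and FY = trace_TenA_Mor[OF F i(3)] and XG = trace_TenA_Mor[OF i(2) G]
  have "\<J> X' Y' \<cdot>\<^bsub>\<T>\<^esub> (trace_tilde C G \<star>\<^bsub>\<T>\<^esub> trace_tilde C F)
      = (\<J> X' Y' \<cdot>\<^bsub>\<T>\<^esub> (trace_tilde C G \<star>\<^bsub>\<T>\<^esub> Idt \<T> X')) \<cdot>\<^bsub>\<T>\<^esub> (Idt \<T> Y \<star>\<^bsub>\<T>\<^esub> trace_tilde C F)"
    unfolding trace_tensor_factor(1)[OF UG UF] using trace.Cmp_assoc[OF l r B[OF o(2,4)]] by (simp del: trace_sel)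
  also have "\<dots> = trace_tilde C (Idt \<T> X' \<star>\<^bsub>\<T>\<^esub> G) \<cdot>\<^bsub>\<T>\<^esub> (\<J> X' Y \<cdot>\<^bsub>\<T>\<^esub> (Idt \<T> Y \<star>\<^bsub>\<T>\<^esub> trace_tilde C F))"
    unfolding tilde_braid_left[OF G o(2)] by (rule trace.Cmp_assoc[OF l B[OF o(2,3)] tilde_Mor[OF XG]])
  also have "\<dots> = (trace_tilde C (Idt \<T> X' \<star>\<^bsub>\<T>\<^esub> G) \<cdot>\<^bsub>\<T>\<^esub> trace_tilde C (F \<star>\<^bsub>\<T>\<^esub> Idt \<T> Y)) \<cdot>\<^bsub>\<T>\<^esub> \<J> X Y"
    unfolding tilde_braid_right[OF F o(3)] by (rule trace.Cmp_assoc[OF B[OF o(1,3)] tilde_Mor[OF FY] tilde_Mor[OF XG], symmetric])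
  also have "\<dots> = trace_tilde C (F \<star>\<^bsub>\<T>\<^esub> G) \<cdot>\<^bsub>\<T>\<^esub> \<J> X Y"
    unfolding trace_tensor_factor(2)[OF F G] tilde_Cmp[OF FY XG] ..
  finally show ?thesis .
qed

lemma trace_tensor_functor: "tensor_functor \<T> (rev_tensor \<T>) id (trace_tilde C) \<J> (Idt \<T> (Unit \<T>))"
proof (rule tensor_functor.intro)
  show rev: "monoidal_category (rev_tensor \<T>)" by (rule trace.rev_tensor_monoidal)
  show "linear_functor \<T> (rev_tensor \<T>) id (trace_tilde C)"
    using tilde_linear_functor monoidal_category.axioms(1)[OF rev] by (simp add: linear_functor_def linear_functor_axioms_def)
  show "monoidal_category \<T>" by (rule trace_monoidal_category)
  have bm: "Brd C Y X \<in> Mor C (Y \<boxtimes> X) (X \<boxtimes> Y)" if "X \<in> Obj C" "Y \<in> Obj C" for X Y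
    using that by (simp add: Mor_iff)
  show "tensor_functor_axioms \<T> (rev_tensor \<T>) id (trace_tilde C) \<J> (Idt \<T> (Unit \<T>))"
  proof (rule tensor_functor_axioms.intro, unfold rev_tensor_sel rev_tensor_cat id_apply)
    fix X Y assume "X \<in> Obj \<T>" "Y \<in> Obj \<T>"
    then show "\<J> X Y \<in> Mor \<T> (TenO \<T> Y X) (TenO \<T> X Y) \<and> iso_arr \<T> (\<J> X Y)"
      using embed_Mor[OF bm[of X Y]] embed_iso(1)[OF bm[of X Y]] by simp
  next
    fix F G X X' Y Y' assume "F \<in> Mor \<T> X X'" "G \<in> Mor \<T> Y Y'"
    then show "\<J> X' Y' \<cdot>\<^bsub>\<T>\<^esub> (trace_tilde C G \<star>\<^bsub>\<T>\<^esub> trace_tilde C F) = trace_tilde C (F \<star>\<^bsub>\<T>\<^esub> G) \<cdot>\<^bsub>\<T>\<^esub> \<J> X Y"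
      by (rule trace_J_natural)
  next
    show "Idt \<T> (Unit \<T>) \<in> Mor \<T> (Unit \<T>) (Unit \<T>) \<and> iso_arr \<T> (Idt \<T> (Unit \<T>))"
      by (simp add: trace_Idt_Mor del: trace_sel(4))
  next
    fix X Y Z assume "X \<in> Obj \<T>" "Y \<in> Obj \<T>" "Z \<in> Obj \<T>"
    then have o [simp]: "X \<in> Obj C" "Y \<in> Obj C" "Z \<in> Obj C" by simp_all
    have a: "Asc C X Y Z \<in> Mor C ((X \<boxtimes> Y) \<boxtimes> Z) (X \<boxtimes> (Y \<boxtimes> Z))" "Asc C Z Y X \<in> Mor C ((Z \<boxtimes> Y) \<boxtimes> X) (Z \<boxtimes> (Y \<boxtimes> X))"
      "inv_arr C (Asc C Z Y X) \<in> Mor C (Z \<boxtimes> (Y \<boxtimes> X)) ((Z \<boxtimes> Y) \<boxtimes> X)" by (simp_all add: Mor_iff)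
    have b: "Brd C Z (X \<boxtimes> Y) \<in> Mor C (Z \<boxtimes> (X \<boxtimes> Y)) ((X \<boxtimes> Y) \<boxtimes> Z)" "Idt C Z \<star> Brd C Y X \<in> Mor C (Z \<boxtimes> (Y \<boxtimes> X)) (Z \<boxtimes> (X \<boxtimes> Y))"
      "Brd C (Y \<boxtimes> Z) X \<in> Mor C ((Y \<boxtimes> Z) \<boxtimes> X) (X \<boxtimes> (Y \<boxtimes> Z))" "Brd C Z Y \<star> Idt C X \<in> Mor C ((Z \<boxtimes> Y) \<boxtimes> X) ((Y \<boxtimes> Z) \<boxtimes> X)"
      by (simp_all add: Mor_iff)
    have "trace_embed C (Asc C X Y Z) \<cdot>\<^bsub>\<T>\<^esub> trace_embed C (Brd C Z (X \<boxtimes> Y)) \<cdot>\<^bsub>\<T>\<^esub> trace_embed C (Idt C Z \<star> Brd C Y X)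
      = trace_embed C (Brd C (Y \<boxtimes> Z) X) \<cdot>\<^bsub>\<T>\<^esub> trace_embed C (Brd C Z Y \<star> Idt C X) \<cdot>\<^bsub>\<T>\<^esub> trace_embed C (inv_arr C (Asc C Z Y X))"
      using trace_J_assoc[OF o] embed_Cmp[OF b(2,1)] embed_Cmp[OF Cmp_Mor[OF b(2,1)] a(1)]
        embed_Cmp[OF a(3) b(4)] embed_Cmp[OF Cmp_Mor[OF a(3) b(4)] b(3)] by simp
    then show "trace_tilde C (Asc \<T> X Y Z) \<cdot>\<^bsub>\<T>\<^esub> \<J> (TenO \<T> X Y) Z \<cdot>\<^bsub>\<T>\<^esub> (Idt \<T> Z \<star>\<^bsub>\<T>\<^esub> \<J> X Y)
      = \<J> X (TenO \<T> Y Z) \<cdot>\<^bsub>\<T>\<^esub> (\<J> Y Z \<star>\<^bsub>\<T>\<^esub> Idt \<T> X) \<cdot>\<^bsub>\<T>\<^esub> inv_arr \<T> (Asc \<T> Z Y X)"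
      using tilde_embed[OF a(1)] embed_iso(2)[OF a(2)] embed_TenA[OF Idt_Mor[OF o(3)] bm[OF o(1,2)]]
        embed_TenA[OF bm[OF o(2,3)] Idt_Mor[OF o(1)]] by simp
  next
    fix X assume "X \<in> Obj \<T>"
    then have X [simp]: "X \<in> Obj C" by simp
    have l: "LUn C X \<in> Mor C (\<I> \<boxtimes> X) X" and r: "RUn C X \<in> Mor C (X \<boxtimes> \<I>) X" by (simp_all add: Mor_iff)
    have "trace_embed C (LUn C X) \<cdot>\<^bsub>\<T>\<^esub> \<J> \<I> X = trace_embed C (RUn C X)" "trace_embed C (RUn C X) \<cdot>\<^bsub>\<T>\<^esub> \<J> X \<I> = trace_embed C (LUn C X)"
      using embed_Cmp[OF bm[of \<I> X] l] embed_Cmp[OF bm[of X \<I>] r] Brd_Unit[OF X] by simp_all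
    moreover have "Idt \<T> X \<star>\<^bsub>\<T>\<^esub> Idt \<T> (Unit \<T>) = Idt \<T> (TenO \<T> X (Unit \<T>))" "Idt \<T> (Unit \<T>) \<star>\<^bsub>\<T>\<^esub> Idt \<T> X = Idt \<T> (TenO \<T> (Unit \<T>) X)"
      using trace.TenA_Idt[of X "\<I>"] trace.TenA_Idt[of "\<I>" X] by simp_all
    moreover have "\<J> \<I> X \<cdot>\<^bsub>\<T>\<^esub> Idt \<T> (TenO \<T> X (Unit \<T>)) = \<J> \<I> X" "\<J> X \<I> \<cdot>\<^bsub>\<T>\<^esub> Idt \<T> (TenO \<T> (Unit \<T>) X) = \<J> X \<I>"
      using trace.Cmp_Idt[OF embed_Mor[OF bm[of \<I> X]]] trace.Cmp_Idt[OF embed_Mor[OF bm[of X \<I>]]] by simp_all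
    ultimately show "trace_tilde C (LUn \<T> X) \<cdot>\<^bsub>\<T>\<^esub> \<J> (Unit \<T>) X \<cdot>\<^bsub>\<T>\<^esub> (Idt \<T> X \<star>\<^bsub>\<T>\<^esub> Idt \<T> (Unit \<T>)) = RUn \<T> X"
      "trace_tilde C (RUn \<T> X) \<cdot>\<^bsub>\<T>\<^esub> \<J> X (Unit \<T>) \<cdot>\<^bsub>\<T>\<^esub> (Idt \<T> (Unit \<T>) \<star>\<^bsub>\<T>\<^esub> Idt \<T> X) = LUn \<T> X"
      using tilde_embed[OF l] tilde_embed[OF r] by simp_all
  qed
qed

text \<open>
  As a functor, tilde is inverse to itself up to the twist.
\<close>

lemma trace_tensor_equivalence: "tensor_equivalence \<T> (rev_tensor \<T>) id (trace_tilde C) \<J> (Idt \<T> (Unit \<T>))"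
proof -
  have 1: "linear_functor \<T> (rev_tensor \<T>) id (trace_tilde C)" using trace_tensor_functor by (rule tensor_functor.axioms(1))
  then have 2: "linear_functor (rev_tensor \<T>) \<T> id (trace_tilde C)"
    by (simp add: linear_functor_def linear_functor_axioms_def)
  have 3: "natural_iso (rev_tensor \<T>) (rev_tensor \<T>) (id \<circ> id) (trace_tilde C \<circ> trace_tilde C) id id \<eta>"
    using tilde_eta(1) by (simp add: natural_iso_def)
  show ?thesis unfolding tensor_equivalence_def category_equivalence_def
    using trace_tensor_functor 1 2 3 tilde_eta(2) by blast
qed

end

section \<open>Karoubi envelopes\<close>

context monoidal_category
begin

abbreviation \<K> where "\<K> \<equiv> karoubi C"

lemma karoubi_sel [simp]:
  "Obj \<K> = kar_obj C" "Dom \<K> (p, q, f) = p" "Cod \<K> (p, q, f) = q" "Idt \<K> p = (p, p, snd p)"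
  "Cmp \<K> (q', r, g) (p, q, f) = (p, r, g \<cdot> f)" "Zer \<K> p q = (p, q, Zer C (fst p) (fst q))"
  "Add \<K> (p, q, f) (p', q', g) = (p, q, Add C f g)" "Scl \<K> a (p, q, f) = (p, q, Scl C a f)"
  "Unit \<K> = (\<I>, Idt C \<I>)" "TenO \<K> p q = (fst p \<boxtimes> fst q, snd p \<star> snd q)"
  "TenA \<K> (p, q, f) (p', q', g) = (TenO \<K> p p', TenO \<K> q q', f \<star> g)"
  "Asc \<K> p q r = (TenO \<K> (TenO \<K> p q) r, TenO \<K> p (TenO \<K> q r), Asc C (fst p) (fst q) (fst r) \<cdot> ((snd p \<star> snd q) \<star> snd r))"
  "LUn \<K> p = (TenO \<K> (Unit \<K>) p, p, snd p \<cdot> LUn C (fst p))"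
  "RUn \<K> p = (TenO \<K> p (Unit \<K>), p, snd p \<cdot> RUn C (fst p))"
  by (cases p; cases q; cases p'; cases q'; cases r; simp add: karoubi_def Let_def)+

lemma kar_objD [simp]:
  assumes "p \<in> kar_obj C"
  shows "fst p \<in> Obj C" "snd p \<in> Arr C" "Dom C (snd p) = fst p" "Cod C (snd p) = fst p" "snd p \<cdot> snd p = snd p"
    "k \<in> Arr C \<Longrightarrow> Cod C k = fst p \<Longrightarrow> snd p \<cdot> (snd p \<cdot> k) = snd p \<cdot> k"
proof -
  show 1: "fst p \<in> Obj C" "snd p \<in> Arr C" "Dom C (snd p) = fst p" "Cod C (snd p) = fst p" "snd p \<cdot> snd p = snd p"
    using assms by (auto simp: kar_obj_def Mor_iff)
  show "k \<in> Arr C \<Longrightarrow> Cod C k = fst p \<Longrightarrow> snd p \<cdot> (snd p \<cdot> k) = snd p \<cdot> k"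
    using Cmp_tail[OF 1(5)] 1 by simp
qed

lemma kar_objI: "fst p \<in> Obj C \<Longrightarrow> snd p \<in> Mor C (fst p) (fst p) \<Longrightarrow> snd p \<cdot> snd p = snd p \<Longrightarrow> p \<in> kar_obj C"
  by (cases p) (simp add: kar_obj_def)

lemma kar_Mor:
  "F \<in> Mor \<K> p q \<longleftrightarrow> p \<in> kar_obj C \<and> q \<in> kar_obj C \<and>
     (\<exists>f. F = (p, q, f) \<and> f \<in> Arr C \<and> Dom C f = fst p \<and> Cod C f = fst q \<and> snd q \<cdot> f = f \<and> f \<cdot> snd p = f)"
proof -
  have "snd q \<cdot> f \<cdot> snd p = f \<longleftrightarrow> snd q \<cdot> f = f \<and> f \<cdot> snd p = f"
    if [simp]: "p \<in> kar_obj C" "q \<in> kar_obj C" "f \<in> Arr C" "Dom C f = fst p" "Cod C f = fst q" for f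
  proof
    assume e: "snd q \<cdot> f \<cdot> snd p = f"
    have "snd q \<cdot> (snd q \<cdot> f \<cdot> snd p) = snd q \<cdot> f \<cdot> snd p" "(snd q \<cdot> f \<cdot> snd p) \<cdot> snd p = snd q \<cdot> f \<cdot> snd p" by simp_all
    then show "snd q \<cdot> f = f \<and> f \<cdot> snd p = f" unfolding e by simp
  qed simp
  then show ?thesis by (cases F) (auto simp: Mor_def karoubi_def Let_def)
qed

lemma kar_Arr: "F \<in> Arr \<K> \<longleftrightarrow> (\<exists>p q. F \<in> Mor \<K> p q)"
  by (auto simp: Mor_def)

lemma kar_MorE:
  assumes "F \<in> Mor \<K> p q"
  obtains f where "F = (p, q, f)" "p \<in> kar_obj C" "q \<in> kar_obj C" "f \<in> Arr C" "Dom C f = fst p" "Cod C f = fst q"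
    "snd q \<cdot> f = f" "f \<cdot> snd p = f"
  using assms by (auto simp: kar_Mor)

lemma karoubi_linear_category: "linear_category \<K>"
proof (rule linear_category.intro)
  fix F assume "F \<in> Arr \<K>" then show "Dom \<K> F \<in> Obj \<K> \<and> Cod \<K> F \<in> Obj \<K>" by (auto simp: kar_Arr kar_Mor)
next
  fix p assume "p \<in> Obj \<K>" then show "Idt \<K> p \<in> Mor \<K> p p" by (simp add: kar_Mor)
next
  fix F G p q r assume "F \<in> Mor \<K> p q" "G \<in> Mor \<K> q r"
  then show "G \<cdot>\<^bsub>\<K>\<^esub> F \<in> Mor \<K> p r" by (auto elim!: kar_MorE simp: kar_Mor Cmp_tail)
next
  fix F p q assume "F \<in> Mor \<K> p q"
  then show "F \<cdot>\<^bsub>\<K>\<^esub> Idt \<K> p = F" "Idt \<K> q \<cdot>\<^bsub>\<K>\<^esub> F = F" by (auto elim!: kar_MorE)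
next
  fix F G H s p q r assume "F \<in> Mor \<K> s p" "G \<in> Mor \<K> p q" "H \<in> Mor \<K> q r"
  then show "(H \<cdot>\<^bsub>\<K>\<^esub> G) \<cdot>\<^bsub>\<K>\<^esub> F = H \<cdot>\<^bsub>\<K>\<^esub> (G \<cdot>\<^bsub>\<K>\<^esub> F)" by (auto elim!: kar_MorE)
next
  fix p q assume "p \<in> Obj \<K>" "q \<in> Obj \<K>"
  then have pq [simp]: "p \<in> kar_obj C" "q \<in> kar_obj C" by simp_all
  let ?H = "hom_space \<K> p q" and ?X = "fst p" and ?Y = "fst q"
  have X: "?X \<in> Obj C" "?Y \<in> Obj C" by simp_all
  have sel [simp]: "carrier ?H = Mor \<K> p q" "add ?H = Add \<K>" "smult ?H = Scl \<K>" "ring.zero ?H = Zer \<K> p q"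
    by (simp_all add: hom_space_def)
  have Z: "Zer C ?X ?Y \<in> Arr C \<and> Dom C (Zer C ?X ?Y) = ?X \<and> Cod C (Zer C ?X ?Y) = ?Y"
    using Zer_Mor[OF X] by (simp add: Mor_iff)
  have zer: "Zer \<K> p q \<in> Mor \<K> p q"
  proof -
    have "snd q \<cdot> Scl C 0 (Zer C ?X ?Y) = Scl C 0 (snd q \<cdot> Zer C ?X ?Y)" "Scl C 0 (Zer C ?X ?Y) \<cdot> snd p = Scl C 0 (Zer C ?X ?Y \<cdot> snd p)"
      using Z by (simp_all add: Cmp_linear)
    moreover have "snd q \<cdot> Zer C ?X ?Y \<in> Mor C ?X ?Y" "Zer C ?X ?Y \<cdot> snd p \<in> Mor C ?X ?Y" using Z by (simp_all add: Mor_iff)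
    ultimately show ?thesis using Z Scl_zero[OF X] Scl_Zer[OF X] by (simp add: kar_Mor)
  qed
  have add: "Add \<K> F G \<in> Mor \<K> p q" if "F \<in> Mor \<K> p q" "G \<in> Mor \<K> p q" for F G
    using that by (auto elim!: kar_MorE simp: kar_Mor Add_simps Cmp_linear)
  have scl: "Scl \<K> a F \<in> Mor \<K> p q" if "F \<in> Mor \<K> p q" for a F
    using that by (auto elim!: kar_MorE simp: kar_Mor Scl_simps Cmp_linear)
  have M: "f \<in> Mor C ?X ?Y" if "f \<in> Arr C" "Dom C f = ?X" "Cod C f = ?Y" for f using that by (simp add: Mor_iff)
  show "module (scalars :: 'k ring) ?H"
  proof (rule moduleI)
    show "abelian_group ?H"
    proof (rule abelian_groupI, unfold sel)
      fix F G H assume FGH: "F \<in> Mor \<K> p q" "G \<in> Mor \<K> p q" "H \<in> Mor \<K> p q"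
      show "Add \<K> F G \<in> Mor \<K> p q" by (rule add[OF FGH(1,2)])
      show "Add \<K> (Add \<K> F G) H = Add \<K> F (Add \<K> G H)" using FGH by (auto elim!: kar_MorE simp: Add_assoc[OF X M M M])
      show "Add \<K> F G = Add \<K> G F" using FGH by (auto elim!: kar_MorE simp: Add_comm[OF X M M])
    next
      fix F assume F: "F \<in> Mor \<K> p q"
      then show "Add \<K> (Zer \<K> p q) F = F" by (auto elim!: kar_MorE simp: Zer_Add[OF X M])
      show "\<exists>G\<in>Mor \<K> p q. Add \<K> G F = Zer \<K> p q"
        using F by (intro bexI[OF _ scl[OF F, of "- 1"]]) (auto elim!: kar_MorE simp: neg_Add[OF X M])
    qed (rule zer)
  next
    fix a b :: 'k and F G assume "F \<in> carrier ?H" "G \<in> carrier ?H"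
    then show "(a \<oplus>\<^bsub>scalars\<^esub> b) \<odot>\<^bsub>?H\<^esub> F = a \<odot>\<^bsub>?H\<^esub> F \<oplus>\<^bsub>?H\<^esub> b \<odot>\<^bsub>?H\<^esub> F"
      "a \<odot>\<^bsub>?H\<^esub> (F \<oplus>\<^bsub>?H\<^esub> G) = a \<odot>\<^bsub>?H\<^esub> F \<oplus>\<^bsub>?H\<^esub> a \<odot>\<^bsub>?H\<^esub> G"
      "(a \<otimes>\<^bsub>scalars\<^esub> b) \<odot>\<^bsub>?H\<^esub> F = a \<odot>\<^bsub>?H\<^esub> (b \<odot>\<^bsub>?H\<^esub> F)" "\<one>\<^bsub>scalars\<^esub> \<odot>\<^bsub>?H\<^esub> F = F" "a \<odot>\<^bsub>?H\<^esub> F \<in> carrier ?H"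
      by (auto elim!: kar_MorE simp: Add_Scl[OF X M] Scl_Add[OF X M M] Scl_Scl[OF X M] Scl_one[OF X M] scl[unfolded karoubi_sel] kar_Mor Scl_simps Cmp_linear)
  qed (rule scalars_cring)
next
  fix F F' G p q r assume "F \<in> Mor \<K> p q" "F' \<in> Mor \<K> p q" "G \<in> Mor \<K> q r"
  then show "G \<cdot>\<^bsub>\<K>\<^esub> Add \<K> F F' = Add \<K> (G \<cdot>\<^bsub>\<K>\<^esub> F) (G \<cdot>\<^bsub>\<K>\<^esub> F')" by (auto elim!: kar_MorE simp: Cmp_linear)
next
  fix F G G' p q r assume "F \<in> Mor \<K> p q" "G \<in> Mor \<K> q r" "G' \<in> Mor \<K> q r"
  then show "Add \<K> G G' \<cdot>\<^bsub>\<K>\<^esub> F = Add \<K> (G \<cdot>\<^bsub>\<K>\<^esub> F) (G' \<cdot>\<^bsub>\<K>\<^esub> F)" by (auto elim!: kar_MorE simp: Cmp_linear)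
next
  fix F G p q r k assume "F \<in> Mor \<K> p q" "G \<in> Mor \<K> q r"
  then show "G \<cdot>\<^bsub>\<K>\<^esub> Scl \<K> k F = Scl \<K> k (G \<cdot>\<^bsub>\<K>\<^esub> F)" "Scl \<K> k G \<cdot>\<^bsub>\<K>\<^esub> F = Scl \<K> k (G \<cdot>\<^bsub>\<K>\<^esub> F)"
    by (auto elim!: kar_MorE simp: Cmp_linear)
qed

text \<open>
  Every structure isomorphism of the envelope arises from an isomorphism of \<open>C\<close> that intertwines two
  idempotents, by restriction to their images.
\<close>

lemma kar_iso_restrict:
  assumes [simp]: "p \<in> kar_obj C" "q \<in> kar_obj C" "iso_arr C f" "Dom C f = fst p" "Cod C f = fst q"
    and e: "snd q \<cdot> f = f \<cdot> snd p"
  shows "(p, q, f \<cdot> snd p) \<in> Mor \<K> p q" "iso_arr \<K> (p, q, f \<cdot> snd p)"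
    "inv_arr \<K> (p, q, f \<cdot> snd p) = (q, p, inv_arr C f \<cdot> snd q)"
proof -
  interpret K: linear_category \<K> by (rule karoubi_linear_category)
  have e': "inv_arr C f \<cdot> snd q = snd p \<cdot> inv_arr C f"
  proof -
    have "inv_arr C f \<cdot> (snd q \<cdot> f) \<cdot> inv_arr C f = inv_arr C f \<cdot> (f \<cdot> snd p) \<cdot> inv_arr C f" unfolding e ..
    then show ?thesis by simp
  qed
  show m: "(p, q, f \<cdot> snd p) \<in> Mor \<K> p q" by (simp add: kar_Mor Cmp_tail[OF e])
  have m': "(q, p, inv_arr C f \<cdot> snd q) \<in> Mor \<K> q p" by (simp add: kar_Mor e')
  show "iso_arr \<K> (p, q, f \<cdot> snd p)" "inv_arr \<K> (p, q, f \<cdot> snd p) = (q, p, inv_arr C f \<cdot> snd q)"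
    using K.inv_arrI[OF m m'] by (simp_all add: Cmp_tail[OF e] Cmp_tail[OF e'] e flip: e)
qed

lemma kar_ten_obj [simp]:
  assumes "p \<in> kar_obj C" "q \<in> kar_obj C"
  shows "(fst p \<boxtimes> fst q, snd p \<star> snd q) \<in> kar_obj C"
  using assms by (simp add: kar_obj_def Mor_iff interchange)

lemma kar_unit_obj [simp]: "(\<I>, Idt C \<I>) \<in> kar_obj C"
  by (simp add: kar_obj_def Mor_iff)

lemma karoubi_Asc:
  assumes p [simp]: "p \<in> kar_obj C" "q \<in> kar_obj C" "r \<in> kar_obj C"
  shows "Asc \<K> p q r \<in> Mor \<K> (TenO \<K> (TenO \<K> p q) r) (TenO \<K> p (TenO \<K> q r))" "iso_arr \<K> (Asc \<K> p q r)"
    "inv_arr \<K> (Asc \<K> p q r) = (TenO \<K> p (TenO \<K> q r), TenO \<K> (TenO \<K> p q) r, inv_arr C (Asc C (fst p) (fst q) (fst r)) \<cdot> (snd p \<star> (snd q \<star> snd r)))"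
proof -
  have o: "TenO \<K> (TenO \<K> p q) r \<in> kar_obj C" "TenO \<K> p (TenO \<K> q r) \<in> kar_obj C"
    using kar_ten_obj[OF kar_ten_obj[OF p(1,2)] p(3)] kar_ten_obj[OF p(1) kar_ten_obj[OF p(2,3)]] by simp_all
  have e: "snd (TenO \<K> p (TenO \<K> q r)) \<cdot> Asc C (fst p) (fst q) (fst r) = Asc C (fst p) (fst q) (fst r) \<cdot> snd (TenO \<K> (TenO \<K> p q) r)"
    using Asc_nat[of "snd p" "snd q" "snd r"] by simp
  show "Asc \<K> p q r \<in> Mor \<K> (TenO \<K> (TenO \<K> p q) r) (TenO \<K> p (TenO \<K> q r))" "iso_arr \<K> (Asc \<K> p q r)"
    "inv_arr \<K> (Asc \<K> p q r) = (TenO \<K> p (TenO \<K> q r), TenO \<K> (TenO \<K> p q) r, inv_arr C (Asc C (fst p) (fst q) (fst r)) \<cdot> (snd p \<star> (snd q \<star> snd r)))"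
    using kar_iso_restrict[OF o _ _ _ e] by simp_all
qed

lemma karoubi_unitors:
  assumes [simp]: "p \<in> kar_obj C"
  shows "LUn \<K> p \<in> Mor \<K> (TenO \<K> (Unit \<K>) p) p \<and> iso_arr \<K> (LUn \<K> p)"
    "RUn \<K> p \<in> Mor \<K> (TenO \<K> p (Unit \<K>)) p \<and> iso_arr \<K> (RUn \<K> p)"
proof -
  have o: "TenO \<K> (Unit \<K>) p \<in> kar_obj C" "TenO \<K> p (Unit \<K>) \<in> kar_obj C"
    using kar_ten_obj[OF kar_unit_obj assms] kar_ten_obj[OF assms kar_unit_obj] by simp_all
  have e: "snd p \<cdot> LUn C (fst p) = LUn C (fst p) \<cdot> snd (TenO \<K> (Unit \<K>) p)"
    "snd p \<cdot> RUn C (fst p) = RUn C (fst p) \<cdot> snd (TenO \<K> p (Unit \<K>))"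
    using LUn_nat[of "snd p"] RUn_nat[of "snd p"] by simp_all
  show "LUn \<K> p \<in> Mor \<K> (TenO \<K> (Unit \<K>) p) p \<and> iso_arr \<K> (LUn \<K> p)"
    using kar_iso_restrict[OF o(1) assms _ _ _ e(1)] e(1) by simp
  show "RUn \<K> p \<in> Mor \<K> (TenO \<K> p (Unit \<K>)) p \<and> iso_arr \<K> (RUn \<K> p)"
    using kar_iso_restrict[OF o(2) assms _ _ _ e(2)] e(2) by simp
qed

lemma karoubi_monoidal_category: "monoidal_category \<K>"
proof (rule monoidal_category.intro[OF karoubi_linear_category], rule monoidal_category_axioms.intro)
  show "Unit \<K> \<in> Obj \<K>" by simp
  show "p \<in> Obj \<K> \<Longrightarrow> q \<in> Obj \<K> \<Longrightarrow> TenO \<K> p q \<in> Obj \<K>" for p q by simp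
  show "F \<star>\<^bsub>\<K>\<^esub> G \<in> Mor \<K> (TenO \<K> p q) (TenO \<K> p' q')" if "F \<in> Mor \<K> p p'" "G \<in> Mor \<K> q q'" for F G p p' q q'
    using that by (auto elim!: kar_MorE simp: kar_Mor interchange)
  show "Idt \<K> p \<star>\<^bsub>\<K>\<^esub> Idt \<K> q = Idt \<K> (TenO \<K> p q)" if "p \<in> Obj \<K>" "q \<in> Obj \<K>" for p q by simp
  show "(F' \<cdot>\<^bsub>\<K>\<^esub> F) \<star>\<^bsub>\<K>\<^esub> (G' \<cdot>\<^bsub>\<K>\<^esub> G) = (F' \<star>\<^bsub>\<K>\<^esub> G') \<cdot>\<^bsub>\<K>\<^esub> (F \<star>\<^bsub>\<K>\<^esub> G)"
    if "F \<in> Mor \<K> p p'" "F' \<in> Mor \<K> p' p''" "G \<in> Mor \<K> q q'" "G' \<in> Mor \<K> q' q''" for F F' G G' p p' p'' q q' q''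
    using that by (auto elim!: kar_MorE simp: interchange)
  show "Add \<K> F F' \<star>\<^bsub>\<K>\<^esub> G = Add \<K> (F \<star>\<^bsub>\<K>\<^esub> G) (F' \<star>\<^bsub>\<K>\<^esub> G)"
    if "F \<in> Mor \<K> p p'" "F' \<in> Mor \<K> p p'" "G \<in> Mor \<K> q q'" for F F' G p p' q q'
    using that by (auto elim!: kar_MorE simp: TenA_linear)
  show "F \<star>\<^bsub>\<K>\<^esub> Add \<K> G G' = Add \<K> (F \<star>\<^bsub>\<K>\<^esub> G) (F \<star>\<^bsub>\<K>\<^esub> G')"
    if "F \<in> Mor \<K> p p'" "G \<in> Mor \<K> q q'" "G' \<in> Mor \<K> q q'" for F G G' p p' q q'
    using that by (auto elim!: kar_MorE simp: TenA_linear)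
  show "Scl \<K> k F \<star>\<^bsub>\<K>\<^esub> G = Scl \<K> k (F \<star>\<^bsub>\<K>\<^esub> G)" "F \<star>\<^bsub>\<K>\<^esub> Scl \<K> k G = Scl \<K> k (F \<star>\<^bsub>\<K>\<^esub> G)"
    if "F \<in> Mor \<K> p p'" "G \<in> Mor \<K> q q'" for F G p p' q q' k
    using that by (auto elim!: kar_MorE simp: TenA_linear)
  show "Asc \<K> p q r \<in> Mor \<K> (TenO \<K> (TenO \<K> p q) r) (TenO \<K> p (TenO \<K> q r)) \<and> iso_arr \<K> (Asc \<K> p q r)"
    if "p \<in> Obj \<K>" "q \<in> Obj \<K>" "r \<in> Obj \<K>" for p q r using karoubi_Asc that by (simp del: karoubi_sel(10,12))
  show "LUn \<K> p \<in> Mor \<K> (TenO \<K> (Unit \<K>) p) p \<and> iso_arr \<K> (LUn \<K> p)"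
    "RUn \<K> p \<in> Mor \<K> (TenO \<K> p (Unit \<K>)) p \<and> iso_arr \<K> (RUn \<K> p)" if "p \<in> Obj \<K>" for p
    using karoubi_unitors[of p] that by (simp_all only: karoubi_sel(1))
next
  fix F G H p p' q q' r r' assume "F \<in> Mor \<K> p p'" "G \<in> Mor \<K> q q'" "H \<in> Mor \<K> r r'"
  then show "Asc \<K> p' q' r' \<cdot>\<^bsub>\<K>\<^esub> ((F \<star>\<^bsub>\<K>\<^esub> G) \<star>\<^bsub>\<K>\<^esub> H) = (F \<star>\<^bsub>\<K>\<^esub> (G \<star>\<^bsub>\<K>\<^esub> H)) \<cdot>\<^bsub>\<K>\<^esub> Asc \<K> p q r"
  proof (elim kar_MorE)
    fix f g h assume FGH: "F = (p, p', f)" "G = (q, q', g)" "H = (r, r', h)"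
      and [simp]: "p \<in> kar_obj C" "p' \<in> kar_obj C" "q \<in> kar_obj C" "q' \<in> kar_obj C" "r \<in> kar_obj C" "r' \<in> kar_obj C"
      "f \<in> Arr C" "Dom C f = fst p" "Cod C f = fst p'" "snd p' \<cdot> f = f" "f \<cdot> snd p = f"
      "g \<in> Arr C" "Dom C g = fst q" "Cod C g = fst q'" "snd q' \<cdot> g = g" "g \<cdot> snd q = g"
      "h \<in> Arr C" "Dom C h = fst r" "Cod C h = fst r'" "snd r' \<cdot> h = h" "h \<cdot> snd r = h"
    have n: "(f \<star> (g \<star> h)) \<cdot> Asc C (fst p) (fst q) (fst r) = Asc C (fst p') (fst q') (fst r') \<cdot> ((f \<star> g) \<star> h)"
      using Asc_nat[of f g h] by simp
    show ?thesis by (simp add: FGH interchange n Cmp_tail[OF n])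
  qed
next
  fix F p q assume "F \<in> Mor \<K> p q"
  then obtain f where [simp]: "F = (p, q, f)" "p \<in> kar_obj C" "q \<in> kar_obj C" "f \<in> Arr C" "Dom C f = fst p" "Cod C f = fst q"
    "snd q \<cdot> f = f" "f \<cdot> snd p = f" by (rule kar_MorE)
  show "LUn \<K> q \<cdot>\<^bsub>\<K>\<^esub> (Idt \<K> (Unit \<K>) \<star>\<^bsub>\<K>\<^esub> F) = F \<cdot>\<^bsub>\<K>\<^esub> LUn \<K> p"
    using LUn_nat[of f] by (simp add: Cmp_tail[of "snd q" f f] Cmp_tail[of f "snd p" f])
  show "RUn \<K> q \<cdot>\<^bsub>\<K>\<^esub> (F \<star>\<^bsub>\<K>\<^esub> Idt \<K> (Unit \<K>)) = F \<cdot>\<^bsub>\<K>\<^esub> RUn \<K> p"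
    using RUn_nat[of f] by (simp add: Cmp_tail[of "snd q" f f] Cmp_tail[of f "snd p" f])
next
  fix w x y z assume "w \<in> Obj \<K>" "x \<in> Obj \<K>" "y \<in> Obj \<K>" "z \<in> Obj \<K>"
  then have [simp]: "w \<in> kar_obj C" "x \<in> kar_obj C" "y \<in> kar_obj C" "z \<in> kar_obj C" by simp_all
  let ?W = "fst w" and ?X = "fst x" and ?Y = "fst y" and ?Z = "fst z"
  let ?e = "((snd w \<star> snd x) \<star> snd y) \<star> snd z"
  have n1: "((snd w \<star> snd x) \<star> (snd y \<star> snd z)) \<cdot> Asc C (?W \<boxtimes> ?X) ?Y ?Z = Asc C (?W \<boxtimes> ?X) ?Y ?Z \<cdot> ?e"
    using Asc_nat[of "snd w \<star> snd x" "snd y" "snd z"] by simp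
  have n2: "((snd w \<star> (snd x \<star> snd y)) \<star> snd z) \<cdot> (Asc C ?W ?X ?Y \<star> Idt C ?Z) = (Asc C ?W ?X ?Y \<star> Idt C ?Z) \<cdot> ?e"
    using Asc_nat[of "snd w" "snd x" "snd y"] by (simp add: interchange)
  have n3: "(snd w \<star> ((snd x \<star> snd y) \<star> snd z)) \<cdot> Asc C ?W (?X \<boxtimes> ?Y) ?Z = Asc C ?W (?X \<boxtimes> ?Y) ?Z \<cdot> ((snd w \<star> (snd x \<star> snd y)) \<star> snd z)"
    using Asc_nat[of "snd w" "snd x \<star> snd y" "snd z"] by simp
  have s1: "snd w \<star> (Asc C ?X ?Y ?Z \<cdot> ((snd x \<star> snd y) \<star> snd z)) = (Idt C ?W \<star> Asc C ?X ?Y ?Z) \<cdot> (snd w \<star> ((snd x \<star> snd y) \<star> snd z))"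
    by (simp add: interchange)
  have s2: "(Asc C ?W ?X ?Y \<cdot> ((snd w \<star> snd x) \<star> snd y)) \<star> snd z = (Asc C ?W ?X ?Y \<star> Idt C ?Z) \<cdot> ?e"
    by (simp add: interchange)
  have i: "?e \<cdot> ?e = ?e" "((snd w \<star> (snd x \<star> snd y)) \<star> snd z) \<cdot> ((snd w \<star> (snd x \<star> snd y)) \<star> snd z) = ((snd w \<star> (snd x \<star> snd y)) \<star> snd z)"
    by (simp_all add: interchange)
  have L: "(Asc C ?W ?X (?Y \<boxtimes> ?Z) \<cdot> ((snd w \<star> snd x) \<star> (snd y \<star> snd z))) \<cdot> (Asc C (?W \<boxtimes> ?X) ?Y ?Z \<cdot> ?e)
      = (Asc C ?W ?X (?Y \<boxtimes> ?Z) \<cdot> Asc C (?W \<boxtimes> ?X) ?Y ?Z) \<cdot> ?e"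
    by (simp add: Cmp_tail[OF n1] i)
  have R: "(snd w \<star> (Asc C ?X ?Y ?Z \<cdot> ((snd x \<star> snd y) \<star> snd z))) \<cdot> (Asc C ?W (?X \<boxtimes> ?Y) ?Z \<cdot> ((snd w \<star> (snd x \<star> snd y)) \<star> snd z)) \<cdot> ((Asc C ?W ?X ?Y \<cdot> ((snd w \<star> snd x) \<star> snd y)) \<star> snd z)
      = ((Idt C ?W \<star> Asc C ?X ?Y ?Z) \<cdot> Asc C ?W (?X \<boxtimes> ?Y) ?Z \<cdot> (Asc C ?W ?X ?Y \<star> Idt C ?Z)) \<cdot> ?e"
    unfolding s1 s2 by (simp add: Cmp_tail[OF n3] Cmp_tail[OF n2] Cmp_tail[OF i(2)] i)
  show "Asc \<K> w x (TenO \<K> y z) \<cdot>\<^bsub>\<K>\<^esub> Asc \<K> (TenO \<K> w x) y z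
      = (Idt \<K> w \<star>\<^bsub>\<K>\<^esub> Asc \<K> x y z) \<cdot>\<^bsub>\<K>\<^esub> Asc \<K> w (TenO \<K> x y) z \<cdot>\<^bsub>\<K>\<^esub> (Asc \<K> w x y \<star>\<^bsub>\<K>\<^esub> Idt \<K> z)"
    unfolding karoubi_sel fst_conv snd_conv L R by (simp add: pentagon)
  have t: "(snd x \<star> (snd y \<cdot> LUn C ?Y)) \<cdot> (Asc C ?X \<I> ?Y \<cdot> ((snd x \<star> Idt C \<I>) \<star> snd y)) = (snd x \<cdot> RUn C ?X) \<star> snd y"
  proof -
    have "(snd x \<star> (snd y \<cdot> LUn C ?Y)) \<cdot> (Asc C ?X \<I> ?Y \<cdot> ((snd x \<star> Idt C \<I>) \<star> snd y))
        = (snd x \<star> snd y) \<cdot> ((Idt C ?X \<star> LUn C ?Y) \<cdot> Asc C ?X \<I> ?Y) \<cdot> ((snd x \<star> Idt C \<I>) \<star> snd y)"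
      by (simp add: interchange_tail)
    also have "\<dots> = (snd x \<cdot> RUn C ?X) \<star> snd y"
      using RUn_nat[of "snd x"] by (simp add: triangle interchange)
    finally show ?thesis .
  qed
  show "(Idt \<K> x \<star>\<^bsub>\<K>\<^esub> LUn \<K> y) \<cdot>\<^bsub>\<K>\<^esub> Asc \<K> x (Unit \<K>) y = RUn \<K> x \<star>\<^bsub>\<K>\<^esub> Idt \<K> y"
    unfolding karoubi_sel fst_conv snd_conv t by simp
qed

end

section \<open>Functors between Karoubi envelopes\<close>

lemma kar_funO_simps [simp]: "fst (kar_funO Fo Fa p) = Fo (fst p)" "snd (kar_funO Fo Fa p) = Fa (snd p)"
  "kar_funO Fo Fa p = kar_funO Fo Fa p' \<longleftrightarrow> Fo (fst p) = Fo (fst p') \<and> Fa (snd p) = Fa (snd p')"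
  by (cases p; cases p'; simp add: kar_funO_def)+

lemma kar_funA_simp [simp]: "kar_funA Fo Fa (p, q, f) = (kar_funO Fo Fa p, kar_funO Fo Fa q, Fa f)"
  by (simp add: kar_funA_def)

lemma kar_fun_id: "kar_funO id id = id" "kar_funA id id = id"
  by (auto simp: fun_eq_iff kar_funO_def kar_funA_def)

lemma kar_fun_comp: "kar_funO (Go \<circ> Fo) (Ga \<circ> Fa) = kar_funO Go Ga \<circ> kar_funO Fo Fa"
  "kar_funA (Go \<circ> Fo) (Ga \<circ> Fa) = kar_funA Go Ga \<circ> kar_funA Fo Fa"
  by (auto simp: fun_eq_iff kar_funO_def kar_funA_def)

lemma (in linear_functor) Fa_simps [simp]:
  assumes "f \<in> Arr C"
  shows "Fa f \<in> Arr D" "Dom D (Fa f) = Fo (Dom C f)" "Cod D (Fa f) = Fo (Cod C f)"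
  using Fa_Mor[of f "Dom C f" "Cod C f"] assms by (auto simp: C.Mor_iff D.Mor_iff)

lemma (in linear_functor) Fa_Cmp_simp:
  assumes "f \<in> Arr C" "g \<in> Arr C" "Dom C g = Cod C f"
  shows "Fa (g \<cdot>\<^bsub>C\<^esub> f) = Fa g \<cdot>\<^bsub>D\<^esub> Fa f"
  using Fa_Cmp[of f "Dom C f" "Cod C f" g "Cod C g"] assms by (auto simp: C.Mor_iff)

lemma linear_functor_id: "linear_category C \<Longrightarrow> linear_functor C C id id"
  by (simp add: linear_functor_def linear_functor_axioms_def)

lemma linear_functor_comp:
  assumes "linear_functor C D Fo Fa" "linear_functor D E Go Ga"
  shows "linear_functor C E (Go \<circ> Fo) (Ga \<circ> Fa)"
proof -
  interpret F: linear_functor C D Fo Fa by (rule assms(1))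
  interpret G: linear_functor D E Go Ga by (rule assms(2))
  show ?thesis
    by (intro linear_functor.intro F.C.linear_category_axioms G.D.linear_category_axioms linear_functor_axioms.intro)
      (auto simp: F.Fa_Idt G.Fa_Idt F.Fo_Obj G.Fo_Obj F.Fa_Cmp G.Fa_Cmp[OF F.Fa_Mor F.Fa_Mor] F.Fa_Add G.Fa_Add[OF F.Fa_Mor F.Fa_Mor]
        F.Fa_Scl G.Fa_Scl[OF F.Fa_Mor] intro: F.Fa_Mor G.Fa_Mor)
qed

text \<open>
  The envelope is formed together with its tensor product, so source and target are monoidal even
  when the functor carries no tensor structure.
\<close>

locale monoidal_linear_functor = C: monoidal_category C + D: monoidal_category D + linear_functor C D Fo Fa
  for C :: "('o, 'a, 'k::field, 'z) monoidal_cat_scheme"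
    and D :: "('p, 'b, 'k, 'y) monoidal_cat_scheme"
    and Fo :: "'o \<Rightarrow> 'p" and Fa :: "'a \<Rightarrow> 'b"
begin

lemma kar_funO_obj [simp]: "p \<in> kar_obj C \<Longrightarrow> kar_funO Fo Fa p \<in> kar_obj D"
  using Fa_Cmp_simp[of "snd p" "snd p"] by (intro D.kar_objI) (auto simp: D.Mor_iff Fo_Obj)

lemma kar_funA_Mor:
  assumes "F \<in> Mor (karoubi C) p q"
  shows "kar_funA Fo Fa F \<in> Mor (karoubi D) (kar_funO Fo Fa p) (kar_funO Fo Fa q)"
proof -
  obtain f where [simp]: "F = (p, q, f)" "p \<in> kar_obj C" "q \<in> kar_obj C" "f \<in> Arr C" "Dom C f = fst p" "Cod C f = fst q"
    and e: "snd q \<cdot>\<^bsub>C\<^esub> f = f" "f \<cdot>\<^bsub>C\<^esub> snd p = f" using assms by (rule C.kar_MorE)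
  show ?thesis using Fa_Cmp_simp[of f "snd q"] Fa_Cmp_simp[of "snd p" f] by (simp add: D.kar_Mor e)
qed

lemma karoubi_linear_functor: "linear_functor (karoubi C) (karoubi D) (kar_funO Fo Fa) (kar_funA Fo Fa)"
proof (rule linear_functor.intro[OF C.karoubi_linear_category D.karoubi_linear_category], rule linear_functor_axioms.intro)
  show "kar_funA Fo Fa (Cmp (karoubi C) G F) = Cmp (karoubi D) (kar_funA Fo Fa G) (kar_funA Fo Fa F)"
    if "F \<in> Mor (karoubi C) p q" "G \<in> Mor (karoubi C) q r" for F G p q r
    using that by (auto elim!: C.kar_MorE simp: Fa_Cmp_simp)
  show "kar_funA Fo Fa (Add (karoubi C) F G) = Add (karoubi D) (kar_funA Fo Fa F) (kar_funA Fo Fa G)"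
    if "F \<in> Mor (karoubi C) p q" "G \<in> Mor (karoubi C) p q" for F G p q
    using that by (auto elim!: C.kar_MorE simp: Fa_Add[of _ "fst p" "fst q"] C.Mor_iff)
  show "kar_funA Fo Fa (Scl (karoubi C) a F) = Scl (karoubi D) a (kar_funA Fo Fa F)"
    if "F \<in> Mor (karoubi C) p q" for F p q a
    using that by (auto elim!: C.kar_MorE simp: Fa_Scl[of _ "fst p" "fst q"] C.Mor_iff)
qed (use kar_funA_Mor in auto)

end

text \<open>
  By naturality one of the two idempotents in the definition of \<open>kar_nat\<close> can be dropped.
\<close>

lemma kar_nat_natural_iso:
  assumes F: "monoidal_linear_functor C D Fo Fa" and G: "monoidal_linear_functor C D Go Ga"
    and n: "natural_iso C D Fo Fa Go Ga \<eta>"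
  shows "p \<in> kar_obj C \<Longrightarrow> kar_nat D Fo Fa Go Ga \<eta> p = (kar_funO Fo Fa p, kar_funO Go Ga p, Cmp D (\<eta> (fst p)) (Fa (snd p)))"
    "natural_iso (karoubi C) (karoubi D) (kar_funO Fo Fa) (kar_funA Fo Fa) (kar_funO Go Ga) (kar_funA Go Ga)
      (kar_nat D Fo Fa Go Ga \<eta>)"
proof -
  interpret F: monoidal_linear_functor C D Fo Fa by (rule F)
  interpret G: monoidal_linear_functor C D Go Ga by (rule G)
  have \<eta> [simp]: "\<eta> X \<in> Arr D" "Dom D (\<eta> X) = Fo X" "Cod D (\<eta> X) = Go X" "iso_arr D (\<eta> X)" if "X \<in> Obj C" for X
    using n that by (auto simp: natural_iso_def F.D.Mor_iff)
  have nat: "Cmp D (\<eta> (Cod C f)) (Fa f) = Cmp D (Ga f) (\<eta> (Dom C f))" if "f \<in> Arr C" for f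
    using n that by (auto simp: natural_iso_def)
  have Fe: "Cmp D (Fa (snd p)) (Fa (snd p)) = Fa (snd p)" if "p \<in> kar_obj C" for p
    using that F.Fa_Cmp_simp[of "snd p" "snd p"] by simp
  show comp: "kar_nat D Fo Fa Go Ga \<eta> p = (kar_funO Fo Fa p, kar_funO Go Ga p, Cmp D (\<eta> (fst p)) (Fa (snd p)))"
    if [simp]: "p \<in> kar_obj C" for p
  proof -
    have n: "Cmp D (Ga (snd p)) (\<eta> (fst p)) = Cmp D (\<eta> (fst p)) (Fa (snd p))" using nat[of "snd p"] by simp
    have "Cmp D (Ga (snd p)) (Cmp D (\<eta> (fst p)) (Fa (snd p))) = Cmp D (\<eta> (fst p)) (Fa (snd p))"
      by (simp add: F.D.Cmp_tail[OF n] Fe)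
    then show ?thesis by (cases p) (simp add: kar_nat_def)
  qed
  show "natural_iso (karoubi C) (karoubi D) (kar_funO Fo Fa) (kar_funA Fo Fa) (kar_funO Go Ga) (kar_funA Go Ga)
      (kar_nat D Fo Fa Go Ga \<eta>)"
    unfolding natural_iso_def
  proof (rule conjI; rule ballI)
    fix p assume "p \<in> Obj (karoubi C)"
    then have [simp]: "p \<in> kar_obj C" by simp
    show "kar_nat D Fo Fa Go Ga \<eta> p \<in> Mor (karoubi D) (kar_funO Fo Fa p) (kar_funO Go Ga p) \<and> iso_arr (karoubi D) (kar_nat D Fo Fa Go Ga \<eta> p)"
      using F.D.kar_iso_restrict[of "kar_funO Fo Fa p" "kar_funO Go Ga p" "\<eta> (fst p)"] nat[of "snd p"] by (simp add: comp)
  next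
    fix P assume "P \<in> Arr (karoubi C)"
    then obtain p q f where [simp]: "P = (p, q, f)" "p \<in> kar_obj C" "q \<in> kar_obj C" "f \<in> Arr C" "Dom C f = fst p" "Cod C f = fst q"
      and e: "Cmp C (snd q) f = f" "Cmp C f (snd p) = f" using F.C.kar_Arr F.C.kar_MorE by metis
    have "Cmp D (Fa (snd q)) (Fa f) = Fa f" "Cmp D (Fa f) (Fa (snd p)) = Fa f"
      using F.Fa_Cmp_simp[of f "snd q"] F.Fa_Cmp_simp[of "snd p" f] by (simp_all add: e)
    moreover have n: "Cmp D (Ga f) (\<eta> (fst p)) = Cmp D (\<eta> (fst q)) (Fa f)" using nat[of f] by simp
    ultimately show "Cmp (karoubi D) (kar_nat D Fo Fa Go Ga \<eta> (Cod (karoubi C) P)) (kar_funA Fo Fa P)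
        = Cmp (karoubi D) (kar_funA Go Ga P) (kar_nat D Fo Fa Go Ga \<eta> (Dom (karoubi C) P))"
      by (simp add: comp F.D.Cmp_tail[OF n])
  qed
qed

context tensor_functor
begin

lemma monoidal_linear: "monoidal_linear_functor C D Fo Fa"
  by unfold_locales

lemma Fa_TenA:
  assumes "f \<in> Arr C" "g \<in> Arr C"
  shows "J (Cod C f) (Cod C g) \<cdot>\<^bsub>D\<^esub> (Fa f \<star>\<^bsub>D\<^esub> Fa g) = Fa (f \<star>\<^bsub>C\<^esub> g) \<cdot>\<^bsub>D\<^esub> J (Dom C f) (Dom C g)"
  using J_natural[of f "Dom C f" "Cod C f" g "Dom C g" "Cod C g"] assms by (simp add: C.Mor_iff)

lemma J_simps [simp]:
  assumes "X \<in> Obj C" "Y \<in> Obj C"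
  shows "J X Y \<in> Arr D" "Dom D (J X Y) = Fo X \<boxtimes>\<^bsub>D\<^esub> Fo Y" "Cod D (J X Y) = Fo (X \<boxtimes>\<^bsub>C\<^esub> Y)" "iso_arr D (J X Y)"
  using J_Mor[OF assms] by (auto simp: D.Mor_iff)

lemma kar_ten_eq:
  assumes [simp]: "p \<in> kar_obj C" "q \<in> kar_obj C"
  shows "kar_ten C D Fo Fa J p q = (TenO (karoubi D) (kar_funO Fo Fa p) (kar_funO Fo Fa q), kar_funO Fo Fa (TenO (karoubi C) p q),
      J (fst p) (fst q) \<cdot>\<^bsub>D\<^esub> (Fa (snd p) \<star>\<^bsub>D\<^esub> Fa (snd q)))"
proof -
  have i: "Fa (snd r) \<cdot>\<^bsub>D\<^esub> Fa (snd r) = Fa (snd r)" if "r \<in> kar_obj C" for r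
    using that Fa_Cmp_simp[of "snd r" "snd r"] by simp
  have n: "Fa (snd p \<star>\<^bsub>C\<^esub> snd q) \<cdot>\<^bsub>D\<^esub> J (fst p) (fst q) = J (fst p) (fst q) \<cdot>\<^bsub>D\<^esub> (Fa (snd p) \<star>\<^bsub>D\<^esub> Fa (snd q))"
    using Fa_TenA[of "snd p" "snd q"] by simp
  have "Fa (snd p \<star>\<^bsub>C\<^esub> snd q) \<cdot>\<^bsub>D\<^esub> J (fst p) (fst q) \<cdot>\<^bsub>D\<^esub> (Fa (snd p) \<star>\<^bsub>D\<^esub> Fa (snd q)) = J (fst p) (fst q) \<cdot>\<^bsub>D\<^esub> (Fa (snd p) \<star>\<^bsub>D\<^esub> Fa (snd q))"
    by (simp add: D.Cmp_tail[OF n] D.interchange i Fo_Obj)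
  then show ?thesis by (cases p; cases q) (simp add: kar_ten_def kar_funO_def)
qed

text \<open>
  Each coherence equation holds in \<open>D\<close> without the idempotents; naturality moves the idempotents to
  one end, where they merge into one.
\<close>

lemma karoubi_tensor_functor:
  "tensor_functor (karoubi C) (karoubi D) (kar_funO Fo Fa) (kar_funA Fo Fa) (kar_ten C D Fo Fa J)
     (Unit (karoubi D), kar_funO Fo Fa (Unit (karoubi C)), e)"
proof -
  interpret M: monoidal_linear_functor C D Fo Fa by (rule monoidal_linear)
  have [simp]: "e \<in> Arr D" "Dom D e = Unit D" "Cod D e = Fo (Unit C)" "iso_arr D e" using e_Mor by (auto simp: D.Mor_iff)
  have [simp]: "Fo X \<in> Obj D" if "X \<in> Obj C" for X using that by (rule Fo_Obj)
  have Fe [simp]: "Fa (snd p) \<cdot>\<^bsub>D\<^esub> Fa (snd p) = Fa (snd p)" if "p \<in> kar_obj C" for p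
    using that Fa_Cmp_simp[of "snd p" "snd p"] by simp
  have [simp]: "Fa (Idt C X) = Idt D (Fo X)" if "X \<in> Obj C" for X using that by (rule Fa_Idt)
  show ?thesis
  proof (rule tensor_functor.intro[OF M.karoubi_linear_functor C.karoubi_monoidal_category D.karoubi_monoidal_category],
      rule tensor_functor_axioms.intro)
    fix p q assume "p \<in> Obj (karoubi C)" "q \<in> Obj (karoubi C)"
    then have [simp]: "p \<in> kar_obj C" "q \<in> kar_obj C" by simp_all
    have o: "TenO (karoubi D) (kar_funO Fo Fa p) (kar_funO Fo Fa q) \<in> kar_obj D" "kar_funO Fo Fa (TenO (karoubi C) p q) \<in> kar_obj D"
      using D.kar_ten_obj[of "kar_funO Fo Fa p" "kar_funO Fo Fa q"] by simp_all
    show "kar_ten C D Fo Fa J p q \<in> Mor (karoubi D) (TenO (karoubi D) (kar_funO Fo Fa p) (kar_funO Fo Fa q)) (kar_funO Fo Fa (TenO (karoubi C) p q))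
        \<and> iso_arr (karoubi D) (kar_ten C D Fo Fa J p q)"
      using D.kar_iso_restrict[OF o, of "J (fst p) (fst q)"] Fa_TenA[of "snd p" "snd q"] kar_ten_eq[of p q] by simp
  next
    fix F G p p' q q' assume "F \<in> Mor (karoubi C) p p'" "G \<in> Mor (karoubi C) q q'"
    then show "kar_ten C D Fo Fa J p' q' \<cdot>\<^bsub>karoubi D\<^esub> (kar_funA Fo Fa F \<star>\<^bsub>karoubi D\<^esub> kar_funA Fo Fa G)
        = kar_funA Fo Fa (F \<star>\<^bsub>karoubi C\<^esub> G) \<cdot>\<^bsub>karoubi D\<^esub> kar_ten C D Fo Fa J p q"
    proof (elim C.kar_MorE)
      fix f g assume [simp]: "F = (p, p', f)" "G = (q, q', g)" "p \<in> kar_obj C" "p' \<in> kar_obj C" "q \<in> kar_obj C" "q' \<in> kar_obj C"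
        "f \<in> Arr C" "Dom C f = fst p" "Cod C f = fst p'" "g \<in> Arr C" "Dom C g = fst q" "Cod C g = fst q'"
        and e: "snd p' \<cdot>\<^bsub>C\<^esub> f = f" "f \<cdot>\<^bsub>C\<^esub> snd p = f" "snd q' \<cdot>\<^bsub>C\<^esub> g = g" "g \<cdot>\<^bsub>C\<^esub> snd q = g"
      have [simp]: "Fa (snd p') \<cdot>\<^bsub>D\<^esub> Fa f = Fa f" "Fa f \<cdot>\<^bsub>D\<^esub> Fa (snd p) = Fa f" "Fa (snd q') \<cdot>\<^bsub>D\<^esub> Fa g = Fa g" "Fa g \<cdot>\<^bsub>D\<^esub> Fa (snd q) = Fa g"
        using Fa_Cmp_simp[of f "snd p'"] Fa_Cmp_simp[of "snd p" f] Fa_Cmp_simp[of g "snd q'"] Fa_Cmp_simp[of "snd q" g] by (simp_all add: e)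
      have n: "Fa (f \<star>\<^bsub>C\<^esub> g) \<cdot>\<^bsub>D\<^esub> J (fst p) (fst q) = J (fst p') (fst q') \<cdot>\<^bsub>D\<^esub> (Fa f \<star>\<^bsub>D\<^esub> Fa g)"
        using Fa_TenA[of f g] by simp
      have "Fa (f \<star>\<^bsub>C\<^esub> g) \<cdot>\<^bsub>D\<^esub> J (fst p) (fst q) \<cdot>\<^bsub>D\<^esub> (Fa (snd p) \<star>\<^bsub>D\<^esub> Fa (snd q)) = J (fst p') (fst q') \<cdot>\<^bsub>D\<^esub> (Fa f \<star>\<^bsub>D\<^esub> Fa g)"
        by (simp add: D.Cmp_tail[OF n] D.interchange)
      then show ?thesis by (simp add: kar_ten_eq D.interchange)
    qed
  next
    show "(Unit (karoubi D), kar_funO Fo Fa (Unit (karoubi C)), e) \<in> Mor (karoubi D) (Unit (karoubi D)) (kar_funO Fo Fa (Unit (karoubi C)))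
        \<and> iso_arr (karoubi D) (Unit (karoubi D), kar_funO Fo Fa (Unit (karoubi C)), e)"
      using D.kar_iso_restrict[of "Unit (karoubi D)" "kar_funO Fo Fa (Unit (karoubi C))" e] by simp
  next
    fix p q r assume "p \<in> Obj (karoubi C)" "q \<in> Obj (karoubi C)" "r \<in> Obj (karoubi C)"
    then have [simp]: "p \<in> kar_obj C" "q \<in> kar_obj C" "r \<in> kar_obj C" by simp_all
    let ?p = "Fa (snd p)" and ?q = "Fa (snd q)" and ?r = "Fa (snd r)"
    let ?E = "(?p \<star>\<^bsub>D\<^esub> ?q) \<star>\<^bsub>D\<^esub> ?r"
    have n1: "Fa (snd p \<star>\<^bsub>C\<^esub> snd q) \<cdot>\<^bsub>D\<^esub> J (fst p) (fst q) = J (fst p) (fst q) \<cdot>\<^bsub>D\<^esub> (?p \<star>\<^bsub>D\<^esub> ?q)"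
      "Fa (snd q \<star>\<^bsub>C\<^esub> snd r) \<cdot>\<^bsub>D\<^esub> J (fst q) (fst r) = J (fst q) (fst r) \<cdot>\<^bsub>D\<^esub> (?q \<star>\<^bsub>D\<^esub> ?r)"
      using Fa_TenA[of "snd p" "snd q"] Fa_TenA[of "snd q" "snd r"] by simp_all
    have n2: "Fa ((snd p \<star>\<^bsub>C\<^esub> snd q) \<star>\<^bsub>C\<^esub> snd r) \<cdot>\<^bsub>D\<^esub> J (fst p \<boxtimes>\<^bsub>C\<^esub> fst q) (fst r) = J (fst p \<boxtimes>\<^bsub>C\<^esub> fst q) (fst r) \<cdot>\<^bsub>D\<^esub> (Fa (snd p \<star>\<^bsub>C\<^esub> snd q) \<star>\<^bsub>D\<^esub> ?r)"
      using Fa_TenA[of "snd p \<star>\<^bsub>C\<^esub> snd q" "snd r"] by simp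
    have n3: "(Fa (snd p \<star>\<^bsub>C\<^esub> snd q) \<star>\<^bsub>D\<^esub> ?r) \<cdot>\<^bsub>D\<^esub> (J (fst p) (fst q) \<star>\<^bsub>D\<^esub> Idt D (Fo (fst r))) = (J (fst p) (fst q) \<star>\<^bsub>D\<^esub> Idt D (Fo (fst r))) \<cdot>\<^bsub>D\<^esub> ?E"
      by (simp add: D.interchange n1)
    have n4: "(?p \<star>\<^bsub>D\<^esub> (?q \<star>\<^bsub>D\<^esub> ?r)) \<cdot>\<^bsub>D\<^esub> Asc D (Fo (fst p)) (Fo (fst q)) (Fo (fst r)) = Asc D (Fo (fst p)) (Fo (fst q)) (Fo (fst r)) \<cdot>\<^bsub>D\<^esub> ?E"
      using D.Asc_nat[of ?p ?q ?r] by simp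
    have idem: "?E \<cdot>\<^bsub>D\<^esub> ?E = ?E" "Fa (snd p \<star>\<^bsub>C\<^esub> snd q) \<cdot>\<^bsub>D\<^esub> Fa (snd p \<star>\<^bsub>C\<^esub> snd q) = Fa (snd p \<star>\<^bsub>C\<^esub> snd q)"
      using Fa_Cmp_simp[of "snd p \<star>\<^bsub>C\<^esub> snd q" "snd p \<star>\<^bsub>C\<^esub> snd q"] by (simp_all add: D.interchange C.interchange)
    have s1: "(J (fst p) (fst q) \<cdot>\<^bsub>D\<^esub> (?p \<star>\<^bsub>D\<^esub> ?q)) \<star>\<^bsub>D\<^esub> ?r = (J (fst p) (fst q) \<star>\<^bsub>D\<^esub> Idt D (Fo (fst r))) \<cdot>\<^bsub>D\<^esub> ?E"
      "?p \<star>\<^bsub>D\<^esub> (J (fst q) (fst r) \<cdot>\<^bsub>D\<^esub> (?q \<star>\<^bsub>D\<^esub> ?r)) = (Idt D (Fo (fst p)) \<star>\<^bsub>D\<^esub> J (fst q) (fst r)) \<cdot>\<^bsub>D\<^esub> (?p \<star>\<^bsub>D\<^esub> (?q \<star>\<^bsub>D\<^esub> ?r))"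
      by (simp_all add: D.interchange)
    have n5: "(?p \<star>\<^bsub>D\<^esub> Fa (snd q \<star>\<^bsub>C\<^esub> snd r)) \<cdot>\<^bsub>D\<^esub> (Idt D (Fo (fst p)) \<star>\<^bsub>D\<^esub> J (fst q) (fst r)) = (Idt D (Fo (fst p)) \<star>\<^bsub>D\<^esub> J (fst q) (fst r)) \<cdot>\<^bsub>D\<^esub> (?p \<star>\<^bsub>D\<^esub> (?q \<star>\<^bsub>D\<^esub> ?r))"
      by (simp add: D.interchange n1)
    have i2: "(?p \<star>\<^bsub>D\<^esub> (?q \<star>\<^bsub>D\<^esub> ?r)) \<cdot>\<^bsub>D\<^esub> (?p \<star>\<^bsub>D\<^esub> (?q \<star>\<^bsub>D\<^esub> ?r)) = ?p \<star>\<^bsub>D\<^esub> (?q \<star>\<^bsub>D\<^esub> ?r)"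
      by (simp add: D.interchange)
    \<comment> \<open>the idempotents are moved to the right, where they merge\<close>
    have L: "Fa (Asc C (fst p) (fst q) (fst r) \<cdot>\<^bsub>C\<^esub> ((snd p \<star>\<^bsub>C\<^esub> snd q) \<star>\<^bsub>C\<^esub> snd r)) \<cdot>\<^bsub>D\<^esub> (J (fst p \<boxtimes>\<^bsub>C\<^esub> fst q) (fst r) \<cdot>\<^bsub>D\<^esub> (Fa (snd p \<star>\<^bsub>C\<^esub> snd q) \<star>\<^bsub>D\<^esub> ?r)) \<cdot>\<^bsub>D\<^esub> ((J (fst p) (fst q) \<cdot>\<^bsub>D\<^esub> (?p \<star>\<^bsub>D\<^esub> ?q)) \<star>\<^bsub>D\<^esub> ?r)
        = (Fa (Asc C (fst p) (fst q) (fst r)) \<cdot>\<^bsub>D\<^esub> J (fst p \<boxtimes>\<^bsub>C\<^esub> fst q) (fst r) \<cdot>\<^bsub>D\<^esub> (J (fst p) (fst q) \<star>\<^bsub>D\<^esub> Idt D (Fo (fst r)))) \<cdot>\<^bsub>D\<^esub> ?E"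
      unfolding s1 by (simp add: Fa_Cmp_simp D.Cmp_tail[OF n2] D.Cmp_tail[OF n3] D.Cmp_tail[OF idem(1)] idem(1))
    have R: "(J (fst p) (fst q \<boxtimes>\<^bsub>C\<^esub> fst r) \<cdot>\<^bsub>D\<^esub> (?p \<star>\<^bsub>D\<^esub> Fa (snd q \<star>\<^bsub>C\<^esub> snd r))) \<cdot>\<^bsub>D\<^esub> (?p \<star>\<^bsub>D\<^esub> (J (fst q) (fst r) \<cdot>\<^bsub>D\<^esub> (?q \<star>\<^bsub>D\<^esub> ?r))) \<cdot>\<^bsub>D\<^esub> (Asc D (Fo (fst p)) (Fo (fst q)) (Fo (fst r)) \<cdot>\<^bsub>D\<^esub> ?E)
        = (J (fst p) (fst q \<boxtimes>\<^bsub>C\<^esub> fst r) \<cdot>\<^bsub>D\<^esub> (Idt D (Fo (fst p)) \<star>\<^bsub>D\<^esub> J (fst q) (fst r)) \<cdot>\<^bsub>D\<^esub> Asc D (Fo (fst p)) (Fo (fst q)) (Fo (fst r))) \<cdot>\<^bsub>D\<^esub> ?E"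
      unfolding s1 by (simp add: D.Cmp_tail[OF n5] D.Cmp_tail[OF i2] D.Cmp_tail[OF n4] D.Cmp_tail[OF idem(1)] idem(1))
    have t: "TenO (karoubi C) p q \<in> kar_obj C" "TenO (karoubi C) q r \<in> kar_obj C" by simp_all
    show "kar_funA Fo Fa (Asc (karoubi C) p q r) \<cdot>\<^bsub>karoubi D\<^esub> kar_ten C D Fo Fa J (TenO (karoubi C) p q) r \<cdot>\<^bsub>karoubi D\<^esub> (kar_ten C D Fo Fa J p q \<star>\<^bsub>karoubi D\<^esub> Idt (karoubi D) (kar_funO Fo Fa r))
      = kar_ten C D Fo Fa J p (TenO (karoubi C) q r) \<cdot>\<^bsub>karoubi D\<^esub> (Idt (karoubi D) (kar_funO Fo Fa p) \<star>\<^bsub>karoubi D\<^esub> kar_ten C D Fo Fa J q r) \<cdot>\<^bsub>karoubi D\<^esub> Asc (karoubi D) (kar_funO Fo Fa p) (kar_funO Fo Fa q) (kar_funO Fo Fa r)"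
      using L R J_assoc[of "fst p" "fst q" "fst r"] by (simp add: kar_ten_eq[OF t(1)] kar_ten_eq[OF _ t(2)] kar_ten_eq)
  next
    fix p assume "p \<in> Obj (karoubi C)"
    then have [simp]: "p \<in> kar_obj C" by simp
    let ?p = "Fa (snd p)"
    have u: "Unit (karoubi C) \<in> kar_obj C" by simp
    have l: "Fa (snd p \<cdot>\<^bsub>C\<^esub> LUn C (fst p)) \<cdot>\<^bsub>D\<^esub> (J (Unit C) (fst p) \<cdot>\<^bsub>D\<^esub> (Fa (Idt C (Unit C)) \<star>\<^bsub>D\<^esub> ?p)) \<cdot>\<^bsub>D\<^esub> (e \<star>\<^bsub>D\<^esub> ?p)
        = ?p \<cdot>\<^bsub>D\<^esub> LUn D (Fo (fst p))"
    proof -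
      have s: "(Idt D (Fo (Unit C)) \<star>\<^bsub>D\<^esub> ?p) \<cdot>\<^bsub>D\<^esub> (e \<star>\<^bsub>D\<^esub> ?p) = (e \<star>\<^bsub>D\<^esub> Idt D (Fo (fst p))) \<cdot>\<^bsub>D\<^esub> (Idt D (Unit D) \<star>\<^bsub>D\<^esub> ?p)"
        by (simp add: D.interchange)
      have "Fa (snd p \<cdot>\<^bsub>C\<^esub> LUn C (fst p)) \<cdot>\<^bsub>D\<^esub> (J (Unit C) (fst p) \<cdot>\<^bsub>D\<^esub> (Fa (Idt C (Unit C)) \<star>\<^bsub>D\<^esub> ?p)) \<cdot>\<^bsub>D\<^esub> (e \<star>\<^bsub>D\<^esub> ?p)
          = ?p \<cdot>\<^bsub>D\<^esub> (Fa (LUn C (fst p)) \<cdot>\<^bsub>D\<^esub> J (Unit C) (fst p) \<cdot>\<^bsub>D\<^esub> (e \<star>\<^bsub>D\<^esub> Idt D (Fo (fst p)))) \<cdot>\<^bsub>D\<^esub> (Idt D (Unit D) \<star>\<^bsub>D\<^esub> ?p)"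
        by (simp add: Fa_Cmp_simp s)
      also have "\<dots> = ?p \<cdot>\<^bsub>D\<^esub> LUn D (Fo (fst p))"
        unfolding J_left_unit[OF C.kar_objD(1)[OF \<open>p \<in> kar_obj C\<close>]] using D.LUn_nat[of ?p] by (simp add: D.Cmp_tail[OF Fe])
      finally show ?thesis .
    qed
    have r: "Fa (snd p \<cdot>\<^bsub>C\<^esub> RUn C (fst p)) \<cdot>\<^bsub>D\<^esub> (J (fst p) (Unit C) \<cdot>\<^bsub>D\<^esub> (?p \<star>\<^bsub>D\<^esub> Fa (Idt C (Unit C)))) \<cdot>\<^bsub>D\<^esub> (?p \<star>\<^bsub>D\<^esub> e)
        = ?p \<cdot>\<^bsub>D\<^esub> RUn D (Fo (fst p))"
    proof -
      have s: "(?p \<star>\<^bsub>D\<^esub> Idt D (Fo (Unit C))) \<cdot>\<^bsub>D\<^esub> (?p \<star>\<^bsub>D\<^esub> e) = (Idt D (Fo (fst p)) \<star>\<^bsub>D\<^esub> e) \<cdot>\<^bsub>D\<^esub> (?p \<star>\<^bsub>D\<^esub> Idt D (Unit D))"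
        by (simp add: D.interchange)
      have "Fa (snd p \<cdot>\<^bsub>C\<^esub> RUn C (fst p)) \<cdot>\<^bsub>D\<^esub> (J (fst p) (Unit C) \<cdot>\<^bsub>D\<^esub> (?p \<star>\<^bsub>D\<^esub> Fa (Idt C (Unit C)))) \<cdot>\<^bsub>D\<^esub> (?p \<star>\<^bsub>D\<^esub> e)
          = ?p \<cdot>\<^bsub>D\<^esub> (Fa (RUn C (fst p)) \<cdot>\<^bsub>D\<^esub> J (fst p) (Unit C) \<cdot>\<^bsub>D\<^esub> (Idt D (Fo (fst p)) \<star>\<^bsub>D\<^esub> e)) \<cdot>\<^bsub>D\<^esub> (?p \<star>\<^bsub>D\<^esub> Idt D (Unit D))"
        by (simp add: Fa_Cmp_simp s)
      also have "\<dots> = ?p \<cdot>\<^bsub>D\<^esub> RUn D (Fo (fst p))"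
        unfolding J_right_unit[OF C.kar_objD(1)[OF \<open>p \<in> kar_obj C\<close>]] using D.RUn_nat[of ?p] by (simp add: D.Cmp_tail[OF Fe])
      finally show ?thesis .
    qed
    show "kar_funA Fo Fa (LUn (karoubi C) p) \<cdot>\<^bsub>karoubi D\<^esub> kar_ten C D Fo Fa J (Unit (karoubi C)) p \<cdot>\<^bsub>karoubi D\<^esub>
        ((Unit (karoubi D), kar_funO Fo Fa (Unit (karoubi C)), e) \<star>\<^bsub>karoubi D\<^esub> Idt (karoubi D) (kar_funO Fo Fa p)) = LUn (karoubi D) (kar_funO Fo Fa p)"
      using l kar_ten_eq[OF u, of p] by simp
    show "kar_funA Fo Fa (RUn (karoubi C) p) \<cdot>\<^bsub>karoubi D\<^esub> kar_ten C D Fo Fa J p (Unit (karoubi C)) \<cdot>\<^bsub>karoubi D\<^esub>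
        (Idt (karoubi D) (kar_funO Fo Fa p) \<star>\<^bsub>karoubi D\<^esub> (Unit (karoubi D), kar_funO Fo Fa (Unit (karoubi C)), e)) = RUn (karoubi D) (kar_funO Fo Fa p)"
      using r kar_ten_eq[OF _ u, of p] by simp
  qed
qed

end

lemma karoubi_category_equivalence:
  assumes C: "monoidal_category C" and D: "monoidal_category D" and E: "category_equivalence C D Fo Fa"
  shows "category_equivalence (karoubi C) (karoubi D) (kar_funO Fo Fa) (kar_funA Fo Fa)"
proof -
  obtain Go Ga \<eta> \<epsilon> where F: "linear_functor C D Fo Fa" and G: "linear_functor D C Go Ga"
    and n: "natural_iso C C id id (Go \<circ> Fo) (Ga \<circ> Fa) \<eta>" "natural_iso D D (Fo \<circ> Go) (Fa \<circ> Ga) id id \<epsilon>"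
    using E by (auto simp: category_equivalence_def)
  have I: "linear_functor C C id id" "linear_functor D D id id"
    using C D by (simp_all add: linear_functor_id monoidal_category_def)
  note M = monoidal_linear_functor.intro
  note K = monoidal_linear_functor.karoubi_linear_functor[OF M]
  show ?thesis
    unfolding category_equivalence_def
    using K[OF C D F] K[OF D C G] kar_nat_natural_iso(2)[OF M[OF C C I(1)] M[OF C C linear_functor_comp[OF F G]] n(1)]
      kar_nat_natural_iso(2)[OF M[OF D D linear_functor_comp[OF G F]] M[OF D D I(2)] n(2)]
    unfolding kar_fun_comp kar_fun_id by blast
qed

lemma karoubi_tensor_equivalence:
  assumes "tensor_equivalence C D Fo Fa J e"
  shows "tensor_equivalence (karoubi C) (karoubi D) (kar_funO Fo Fa) (kar_funA Fo Fa) (kar_ten C D Fo Fa J)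
     (Unit (karoubi D), kar_funO Fo Fa (Unit (karoubi C)), e)"
proof -
  interpret tensor_functor C D Fo Fa J e using assms by (simp add: tensor_equivalence_def)
  show ?thesis
    using assms karoubi_tensor_functor karoubi_category_equivalence[OF C.monoidal_category_axioms D.monoidal_category_axioms]
    by (simp add: tensor_equivalence_def)
qed

lemma karoubi_z2_action:
  assumes C: "monoidal_category C" and U: "z2_action C Uo Ua \<eta>"
  shows "z2_action (karoubi C) (kar_funO Uo Ua) (kar_funA Uo Ua) (kar_nat C (Uo \<circ> Uo) (Ua \<circ> Ua) id id \<eta>)"
proof -
  interpret monoidal_category C by (rule C)
  have L: "linear_functor C C Uo Ua" and n: "natural_iso C C (Uo \<circ> Uo) (Ua \<circ> Ua) id id \<eta>"
    and \<eta>: "\<And>X. X \<in> Obj C \<Longrightarrow> Ua (\<eta> X) = \<eta> (Uo X)"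
    using U by (simp_all add: z2_action_def)
  interpret monoidal_linear_functor C C Uo Ua using C C L by (rule monoidal_linear_functor.intro)
  note M = monoidal_linear_functor.intro[OF C C]
  note N = kar_nat_natural_iso[OF M[OF linear_functor_comp[OF L L]] M[OF linear_functor_id] n, OF linear_category_axioms]
  have "kar_funA Uo Ua (kar_nat C (Uo \<circ> Uo) (Ua \<circ> Ua) id id \<eta> p) = kar_nat C (Uo \<circ> Uo) (Ua \<circ> Ua) id id \<eta> (kar_funO Uo Ua p)"
    if p: "p \<in> kar_obj C" for p
  proof -
    have "\<eta> (fst p) \<in> Mor C (Uo (Uo (fst p))) (fst p)" using n kar_objD(1)[OF p] by (simp add: natural_iso_def)
    then have "Ua (Cmp C (\<eta> (fst p)) (Ua (Ua (snd p)))) = Cmp C (\<eta> (Uo (fst p))) (Ua (Ua (Ua (snd p))))"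
      using Fa_Cmp_simp[of "Ua (Ua (snd p))" "\<eta> (fst p)"] p by (simp add: Mor_iff \<eta>)
    then show ?thesis using p by (simp add: N(1) kar_fun_comp kar_fun_id)
  qed
  then show ?thesis
    using karoubi_linear_functor N(2) by (simp add: z2_action_def kar_fun_comp kar_fun_id)
qed

lemma (in linear_functor) kar_fun_inc:
  "X \<in> Obj C \<Longrightarrow> kar_funO Fo Fa (kar_incO C X) = kar_incO D (Fo X)"
  "f \<in> Arr C \<Longrightarrow> kar_funA Fo Fa (kar_incA C f) = kar_incA D (Fa f)"
  by (simp_all add: kar_incO_def kar_incA_def kar_funO_def kar_funA_def Fa_Idt)

lemma (in tensor_functor) kar_ten_inc:
  "X \<in> Obj C \<Longrightarrow> Y \<in> Obj C \<Longrightarrow> kar_ten C D Fo Fa J (kar_incO C X) (kar_incO C Y) = kar_incA D (J X Y)"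
  by (simp add: kar_incO_def kar_incA_def kar_ten_def Fa_Idt Fo_Obj)

lemma kar_nat_inc:
  assumes "linear_functor C D Fo Fa" "linear_functor C D Go Ga" "natural_iso C D Fo Fa Go Ga \<eta>" "X \<in> Obj C"
  shows "kar_nat D Fo Fa Go Ga \<eta> (kar_incO C X) = kar_incA D (\<eta> X)"
proof -
  interpret F: linear_functor C D Fo Fa by (rule assms(1))
  interpret G: linear_functor C D Go Ga by (rule assms(2))
  have "\<eta> X \<in> Mor D (Fo X) (Go X)" using assms(3,4) by (simp add: natural_iso_def)
  then show ?thesis
    using assms(4) by (simp add: F.D.Mor_iff kar_nat_def kar_incO_def kar_incA_def kar_funO_def F.Fa_Idt G.Fa_Idt F.Fo_Obj G.Fo_Obj)
qed

text \<open>
  The associator of \<open>rev_tensor\<close> is an inverse arrow.  Taking inverses before or after passing to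
  the envelope agrees on objects, but \<open>inv_arr\<close> has arbitrary values elsewhere, so the two records
  may differ in this one field.
\<close>

lemma karoubi_rev_tensor:
  "karoubi (rev_tensor C) = (rev_tensor (karoubi C))\<lparr>Asc := Asc (karoubi (rev_tensor C))\<rparr>"
  by (simp add: karoubi_def rev_tensor_def Let_def fun_eq_iff kar_obj_def Mor_def)

lemma (in monoidal_category) karoubi_rev_tensor_Asc:
  assumes "p \<in> kar_obj C" "q \<in> kar_obj C" "r \<in> kar_obj C"
  shows "Asc (karoubi (rev_tensor C)) p q r = Asc (rev_tensor \<K>) p q r"
proof -
  interpret R: monoidal_category "rev_tensor C" by (rule rev_tensor_monoidal)
  show ?thesis
    by (simp only: rev_tensor_sel karoubi_Asc(3)[OF assms(3,2,1)]) (simp del: karoubi_sel(12))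
qed

lemma Asc_update_cat [simp]:
  "Mor (C\<lparr>Asc := a\<rparr>) = Mor C" "hom_space (C\<lparr>Asc := a\<rparr>) = hom_space C"
  "iso_arr (C\<lparr>Asc := a\<rparr>) = iso_arr C" "inv_arr (C\<lparr>Asc := a\<rparr>) = inv_arr C"
  by (auto simp: fun_eq_iff Mor_def hom_space_def iso_arr_def inv_arr_def inverse_arrows_def)

lemma tensor_equivalence_Asc_update:
  assumes E: "tensor_equivalence C (D\<lparr>Asc := a\<rparr>) Fo Fa J e" and D: "monoidal_category D"
    and a: "\<And>X Y Z. X \<in> Obj D \<Longrightarrow> Y \<in> Obj D \<Longrightarrow> Z \<in> Obj D \<Longrightarrow> a X Y Z = Asc D X Y Z"
  shows "tensor_equivalence C D Fo Fa J e"
proof -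
  interpret F: tensor_functor C "D\<lparr>Asc := a\<rparr>" Fo Fa J e using E by (simp add: tensor_equivalence_def)
  interpret D: monoidal_category D by (rule D)
  have L: "linear_functor C D Go Ga" if "linear_functor C (D\<lparr>Asc := a\<rparr>) Go Ga" for Go Ga
    using that D.linear_category_axioms by (simp add: linear_functor_def linear_functor_axioms_def)
  have L': "linear_functor D C Go Ga" if "linear_functor (D\<lparr>Asc := a\<rparr>) C Go Ga" for Go Ga
    using that D.linear_category_axioms by (simp add: linear_functor_def linear_functor_axioms_def)
  have N: "natural_iso (D\<lparr>Asc := a\<rparr>) (D\<lparr>Asc := a\<rparr>) Go Ga Ho Ha n = natural_iso D D Go Ga Ho Ha n" for Go Ga Ho Ha n
    by (simp add: natural_iso_def)
  have "tensor_functor C D Fo Fa J e"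
    using L[OF F.linear_functor_axioms] F.C.monoidal_category_axioms D F.tensor_functor_axioms F.Fo_Obj
    by (simp add: tensor_functor_def tensor_functor_axioms_def a)
  moreover have "category_equivalence C D Fo Fa"
    using E L L' unfolding tensor_equivalence_def category_equivalence_def N by blast
  ultimately show ?thesis by (simp add: tensor_equivalence_def)
qed

theorem proposition3p8:
  fixes \<A> :: "('o, 'a, 'k::{alg_closed_field, field_char_0}) ribbon_cat"
  assumes "premodular_category \<A>"
  defines "T \<equiv> horizontal_trace \<A>"
    and "U \<equiv> trace_tilde \<A>"
    and "J \<equiv> (\<lambda>X Y. trace_embed \<A> (Brd \<A> Y X))"
    and "\<eta> \<equiv> (\<lambda>X. trace_embed \<A> (inv_arr \<A> (Twist \<A> X)))"
  defines "K \<equiv> karoubi T"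
    and "KUo \<equiv> kar_funO id U"
    and "KU \<equiv> kar_funA id U"
    and "KJ \<equiv> kar_ten T (rev_tensor T) id U J"
    and "K\<eta> \<equiv> kar_nat T (id \<circ> id) (U \<circ> U) id id \<eta>"
  shows
    "tensor_equivalence T (rev_tensor T) id U J (Idt T \<I>\<^bsub>T\<^esub>)
     \<and> z2_action T id U \<eta>
     \<and> tensor_equivalence K (rev_tensor K) KUo KU KJ (Idt K \<I>\<^bsub>K\<^esub>)
     \<and> z2_action K KUo KU K\<eta>
     \<and> (\<forall>X \<in> Obj T. KUo (kar_incO T X) = kar_incO T X)
     \<and> (\<forall>f \<in> Arr T. KU (kar_incA T f) = kar_incA T (U f))
     \<and> (\<forall>X \<in> Obj T. \<forall>Y \<in> Obj T. KJ (kar_incO T X) (kar_incO T Y) = kar_incA T (J X Y))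
     \<and> (\<forall>X \<in> Obj T. K\<eta> (kar_incO T X) = kar_incA T (\<eta> X))"
proof -
  interpret A: premodular_category \<A> by (rule assms(1))
  interpret T: monoidal_category T unfolding T_def by (rule A.trace_monoidal_category)
  have E: "tensor_equivalence T (rev_tensor T) id U J (Idt T \<I>\<^bsub>T\<^esub>)"
    unfolding T_def U_def J_def by (rule A.trace_tensor_equivalence)
  have Z: "z2_action T id U \<eta>" unfolding T_def U_def \<eta>_def by (rule A.trace_z2_action)
  interpret F: tensor_functor T "rev_tensor T" id U J "Idt T \<I>\<^bsub>T\<^esub>" using E by (simp add: tensor_equivalence_def)
  have L: "linear_functor T T id U" and n: "natural_iso T T (id \<circ> id) (U \<circ> U) id id \<eta>"
    using Z by (simp_all add: z2_action_def)
  \<comment> \<open>the unit of the envelope is the unit with its identity as idempotent, and tilde fixes that identity\<close>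
  have u: "(Unit (karoubi (rev_tensor T)), kar_funO id U (Unit (karoubi T)), Idt T \<I>\<^bsub>T\<^esub>) = Idt K \<I>\<^bsub>K\<^esub>"
    using F.Fa_Idt[of "\<I>\<^bsub>T\<^esub>"] by (simp add: K_def kar_funO_def F.D.karoubi_sel)
  have KE: "tensor_equivalence K (rev_tensor K) KUo KU KJ (Idt K \<I>\<^bsub>K\<^esub>)"
  proof (rule tensor_equivalence_Asc_update[where a = "Asc (karoubi (rev_tensor T))"])
    show "tensor_equivalence K (rev_tensor K\<lparr>Asc := Asc (karoubi (rev_tensor T))\<rparr>) KUo KU KJ (Idt K \<I>\<^bsub>K\<^esub>)"
      using karoubi_tensor_equivalence[OF E] unfolding u KUo_def KU_def KJ_def K_def karoubi_rev_tensor[symmetric] .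
    show "monoidal_category (rev_tensor K)"
      unfolding K_def by (rule monoidal_category.rev_tensor_monoidal[OF T.karoubi_monoidal_category])
  qed (simp add: K_def T.karoubi_rev_tensor_Asc del: T.karoubi_sel(12) F.D.karoubi_sel(12) rev_tensor_sel(13))
  have KZ: "z2_action K KUo KU K\<eta>"
    unfolding K_def KUo_def KU_def K\<eta>_def by (rule karoubi_z2_action[OF T.monoidal_category_axioms Z])
  have "kar_incA (rev_tensor T) f = kar_incA T f" for f by (simp add: kar_incA_def kar_incO_def)
  then have "\<forall>X \<in> Obj T. \<forall>Y \<in> Obj T. KJ (kar_incO T X) (kar_incO T Y) = kar_incA T (J X Y)"
    using F.kar_ten_inc by (simp add: KJ_def)
  moreover have "\<forall>X \<in> Obj T. K\<eta> (kar_incO T X) = kar_incA T (\<eta> X)"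
    unfolding K\<eta>_def
    using kar_nat_inc[OF linear_functor_comp[OF L L] linear_functor_id[OF T.linear_category_axioms] n] by blast
  moreover have "\<forall>X \<in> Obj T. KUo (kar_incO T X) = kar_incO T X" "\<forall>f \<in> Arr T. KU (kar_incA T f) = kar_incA T (U f)"
    unfolding KUo_def KU_def using linear_functor.kar_fun_inc[OF L] by simp_all
  ultimately show ?thesis using E Z KE KZ by blast
qed

end
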